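(* Let $(M^{2n},\omega)$ be a symplectic manifold with compatible triple $(\omega,J,g)$. On $\Omega^k$ define $$\Delta_{dd^{\Lambda}}=d^{\Lambda*}d^{*}dd^{\Lambda}+\tfrac14\left(dd^{*}+d^{\Lambda}d^{\Lambda *}\right)^2,\qquad \Delta_{d+d^{\Lambda}}=dd^{\Lambda}d^{\Lambda*}d^{*}+\tfrac14\left(d^{*}d+d^{\Lambda *}d^{\Lambda}\right)^2 .$$ Then $\Delta_{dd^\Lambda}$ and $\Delta_{d+d^\Lambda}$ are elliptic. Moreover, restricted to the space $P^n$ of primitive $n$-forms they coincide, respectively, with $$\Delta_{++}=(\partial_{+}\partial_{-})^{*}\partial_{+}\partial_{-}+(\partial_{+}\partial_{+}^{*})^2,\qquad \Delta_{--}=\partial_{+}\partial_{-}(\partial_{+}\partial_{-})^{*}+(\partial_{-}^{*}\partial_{-})^2 .$$ Therefore $\Delta_{++}$ and $\Delta_{--}$ are elliptic on $P^n$.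
   Context: $L\eta=\omega\wedge\eta$ is the Lefschetz operator and $\Lambda:\Omega^k\to\Omega^{k-2}$ its dual, $\Lambda\eta=\frac12(\omega^{-1})^{ij}i_{\partial_{x^i}}i_{\partial_{x^j}}\eta$, normalized so that $[\Lambda,L]=H$, where $H$ acts on $k$-forms as multiplication by $n-k$. $d^\Lambda=d\Lambda-\Lambda d:\Omega^k\to\Omega^{k-1}$. $P^k=\{\eta\in\Omega^k:\Lambda\eta=0\}$, $0\le k\le n$, is the space of primitive $k$-forms. For $B\in P^k$ one has uniquely $dB=B_{k+1}+L B_{k-1}$ with $B_{k+1}\in P^{k+1}$, $B_{k-1}\in P^{k-1}$ (with $B_{k+1}=0$ if $k=n$); define $\partial_+B=B_{k+1}$, $\partial_-B=B_{k-1}$, so $d=\partial_++L\partial_-$. A superscript $*$ denotes the formal adjoint with respect to the $L^2$ inner product of $g$ (for $\partial_\pm$, as operators between spaces of primitive forms). Elliptic means that the principal symbol at every nonzero real covector is invertible. *)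

theory Defs
  imports "HOL-Analysis.Analysis" "HOL-Library.Function_Algebras"
begin

section \<open>Smooth maps and smooth manifolds\<close>

primrec Ck_on :: "nat \<Rightarrow> (real^'n) set \<Rightarrow> (real^'n \<Rightarrow> 'b::real_normed_vector) \<Rightarrow> bool" where
  "Ck_on 0 S f \<longleftrightarrow> continuous_on S f"
| "Ck_on (Suc k) S f \<longleftrightarrow>
     (\<forall>x\<in>S. f differentiable (at x)) \<and> (\<forall>v. Ck_on k S (\<lambda>x. frechet_derivative f (at x) v))"

definition smooth_on :: "(real^'n) set \<Rightarrow> (real^'n \<Rightarrow> 'b::real_normed_vector) \<Rightarrow> bool" where
  "smooth_on S f \<longleftrightarrow> (\<forall>k. Ck_on k S f)"

type_synonym ('m, 'n) chart = "'m set \<times> ('m \<Rightarrow> real^'n)"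

definition chart_inv :: "('m, 'n) chart \<Rightarrow> real^'n \<Rightarrow> 'm" where
  "chart_inv c = inv_into (fst c) (snd c)"

definition chart_image :: "('m, 'n) chart \<Rightarrow> (real^'n) set" where
  "chart_image c = snd c ` fst c"

definition smooth_atlas :: "('m::topological_space, 'n::finite) chart set \<Rightarrow> bool" where
  "smooth_atlas A \<longleftrightarrow>
     (\<forall>c\<in>A. open (fst c) \<and> open (chart_image c) \<and>
        homeomorphism (fst c) (chart_image c) (snd c) (chart_inv c)) \<and>
     (\<Union>c\<in>A. fst c) = UNIV \<and>
     (\<forall>c\<in>A. \<forall>c'\<in>A. smooth_on (snd c ` (fst c \<inter> fst c')) (snd c' \<circ> chart_inv c))"

definition smooth_fun :: "('m, 'n::finite) chart set \<Rightarrow> ('m \<Rightarrow> real) \<Rightarrow> bool" where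
  "smooth_fun A f \<longleftrightarrow> (\<forall>c\<in>A. smooth_on (chart_image c) (f \<circ> chart_inv c))"

definition transition :: "('m, 'n::finite) chart \<Rightarrow> ('m, 'n) chart \<Rightarrow> 'm \<Rightarrow> real^'n \<Rightarrow> real^'n" where
  "transition c c' p = frechet_derivative (snd c' \<circ> chart_inv c) (at (snd c p))"


section \<open>Differential forms\<close>

text \<open>
  A tangent vector at a point is represented, in each chart around the point, by a vector of
  the model space; two representatives are related by the derivative of the transition map.
  Accordingly \<open>\<eta> c p [v1, ..., vk]\<close> is the value at the point \<open>p\<close> of the
  degree \<open>k\<close> part of \<open>\<eta>\<close> on the tangent vectors
  represented by \<open>v1, ..., vk\<close> in the chart \<open>c\<close>. A form of pure degree \<open>k\<close> vanishes on
  lists of other lengths, and representatives are 0 outside the domain of the chart, so that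
  equality of forms is equality of functions.
\<close>

type_synonym ('m, 'n) form = "('m, 'n) chart \<Rightarrow> 'm \<Rightarrow> (real^'n) list \<Rightarrow> real"

definition alternating :: "((real^'n) list \<Rightarrow> real) \<Rightarrow> bool" where
  "alternating a \<longleftrightarrow>
     (\<forall>us vs. linear (\<lambda>v. a (us @ v # vs))) \<and>
     (\<forall>us v ws vs. a (us @ v # ws @ v # vs) = 0)"

text \<open>Smooth forms of mixed degree; in \<open>Forms_deg A k\<close> those of pure degree \<open>k\<close>.\<close>

definition Forms :: "('m, 'n::finite) chart set \<Rightarrow> ('m, 'n) form set" where
  "Forms A = {\<eta>.
     (\<forall>c p vs. c \<notin> A \<or> p \<notin> fst c \<longrightarrow> \<eta> c p vs = 0) \<and>
     (\<forall>c\<in>A. \<forall>p\<in>fst c. alternating (\<eta> c p)) \<and>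
     (\<forall>c\<in>A. \<forall>c'\<in>A. \<forall>p\<in>fst c \<inter> fst c'. \<forall>vs. \<eta> c' p (map (transition c c' p) vs) = \<eta> c p vs) \<and>
     (\<forall>c\<in>A. \<forall>vs. smooth_on (chart_image c) (\<lambda>x. \<eta> c (chart_inv c x) vs))}"

definition Forms_deg :: "('m, 'n::finite) chart set \<Rightarrow> nat \<Rightarrow> ('m, 'n) form set" where
  "Forms_deg A k = {\<eta> \<in> Forms A. \<forall>c p vs. length vs \<noteq> k \<longrightarrow> \<eta> c p vs = 0}"

definition fmult :: "('m \<Rightarrow> real) \<Rightarrow> ('m, 'n) form \<Rightarrow> ('m, 'n) form" where
  "fmult f \<eta> = (\<lambda>c p vs. f p * \<eta> c p vs)"

definition cmult :: "real \<Rightarrow> ('m, 'n) form \<Rightarrow> ('m, 'n) form" where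
  "cmult r = fmult (\<lambda>_. r)"

text \<open>\<open>d\<eta>(v\<^sub>0, ..., v\<^sub>k) = \<Sum>\<^sub>i (-1)^i D\<^bsub>v\<^sub>i\<^esub> \<eta>(v\<^sub>0, ..., omit v\<^sub>i, ..., v\<^sub>k)\<close> for constant \<open>v\<^sub>i\<close> in a chart.\<close>

definition ext_d :: "('m, 'n::finite) form \<Rightarrow> ('m, 'n) form" where
  "ext_d \<eta> = (\<lambda>c p vs. if p \<in> fst c then
     (\<Sum>i<length vs. (-1) ^ i *
        frechet_derivative (\<lambda>x. \<eta> c (chart_inv c x) (nths vs (- {i}))) (at (snd c p)) (vs ! i))
     else 0)"


section \<open>Compatible triples\<close>

definition symplectic_form :: "('m, 'n::finite) chart set \<Rightarrow> ('m, 'n) form \<Rightarrow> bool" where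
  "symplectic_form A \<omega> \<longleftrightarrow> \<omega> \<in> Forms_deg A 2 \<and> ext_d \<omega> = 0 \<and>
     (\<forall>c\<in>A. \<forall>p\<in>fst c. \<forall>u. u \<noteq> 0 \<longrightarrow> (\<exists>v. \<omega> c p [u, v] \<noteq> 0))"

type_synonym ('m, 'n) endo = "('m, 'n) chart \<Rightarrow> 'm \<Rightarrow> real^'n \<Rightarrow> real^'n"
type_synonym ('m, 'n) bilin = "('m, 'n) chart \<Rightarrow> 'm \<Rightarrow> real^'n \<Rightarrow> real^'n \<Rightarrow> real"

definition almost_complex :: "('m, 'n::finite) chart set \<Rightarrow> ('m, 'n) endo \<Rightarrow> bool" where
  "almost_complex A J \<longleftrightarrow>
     (\<forall>c\<in>A. \<forall>p\<in>fst c. linear (J c p) \<and> (\<forall>u. J c p (J c p u) = - u)) \<and>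
     (\<forall>c\<in>A. \<forall>c'\<in>A. \<forall>p\<in>fst c \<inter> fst c'. \<forall>u.
        J c' p (transition c c' p u) = transition c c' p (J c p u)) \<and>
     (\<forall>c\<in>A. \<forall>u. smooth_on (chart_image c) (\<lambda>x. J c (chart_inv c x) u))"

definition riemannian_metric :: "('m, 'n::finite) chart set \<Rightarrow> ('m, 'n) bilin \<Rightarrow> bool" where
  "riemannian_metric A g \<longleftrightarrow>
     (\<forall>c\<in>A. \<forall>p\<in>fst c. bilinear (g c p) \<and> (\<forall>u v. g c p u v = g c p v u) \<and>
        (\<forall>u. u \<noteq> 0 \<longrightarrow> g c p u u > 0)) \<and>
     (\<forall>c\<in>A. \<forall>c'\<in>A. \<forall>p\<in>fst c \<inter> fst c'. \<forall>u v.
        g c' p (transition c c' p u) (transition c c' p v) = g c p u v) \<and>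
     (\<forall>c\<in>A. \<forall>u v. smooth_on (chart_image c) (\<lambda>x. g c (chart_inv c x) u v))"

text \<open>
  Symmetry of \<open>g\<close> together with \<open>J\<^sup>2 = -1\<close> gives \<open>\<omega>(Ju, Jv) = \<omega>(u, v)\<close>.
\<close>

definition compatible_triple ::
  "('m, 'n::finite) chart set \<Rightarrow> ('m, 'n) form \<Rightarrow> ('m, 'n) endo \<Rightarrow> ('m, 'n) bilin \<Rightarrow> bool" where
  "compatible_triple A \<omega> J g \<longleftrightarrow>
     symplectic_form A \<omega> \<and> almost_complex A J \<and> riemannian_metric A g \<and>
     (\<forall>c\<in>A. \<forall>p\<in>fst c. \<forall>u v. g c p u v = \<omega> c p [u, J c p v])"


section \<open>Lefschetz operators\<close>

text \<open>\<open>\<omega> \<and> \<eta>\<close>, written as the sum over all \<open>(2, k)\<close>-shuffles.\<close>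

definition lefschetz :: "('m, 'n) form \<Rightarrow> ('m, 'n) form \<Rightarrow> ('m, 'n) form" where
  "lefschetz \<omega> \<eta> = (\<lambda>c p vs. \<Sum>j<length vs. \<Sum>i<j.
     (-1) ^ (i + j + 1) * \<omega> c p [vs ! i, vs ! j] * \<eta> c p (nths vs (- {i, j})))"

definition omega_matrix :: "('m, 'n) form \<Rightarrow> ('m, 'n) chart \<Rightarrow> 'm \<Rightarrow> real^'n^'n" where
  "omega_matrix \<omega> c p = (\<chi> i j. \<omega> c p [axis i 1, axis j 1])"

text \<open>
  \<open>\<Lambda>\<eta> = 1/2 (\<omega>\<^sup>-\<^sup>1)\<^sup>i\<^sup>j \<iota>\<^sub>i \<iota>\<^sub>j \<eta>\<close>; since \<open>(\<iota>\<^sub>u \<eta>)(v, ...) = \<eta>(u, v, ...)\<close>, the vector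
  contracted last is inserted second.
\<close>

definition lambda_op :: "('m, 'n::finite) form \<Rightarrow> ('m, 'n) form \<Rightarrow> ('m, 'n) form" where
  "lambda_op \<omega> \<eta> = (\<lambda>c p vs. 1/2 * (\<Sum>i\<in>UNIV. \<Sum>j\<in>UNIV.
     matrix_inv (omega_matrix \<omega> c p) $ i $ j * \<eta> c p (axis j 1 # axis i 1 # vs)))"

definition d_lambda :: "('m, 'n::finite) form \<Rightarrow> ('m, 'n) form \<Rightarrow> ('m, 'n) form" where
  "d_lambda \<omega> \<eta> = ext_d (lambda_op \<omega> \<eta>) - lambda_op \<omega> (ext_d \<eta>)"

text \<open>Only used for \<open>0 \<le> k \<le> n\<close>, where \<open>2 n\<close> is the dimension.\<close>

definition Prim :: "('m, 'n::finite) chart set \<Rightarrow> ('m, 'n) form \<Rightarrow> nat \<Rightarrow> ('m, 'n) form set" where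
  "Prim A \<omega> k = {\<eta> \<in> Forms_deg A k. lambda_op \<omega> \<eta> = 0}"

text \<open>
  \<open>dB = B\<^sub>+ + L B\<^sub>-\<close> with primitive \<open>B\<^sub>+\<close> and \<open>B\<^sub>-\<close> of degrees \<open>k + 1\<close> and \<open>k - 1\<close>; there are no
  primitive forms of degree \<open>n + 1\<close> or \<open>-1\<close>.
\<close>

definition d_decomposition ::
  "('m, 'n::finite) chart set \<Rightarrow> ('m, 'n) form \<Rightarrow> nat \<Rightarrow> nat \<Rightarrow>
   ('m, 'n) form \<Rightarrow> ('m, 'n) form \<Rightarrow> ('m, 'n) form \<Rightarrow> bool" where
  "d_decomposition A \<omega> n k B Bp Bm \<longleftrightarrow>
     (if k < n then Bp \<in> Prim A \<omega> (k + 1) else Bp = 0) \<and>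
     (if k > 0 then Bm \<in> Prim A \<omega> (k - 1) else Bm = 0) \<and>
     ext_d B = Bp + lefschetz \<omega> Bm"

definition del_plus ::
  "('m, 'n::finite) chart set \<Rightarrow> ('m, 'n) form \<Rightarrow> nat \<Rightarrow> nat \<Rightarrow> ('m, 'n) form \<Rightarrow> ('m, 'n) form" where
  "del_plus A \<omega> n k B = (THE Bp. \<exists>Bm. d_decomposition A \<omega> n k B Bp Bm)"

definition del_minus ::
  "('m, 'n::finite) chart set \<Rightarrow> ('m, 'n) form \<Rightarrow> nat \<Rightarrow> nat \<Rightarrow> ('m, 'n) form \<Rightarrow> ('m, 'n) form" where
  "del_minus A \<omega> n k B = (THE Bm. \<exists>Bp. d_decomposition A \<omega> n k B Bp Bm)"


section \<open>The \<open>L\<^sup>2\<close> inner product and formal adjoints\<close>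

definition gram :: "('m, 'n) bilin \<Rightarrow> ('m, 'n) chart \<Rightarrow> 'm \<Rightarrow> real^'n^'n" where
  "gram g c p = (\<chi> i j. g c p (axis i 1) (axis j 1))"

definition riemannian_measure ::
  "('m::topological_space, 'n::finite) chart set \<Rightarrow> ('m, 'n) bilin \<Rightarrow> 'm measure" where
  "riemannian_measure A g = (THE \<mu>. sets \<mu> = sets borel \<and>
     (\<forall>c\<in>A. \<forall>B\<in>sets borel. B \<subseteq> fst c \<longrightarrow>
        emeasure \<mu> B = (\<integral>\<^sup>+x. ennreal (sqrt (det (gram g c (chart_inv c x)))) *
                              indicator (snd c ` B) x \<partial>lborel)))"

text \<open>
  The inner product induced on alternating forms by \<open>g\<close>:
  \<open>1/k! g\<^bsup>i1 j1\<^esup> ... g\<^bsup>ik jk\<^esup> a\<^bsub>i1...ik\<^esub> b\<^bsub>j1...jk\<^esub>\<close> in degree \<open>k\<close>,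
  with different degrees orthogonal.
\<close>

definition alt_inner ::
  "real^'n^'n \<Rightarrow> ((real^'n::finite) list \<Rightarrow> real) \<Rightarrow> ((real^'n) list \<Rightarrow> real) \<Rightarrow> real" where
  "alt_inner G a b = (\<Sum>k\<le>CARD('n). 1 / fact k *
     (\<Sum>I | length I = k. \<Sum>K | length K = k.
        (\<Prod>r<k. matrix_inv G $ (I ! r) $ (K ! r)) *
        a (map (\<lambda>i. axis i 1) I) * b (map (\<lambda>i. axis i 1) K)))"

text \<open>The value does not depend on the chosen chart.\<close>

definition form_inner ::
  "('m, 'n::finite) chart set \<Rightarrow> ('m, 'n) bilin \<Rightarrow> ('m, 'n) form \<Rightarrow> ('m, 'n) form \<Rightarrow> 'm \<Rightarrow> real" where
  "form_inner A g \<alpha> \<beta> p =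
     (let c = (SOME c. c \<in> A \<and> p \<in> fst c) in alt_inner (gram g c p) (\<alpha> c p) (\<beta> c p))"

definition L2_inner ::
  "('m::topological_space, 'n::finite) chart set \<Rightarrow> ('m, 'n) bilin \<Rightarrow>
   ('m, 'n) form \<Rightarrow> ('m, 'n) form \<Rightarrow> real" where
  "L2_inner A g \<alpha> \<beta> = (\<integral>p. form_inner A g \<alpha> \<beta> p \<partial>riemannian_measure A g)"

definition compactly_supported :: "('m::topological_space, 'n) form \<Rightarrow> bool" where
  "compactly_supported \<alpha> \<longleftrightarrow> compact (closure {p. \<exists>c vs. \<alpha> c p vs \<noteq> 0})"

text \<open>
  \<open>formal_adjoint A g E D\<close> is the formal adjoint of an operator \<open>D\<close> whose domain is the space \<open>E\<close>
  of smooth sections.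
\<close>

definition formal_adjoint ::
  "('m::topological_space, 'n::finite) chart set \<Rightarrow> ('m, 'n) bilin \<Rightarrow> ('m, 'n) form set \<Rightarrow>
   (('m, 'n) form \<Rightarrow> ('m, 'n) form) \<Rightarrow> ('m, 'n) form \<Rightarrow> ('m, 'n) form" where
  "formal_adjoint A g E D \<beta> = (THE \<gamma>. \<gamma> \<in> E \<and>
     (\<forall>\<alpha>\<in>E. compactly_supported \<alpha> \<longrightarrow> L2_inner A g (D \<alpha>) \<beta> = L2_inner A g \<alpha> \<gamma>))"

definition d_star ::
  "('m::topological_space, 'n::finite) chart set \<Rightarrow> ('m, 'n) bilin \<Rightarrow> ('m, 'n) form \<Rightarrow> ('m, 'n) form" where
  "d_star A g = formal_adjoint A g (Forms A) ext_d"

definition d_lambda_star ::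
  "('m::topological_space, 'n::finite) chart set \<Rightarrow> ('m, 'n) form \<Rightarrow> ('m, 'n) bilin \<Rightarrow>
   ('m, 'n) form \<Rightarrow> ('m, 'n) form" where
  "d_lambda_star A \<omega> g = formal_adjoint A g (Forms A) (d_lambda \<omega>)"


section \<open>Elliptic operators\<close>

text \<open>
  A vector bundle (here: a subbundle of the exterior bundle) is given by its space \<open>E\<close> of smooth
  sections, and its fibre at a point consists of the values of these sections.
\<close>

definition fibre :: "('m, 'n) form set \<Rightarrow> ('m, 'n) chart \<Rightarrow> 'm \<Rightarrow> ((real^'n) list \<Rightarrow> real) set" where
  "fibre E c p = (\<lambda>s. s c p) ` E"

definition linear_op ::
  "('m, 'n) form set \<Rightarrow> ('m, 'n) form set \<Rightarrow> (('m, 'n) form \<Rightarrow> ('m, 'n) form) \<Rightarrow> bool" where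
  "linear_op E F P \<longleftrightarrow> (\<forall>s\<in>E. P s \<in> F) \<and>
     (\<forall>s\<in>E. \<forall>t\<in>E. P (s + t) = P s + P t) \<and> (\<forall>s\<in>E. \<forall>r. P (cmult r s) = cmult r (P s))"

text \<open>
  \<open>diff_op A E F m P\<close>: \<open>P\<close> is a linear differential operator of order at most \<open>m\<close> from \<open>E\<close> to \<open>F\<close>,
  in the sense of Grothendieck: commutators with multiplication operators lower the order, and
  operators of order 0 commute with multiplication by smooth functions.
\<close>

primrec diff_op ::
  "('m, 'n::finite) chart set \<Rightarrow> ('m, 'n) form set \<Rightarrow> ('m, 'n) form set \<Rightarrow> nat \<Rightarrow>
   (('m, 'n) form \<Rightarrow> ('m, 'n) form) \<Rightarrow> bool" where
  "diff_op A E F 0 P \<longleftrightarrow> linear_op E F P \<and>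
     (\<forall>f. smooth_fun A f \<longrightarrow> (\<forall>s\<in>E. P (fmult f s) = fmult f (P s)))"
| "diff_op A E F (Suc m) P \<longleftrightarrow> linear_op E F P \<and>
     (\<forall>f. smooth_fun A f \<longrightarrow> diff_op A E F m (\<lambda>s. P (fmult f s) - fmult f (P s)))"

definition has_differential ::
  "('m, 'n) chart \<Rightarrow> 'm \<Rightarrow> ('m \<Rightarrow> real) \<Rightarrow> real^'n::finite \<Rightarrow> bool" where
  "has_differential c p f \<xi> \<longleftrightarrow> ((f \<circ> chart_inv c) has_derivative (\<lambda>u. \<xi> \<bullet> u)) (at (snd c p))"

text \<open>
  The principal symbol at the covector \<open>\<xi>\<close> at \<open>p\<close> (components with respect to the chart \<open>c\<close>):
  \<open>\<sigma>(p, \<xi>) v = 1/m! P((f - f(p))^m s)(p)\<close> for any smooth \<open>f\<close>, \<open>s\<close> with \<open>df\<^sub>p = \<xi>\<close>, \<open>s(p) = v\<close>. In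
  local coordinates this is the sum over \<open>|\<alpha>| = m\<close> of \<open>a\<^sub>\<alpha>(p) \<xi>^\<alpha>\<close>; the factor \<open>i^m\<close> that some
  authors include is immaterial for invertibility (and is 1 for \<open>m = 4\<close>).
\<close>

definition symbol_value ::
  "('m, 'n::finite) chart set \<Rightarrow> ('m, 'n) form set \<Rightarrow> nat \<Rightarrow> (('m, 'n) form \<Rightarrow> ('m, 'n) form) \<Rightarrow>
   ('m, 'n) chart \<Rightarrow> 'm \<Rightarrow> real^'n \<Rightarrow> ((real^'n) list \<Rightarrow> real) \<Rightarrow> ((real^'n) list \<Rightarrow> real) \<Rightarrow> bool" where
  "symbol_value A E m P c p \<xi> v w \<longleftrightarrow>
     (\<exists>f s. smooth_fun A f \<and> has_differential c p f \<xi> \<and> s \<in> E \<and> s c p = v \<and>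
        w = cmult (1 / fact m) (P (fmult (\<lambda>q. (f q - f p) ^ m) s)) c p)"

definition principal_symbol ::
  "('m, 'n::finite) chart set \<Rightarrow> ('m, 'n) form set \<Rightarrow> nat \<Rightarrow> (('m, 'n) form \<Rightarrow> ('m, 'n) form) \<Rightarrow>
   ('m, 'n) chart \<Rightarrow> 'm \<Rightarrow> real^'n \<Rightarrow> ((real^'n) list \<Rightarrow> real) \<Rightarrow> ((real^'n) list \<Rightarrow> real)" where
  "principal_symbol A E m P c p \<xi> v = (THE w. symbol_value A E m P c p \<xi> v w)"

definition elliptic ::
  "('m, 'n::finite) chart set \<Rightarrow> ('m, 'n) form set \<Rightarrow> nat \<Rightarrow> (('m, 'n) form \<Rightarrow> ('m, 'n) form) \<Rightarrow> bool" where
  "elliptic A E m P \<longleftrightarrow> diff_op A E E m P \<and>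
     (\<forall>c\<in>A. \<forall>p\<in>fst c. \<forall>\<xi>. \<xi> \<noteq> 0 \<longrightarrow>
        bij_betw (principal_symbol A E m P c p \<xi>) (fibre E c p) (fibre E c p))"


section \<open>The Laplacians\<close>

definition Delta_dd_lambda ::
  "('m::topological_space, 'n::finite) chart set \<Rightarrow> ('m, 'n) form \<Rightarrow> ('m, 'n) bilin \<Rightarrow>
   ('m, 'n) form \<Rightarrow> ('m, 'n) form" where
  "Delta_dd_lambda A \<omega> g \<eta> =
     (let d = ext_d; d' = d_lambda \<omega>; ds = d_star A g; ds' = d_lambda_star A \<omega> g;
          Q = (\<lambda>\<eta>. d (ds \<eta>) + d' (ds' \<eta>))
      in ds' (ds (d (d' \<eta>))) + cmult (1/4) (Q (Q \<eta>)))"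

definition Delta_d_plus_d_lambda ::
  "('m::topological_space, 'n::finite) chart set \<Rightarrow> ('m, 'n) form \<Rightarrow> ('m, 'n) bilin \<Rightarrow>
   ('m, 'n) form \<Rightarrow> ('m, 'n) form" where
  "Delta_d_plus_d_lambda A \<omega> g \<eta> =
     (let d = ext_d; d' = d_lambda \<omega>; ds = d_star A g; ds' = d_lambda_star A \<omega> g;
          Q = (\<lambda>\<eta>. ds (d \<eta>) + ds' (d' \<eta>))
      in d (d' (ds' (ds \<eta>))) + cmult (1/4) (Q (Q \<eta>)))"

text \<open>
  On \<open>Prim A \<omega> n\<close>; here \<open>dm\<close> is \<open>\<partial>\<^sub>-\<close> from degree \<open>n\<close> to degree \<open>n - 1\<close>, and \<open>dp\<close> is \<open>\<partial>\<^sub>+\<close> from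
  degree \<open>n - 1\<close> to degree \<open>n\<close>.
\<close>

definition Delta_plus_plus ::
  "('m::topological_space, 'n::finite) chart set \<Rightarrow> ('m, 'n) form \<Rightarrow> ('m, 'n) bilin \<Rightarrow> nat \<Rightarrow>
   ('m, 'n) form \<Rightarrow> ('m, 'n) form" where
  "Delta_plus_plus A \<omega> g n B =
     (let dp = del_plus A \<omega> n (n - 1); dm = del_minus A \<omega> n n;
          dps = formal_adjoint A g (Prim A \<omega> (n - 1)) dp;
          dpms = formal_adjoint A g (Prim A \<omega> n) (dp \<circ> dm)
      in dpms (dp (dm B)) + dp (dps (dp (dps B))))"

definition Delta_minus_minus ::
  "('m::topological_space, 'n::finite) chart set \<Rightarrow> ('m, 'n) form \<Rightarrow> ('m, 'n) bilin \<Rightarrow> nat \<Rightarrow>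
   ('m, 'n) form \<Rightarrow> ('m, 'n) form" where
  "Delta_minus_minus A \<omega> g n B =
     (let dp = del_plus A \<omega> n (n - 1); dm = del_minus A \<omega> n n;
          dms = formal_adjoint A g (Prim A \<omega> n) dm;
          dpms = formal_adjoint A g (Prim A \<omega> n) (dp \<circ> dm)
      in dp (dm (dpms B)) + dms (dm (dms (dm B))))"

end

theory Submission
  imports Defs
begin

text \<open>
  The codifferential \<open>d\<^sup>*\<close> is written down in each chart. That it is the formal adjoint of \<open>d\<close> is the
  vanishing of the integral of a compactly supported divergence together with a decomposition by bump
  functions, and its independence of the chart follows from adjointness on forms supported in the overlap.
  Since \<open>\<Lambda>\<close> is the pointwise adjoint of \<open>L\<close>, the adjoint of \<open>d\<^sup>\<Lambda> = d \<Lambda> - \<Lambda> d\<close> is \<open>L d\<^sup>* - d\<^sup>* L\<close>.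

  From \<open>[L, d] = 0\<close> and the \<open>sl\<^sub>2\<close>-relations, \<open>\<Lambda> \<Lambda> d B = 0\<close> for primitive \<open>B\<close>; this gives the decomposition
  \<open>dB = \<partial>\<^sub>+ B + L \<partial>\<^sub>- B\<close> with \<open>\<partial>\<^sub>- B\<close> a multiple of \<open>\<Lambda> d B\<close>. On primitive forms of degree \<open>n\<close> one has
  \<open>LB = 0\<close>, \<open>d\<^sup>\<Lambda> B = - \<partial>\<^sub>- B\<close>, and the adjoints of \<open>\<partial>\<^sub>+\<close>, \<open>\<partial>\<^sub>-\<close> and \<open>\<partial>\<^sub>+ \<partial>\<^sub>-\<close> are \<open>d\<^sup>*\<close>,
  \<open>d\<^sup>* L - (1/2) L d\<^sup>*\<close> and \<open>d\<^sup>* L d\<^sup>*\<close>, so that the second-order factors of the Laplacians agree up to a factor 2.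

  The symbols of \<open>d\<close>, \<open>d\<^sup>*\<close>, \<open>d\<^sup>\<Lambda>\<close> and \<open>d\<^sup>\<Lambda>\<^sup>*\<close> at \<open>\<xi>\<close> are \<open>\<xi> \<and>\<close>, \<open>- \<iota>\<^sub>v\<close>, \<open>- \<iota>\<^sub>u\<close> and \<open>\<zeta> \<and>\<close>, where
  \<open>\<xi>(v) = \<zeta>(u) = |\<xi>|\<^sup>2\<close> and \<open>\<xi>(u) = \<zeta>(v) = 0\<close>. By the anticommutation relations, \<open>\<xi> \<and> \<iota>\<^sub>v\<close> and \<open>\<iota>\<^sub>u \<zeta> \<and>\<close> are
  \<open>|\<xi>|\<^sup>2\<close> times commuting projections, and both fourth-order Laplacians have the same symbol, with
  eigenvalues \<open>|\<xi>|\<^sup>4\<close> and \<open>|\<xi>|\<^sup>4 / 4\<close>. Its inverse is a polynomial in it, hence preserves the fibres of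
  every invariant subbundle, in particular that of primitive forms.
\<close>

section \<open>Wedge and contraction on multilinear functions of lists\<close>

text \<open>The starred operators, \<open>riemannian_measure\<close>, \<open>del_plus\<close> and
  \<open>del_minus\<close> are definite descriptions: each yields information only after a candidate
  has been exhibited and proved unique. This dictates the analytic half (volume measure, divergence,
  bump functions); ellipticity itself is algebra in one fibre. The codifferential comes from a
  coordinate divergence instead of a Hodge star, and \<open>J\<close> enters through the single
  identity \<open>P = - G^-1 W G^-1\<close> for the matrices of
  \<open>\<omega>\<^sup>-\<^sup>1\<close>, \<open>g\<close> and \<open>\<omega>\<close>, which makes
  L and \<Lambda> adjoint.

  Forms take argument lists of every length at once, so identities for wedge and contraction are
  proved by recursion on the list. Covectors are stored as vectors acting through the Euclidean
  product.

  Write N and M for the two multiples of projections and c for the squared norm of \<xi>. That both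
  Laplacians have one symbol is the identity (c - N)(c - M) + (N + M)^2 / 4 = N M + (2c - N - M)^2 /
  4, where the two sides are the symbols of the two operators. The same 1/4 cancels the square of
  the factor 2 on primitive forms.\<close>

definition tscale :: "real \<Rightarrow> ('v list \<Rightarrow> real) \<Rightarrow> 'v list \<Rightarrow> real" where
  "tscale r a = (\<lambda>vs. r * a vs)"

definition contr :: "'v \<Rightarrow> ('v list \<Rightarrow> real) \<Rightarrow> 'v list \<Rightarrow> real" where
  "contr v a = (\<lambda>vs. a (v # vs))"

definition pull :: "('u \<Rightarrow> 'v) \<Rightarrow> ('v list \<Rightarrow> real) \<Rightarrow> 'u list \<Rightarrow> real" where
  "pull T a = (\<lambda>vs. a (map T vs))"

text \<open>The product \<open>\<xi> \<and> a\<close>, by the recursion \<open>\<iota>\<^sub>v (\<xi> \<and> a) = \<xi>(v) a - \<xi> \<and> \<iota>\<^sub>v a\<close>.\<close>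

primrec wedge_list :: "('v list) \<Rightarrow> 'v \<Rightarrow> ('v::real_inner list \<Rightarrow> real) \<Rightarrow> real" where
  "wedge_list [] \<xi> a = 0"
| "wedge_list (v # vs) \<xi> a = (\<xi> \<bullet> v) * a vs - wedge_list vs \<xi> (contr v a)"

definition wedge :: "'v::real_inner \<Rightarrow> ('v list \<Rightarrow> real) \<Rightarrow> 'v list \<Rightarrow> real" where
  "wedge \<xi> a = (\<lambda>vs. wedge_list vs \<xi> a)"

lemma tscale_apply [simp]: "tscale r a vs = r * a vs"
  by (simp add: tscale_def)

lemma contr_apply [simp]: "contr v a vs = a (v # vs)"
  by (simp add: contr_def)

lemma pull_apply [simp]: "pull T a vs = a (map T vs)"
  by (simp add: pull_def)

lemma wedge_Nil [simp]: "wedge \<xi> a [] = 0"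
  by (simp add: wedge_def)

lemma wedge_Cons [simp]: "wedge \<xi> a (v # vs) = (\<xi> \<bullet> v) * a vs - wedge \<xi> (contr v a) vs"
  by (simp add: wedge_def)

lemma fun_sum_apply: "(sum f S :: 'a \<Rightarrow> 'b::comm_monoid_add) x = (\<Sum>i\<in>S. f i x)"
  by (induction S rule: infinite_finite_induct) auto

lemma tscale_simps [simp]:
  "tscale 0 a = 0" "tscale r 0 = 0" "tscale 1 a = a" "tscale r (tscale s a) = tscale (r * s) a"
  "tscale (-1) a = - a" "tscale r (- a) = tscale (- r) a"
  by (auto simp: fun_eq_iff)

lemma tscale_add: "tscale r (a + b) = tscale r a + tscale r b"
  and tscale_diff: "tscale r (a - b) = tscale r a - tscale r b"
  and tscale_add_left: "tscale (r + s) a = tscale r a + tscale s a"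
  and tscale_minus_left: "tscale (- r) a = - tscale r a"
  by (auto simp: fun_eq_iff algebra_simps)

lemma tscale_sum: "tscale r (sum f S) = (\<Sum>i\<in>S. tscale r (f i))"
  by (auto simp: fun_eq_iff fun_sum_apply sum_distrib_left)

lemma contr_add [simp]: "contr v (a + b) = contr v a + contr v b"
  and contr_diff [simp]: "contr v (a - b) = contr v a - contr v b"
  and contr_minus [simp]: "contr v (- a) = - contr v a"
  and contr_zero [simp]: "contr v 0 = 0"
  and contr_tscale [simp]: "contr v (tscale r a) = tscale r (contr v a)"
  by (auto simp: fun_eq_iff)

lemma contr_sum: "contr v (sum f S) = (\<Sum>i\<in>S. contr v (f i))"
  by (auto simp: fun_eq_iff fun_sum_apply)

lemma contr_wedge: "contr v (wedge \<xi> a) = tscale (\<xi> \<bullet> v) a - wedge \<xi> (contr v a)"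
  by (auto simp: fun_eq_iff)

lemma wedge_add: "wedge \<xi> (a + b) = wedge \<xi> a + wedge \<xi> b"
proof
  fix vs show "wedge \<xi> (a + b) vs = (wedge \<xi> a + wedge \<xi> b) vs"
    by (induction vs arbitrary: a b) (auto simp: algebra_simps)
qed

lemma wedge_tscale: "wedge \<xi> (tscale r a) = tscale r (wedge \<xi> a)"
proof
  fix vs show "wedge \<xi> (tscale r a) vs = tscale r (wedge \<xi> a) vs"
    by (induction vs arbitrary: a) (auto simp: algebra_simps)
qed

lemma wedge_zero [simp]: "wedge \<xi> 0 = 0"
  using wedge_tscale[of \<xi> 0 0] by simp

lemma wedge_minus: "wedge \<xi> (- a) = - wedge \<xi> a"
  using wedge_tscale[of \<xi> "-1" a] by simp

lemma wedge_diff: "wedge \<xi> (a - b) = wedge \<xi> a - wedge \<xi> b"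
  using wedge_add[of \<xi> a "- b"] by (simp add: wedge_minus)

lemma wedge_sum: "wedge \<xi> (sum f S) = (\<Sum>i\<in>S. wedge \<xi> (f i))"
  using sum_comp_morphism[of "wedge \<xi>" f S] by (simp add: wedge_add)

lemma wedge_add_left: "wedge (\<xi> + \<eta>) a = wedge \<xi> a + wedge \<eta> a"
proof
  fix vs show "wedge (\<xi> + \<eta>) a vs = (wedge \<xi> a + wedge \<eta> a) vs"
    by (induction vs arbitrary: a) (auto simp: algebra_simps inner_add_left)
qed

lemma wedge_scale_left: "wedge (r *\<^sub>R \<xi>) a = tscale r (wedge \<xi> a)"
proof
  fix vs show "wedge (r *\<^sub>R \<xi>) a vs = tscale r (wedge \<xi> a) vs"
    by (induction vs arbitrary: a) (auto simp: algebra_simps)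
qed

lemma wedge_zero_left [simp]: "wedge 0 a = 0"
  using wedge_scale_left[of 0 0 a] by simp

lemma wedge_sum_left: "wedge (sum f S) a = (\<Sum>i\<in>S. wedge (f i) a)"
  using sum_comp_morphism[of "\<lambda>\<xi>. wedge \<xi> a" f S] wedge_scale_left[of 0 0 a]
  by (simp add: wedge_add_left o_def)

text \<open>Contracting the first argument by \<open>contr_wedge\<close> produces the same mixed
  terms with opposite signs in the two products; what is left is the claim for
  \<open>contr v a\<close>.\<close>

lemma wedge_anticommute: "wedge \<xi> (wedge \<eta> a) = - wedge \<eta> (wedge \<xi> a)"
proof
  fix vs show "wedge \<xi> (wedge \<eta> a) vs = (- wedge \<eta> (wedge \<xi> a)) vs"
  proof (induction vs arbitrary: a)
    case (Cons v vs)
    have "wedge \<xi> (wedge \<eta> (contr v a)) vs = (- wedge \<eta> (wedge \<xi> (contr v a))) vs"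
      by (rule Cons.IH)
    then show ?case
      by (simp add: contr_wedge wedge_diff wedge_tscale)
  qed simp
qed

lemma wedge_self [simp]: "wedge \<xi> (wedge \<xi> a) = 0"
  using wedge_anticommute[of \<xi> \<xi> a] by (auto simp: fun_eq_iff)

lemma pull_add: "pull T (a + b) = pull T a + pull T b"
  and pull_diff: "pull T (a - b) = pull T a - pull T b"
  and pull_zero [simp]: "pull T 0 = 0"
  and pull_tscale: "pull T (tscale r a) = tscale r (pull T a)"
  and pull_pull: "pull T (pull S a) = pull (S \<circ> T) a"
  and contr_pull: "contr v (pull T a) = pull T (contr (T v) a)"
  by (auto simp: fun_eq_iff)

lemma pull_sum: "pull T (sum f S) = (\<Sum>i\<in>S. pull T (f i))"
  by (auto simp: fun_eq_iff fun_sum_apply)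

text \<open>Covectors are represented by vectors, so the hypothesis says that \<open>\<xi>'\<close>
  is the pullback of \<open>\<xi>\<close> along \<open>T\<close>.\<close>

lemma pull_wedge:
  assumes "\<And>v. \<xi> \<bullet> T v = \<xi>' \<bullet> v"
  shows "pull T (wedge \<xi> a) = wedge \<xi>' (pull T a)"
proof
  fix vs show "pull T (wedge \<xi> a) vs = wedge \<xi>' (pull T a) vs"
    by (induction vs arbitrary: a) (auto simp: assms contr_pull)
qed

section \<open>Alternating functions\<close>

lemma alternating_linear: "alternating a \<Longrightarrow> linear (\<lambda>v. a (us @ v # vs))"
  by (simp add: alternating_def)

lemma alternating_linear_hd: "alternating a \<Longrightarrow> linear (\<lambda>v. a (v # vs))"
  using alternating_linear[of a "[]"] by simp

lemma alternating_adjacent: "alternating a \<Longrightarrow> a (us @ v # v # vs) = 0"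
  unfolding alternating_def by (metis append_Nil)

text \<open>Polarisation: with \<open>v + w\<close> in both slots the value is 0, and its expansion
  leaves only the two mixed terms.\<close>

lemma swap_of_adjacent:
  assumes lin: "\<And>us vs. linear (\<lambda>v. a (us @ v # vs))"
    and adj: "\<And>us v vs. a (us @ v # v # vs) = (0::real)"
  shows "a (us @ v # w # vs) = - a (us @ w # v # vs)"
proof -
  have "a (us @ (v + w) # (v + w) # vs) = a (us @ v # (v + w) # vs) + a (us @ w # (v + w) # vs)"
    using linear_add[OF lin[of us "(v + w) # vs"]] by simp
  also have "\<dots> = a (us @ v # v # vs) + a (us @ v # w # vs) + (a (us @ w # v # vs) + a (us @ w # w # vs))"
    using linear_add[OF lin[of "us @ [v]" vs]] linear_add[OF lin[of "us @ [w]" vs]] by simp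
  finally show ?thesis by (simp add: adj)
qed

text \<open>\<open>alternating\<close> asks for 0 whenever two arguments agree, however far apart.
  Adjacent repetitions suffice, since one of the two can be moved past the list in between by
  transpositions.\<close>

lemma alternatingI:
  assumes lin: "\<And>us vs. linear (\<lambda>v. a (us @ v # vs))"
    and adj: "\<And>us v vs. a (us @ v # v # vs) = (0::real)"
  shows "alternating a"
proof -
  have "a (us @ v # ws @ v # vs) = 0" for us v ws vs
  proof (induction ws arbitrary: us)
    case Nil then show ?case by (simp add: adj)
  next
    case (Cons w ws)
    have "a (us @ v # w # (ws @ v # vs)) = - a ((us @ [w]) @ v # ws @ v # vs)"
      using swap_of_adjacent[of a us v w "ws @ v # vs", OF lin adj] by simp
    then show ?case using Cons[of "us @ [w]"] by simp
  qed
  then show ?thesis using lin by (simp add: alternating_def)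
qed

lemma alternating_swap: "alternating a \<Longrightarrow> a (us @ v # w # vs) = - a (us @ w # v # vs)"
  by (rule swap_of_adjacent) (auto intro: alternating_linear alternating_adjacent)

lemma contr_anticommute: "alternating a \<Longrightarrow> contr u (contr v a) = - contr v (contr u a)"
  using alternating_swap[of a "[]" v u] by (auto simp: fun_eq_iff)

lemma alternating_zero [simp, intro]: "alternating 0"
  by (rule alternatingI) (auto intro: linearI)

lemma alternating_add [intro]: "alternating a \<Longrightarrow> alternating b \<Longrightarrow> alternating (a + b)"
  using linear_compose_add[OF alternating_linear alternating_linear, of a b]
  by (intro alternatingI) (simp_all add: alternating_adjacent)

lemma alternating_tscale [intro]: "alternating a \<Longrightarrow> alternating (tscale r a)"
  by (rule alternatingI)
    (auto intro!: linearI simp: alternating_adjacent algebra_simps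
       linear_add[OF alternating_linear] linear_scale[OF alternating_linear])

lemma alternating_minus [intro]: "alternating a \<Longrightarrow> alternating (- a)"
  using alternating_tscale[of a "-1"] by simp

lemma alternating_diff [intro]: "alternating a \<Longrightarrow> alternating b \<Longrightarrow> alternating (a - b)"
  using alternating_add[of a "- b"] by auto

lemma alternating_sum [intro]: "(\<And>i. i \<in> S \<Longrightarrow> alternating (f i)) \<Longrightarrow> alternating (sum f S)"
proof (induction S rule: infinite_finite_induct)
  case (insert x F)
  then have "alternating (f x + sum f F)" by (intro alternating_add) auto
  then show "alternating (sum f (insert x F))" using insert.hyps by simp
qed simp_all

lemma alternating_contr [intro]: "alternating a \<Longrightarrow> alternating (contr v a)"
  using alternating_linear[of a "v # us" for us] alternating_adjacent[of a "v # us" for us]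
  by (intro alternatingI) (simp_all)

lemma alternating_pull [intro]:
  assumes "alternating a" "linear T" shows "alternating (pull T a)"
proof (rule alternatingI)
  fix us vs
  have "linear ((\<lambda>v. a (map T us @ v # map T vs)) \<circ> T)"
    by (intro linear_compose assms alternating_linear)
  then show "linear (\<lambda>v. pull T a (us @ v # vs))" by (simp add: o_def)
qed (simp add: alternating_adjacent[OF assms(1)])

text \<open>The induction runs over the arguments in front of the tested slots: the recursion strips
  them one by one and replaces \<open>a\<close> by \<open>contr u a\<close>, which is again
  alternating.\<close>

lemma alternating_wedge [intro]:
  assumes "alternating a" shows "alternating (wedge \<xi> a)"
proof -
  have "linear (\<lambda>v. wedge \<xi> a (us @ v # vs)) \<and> (\<forall>v. wedge \<xi> a (us @ v # v # vs) = 0)" for us vs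
    using assms
  proof (induction us arbitrary: a vs)
    case Nil
    have 1: "contr (u + v) a = contr u a + contr v a" "contr (r *\<^sub>R v) a = tscale r (contr v a)" for u v r
      using linear_add[OF alternating_linear_hd[OF Nil]] linear_scale[OF alternating_linear_hd[OF Nil]]
      by (auto simp: fun_eq_iff)
    have 2: "contr v (contr v a) = 0" for v
      using alternating_adjacent[OF Nil, of "[]"] by (auto simp: fun_eq_iff)
    show ?case
      by (auto intro!: linearI simp: 1 2 inner_add_right wedge_add wedge_tscale algebra_simps)
  next
    case (Cons u us)
    have IH: "linear (\<lambda>v. wedge \<xi> (contr u a) (us @ v # vs)) \<and>
        (\<forall>v. wedge \<xi> (contr u a) (us @ v # v # vs) = 0)"
      by (rule Cons.IH) (rule alternating_contr[OF Cons.prems])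
    have "linear (\<lambda>v. (\<xi> \<bullet> u) * a (us @ v # vs))"
      using alternating_linear[OF alternating_tscale[OF Cons.prems, of "\<xi> \<bullet> u"], of us vs] by simp
    then have "linear (\<lambda>v. (\<xi> \<bullet> u) * a (us @ v # vs) - wedge \<xi> (contr u a) (us @ v # vs))"
      using conjunct1[OF IH] by (rule linear_compose_sub)
    moreover have "wedge \<xi> (contr u a) (us @ v # v # vs) = 0" for v using IH by blast
    ultimately show ?case by (simp add: alternating_adjacent[OF Cons.prems])
  qed
  then show ?thesis by (intro alternatingI) blast+
qed

section \<open>Expansion along the coordinate axes\<close>

lemma alternating_expand:
  fixes a :: "(real^'n::finite) list \<Rightarrow> real"
  assumes "alternating a"
  shows "a (us @ v # vs) = (\<Sum>k\<in>UNIV. v $ k * a (us @ axis k 1 # vs))"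
proof -
  note lin = alternating_linear[OF assms, of us vs]
  have "v = (\<Sum>k\<in>UNIV. (v $ k) *\<^sub>R axis k 1)"
    by (simp add: basis_expansion scalar_mult_eq_scaleR [symmetric])
  then have "a (us @ v # vs) = (\<lambda>v. a (us @ v # vs)) (\<Sum>k\<in>UNIV. (v $ k) *\<^sub>R axis k 1)" by simp
  also have "\<dots> = (\<Sum>k\<in>UNIV. v $ k * a (us @ axis k 1 # vs))"
    by (simp only: linear_sum[OF lin] linear_scale[OF lin] real_scaleR_def)
  finally show ?thesis .
qed

lemma contr_expand:
  fixes a :: "(real^'n::finite) list \<Rightarrow> real"
  assumes "alternating a"
  shows "contr v a = (\<Sum>k\<in>UNIV. tscale (v $ k) (contr (axis k 1) a))"
  using alternating_expand[OF assms, of "[]" v] by (auto simp: fun_eq_iff fun_sum_apply)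

lemma contr_linear_comb:
  assumes "alternating a"
  shows "contr (u + v) a = contr u a + contr v a" "contr (r *\<^sub>R v) a = tscale r (contr v a)"
    "contr (- v) a = - contr v a" "contr 0 a = 0"
    "contr (sum f S) a = (\<Sum>i\<in>S. contr (f i) a)"
proof -
  note lin = alternating_linear_hd[OF assms]
  show "contr (u + v) a = contr u a + contr v a" "contr (r *\<^sub>R v) a = tscale r (contr v a)"
    "contr (- v) a = - contr v a" "contr 0 a = 0"
    using linear_add[OF lin] linear_scale[OF lin] linear_neg[OF lin] linear_0[OF lin] by (auto simp: fun_eq_iff)
  show "contr (sum f S) a = (\<Sum>i\<in>S. contr (f i) a)"
    using linear_sum[OF lin] by (auto simp: fun_eq_iff fun_sum_apply)
qed

lemma wedge_expand:
  fixes \<xi> :: "real^'n::finite"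
  shows "wedge \<xi> a = (\<Sum>k\<in>UNIV. tscale (\<xi> $ k) (wedge (axis k 1) a))"
proof -
  have "\<xi> = (\<Sum>k\<in>UNIV. (\<xi> $ k) *\<^sub>R axis k 1)"
    by (simp add: basis_expansion scalar_mult_eq_scaleR [symmetric])
  then have "wedge \<xi> a = wedge (\<Sum>k\<in>UNIV. (\<xi> $ k) *\<^sub>R axis k 1) a" by simp
  then show ?thesis by (simp only: wedge_sum_left wedge_scale_left)
qed

text \<open>The derivation of the exterior algebra extending the transpose of \<open>S\<close>.\<close>

primrec derivation_list :: "'v list \<Rightarrow> ('v \<Rightarrow> 'v) \<Rightarrow> ('v list \<Rightarrow> real) \<Rightarrow> real" where
  "derivation_list [] S a = 0"
| "derivation_list (v # vs) S a = a (S v # vs) + derivation_list vs S (contr v a)"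

text \<open>A derivation of the exterior algebra is the sum of \<open>e_l \<and>\<close> composed
  with contraction by \<open>S e_l\<close>. In the recursion the sign of \<open>contr_wedge\<close>
  is undone by exchanging the two contractions. The formula serves for the degree operator and for
  the naturality of the exterior derivative.\<close>

lemma derivation_list_eq:
  fixes a :: "(real^'n::finite) list \<Rightarrow> real"
  assumes "alternating a" "linear S"
  shows "derivation_list vs S a = (\<Sum>l\<in>UNIV. wedge (axis l 1) (contr (S (axis l 1)) a) vs)"
  using assms(1)
proof (induction vs arbitrary: a)
  case (Cons v vs)
  have "a (S v # vs) = contr (S (\<Sum>l\<in>UNIV. (v $ l) *\<^sub>R axis l 1)) a vs"
    by (simp add: basis_expansion scalar_mult_eq_scaleR [symmetric])
  also have "\<dots> = (\<Sum>l\<in>UNIV. v $ l * contr (S (axis l 1)) a vs)"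
    by (simp add: linear_sum[OF assms(2)] linear_scale[OF assms(2)] contr_linear_comb[OF Cons.prems]
        fun_sum_apply del: contr_apply)
  finally have 1: "a (S v # vs) = (\<Sum>l\<in>UNIV. v $ l * a (S (axis l 1) # vs))" by simp
  have 2: "contr v (contr (S (axis l 1)) a) = - contr (S (axis l 1)) (contr v a)" for l
    by (rule contr_anticommute[OF Cons.prems])
  have "derivation_list vs S (contr v a) = (\<Sum>l\<in>UNIV. wedge (axis l 1) (contr (S (axis l 1)) (contr v a)) vs)"
    by (rule Cons.IH) (rule alternating_contr[OF Cons.prems])
  then show "derivation_list (v # vs) S a = (\<Sum>l\<in>UNIV. wedge (axis l 1) (contr (S (axis l 1)) a) (v # vs))"
    by (simp add: 1 2 wedge_minus inner_axis' sum.distrib del: contr_apply)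
    (simp add: sum_subtractf)
qed simp

text \<open>The derivation for \<open>S\<close> the identity counts arguments. It turns the trace
  formula for \<open>[\<Lambda>, L]\<close> into multiplication by a number in each degree.\<close>

lemma degree_operator:
  fixes a :: "(real^'n::finite) list \<Rightarrow> real"
  assumes "alternating a"
  shows "(\<Sum>l\<in>UNIV. wedge (axis l 1) (contr (axis l 1) a) vs) = length vs * a vs"
proof -
  have "derivation_list vs (\<lambda>v. v) b = length vs * b vs" for b :: "(real^'n) list \<Rightarrow> real"
    by (induction vs arbitrary: b) (auto simp: algebra_simps)
  then show ?thesis using derivation_list_eq[OF assms linear_id[unfolded id_def], of vs] by simp
qed

lemma alternating_basis_eqI:
  fixes a b :: "(real^'n::finite) list \<Rightarrow> real"
  assumes "alternating a" "alternating b"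
    and "\<And>I. length I = length vs \<Longrightarrow> a (map (\<lambda>i. axis i 1) I) = b (map (\<lambda>i. axis i 1) I)"
  shows "a vs = b vs"
  using assms
proof (induction vs arbitrary: a b)
  case (Cons v vs)
  have "a (axis k 1 # vs) = b (axis k 1 # vs)" for k
  proof -
    have "contr (axis k 1) a vs = contr (axis k 1) b vs"
      by (rule Cons.IH[OF alternating_contr[OF Cons.prems(1)] alternating_contr[OF Cons.prems(2)]])
        (use Cons.prems(3)[of "k # _"] in simp)
    then show ?thesis by simp
  qed
  then show ?case
    using alternating_expand[OF Cons.prems(1), of "[]" v vs] alternating_expand[OF Cons.prems(2), of "[]" v vs]
    by simp
qed auto

text \<open>By multilinearity lists of axis vectors suffice, and one longer than the dimension
  repeats an index.\<close>

lemma alternating_long_zero: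
  fixes a :: "(real^'n::finite) list \<Rightarrow> real"
  assumes "alternating a" "length vs > CARD('n)"
  shows "a vs = 0"
proof -
  have "a (map (\<lambda>i. axis i 1) I) = 0" if "length I = length vs" for I
  proof -
    have "\<not> distinct I"
      using that assms(2) card_mono[of "UNIV::'n set" "set I"] by (auto dest: distinct_card)
    then obtain us v ws xs where "I = us @ [v] @ ws @ [v] @ xs" using not_distinct_decomp by blast
    then show ?thesis using assms(1) by (simp add: alternating_def)
  qed
  then show ?thesis using alternating_basis_eqI[OF assms(1) alternating_zero, of vs] by simp
qed

section \<open>The inner product of alternating functions\<close>

abbreviation basis_list :: "'n list \<Rightarrow> (real^'n::finite) list" where
  "basis_list I \<equiv> map (\<lambda>i. axis i 1) I"

text \<open>On alternating functions this is \<open>k!\<close> times the Euclidean inner product of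
  \<open>k\<close>-forms. Peeling off the first index matches the recursions of \<open>wedge\<close>
  and \<open>pull\<close>.\<close>

primrec cinner :: "nat \<Rightarrow> ((real^'n::finite) list \<Rightarrow> real) \<Rightarrow> ((real^'n) list \<Rightarrow> real) \<Rightarrow> real" where
  "cinner 0 a b = a [] * b []"
| "cinner (Suc k) a b = (\<Sum>j\<in>UNIV. cinner k (contr (axis j 1) a) (contr (axis j 1) b))"

lemma finite_lists_length: "finite {I :: 'n::finite list. length I = k}"
  using finite_lists_length_eq[of "UNIV :: 'n set" k] by simp

lemma sum_lists_Suc:
  fixes f :: "'n::finite list \<Rightarrow> 'b::comm_monoid_add"
  shows "(\<Sum>I | length I = Suc k. f I) = (\<Sum>j\<in>UNIV. \<Sum>I | length I = k. f (j # I))"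
proof -
  have "(\<Sum>j\<in>UNIV. \<Sum>I | length I = k. f (j # I)) = (\<Sum>(j, I) \<in> UNIV \<times> {I. length I = k}. f (j # I))"
    by (simp add: sum.cartesian_product finite_lists_length)
  also have "\<dots> = (\<Sum>I | length I = Suc k. f I)"
    by (rule sum.reindex_bij_witness[of _ "\<lambda>I. (hd I, tl I)" "\<lambda>(j, I). j # I"]) (auto simp: length_Suc_conv)
  finally show ?thesis by simp
qed

lemma cinner_lists: "cinner k a b = (\<Sum>I | length I = k. a (basis_list I) * b (basis_list I))"
proof (induction k arbitrary: a b)
  case (Suc k)
  have "cinner (Suc k) a b = (\<Sum>j\<in>UNIV. \<Sum>I | length I = k. a (basis_list (j # I)) * b (basis_list (j # I)))"
    by (simp add: Suc.IH)
  also have "\<dots> = (\<Sum>I | length I = Suc k. a (basis_list I) * b (basis_list I))"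
    by (simp add: sum_lists_Suc)
  finally show ?case .
qed simp

lemma cinner_commute: "cinner k a b = cinner k b a"
  by (simp add: cinner_lists mult.commute)

lemma cinner_add_right: "cinner k a (b + c) = cinner k a b + cinner k a c"
  and cinner_tscale_right: "cinner k a (tscale r b) = r * cinner k a b"
  and cinner_zero_right [simp]: "cinner k a 0 = 0"
  and cinner_minus_right: "cinner k a (- b) = - cinner k a b"
  and cinner_diff_right: "cinner k a (b - c) = cinner k a b - cinner k a c"
  by (simp_all add: cinner_lists algebra_simps sum.distrib sum_distrib_left sum_negf sum_subtractf)

lemma cinner_add_left: "cinner k (b + c) a = cinner k b a + cinner k c a"
  and cinner_tscale_left: "cinner k (tscale r b) a = r * cinner k b a"
  and cinner_zero_left [simp]: "cinner k 0 a = 0"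
  and cinner_minus_left: "cinner k (- b) a = - cinner k b a"
  and cinner_diff_left: "cinner k (b - c) a = cinner k b a - cinner k c a"
  by (simp_all add: cinner_lists algebra_simps sum.distrib sum_distrib_left sum_negf sum_subtractf)

lemma cinner_sum_right: "cinner k a (sum f S) = (\<Sum>i\<in>S. cinner k a (f i))"
  using sum_comp_morphism[of "cinner k a" f S] by (simp add: cinner_add_right o_def)

lemma cinner_sum_left: "cinner k (sum f S) a = (\<Sum>i\<in>S. cinner k (f i) a)"
  using cinner_sum_right[of k a f S] by (simp add: cinner_commute)

text \<open>Wedge and contraction are adjoint; the factor \<open>Suc k\<close> reflects the missing
  normalisation by \<open>k!\<close>. In the induction the head term contributes one copy of the
  pairing and the remaining arguments the other \<open>k\<close>.\<close>

lemma cinner_wedge: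
  fixes a b :: "(real^'n::finite) list \<Rightarrow> real"
  assumes "alternating b"
  shows "cinner (Suc k) (wedge \<xi> a) b = real (Suc k) * cinner k a (contr \<xi> b)"
  using assms
proof (induction k arbitrary: a b)
  have *: "(\<Sum>j\<in>UNIV. \<xi> $ j * cinner k a (contr (axis j 1) b)) = cinner k a (contr \<xi> b)"
    if "alternating b" for k a and b :: "(real^'n) list \<Rightarrow> real"
    by (simp add: contr_expand[OF that, of \<xi>] cinner_sum_right cinner_tscale_right)
  {
    case 0
    have "(\<Sum>j\<in>UNIV. \<xi> $ j * cinner 0 a (contr (axis j 1) b)) = cinner 0 a (contr \<xi> b)" by (rule *[OF 0])
    then show ?case by (simp add: inner_axis sum_distrib_left mult.assoc)
  next
    case (Suc k)
    have "cinner (Suc (Suc k)) (wedge \<xi> a) b =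
        (\<Sum>j\<in>UNIV. \<xi> $ j * cinner (Suc k) a (contr (axis j 1) b) -
          cinner (Suc k) (wedge \<xi> (contr (axis j 1) a)) (contr (axis j 1) b))"
      by (subst cinner.simps(2), rule sum.cong)
        (simp_all only: contr_wedge cinner_diff_left cinner_tscale_left inner_axis inner_real_def mult_1_right)
    also have "\<dots> = (\<Sum>j\<in>UNIV. \<xi> $ j * cinner (Suc k) a (contr (axis j 1) b)) -
        (\<Sum>j\<in>UNIV. cinner (Suc k) (wedge \<xi> (contr (axis j 1) a)) (contr (axis j 1) b))"
      by (rule sum_subtractf)
    also have "(\<Sum>j\<in>UNIV. cinner (Suc k) (wedge \<xi> (contr (axis j 1) a)) (contr (axis j 1) b)) =
        (\<Sum>j\<in>UNIV. real (Suc k) * cinner k (contr (axis j 1) a) (contr \<xi> (contr (axis j 1) b)))"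
      by (intro sum.cong refl Suc.IH alternating_contr Suc.prems)
    also have "\<dots> = (\<Sum>j\<in>UNIV. - (real (Suc k) * cinner k (contr (axis j 1) a) (contr (axis j 1) (contr \<xi> b))))"
      by (intro sum.cong refl) (subst contr_anticommute[OF Suc.prems], simp only: cinner_minus_right mult_minus_right)
    also have "\<dots> = - real (Suc k) * cinner (Suc k) a (contr \<xi> b)"
      by (simp only: cinner.simps(2) sum_negf sum_distrib_left mult_minus_left)
    also have "(\<Sum>j\<in>UNIV. \<xi> $ j * cinner (Suc k) a (contr (axis j 1) b)) = cinner (Suc k) a (contr \<xi> b)"
      by (rule *[OF Suc.prems])
    finally show "cinner (Suc (Suc k)) (wedge \<xi> a) b = real (Suc (Suc k)) * cinner (Suc k) a (contr \<xi> b)"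
      by (simp add: algebra_simps del: cinner.simps contr_apply)
  }
qed

lemma matrix_vector_axis_expand:
  fixes M :: "real^'n^'m"
  shows "(\<Sum>j\<in>UNIV. (v $ j) *\<^sub>R (M *v axis j 1)) = M *v v"
proof -
  have "M *v v = M *v (\<Sum>j\<in>UNIV. (v $ j) *\<^sub>R axis j 1)"
    by (simp add: basis_expansion scalar_mult_eq_scaleR [symmetric])
  also have "\<dots> = (\<Sum>j\<in>UNIV. (v $ j) *\<^sub>R (M *v axis j 1))"
    by (simp add: linear_sum[OF matrix_vector_mul_linear] linear_scale[OF matrix_vector_mul_linear])
  finally show ?thesis by simp
qed

lemma matrix_vector_axis_nth [simp]: "((M :: real^'n::finite^'m) *v axis j 1) $ i = M $ i $ j"
  by (simp add: matrix_vector_mult_def axis_def if_distrib cong: if_cong)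

lemma axis_vector_matrix_nth [simp]: "(axis i 1 v* (M :: real^'n::finite^'m::finite)) $ j = M $ i $ j"
  by (simp add: vector_matrix_mult_def axis_def if_distrib[of "\<lambda>x. x * _"] cong: if_cong)

lemma alternating_pull_matrix [intro]: "alternating a \<Longrightarrow> alternating (pull ((*v) M) a)"
  by (rule alternating_pull) (auto simp: matrix_vector_mul_linear)

text \<open>The adjoint of pullback along \<open>T\<close> is pullback along its transpose; moving
  it to the right composes it with \<open>S\<close>.\<close>

lemma cinner_pull:
  fixes a :: "(real^'m::finite) list \<Rightarrow> real" and T S :: "real^'n::finite^'m"
  assumes "alternating a" "alternating b"
  shows "cinner k (pull ((*v) T) a) (pull ((*v) S) b) = cinner k a (pull ((*v) (S ** transpose T)) b)"
  using assms
proof (induction k arbitrary: a b)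
  case (Suc k)
  let ?R = "S ** transpose T"
  have "cinner (Suc k) (pull ((*v) T) a) (pull ((*v) S) b) =
      (\<Sum>j\<in>UNIV. cinner k (pull ((*v) T) (contr (T *v axis j 1) a)) (pull ((*v) S) (contr (S *v axis j 1) b)))"
    by (simp only: cinner.simps contr_pull)
  also have "\<dots> = (\<Sum>j\<in>UNIV. cinner k (contr (T *v axis j 1) a) (pull ((*v) ?R) (contr (S *v axis j 1) b)))"
    by (intro sum.cong refl Suc.IH alternating_contr Suc.prems)
  also have "\<dots> = (\<Sum>j\<in>UNIV. \<Sum>m\<in>UNIV. T $ m $ j *
      cinner k (contr (axis m 1) a) (pull ((*v) ?R) (contr (S *v axis j 1) b)))"
    by (subst contr_expand[OF Suc.prems(1)])
       (simp only: cinner_sum_left cinner_tscale_left matrix_vector_axis_nth)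
  also have "\<dots> = (\<Sum>m\<in>UNIV. cinner k (contr (axis m 1) a)
      (pull ((*v) ?R) (contr (\<Sum>j\<in>UNIV. (T $ m $ j) *\<^sub>R (S *v axis j 1)) b)))"
    by (subst sum.swap)
       (simp only: contr_linear_comb[OF Suc.prems(2)] pull_sum pull_tscale cinner_sum_right cinner_tscale_right)
  also have "\<dots> = (\<Sum>m\<in>UNIV. cinner k (contr (axis m 1) a) (pull ((*v) ?R) (contr (?R *v axis m 1) b)))"
  proof -
    have "(\<Sum>j\<in>UNIV. (T $ m $ j) *\<^sub>R (S *v axis j 1)) = ?R *v axis m 1" for m
      using matrix_vector_axis_expand[of "transpose T *v axis m 1" S]
      by (simp add: transpose_def matrix_vector_mul_assoc)
    then show ?thesis by simp
  qed
  also have "\<dots> = cinner (Suc k) a (pull ((*v) ?R) b)"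
    by (simp only: cinner.simps contr_pull)
  finally show ?case .
qed simp

section \<open>Positive definite matrices and their factorisation\<close>

definition spd :: "real^'n^'n::finite \<Rightarrow> bool" where
  "spd G \<longleftrightarrow> transpose G = G \<and> (\<forall>x. x \<noteq> 0 \<longrightarrow> x \<bullet> (G *v x) > 0)"

text \<open>Cholesky decomposition, one pivot \<open>s\<close> at a time.\<close>

lemma psd_factorization:
  fixes P :: "real^'n^'n::finite"
  assumes "transpose P = P" "\<And>x. x \<bullet> (P *v x) \<ge> 0"
  shows "\<exists>W :: real^'n^'n. P = W ** transpose W"
proof -
  \<comment> \<open>The induction is over a set of indices supporting \<open>P\<close>. The columns
    of \<open>W\<close> outside \<open>S\<close> are required to vanish so that column
    \<open>s\<close> is free for the next pivot.\<close>
  have "\<exists>W :: real^'n^'n. P = W ** transpose W \<and> (\<forall>i j. j \<notin> S \<longrightarrow> W $ i $ j = 0)"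
    if "finite S" "transpose P = P" "\<And>x. x \<bullet> (P *v x) \<ge> 0"
      "\<And>i j. i \<notin> S \<or> j \<notin> S \<Longrightarrow> P $ i $ j = 0" for S and P :: "real^'n^'n"
    using that
  proof (induction S arbitrary: P rule: finite_induct)
    case empty
    then have "P = 0" by (simp add: vec_eq_iff)
    then show ?case by (intro exI[of _ 0]) (simp add: vec_eq_iff matrix_matrix_mult_def)
  next
    case (insert s S)
    have sym: "P $ i $ j = P $ j $ i" for i j
      using insert.prems(1) by (metis transpose_def vec_lambda_beta)
    have adj: "x \<bullet> (P *v y) = y \<bullet> (P *v x)" for x y
      by (metis insert.prems(1) dot_lmul_matrix inner_commute vector_transpose_matrix)
    have ee: "axis i 1 \<bullet> (P *v axis j 1) = P $ i $ j" for i j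
      by (simp add: inner_axis')
    show ?case
    proof (cases "P $ s $ s = 0")
      case True
      have "P $ j $ s = 0" for j
      proof (rule ccontr)
        assume nz: "P $ j $ s \<noteq> 0"
        \<comment> \<open>With \<open>P $ s $ s = 0\<close> the quadratic form is affine in
          \<open>t\<close> along \<open>axis j 1 + t *\<^sub>R axis s 1\<close>; this
          \<open>t\<close> solves for the value -1.\<close>
        define t where "t = - (P $ j $ j + 1) / (2 * P $ j $ s)"
        have "0 \<le> (axis j 1 + t *\<^sub>R axis s 1) \<bullet> (P *v (axis j 1 + t *\<^sub>R axis s 1))"
          by (rule insert.prems)
        also have "\<dots> = P $ j $ j + 2 * t * P $ j $ s + t * t * P $ s $ s"
          using sym[of s j]
          by (simp add: matrix_vector_right_distrib matrix_vector_mult_scaleR inner_add_left inner_add_right ee algebra_simps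
              del: matrix_vector_axis_nth)
        also have "\<dots> = -1" using nz True by (simp add: t_def field_simps)
        finally show False by simp
      qed
      then have "P $ i $ j = 0" if "i \<notin> S \<or> j \<notin> S" for i j
        using that insert.prems(3)[of i j] sym[of s] by (cases "i = s"; cases "j = s") auto
      then obtain W where "P = W ** transpose W" "\<forall>i j. j \<notin> S \<longrightarrow> W $ i $ j = 0"
        using insert.IH[OF insert.prems(1,2)] by blast
      then show ?thesis by blast
    next
      case False
      have pos: "P $ s $ s > 0"
        using insert.prems(2)[of "axis s 1"] False by (simp add: ee del: matrix_vector_axis_nth)
      define c where "c = P $ s $ s"
      \<comment> \<open>The Schur complement of the pivot: row and column \<open>s\<close> become
        zero.\<close>
      define P' where "P' = (\<chi> i j. P $ i $ j - P $ i $ s * P $ j $ s / c)"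
      have P'sym: "transpose P' = P'"
        by (simp add: P'_def transpose_def vec_eq_iff mult.commute) (metis sym)
      have P'x: "x \<bullet> (P' *v x) \<ge> 0" for x
      proof -
        define q where "q = (P *v x) $ s"
        have q: "axis s 1 \<bullet> (P *v x) = q" "x \<bullet> (P *v axis s 1) = q"
          using adj[of x "axis s 1"] by (simp_all add: q_def inner_axis')
        have "x \<bullet> (P' *v x) = (\<Sum>i\<in>UNIV. x $ i * (\<Sum>j\<in>UNIV. (P $ i $ j - P $ i $ s * P $ j $ s / c) * x $ j))"
          by (simp add: inner_vec_def matrix_vector_mult_def P'_def)
        also have "\<dots> = x \<bullet> (P *v x) - (\<Sum>i\<in>UNIV. x $ i * P $ i $ s) * (\<Sum>j\<in>UNIV. P $ j $ s * x $ j) / c"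
          by (simp add: inner_vec_def matrix_vector_mult_def left_diff_distrib sum_subtractf right_diff_distrib
              sum_product sum_divide_distrib sum_distrib_left algebra_simps)
        also have "(\<Sum>i\<in>UNIV. x $ i * P $ i $ s) = q"
          by (simp add: q_def matrix_vector_mult_def sym[of s] mult.commute)
        also have "(\<Sum>j\<in>UNIV. P $ j $ s * x $ j) = q"
          by (simp add: q_def matrix_vector_mult_def sym[of s])
        \<comment> \<open>Completing the square: the Schur complement at \<open>x\<close> is the
          value of \<open>P\<close> at the point of the line through \<open>x\<close> along
          \<open>axis s 1\<close> where \<open>P\<close> is smallest.\<close>
        also have "x \<bullet> (P *v x) - q * q / c = (x - (q / c) *\<^sub>R axis s 1) \<bullet> (P *v (x - (q / c) *\<^sub>R axis s 1))"
          using pos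
          by (simp add: matrix_vector_mult_diff_distrib matrix_vector_mult_scaleR inner_diff_left inner_diff_right
              q ee c_def[symmetric] field_simps del: matrix_vector_axis_nth)
        also have "\<dots> \<ge> 0" by (rule insert.prems)
        finally show ?thesis .
      qed
      have "P' $ i $ j = 0" if "i \<notin> S \<or> j \<notin> S" for i j
        using that insert.prems(3)[of i j] insert.prems(3)[of i s] insert.prems(3)[of j s] pos sym
        by (cases "i = s"; cases "j = s") (auto simp: P'_def c_def)
      then obtain W where W: "P' = W ** transpose W" "\<And>i j. j \<notin> S \<Longrightarrow> W $ i $ j = 0"
        using insert.IH[OF P'sym P'x] by blast
      define V where "V = (\<chi> i j. if j = s then P $ i $ s / sqrt c else W $ i $ j)"
      have "P = V ** transpose V"
      proof -
        have "(V ** transpose V) $ i $ j = P $ i $ j" for i j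
        proof -
          have "(V ** transpose V) $ i $ j = (\<Sum>l\<in>UNIV. (if l = s then P $ i $ s * P $ j $ s / c else 0) + W $ i $ l * W $ j $ l)"
            unfolding matrix_matrix_mult_def transpose_def V_def
            using W(2)[of s] insert.hyps(2) pos
            by (auto intro!: sum.cong simp: c_def real_sqrt_mult_self)
          also have "\<dots> = P $ i $ s * P $ j $ s / c + (W ** transpose W) $ i $ j"
            by (simp add: sum.distrib matrix_matrix_mult_def transpose_def)
          also have "\<dots> = P $ i $ j" by (simp add: W(1)[symmetric] P'_def)
          finally show ?thesis .
        qed
        then show ?thesis by (simp add: vec_eq_iff)
      qed
      moreover have "\<forall>i j. j \<notin> insert s S \<longrightarrow> V $ i $ j = 0" using W(2) by (auto simp: V_def)
      ultimately show ?thesis by (intro exI[of _ V] conjI)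
    qed
  qed
  from this[of UNIV P] assms show ?thesis by auto
qed

lemma matrix_inv_right: "invertible A \<Longrightarrow> A ** matrix_inv A = mat 1"
  and matrix_inv_left: "invertible A \<Longrightarrow> matrix_inv A ** A = mat 1"
  unfolding invertible_def matrix_inv_def by (metis (mono_tags, lifting) someI_ex)+

lemma spd_invertible:
  assumes "spd G" shows "invertible G"
proof -
  have "x = 0" if "G *v x = 0" for x
    using assms that by (force simp: spd_def)
  then show ?thesis
    using matrix_left_invertible_ker[of G] invertible_left_inverse[of G] by blast
qed

lemma spd_matrix_inv:
  assumes "spd G"
  shows "G ** matrix_inv G = mat 1" "matrix_inv G ** G = mat 1" "transpose (matrix_inv G) = matrix_inv G"
    "x \<bullet> (matrix_inv G *v x) \<ge> 0"
proof -
  show 1: "G ** matrix_inv G = mat 1" and 2: "matrix_inv G ** G = mat 1"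
    using spd_invertible[OF assms] matrix_inv_right[of G] matrix_inv_left[of G] by auto
  have "transpose (matrix_inv G) ** G = mat 1"
    using arg_cong[OF 1, of transpose] assms by (simp add: matrix_transpose_mul spd_def transpose_mat)
  then show "transpose (matrix_inv G) = matrix_inv G"
    by (metis 1 matrix_mul_assoc matrix_mul_lid matrix_mul_rid)
  have "x \<bullet> (matrix_inv G *v x) = (matrix_inv G *v x) \<bullet> (G *v (matrix_inv G *v x))"
    by (simp add: matrix_vector_mul_assoc 1 inner_commute)
  then show "x \<bullet> (matrix_inv G *v x) \<ge> 0"
    using assms by (cases "matrix_inv G *v x = 0") (auto simp: spd_def less_imp_le)
qed

text \<open>Contracting every index with \<open>M\<close> is evaluation on the images of the axis
  vectors under the transpose of \<open>M\<close>. This rewrites the index formula in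
  \<open>alt_inner\<close> as a pullback.\<close>

lemma sum_lists_expand:
  fixes b :: "(real^'n::finite) list \<Rightarrow> real" and M :: "real^'n^'n"
  assumes "alternating b"
  shows "(\<Sum>K | length K = length I. (\<Prod>r<length I. M $ (I ! r) $ (K ! r)) * b (basis_list K))
    = b (map ((*v) (transpose M)) (basis_list I))"
  using assms
proof (induction I arbitrary: b)
  case (Cons i I)
  have "(\<Sum>K | length K = length (i # I). (\<Prod>r<length (i # I). M $ ((i # I) ! r) $ (K ! r)) * b (basis_list K))
      = (\<Sum>j\<in>UNIV. \<Sum>K | length K = length I. M $ i $ j *
          ((\<Prod>r<length I. M $ (I ! r) $ (K ! r)) * contr (axis j 1) b (basis_list K)))"
    by (simp only: length_Cons sum_lists_Suc prod.lessThan_Suc_shift) (simp add: mult.assoc)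
  also have "\<dots> = (\<Sum>j\<in>UNIV. M $ i $ j * contr (axis j 1) b (map ((*v) (transpose M)) (basis_list I)))"
    using Cons.IH[OF alternating_contr[OF Cons.prems]] by (simp only: sum_distrib_left[symmetric])
  also have "\<dots> = b (map ((*v) (transpose M)) (basis_list (i # I)))"
    using alternating_expand[OF Cons.prems, of "[]" "transpose M *v axis i 1" "map ((*v) (transpose M)) (basis_list I)"]
    by (simp add: transpose_def)
  finally show ?case .
qed simp

lemma alt_inner_eq:
  fixes G :: "real^'n::finite^'n"
  assumes "spd G" "alternating b"
  shows "alt_inner G a b = (\<Sum>k\<le>CARD('n). cinner k a (pull ((*v) (matrix_inv G)) b) / fact k)"
proof -
  have "(\<Sum>I | length I = k. \<Sum>K | length K = k. (\<Prod>r<k. matrix_inv G $ (I ! r) $ (K ! r)) *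
          a (basis_list I) * b (basis_list K)) = cinner k a (pull ((*v) (matrix_inv G)) b)" for k
    unfolding cinner_lists
  proof (rule sum.cong[OF refl])
    fix I :: "'n list" assume "I \<in> {I. length I = k}"
    then have k: "k = length I" by simp
    show "(\<Sum>K | length K = k. (\<Prod>r<k. matrix_inv G $ (I ! r) $ (K ! r)) * a (basis_list I) * b (basis_list K)) =
        a (basis_list I) * pull ((*v) (matrix_inv G)) b (basis_list I)"
      using sum_lists_expand[OF assms(2), where I = I and M = "matrix_inv G"] spd_matrix_inv(3)[OF assms(1)]
      unfolding k pull_apply by (simp add: sum_distrib_left[symmetric] mult.assoc mult.left_commute[of _ "a _"])
  qed
  then show ?thesis by (simp add: alt_inner_def)
qed

text \<open>If the inverse of \<open>G\<close> is \<open>W ** transpose W\<close>, the columns of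
  \<open>W\<close> form a \<open>G\<close>-orthonormal frame, and pulling back along
  \<open>W\<close> makes the metric Euclidean. Symmetry and positivity are then visible.\<close>

lemma alt_inner_factor:
  fixes G :: "real^'n::finite^'n"
  assumes "spd G"
  shows "\<exists>W :: real^'n^'n. invertible W \<and> (\<forall>a b. alternating a \<longrightarrow> alternating b \<longrightarrow>
    alt_inner G a b = (\<Sum>k\<le>CARD('n). cinner k (pull ((*v) W) a) (pull ((*v) W) b) / fact k))"
proof -
  obtain W :: "real^'n^'n" where W: "matrix_inv G = W ** transpose W"
    using psd_factorization[of "matrix_inv G"] spd_matrix_inv[OF assms] by blast
  have "W ** (transpose W ** G) = mat 1"
    using spd_matrix_inv(2)[OF assms] by (simp add: W matrix_mul_assoc)
  then have "invertible W" unfolding invertible_right_inverse by (rule exI)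
  moreover have "alt_inner G a b = (\<Sum>k\<le>CARD('n). cinner k (pull ((*v) W) a) (pull ((*v) W) b) / fact k)"
    if "alternating a" "alternating b" for a b
    using that by (simp add: alt_inner_eq[OF assms] cinner_pull W)
  ultimately show ?thesis by blast
qed

lemma alt_inner_commute:
  fixes G :: "real^'n::finite^'n"
  assumes "spd G" "alternating a" "alternating b" shows "alt_inner G a b = alt_inner G b a"
proof -
  obtain W :: "real^'n^'n" where "\<forall>a b. alternating a \<longrightarrow> alternating b \<longrightarrow>
      alt_inner G a b = (\<Sum>k\<le>CARD('n). cinner k (pull ((*v) W) a) (pull ((*v) W) b) / fact k)"
    using alt_inner_factor[OF assms(1)] by blast
  then show ?thesis
    using assms(2,3) by (simp add: cinner_commute[of _ "pull _ b" "pull _ a"] del: pull_apply)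
qed

lemma alt_inner_nonneg:
  fixes G :: "real^'n::finite^'n"
  assumes "spd G" "alternating a" shows "alt_inner G a a \<ge> 0"
proof -
  obtain W :: "real^'n^'n" where "\<forall>a b. alternating a \<longrightarrow> alternating b \<longrightarrow>
      alt_inner G a b = (\<Sum>k\<le>CARD('n). cinner k (pull ((*v) W) a) (pull ((*v) W) b) / fact k)"
    using alt_inner_factor[OF assms(1)] by blast
  then show ?thesis using assms(2) by (auto simp: cinner_lists intro!: sum_nonneg divide_nonneg_nonneg)
qed

text \<open>A sum of squares forces every coefficient in the orthonormal frame to vanish; lists
  beyond the summation bound are covered by \<open>alternating_long_zero\<close>, and
  \<open>W\<close> is invertible.\<close>

lemma alt_inner_eq_0:
  fixes a :: "(real^'n::finite) list \<Rightarrow> real"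
  assumes "spd G" "alternating a" "alt_inner G a a = 0" shows "a = 0"
proof -
  obtain W :: "real^'n^'n" where W: "invertible W" "\<forall>a b. alternating a \<longrightarrow> alternating b \<longrightarrow>
      alt_inner G a b = (\<Sum>k\<le>CARD('n). cinner k (pull ((*v) W) a) (pull ((*v) W) b) / fact k)"
    using alt_inner_factor[OF assms(1)] by blast
  let ?b = "pull ((*v) W) a"
  have nn: "cinner k ?b ?b / fact k \<ge> 0" for k
    by (auto simp: cinner_lists intro!: sum_nonneg divide_nonneg_nonneg)
  have alt: "alternating ?b" using assms by blast
  have z: "?b vs = 0" for vs
  proof (cases "length vs \<le> CARD('n)")
    case True
    then have "cinner (length vs) ?b ?b / fact (length vs) = 0"
      using assms(3) W(2) assms(2)
        sum_nonneg_eq_0_iff[of "{..CARD('n)}" "\<lambda>k. cinner k ?b ?b / fact k"] nn by (simp del: pull_apply)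
    then have "(\<Sum>I | length I = length vs. ?b (basis_list I) * ?b (basis_list I)) = 0"
      by (simp add: cinner_lists)
    then have "?b (basis_list I) = 0" if "length I = length vs" for I
      using that sum_nonneg_eq_0_iff[OF finite_lists_length, of "length vs" "\<lambda>I. ?b (basis_list I) * ?b (basis_list I)"]
      by simp
    then show ?thesis using alternating_basis_eqI[OF alt alternating_zero, of vs] by simp
  next
    case False
    then show ?thesis by (intro alternating_long_zero[OF alt]) simp
  qed
  have "a vs = ?b (map ((*v) (matrix_inv W)) vs)" for vs
    using matrix_inv_right[OF W(1)] by (simp add: o_def matrix_vector_mul_assoc)
  then show ?thesis unfolding z by auto
qed

lemma alt_inner_linear:
  fixes G :: "real^'n::finite^'n"
  shows "alt_inner G (a + a') b = alt_inner G a b + alt_inner G a' b"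
    "alt_inner G (a - a') b = alt_inner G a b - alt_inner G a' b"
    "alt_inner G (- a) b = - alt_inner G a b"
    "alt_inner G (tscale r a) b = r * alt_inner G a b"
    "alt_inner G 0 b = 0"
    "alt_inner G b (a + a') = alt_inner G b a + alt_inner G b a'"
    "alt_inner G b (a - a') = alt_inner G b a - alt_inner G b a'"
    "alt_inner G b (- a) = - alt_inner G b a"
    "alt_inner G b (tscale r a) = r * alt_inner G b a"
    "alt_inner G b 0 = 0"
  by (simp_all add: alt_inner_def algebra_simps sum.distrib sum_distrib_left sum_negf sum_subtractf)

lemma alt_inner_sum:
  "alt_inner G (sum f S) b = (\<Sum>i\<in>S. alt_inner G (f i) b)"
  "alt_inner G b (sum f S) = (\<Sum>i\<in>S. alt_inner G b (f i))"
  using sum_comp_morphism[of "\<lambda>a. alt_inner G a b" f S] sum_comp_morphism[of "alt_inner G b" f S]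
  by (simp_all add: alt_inner_linear o_def)

text \<open>The adjoint of \<open>wedge \<xi>\<close> is contraction with the vector metrically dual
  to \<open>\<xi>\<close>; the factor \<open>Suc k\<close> of \<open>cinner_wedge\<close> cancels
  against the factorials.\<close>

lemma alt_inner_wedge:
  fixes G :: "real^'n::finite^'n"
  assumes "spd G" "alternating a" "alternating b"
  shows "alt_inner G (wedge \<xi> a) b = alt_inner G a (contr (matrix_inv G *v \<xi>) b)"
proof -
  let ?N = "CARD('n)" and ?P = "\<lambda>b. pull ((*v) (matrix_inv G)) b"
  have altb: "alternating (?P b)" using assms by blast
  have c: "contr \<xi> (?P b) = ?P (contr (matrix_inv G *v \<xi>) b)" by (simp add: contr_pull)
  obtain M where M: "?N = Suc M" using zero_less_card_finite[where 'a='n] by (cases ?N) auto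
  \<comment> \<open>After the degree shift the right-hand side has one summand more, in degree
    \<open>CARD('n)\<close>; it evaluates a form on \<open>CARD('n) + 1\<close> vectors.\<close>
  have top: "cinner ?N a (contr \<xi> (?P b)) = 0"
  proof -
    have "contr \<xi> (?P b) (basis_list I) = 0" if "length I = ?N" for I
      using alternating_long_zero[OF altb, of "\<xi> # basis_list I"] that by simp
    then show ?thesis by (simp add: cinner_lists del: contr_apply pull_apply)
  qed
  have "alt_inner G (wedge \<xi> a) b = (\<Sum>k\<le>Suc M. cinner k (wedge \<xi> a) (?P b) / fact k)"
    by (simp add: alt_inner_eq assms M)
  also have "\<dots> = (\<Sum>k\<le>M. cinner (Suc k) (wedge \<xi> a) (?P b) / fact (Suc k))"
    by (subst sum.atMost_Suc_shift) simp
  also have "\<dots> = (\<Sum>k\<le>M. cinner k a (contr \<xi> (?P b)) / fact k)"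
    by (rule sum.cong) (simp_all only: cinner_wedge[OF altb] fact_Suc of_nat_mult of_nat_fact, simp_all)
  also have "\<dots> = (\<Sum>k\<le>Suc M. cinner k a (contr \<xi> (?P b)) / fact k)"
    using top by (simp only: sum.atMost_Suc M div_0 add_0_right)
  also have "\<dots> = alt_inner G a (contr (matrix_inv G *v \<xi>) b)"
    by (subst alt_inner_eq[OF assms(1) alternating_contr[OF assms(3)]]) (simp only: c M)
  finally show ?thesis .
qed

text \<open>The relation between \<open>G\<close> and \<open>G'\<close> inverts to the
  transformation law of the dual metric, which absorbs both copies of \<open>T\<close> through
  \<open>cinner_pull\<close>. This is the chart independence of the inner product.\<close>

lemma alt_inner_pull:
  fixes G G' T :: "real^'n::finite^'n"
  assumes "spd G'" "spd G" "invertible T" "G = transpose T ** G' ** T" "alternating a" "alternating b"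
  shows "alt_inner G (pull ((*v) T) a) (pull ((*v) T) b) = alt_inner G' a b"
proof -
  have "(T ** matrix_inv G ** transpose T) ** G' = mat 1"
  proof -
    have "T ** matrix_inv G ** transpose T ** G' ** T = T"
      using spd_matrix_inv(2)[OF assms(2)] unfolding assms(4)
      by (simp add: matrix_mul_assoc[symmetric])
    then have "T ** matrix_inv G ** transpose T ** G' ** (T ** matrix_inv T) = T ** matrix_inv T"
      by (metis matrix_mul_assoc)
    then show ?thesis using matrix_inv_right[OF assms(3)] by simp
  qed
  then have *: "T ** matrix_inv G ** transpose T = matrix_inv G'"
    by (metis spd_matrix_inv(1)[OF assms(1)] matrix_mul_assoc matrix_mul_lid matrix_mul_rid)
  have "pull ((*v) (matrix_inv G)) (pull ((*v) T) b) = pull ((*v) (T ** matrix_inv G)) b"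
    by (simp add: pull_pull o_def matrix_vector_mul_assoc)
  then show ?thesis
    using assms(1,2,5,6) by (simp add: alt_inner_eq alternating_pull_matrix cinner_pull *)
qed

section \<open>Pointwise Lefschetz operators\<close>

text \<open>The product with the 2-form of matrix \<open>W\<close>. The sum runs over ordered pairs
  and meets every \<open>e_i \<and> e_j\<close> twice, hence the halves.\<close>

definition Lp :: "real^'n::finite^'n \<Rightarrow> ((real^'n) list \<Rightarrow> real) \<Rightarrow> (real^'n) list \<Rightarrow> real" where
  "Lp W a = (\<Sum>i\<in>UNIV. \<Sum>j\<in>UNIV. tscale (W $ i $ j / 2) (wedge (axis i 1) (wedge (axis j 1) a)))"

definition Lamp :: "real^'n::finite^'n \<Rightarrow> ((real^'n) list \<Rightarrow> real) \<Rightarrow> (real^'n) list \<Rightarrow> real" where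
  "Lamp P a = (\<Sum>i\<in>UNIV. \<Sum>j\<in>UNIV. tscale (P $ i $ j / 2) (contr (axis i 1) (contr (axis j 1) a)))"

lemma Lp_linear:
  "Lp W (a + b) = Lp W a + Lp W b" "Lp W (a - b) = Lp W a - Lp W b" "Lp W (- a) = - Lp W a"
  "Lp W (tscale r a) = tscale r (Lp W a)" "Lp W 0 = 0"
  by (simp_all add: Lp_def wedge_add wedge_diff wedge_minus wedge_tscale tscale_add tscale_diff
      sum.distrib sum_subtractf sum_negf tscale_minus_left tscale_sum mult.commute)

lemma Lamp_linear:
  "Lamp W (a + b) = Lamp W a + Lamp W b" "Lamp W (a - b) = Lamp W a - Lamp W b" "Lamp W (- a) = - Lamp W a"
  "Lamp W (tscale r a) = tscale r (Lamp W a)" "Lamp W 0 = 0"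
  by (simp_all add: Lamp_def tscale_add tscale_diff
      sum.distrib sum_subtractf sum_negf tscale_minus_left tscale_sum mult.commute)

lemma skew_nth: "transpose W = - W \<Longrightarrow> W $ i $ j = - W $ j $ i" for W :: "real^'n^'n"
  by (drule arg_cong[where f = "\<lambda>M. M $ j $ i"]) (simp add: transpose_def)

text \<open>Leibniz rule for contraction: \<open>v v* W\<close> represents the covector obtained by
  inserting \<open>v\<close> into the 2-form. Skewness merges the two halves of the double sum. The
  same commutator later gives the symbol of \<open>d_lambda_star\<close>.\<close>

lemma contr_Lp:
  fixes W :: "real^'n::finite^'n"
  assumes "transpose W = - W"
  shows "contr v (Lp W a) = wedge (v v* W) a + Lp W (contr v a)"
proof -
  have "contr v (Lp W a) = (\<Sum>i\<in>UNIV. \<Sum>j\<in>UNIV. tscale (W $ i $ j / 2 * v $ i) (wedge (axis j 1) a))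
     - (\<Sum>i\<in>UNIV. \<Sum>j\<in>UNIV. tscale (W $ i $ j / 2 * v $ j) (wedge (axis i 1) a)) + Lp W (contr v a)"
    unfolding Lp_def
    by (simp only: contr_sum contr_tscale contr_wedge wedge_diff wedge_tscale inner_axis' tscale_diff
        sum_subtractf tscale_simps(4) inner_real_def mult_1_left) (simp add: algebra_simps)
  also have "(\<Sum>i\<in>UNIV. \<Sum>j\<in>UNIV. tscale (W $ i $ j / 2 * v $ j) (wedge (axis i 1) a)) =
     - (\<Sum>i\<in>UNIV. \<Sum>j\<in>UNIV. tscale (W $ i $ j / 2 * v $ i) (wedge (axis j 1) a))"
    by (subst sum.swap, unfold sum_negf[symmetric], intro sum.cong refl, subst skew_nth[OF assms])
      (auto simp: fun_eq_iff)
  also have "(\<Sum>i\<in>UNIV. \<Sum>j\<in>UNIV. tscale (W $ i $ j / 2 * v $ i) (wedge (axis j 1) a)) -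
      - (\<Sum>i\<in>UNIV. \<Sum>j\<in>UNIV. tscale (W $ i $ j / 2 * v $ i) (wedge (axis j 1) a)) =
      (\<Sum>i\<in>UNIV. \<Sum>j\<in>UNIV. tscale (W $ i $ j * v $ i) (wedge (axis j 1) a))"
    by (simp add: sum.distrib[symmetric] tscale_add_left[symmetric] mult.commute)
  also have "\<dots> = wedge (v v* W) a"
    by (subst wedge_expand[of "v v* W"], subst sum.swap)
      (simp add: fun_eq_iff fun_sum_apply vector_matrix_mult_def sum_distrib_right mult.commute[of "v $ _"])
  finally show ?thesis .
qed

lemma wedge_shuffle:
  "wedge \<xi> a vs = (\<Sum>i<length vs. (-1) ^ i * (\<xi> \<bullet> (vs ! i)) * a (nths vs (- {i})))"
proof (induction vs arbitrary: a)
  case (Cons v vs)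
  have *: "nths (v # vs) (- {0}) = vs" "nths (v # vs) (- {Suc i}) = v # nths vs (- {i})" for i
    by (auto simp: nths_Cons nths_all Collect_neg_eq)
  have "wedge \<xi> a (v # vs) = (\<xi> \<bullet> v) * a vs - (\<Sum>i<length vs. (-1) ^ i * (\<xi> \<bullet> (vs ! i)) * a (v # nths vs (- {i})))"
  proof -
    have "wedge \<xi> (contr v a) vs = (\<Sum>i<length vs. (-1) ^ i * (\<xi> \<bullet> (vs ! i)) * contr v a (nths vs (- {i})))"
      by (rule Cons.IH)
    then show ?thesis by simp
  qed
  then show ?case
    unfolding length_Cons sum.lessThan_Suc_shift by (simp add: * sum_negf)
qed simp

text \<open>Pairs of argument positions are split according to whether the first vector is inserted
  into \<open>w\<close>. By \<open>contr_Lp\<close> the pairs containing it give the wedge term, the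
  others the induction hypothesis for \<open>contr v a\<close>.\<close>

lemma Lp_shuffle:
  fixes w :: "(real^'n::finite) list \<Rightarrow> real"
  assumes w: "alternating w"
  shows "(\<Sum>j<length vs. \<Sum>i<j. (-1) ^ (i + j + 1) * w [vs ! i, vs ! j] * a (nths vs (- {i, j}))) =
    Lp (\<chi> i j. w [axis i 1, axis j 1]) a vs"
proof (induction vs arbitrary: a)
  case Nil
  show ?case by (simp add: Lp_def fun_sum_apply)
next
  case (Cons v vs)
  let ?W = "\<chi> i j. w [axis i 1, axis j 1]"
  have sw: "w [u, v] = - w [v, u]" for u v
    using alternating_swap[OF w, of "[]" u v "[]"] by simp
  have skew: "transpose ?W = - ?W"
    by (simp add: transpose_def vec_eq_iff) (intro allI sw)
  have W: "(v v* ?W) \<bullet> u = w [v, u]" for u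
  proof -
    have "w [v, u] = (\<Sum>i\<in>UNIV. v $ i * w [axis i 1, u])"
      using alternating_expand[OF w, of "[]" v "[u]"] by simp
    also have "\<dots> = (\<Sum>i\<in>UNIV. \<Sum>j\<in>UNIV. v $ i * (u $ j * w [axis i 1, axis j 1]))"
      using alternating_expand[OF w, of "[axis _ 1]" u "[]"] by (simp add: sum_distrib_left)
    also have "\<dots> = (v v* ?W) \<bullet> u"
      by (subst sum.swap) (simp add: inner_vec_def vector_matrix_mult_def sum_distrib_right sum_distrib_left mult_ac)
    finally show ?thesis by simp
  qed
  have *: "nths (v # vs) (- {0, Suc j}) = nths vs (- {j})" "nths (v # vs) (- {Suc i, Suc j}) = v # nths vs (- {i, j})" for i j
    by (auto simp: nths_Cons Collect_neg_eq intro!: arg_cong[where f = "nths vs"])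
  have "Lp ?W a (v # vs) = wedge (v v* ?W) a vs + Lp ?W (contr v a) vs"
    using fun_cong[OF contr_Lp[OF skew, of v a], of vs] by (simp only: contr_apply plus_fun_apply)
  also have "\<dots> = (\<Sum>j<length vs. (-1) ^ j * w [v, vs ! j] * a (nths vs (- {j}))) +
      (\<Sum>j<length vs. \<Sum>i<j. (-1) ^ (i + j + 1) * w [vs ! i, vs ! j] * a (v # nths vs (- {i, j})))"
  proof -
    have "(\<Sum>j<length vs. \<Sum>i<j. (-1) ^ (i + j + 1) * w [vs ! i, vs ! j] * contr v a (nths vs (- {i, j}))) =
      Lp ?W (contr v a) vs" by (rule Cons.IH)
    then show ?thesis by (simp add: wedge_shuffle W)
  qed
  also have "\<dots> = (\<Sum>j<length (v # vs). \<Sum>i<j. (-1) ^ (i + j + 1) * w [(v # vs) ! i, (v # vs) ! j] * a (nths (v # vs) (- {i, j})))"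
    unfolding length_Cons sum.lessThan_Suc_shift by (simp add: * sum.lessThan_Suc_shift sum.distrib)
  finally show ?case by simp
qed

text \<open>The dual of \<open>contr_Lp\<close>: commuting the two contractions past
  \<open>\<xi>\<close> leaves one contraction, with \<open>P *v \<xi>\<close>. It becomes the symbol
  of \<open>d_lambda\<close>.\<close>

lemma Lamp_wedge:
  fixes P :: "real^'n::finite^'n"
  assumes "transpose P = - P" "alternating a"
  shows "Lamp P (wedge \<xi> a) = wedge \<xi> (Lamp P a) + contr (P *v \<xi>) a"
proof -
  have "Lamp P (wedge \<xi> a) = wedge \<xi> (Lamp P a)
     + ((\<Sum>i\<in>UNIV. \<Sum>j\<in>UNIV. tscale (P $ i $ j / 2 * \<xi> $ j) (contr (axis i 1) a))
     - (\<Sum>i\<in>UNIV. \<Sum>j\<in>UNIV. tscale (P $ i $ j / 2 * \<xi> $ i) (contr (axis j 1) a)))"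
    unfolding Lamp_def
    by (simp only: contr_sum contr_diff contr_tscale contr_wedge wedge_diff wedge_sum wedge_tscale inner_axis tscale_diff
        sum_subtractf tscale_simps(4) inner_real_def mult_1_right) (simp add: algebra_simps)
  also have "(\<Sum>i\<in>UNIV. \<Sum>j\<in>UNIV. tscale (P $ i $ j / 2 * \<xi> $ i) (contr (axis j 1) a)) =
     - (\<Sum>i\<in>UNIV. \<Sum>j\<in>UNIV. tscale (P $ i $ j / 2 * \<xi> $ j) (contr (axis i 1) a))"
    by (subst sum.swap, unfold sum_negf[symmetric], intro sum.cong refl, subst skew_nth[OF assms(1)])
      (auto simp: fun_eq_iff)
  also have "(\<Sum>i\<in>UNIV. \<Sum>j\<in>UNIV. tscale (P $ i $ j / 2 * \<xi> $ j) (contr (axis i 1) a)) -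
      - (\<Sum>i\<in>UNIV. \<Sum>j\<in>UNIV. tscale (P $ i $ j / 2 * \<xi> $ j) (contr (axis i 1) a)) =
      (\<Sum>i\<in>UNIV. \<Sum>j\<in>UNIV. tscale (P $ i $ j * \<xi> $ j) (contr (axis i 1) a))"
    by (simp add: sum.distrib[symmetric] tscale_add_left[symmetric] mult.commute)
  also have "\<dots> = contr (P *v \<xi>) a"
    by (subst contr_expand[OF assms(2)])
      (simp add: fun_eq_iff fun_sum_apply matrix_vector_mult_def sum_distrib_right)
  finally show ?thesis .
qed

text \<open>By the Leibniz rule, two contractions hitting the 2-form give half the trace of
  \<open>P ** W\<close>, that is half the dimension. The two mixed terms each give minus half of the
  degree operator, and the rest is \<open>Lp W (Lamp P a)\<close>.\<close>

lemma Lamp_Lp: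
  fixes W P :: "real^'n::finite^'n"
  assumes W: "transpose W = - W" and P: "transpose P = - P" and PW: "P ** W = mat 1" and a: "alternating a"
  shows "Lamp P (Lp W a) = Lp W (Lamp P a) + tscale (real CARD('n) / 2) a
    - (\<Sum>l\<in>UNIV. wedge (axis l 1) (contr (axis l 1) a))"
proof -
  let ?N = "\<Sum>l\<in>UNIV. wedge (axis l 1) (contr (axis l 1) a)"
  have cc: "contr u (contr v (Lp W a)) = tscale ((v v* W) \<bullet> u) a - wedge (v v* W) (contr u a)
      + wedge (u v* W) (contr v a) + Lp W (contr u (contr v a))" for u v
    by (simp only: contr_Lp[OF W] contr_add contr_wedge) (simp add: algebra_simps)
  have LL: "Lp W (Lamp P a) = (\<Sum>i\<in>UNIV. \<Sum>j\<in>UNIV. tscale (P $ i $ j / 2) (Lp W (contr (axis i 1) (contr (axis j 1) a))))"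
  proof -
    have s: "Lp W (sum f S) = (\<Sum>i\<in>S. Lp W (f i))" for f and S :: "'n set"
      using sum_comp_morphism[of "Lp W" f S] by (simp add: Lp_linear o_def)
    show ?thesis by (simp only: Lamp_def s Lp_linear)
  qed
  have tr: "(\<Sum>i\<in>UNIV. \<Sum>j\<in>UNIV. P $ i $ j / 2 * ((axis j 1 v* W) \<bullet> axis i 1)) = real CARD('n) / 2"
  proof -
    have "(\<Sum>j\<in>UNIV. P $ i $ j * ((axis j 1 v* W) \<bullet> axis i 1)) = (P ** W) $ i $ i" for i
      by (simp add: inner_axis matrix_matrix_mult_def)
    then have "(\<Sum>i\<in>UNIV. \<Sum>j\<in>UNIV. P $ i $ j * ((axis j 1 v* W) \<bullet> axis i 1)) = real CARD('n)"
      by (simp add: PW mat_def)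
    then show ?thesis by (simp add: sum_divide_distrib[symmetric])
  qed
  have r1: "(\<Sum>j\<in>UNIV. (P $ i $ j) *\<^sub>R (axis j 1 v* W)) = axis i 1" for i
  proof -
    have "(P ** W) $ i = (\<Sum>j\<in>UNIV. (P $ i $ j) *\<^sub>R (axis j 1 v* W))"
      by (simp add: vec_eq_iff matrix_matrix_mult_def)
    moreover have "(P ** W) $ i = axis i 1" by (auto simp: PW mat_def axis_def vec_eq_iff)
    ultimately show ?thesis by (rule trans[OF sym])
  qed
  have n1: "(\<Sum>i\<in>UNIV. \<Sum>j\<in>UNIV. tscale (P $ i $ j / 2) (wedge (axis j 1 v* W) (contr (axis i 1) a))) = tscale (1/2) ?N"
  proof -
    have "(\<Sum>j\<in>UNIV. tscale (P $ i $ j / 2) (wedge (axis j 1 v* W) (contr (axis i 1) a))) =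
        tscale (1/2) (wedge (\<Sum>j\<in>UNIV. (P $ i $ j) *\<^sub>R (axis j 1 v* W)) (contr (axis i 1) a))" for i
      by (simp only: wedge_sum_left wedge_scale_left tscale_sum tscale_simps) simp
    then show ?thesis by (simp only: r1 tscale_sum)
  qed
  have n2: "(\<Sum>i\<in>UNIV. \<Sum>j\<in>UNIV. tscale (P $ i $ j / 2) (wedge (axis i 1 v* W) (contr (axis j 1) a))) = - tscale (1/2) ?N"
    by (subst n1[symmetric], subst sum.swap, unfold sum_negf[symmetric], intro sum.cong refl, subst skew_nth[OF P])
      (auto simp: fun_eq_iff)
  have "Lamp P (Lp W a) = (\<Sum>i\<in>UNIV. \<Sum>j\<in>UNIV. tscale (P $ i $ j / 2 * ((axis j 1 v* W) \<bullet> axis i 1)) a)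
      - (\<Sum>i\<in>UNIV. \<Sum>j\<in>UNIV. tscale (P $ i $ j / 2) (wedge (axis j 1 v* W) (contr (axis i 1) a)))
      + (\<Sum>i\<in>UNIV. \<Sum>j\<in>UNIV. tscale (P $ i $ j / 2) (wedge (axis i 1 v* W) (contr (axis j 1) a))) + Lp W (Lamp P a)"
    unfolding LL
    by (simp only: Lamp_def[of P "Lp W a"] cc tscale_add tscale_diff sum.distrib sum_subtractf tscale_simps)
  also have "(\<Sum>i\<in>UNIV. \<Sum>j\<in>UNIV. tscale (P $ i $ j / 2 * ((axis j 1 v* W) \<bullet> axis i 1)) a) = tscale (real CARD('n) / 2) a"
    unfolding tr[symmetric] by (simp add: fun_eq_iff fun_sum_apply sum_distrib_right)
  finally show ?thesis unfolding n1 n2 by (auto simp: fun_eq_iff)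
qed

text \<open>Each wedge factor moves to the other side as a contraction with a raised axis vector, so
  the matrix that arises is \<open>W\<close> with both indices raised. The two contractions appear
  in reversed order, and skewness turns the reversal into the minus sign of the hypothesis on
  \<open>P\<close>.\<close>

lemma alt_inner_Lp:
  fixes W P G :: "real^'n::finite^'n"
  assumes G: "spd G" and P: "P = - (matrix_inv G ** W ** matrix_inv G)" and W: "transpose W = - W"
    and a: "alternating a" and b: "alternating b"
  shows "alt_inner G (Lp W a) b = alt_inner G a (Lamp P b)"
proof -
  let ?H = "matrix_inv G"
  have aa: "alternating (wedge \<xi> a)" for \<xi> using a by blast
  have bb: "alternating (contr v b)" for v using b by blast
  have Hs: "?H $ i $ j = ?H $ j $ i" for i j
    using arg_cong[OF spd_matrix_inv(3)[OF G], of "\<lambda>M. M $ j $ i"] by (simp add: transpose_def)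
  have "alt_inner G (Lp W a) b = (\<Sum>i\<in>UNIV. \<Sum>j\<in>UNIV. W $ i $ j / 2 *
      alt_inner G a (contr (?H *v axis j 1) (contr (?H *v axis i 1) b)))"
    by (simp only: Lp_def alt_inner_sum alt_inner_linear alt_inner_wedge[OF G aa b] alt_inner_wedge[OF G a bb])
  also have "\<dots> = (\<Sum>i\<in>UNIV. \<Sum>j\<in>UNIV. \<Sum>l\<in>UNIV. \<Sum>k\<in>UNIV. W $ i $ j / 2 * (?H $ l $ i * (?H $ k $ j *
      alt_inner G a (contr (axis k 1) (contr (axis l 1) b)))))"
    by (simp only: contr_expand[OF bb, of "?H *v _"] contr_expand[OF b, of "?H *v _"] contr_sum contr_tscale
       alt_inner_sum alt_inner_linear matrix_vector_axis_nth sum_distrib_left tscale_sum)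
  also have "\<dots> = (\<Sum>k\<in>UNIV. \<Sum>l\<in>UNIV. P $ k $ l / 2 * alt_inner G a (contr (axis k 1) (contr (axis l 1) b)))"
  proof -
    have P': "P $ k $ l = (\<Sum>i\<in>UNIV. \<Sum>j\<in>UNIV. W $ i $ j * ?H $ l $ i * ?H $ k $ j)" for k l
    proof -
      have "P $ k $ l = (\<Sum>i\<in>UNIV. (\<Sum>j\<in>UNIV. ?H $ k $ j * - W $ j $ i) * ?H $ i $ l)"
        by (simp add: P matrix_matrix_mult_def sum_negf)
      also have "\<dots> = (\<Sum>i\<in>UNIV. \<Sum>j\<in>UNIV. W $ i $ j * ?H $ l $ i * ?H $ k $ j)"
      proof -
        have "?H $ k $ j * - W $ j $ i * ?H $ i $ l = W $ i $ j * ?H $ l $ i * ?H $ k $ j" for i j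
          using skew_nth[OF W, of i j] Hs[of i l] by simp
        then show ?thesis by (simp only: sum_distrib_right)
      qed
      finally show ?thesis .
    qed
    let ?f = "\<lambda>i j k l. W $ i $ j / 2 * (?H $ l $ i * (?H $ k $ j * alt_inner G a (contr (axis k 1) (contr (axis l 1) b))))"
    have "(\<Sum>i\<in>UNIV. \<Sum>j\<in>UNIV. \<Sum>l\<in>UNIV. \<Sum>k\<in>UNIV. ?f i j k l) = (\<Sum>i\<in>UNIV. \<Sum>l\<in>UNIV. \<Sum>j\<in>UNIV. \<Sum>k\<in>UNIV. ?f i j k l)"
      by (intro sum.cong refl sum.swap)
    also have "\<dots> = (\<Sum>i\<in>UNIV. \<Sum>l\<in>UNIV. \<Sum>k\<in>UNIV. \<Sum>j\<in>UNIV. ?f i j k l)"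
      by (intro sum.cong refl sum.swap)
    also have "\<dots> = (\<Sum>i\<in>UNIV. \<Sum>k\<in>UNIV. \<Sum>l\<in>UNIV. \<Sum>j\<in>UNIV. ?f i j k l)"
      by (intro sum.cong refl sum.swap)
    also have "\<dots> = (\<Sum>k\<in>UNIV. \<Sum>i\<in>UNIV. \<Sum>l\<in>UNIV. \<Sum>j\<in>UNIV. ?f i j k l)"
      by (rule sum.swap)
    also have "\<dots> = (\<Sum>k\<in>UNIV. \<Sum>l\<in>UNIV. \<Sum>i\<in>UNIV. \<Sum>j\<in>UNIV. ?f i j k l)"
      by (intro sum.cong refl sum.swap)
    also have "\<dots> = (\<Sum>k\<in>UNIV. \<Sum>l\<in>UNIV. P $ k $ l / 2 * alt_inner G a (contr (axis k 1) (contr (axis l 1) b)))"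
      by (simp only: P' sum_distrib_right sum_divide_distrib times_divide_eq_left mult.assoc)
    finally show ?thesis .
  qed
  also have "\<dots> = alt_inner G a (Lamp P b)"
    by (simp only: Lamp_def alt_inner_sum alt_inner_linear)
  finally show ?thesis .
qed

text \<open>The bivector \<open>P\<close> is pushed forward while forms are pulled back; for
  transition maps \<open>Om_pull(2)\<close> supplies the hypothesis.\<close>

lemma Lamp_pull:
  fixes P P' T :: "real^'n::finite^'n"
  assumes "P' = T ** P ** transpose T" "alternating a"
  shows "Lamp P (pull ((*v) T) a) = pull ((*v) T) (Lamp P' a)"
proof -
  have "contr (axis i 1) (contr (axis j 1) (pull ((*v) T) a)) =
      (\<Sum>k\<in>UNIV. \<Sum>l\<in>UNIV. tscale (T $ k $ i * T $ l $ j) (pull ((*v) T) (contr (axis k 1) (contr (axis l 1) a))))" for i j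
  proof -
    have "contr (axis i 1) (contr (axis j 1) (pull ((*v) T) a)) =
        pull ((*v) T) (contr (T *v axis i 1) (contr (T *v axis j 1) a))"
      by (simp only: contr_pull)
    also have "contr (T *v axis i 1) (contr (T *v axis j 1) a) =
        (\<Sum>k\<in>UNIV. \<Sum>l\<in>UNIV. tscale (T $ k $ i * T $ l $ j) (contr (axis k 1) (contr (axis l 1) a)))"
      by (subst contr_expand[OF alternating_contr[OF assms(2)], of "T *v axis i 1"], subst contr_expand[OF assms(2), of "T *v axis j 1"])
        (simp only: contr_sum contr_tscale tscale_sum tscale_simps matrix_vector_axis_nth)
    finally show ?thesis by (simp only: pull_sum pull_tscale)
  qed
  then have "Lamp P (pull ((*v) T) a) vs = (\<Sum>i\<in>UNIV. \<Sum>j\<in>UNIV. \<Sum>k\<in>UNIV. \<Sum>l\<in>UNIV.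
      P $ i $ j / 2 * (T $ k $ i * T $ l $ j * a (axis l 1 # axis k 1 # map ((*v) T) vs)))" for vs
    by (simp add: Lamp_def fun_sum_apply sum_distrib_left mult.assoc)
  also have "\<dots> vs = (\<Sum>k\<in>UNIV. \<Sum>l\<in>UNIV. P' $ k $ l / 2 * a (axis l 1 # axis k 1 # map ((*v) T) vs))" for vs
  proof -
    let ?f = "\<lambda>i j k l. P $ i $ j / 2 * (T $ k $ i * T $ l $ j * a (axis l 1 # axis k 1 # map ((*v) T) vs))"
    have P': "P' $ k $ l = (\<Sum>j\<in>UNIV. \<Sum>i\<in>UNIV. P $ i $ j * T $ k $ i * T $ l $ j)" for k l
      by (simp add: assms(1) matrix_matrix_mult_def transpose_def sum_distrib_right sum_distrib_left mult_ac)
    have "(\<Sum>i\<in>UNIV. \<Sum>j\<in>UNIV. \<Sum>k\<in>UNIV. \<Sum>l\<in>UNIV. ?f i j k l) = (\<Sum>j\<in>UNIV. \<Sum>i\<in>UNIV. \<Sum>k\<in>UNIV. \<Sum>l\<in>UNIV. ?f i j k l)"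
      by (rule sum.swap)
    also have "\<dots> = (\<Sum>j\<in>UNIV. \<Sum>k\<in>UNIV. \<Sum>i\<in>UNIV. \<Sum>l\<in>UNIV. ?f i j k l)"
      by (intro sum.cong refl sum.swap)
    also have "\<dots> = (\<Sum>j\<in>UNIV. \<Sum>k\<in>UNIV. \<Sum>l\<in>UNIV. \<Sum>i\<in>UNIV. ?f i j k l)"
      by (intro sum.cong refl sum.swap)
    also have "\<dots> = (\<Sum>k\<in>UNIV. \<Sum>j\<in>UNIV. \<Sum>l\<in>UNIV. \<Sum>i\<in>UNIV. ?f i j k l)"
      by (rule sum.swap)
    also have "\<dots> = (\<Sum>k\<in>UNIV. \<Sum>l\<in>UNIV. \<Sum>j\<in>UNIV. \<Sum>i\<in>UNIV. ?f i j k l)"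
      by (intro sum.cong refl sum.swap)
    also have "\<dots> = (\<Sum>k\<in>UNIV. \<Sum>l\<in>UNIV. P' $ k $ l / 2 * a (axis l 1 # axis k 1 # map ((*v) T) vs))"
      by (simp only: P' sum_distrib_right sum_divide_distrib times_divide_eq_left mult.assoc)
    finally show ?thesis .
  qed
  finally show ?thesis by (simp add: fun_eq_iff Lamp_def fun_sum_apply)
qed

section \<open>Calculus of smooth maps\<close>

lemma frechet_derivative_eq: "(f has_derivative f') (at x) \<Longrightarrow> frechet_derivative f (at x) = f'"
  by (rule frechet_derivative_at[symmetric])

lemma frechet_derivative_cong_open:
  assumes "open S" "x \<in> S" "\<And>y. y \<in> S \<Longrightarrow> f y = g y"
  shows "frechet_derivative f (at x) = frechet_derivative g (at x)"
    and "f differentiable (at x) \<longleftrightarrow> g differentiable (at x)"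
proof -
  have "(f has_derivative D) (at x) \<longleftrightarrow> (g has_derivative D) (at x)" for D
    using has_derivative_transform_within_open[OF _ assms(1,2)] assms(3) by metis
  then show "frechet_derivative f (at x) = frechet_derivative g (at x)"
    "f differentiable (at x) \<longleftrightarrow> g differentiable (at x)"
    by (simp_all add: frechet_derivative_def differentiable_def)
qed

lemma Ck_on_cong:
  assumes "open S" "\<And>x. x \<in> S \<Longrightarrow> f x = g x" "Ck_on k S f"
  shows "Ck_on k S g"
  using assms
proof (induction k arbitrary: f g)
  case 0
  then show ?case by (simp cong: continuous_on_cong)
next
  case (Suc k)
  have "Ck_on k S (\<lambda>x. frechet_derivative g (at x) v)" for v
    by (rule Suc.IH[of "\<lambda>x. frechet_derivative f (at x) v"])
      (use Suc.prems frechet_derivative_cong_open[OF Suc.prems(1) _ Suc.prems(2)] in auto)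
  moreover have "g differentiable (at x)" if "x \<in> S" for x
    using frechet_derivative_cong_open(2)[OF Suc.prems(1) that Suc.prems(2)] Suc.prems(3) that by auto
  ultimately show ?case by simp
qed

lemma Ck_on_subset: "Ck_on k S f \<Longrightarrow> T \<subseteq> S \<Longrightarrow> Ck_on k T f"
  by (induction k arbitrary: f) (auto intro: continuous_on_subset)

lemma Ck_on_continuous: "Ck_on k S f \<Longrightarrow> continuous_on S f"
  by (cases k) (auto intro!: continuous_at_imp_continuous_on differentiable_imp_continuous_within)

lemma Ck_on_Suc: "Ck_on (Suc k) S f \<Longrightarrow> Ck_on k S f"
proof (induction k arbitrary: f)
  case 0
  show ?case using Ck_on_continuous[OF 0] by simp
qed auto

lemma Ck_on_SucI:
  assumes "open S" "\<And>x. x \<in> S \<Longrightarrow> (f has_derivative D x) (at x)" "\<And>v. Ck_on k S (\<lambda>x. D x v)"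
  shows "Ck_on (Suc k) S f"
proof -
  have "Ck_on k S (\<lambda>x. frechet_derivative f (at x) v)" for v
    by (rule Ck_on_cong[OF assms(1) _ assms(3)[of v]]) (simp add: frechet_derivative_eq[OF assms(2)])
  then show ?thesis using assms(2) by (auto simp: differentiable_def)
qed

lemmas Ck_on_SucI2 = Ck_on_SucI[rotated 2]

lemma Ck_on_SucD:
  assumes "Ck_on (Suc k) S f" "x \<in> S"
  shows "(f has_derivative frechet_derivative f (at x)) (at x)"
  using assms by (simp add: frechet_derivative_works)

lemma Ck_on_const: "open S \<Longrightarrow> Ck_on k S (\<lambda>x. c)"
proof (induction k arbitrary: c)
  case (Suc k)
  have "Ck_on k S (\<lambda>x::real^'a. 0 :: 'b)" by (rule Suc.IH[OF Suc.prems])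
  then show "Ck_on (Suc k) S (\<lambda>x. c)"
    using Ck_on_SucI[OF Suc.prems, of "\<lambda>x. c" "\<lambda>x v. 0" k] by (simp del: Ck_on.simps)
qed simp

lemma Ck_on_add:
  assumes "open S" "Ck_on k S f" "Ck_on k S g" shows "Ck_on k S (\<lambda>x. f x + g x)"
  using assms
proof (induction k arbitrary: f g)
  case (Suc k)
  have "Ck_on k S (\<lambda>x. frechet_derivative f (at x) v + frechet_derivative g (at x) v)" for v
    by (rule Suc.IH) (use Suc.prems in auto)
  then show "Ck_on (Suc k) S (\<lambda>x. f x + g x)"
    by (rule Ck_on_SucI2, intro Suc.prems(1)) (rule has_derivative_add[OF Ck_on_SucD[OF Suc.prems(2)] Ck_on_SucD[OF Suc.prems(3)]], assumption+)
qed (auto intro: continuous_intros)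

lemma Ck_on_bounded_linear:
  assumes "open S" "bounded_linear L" "Ck_on k S f" shows "Ck_on k S (\<lambda>x. L (f x))"
  using assms(1,3)
proof (induction k arbitrary: f)
  case 0
  then show ?case using bounded_linear.continuous_on[OF assms(2)] by auto
next
  case (Suc k)
  have "Ck_on k S (\<lambda>x. L (frechet_derivative f (at x) v))" for v
    by (rule Suc.IH) (use Suc.prems in auto)
  then show "Ck_on (Suc k) S (\<lambda>x. L (f x))"
    by (rule Ck_on_SucI2, intro Suc.prems(1)) (rule bounded_linear.has_derivative[OF assms(2) Ck_on_SucD[OF Suc.prems(2)]], assumption+)
qed

lemma Ck_on_bounded_bilinear:
  assumes "open S" "bounded_bilinear B" "Ck_on k S f" "Ck_on k S g"
  shows "Ck_on k S (\<lambda>x. B (f x) (g x))"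
  using assms(1,3,4)
proof (induction k arbitrary: f g)
  case 0
  then show ?case using bounded_bilinear.continuous_on[OF assms(2)] by auto
next
  case (Suc k)
  have "Ck_on k S (\<lambda>x. B (f x) (frechet_derivative g (at x) v))"
    "Ck_on k S (\<lambda>x. B (frechet_derivative f (at x) v) (g x))" for v
    by (rule Suc.IH[OF Suc.prems(1)]; use Suc.prems Ck_on_Suc in auto)+
  then have "Ck_on k S (\<lambda>x. B (f x) (frechet_derivative g (at x) v) + B (frechet_derivative f (at x) v) (g x))" for v
    by (intro Ck_on_add Suc.prems)
  then show "Ck_on (Suc k) S (\<lambda>x. B (f x) (g x))"
    by (rule Ck_on_SucI2, intro Suc.prems(1)) (rule bounded_bilinear.FDERIV[OF assms(2) Ck_on_SucD[OF Suc.prems(2)] Ck_on_SucD[OF Suc.prems(3)]], assumption+)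
qed

lemma Ck_on_inverse:
  fixes f :: "real^'n \<Rightarrow> real"
  assumes "open S" "Ck_on k S f" "\<And>x. x \<in> S \<Longrightarrow> f x \<noteq> 0" shows "Ck_on k S (\<lambda>x. inverse (f x))"
  using assms
proof (induction k arbitrary: f)
  case 0
  then show ?case by (auto intro: continuous_intros)
next
  case (Suc k)
  have "Ck_on k S (\<lambda>x. inverse (f x))" by (rule Suc.IH) (use Suc.prems Ck_on_Suc in auto)
  then have "Ck_on k S (\<lambda>x. (- 1) * ((inverse (f x) * frechet_derivative f (at x) v) * inverse (f x)))" for v
    using Suc.prems
    by (intro Ck_on_bounded_linear[OF _ bounded_linear_mult_right] Ck_on_bounded_bilinear[OF _ bounded_bilinear_mult]) auto
  then have "Ck_on k S (\<lambda>x. - (inverse (f x) * frechet_derivative f (at x) v * inverse (f x)))" for v by simp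
  then show "Ck_on (Suc k) S (\<lambda>x. inverse (f x))"
    by (rule Ck_on_SucI2, intro Suc.prems(1)) (rule Deriv.has_derivative_inverse[OF Suc.prems(3) Ck_on_SucD[OF Suc.prems(2)]], assumption+)
qed

lemma Ck_on_sqrt:
  fixes f :: "real^'n \<Rightarrow> real"
  assumes "open S" "Ck_on k S f" "\<And>x. x \<in> S \<Longrightarrow> f x > 0" shows "Ck_on k S (\<lambda>x. sqrt (f x))"
  using assms
proof (induction k arbitrary: f)
  case 0
  then show ?case by (auto intro: continuous_intros)
next
  case (Suc k)
  have "Ck_on k S (\<lambda>x. sqrt (f x))" by (rule Suc.IH) (use Suc.prems Ck_on_Suc in auto)
  then have "Ck_on k S (\<lambda>x. (1/2) * (frechet_derivative f (at x) v * inverse (sqrt (f x))))" for v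
    using Suc.prems
    by (intro Ck_on_bounded_linear[OF _ bounded_linear_mult_right] Ck_on_bounded_bilinear[OF _ bounded_bilinear_mult]
        Ck_on_inverse) force+
  then have "Ck_on k S (\<lambda>x. frechet_derivative f (at x) v * (inverse (sqrt (f x)) / 2))" for v
    by (simp add: field_simps)
  moreover have D: "((\<lambda>x. sqrt (f x)) has_derivative (\<lambda>v. frechet_derivative f (at x) v * (inverse (sqrt (f x)) / 2))) (at x)"
    if "x \<in> S" for x
  proof -
    have "(sqrt has_derivative (\<lambda>v. v * (inverse (sqrt (f x)) / 2))) (at (f x))"
      using DERIV_real_sqrt[OF Suc.prems(3)[OF that]] by (simp only: has_field_derivative_def mult_commute_abs)
    from has_derivative_compose[OF Ck_on_SucD[OF Suc.prems(2) that] this] show ?thesis .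
  qed
  ultimately show "Ck_on (Suc k) S (\<lambda>x. sqrt (f x))"
    by (intro Ck_on_SucI[OF Suc.prems(1) D])
qed

text \<open>A family of functions of one variable that is closed under differentiation keeps the
  induction on \<open>k\<close> inside the family. It is applied to \<open>flat\<close>, whose index
  is a polynomial.\<close>

lemma Ck_on_scalar_compose:
  fixes u :: "real^'n \<Rightarrow> real" and h :: "'p \<Rightarrow> real \<Rightarrow> real"
  assumes "open S" "Ck_on k S u" "\<And>p t. \<exists>q. \<forall>t. (h p has_real_derivative h q t) (at t)"
  shows "Ck_on k S (\<lambda>x. h p (u x))"
  using assms(1,2)
proof (induction k arbitrary: p)
  case 0
  obtain q where "\<And>t. (h p has_real_derivative h q t) (at t)" using assms(3) by blast
  then have "continuous_on UNIV (h p)" by (intro continuous_at_imp_continuous_on ballI DERIV_isCont) blast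
  with 0 show ?case by (auto intro: continuous_on_compose2)
next
  case (Suc k)
  obtain q where q: "\<And>t. (h p has_real_derivative h q t) (at t)" using assms(3) by blast
  have "Ck_on k S (\<lambda>x. h q (u x))" by (rule Suc.IH) (use Suc.prems Ck_on_Suc in auto)
  then have "Ck_on k S (\<lambda>x. frechet_derivative u (at x) v * h q (u x))" for v
    using Suc.prems by (intro Ck_on_bounded_bilinear[OF _ bounded_bilinear_mult]) auto
  moreover have D: "((\<lambda>x. h p (u x)) has_derivative (\<lambda>v. frechet_derivative u (at x) v * h q (u x))) (at x)"
    if "x \<in> S" for x
    using has_derivative_compose[OF Ck_on_SucD[OF Suc.prems(2) that], of "h p" "\<lambda>v. v * h q (u x)"]
      q[of "u x"] by (simp add: has_field_derivative_def mult_commute_abs)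
  ultimately show "Ck_on (Suc k) S (\<lambda>x. h p (u x))"
    by (intro Ck_on_SucI[OF Suc.prems(1) D])
qed

lemma Ck_on_sum:
  assumes "open S" "\<And>i. i \<in> I \<Longrightarrow> Ck_on k S (f i)" shows "Ck_on k S (\<lambda>x. \<Sum>i\<in>I. f i x)"
  using assms(2)
proof (induction I rule: infinite_finite_induct)
  case (insert i I)
  then have "Ck_on k S (\<lambda>x. f i x + (\<Sum>i\<in>I. f i x))" by (intro Ck_on_add assms(1)) auto
  then show ?case using insert.hyps by simp
qed (simp_all add: Ck_on_const assms(1))

lemma linear_axis_expand:
  fixes L :: "real^'n::finite \<Rightarrow> 'b::real_vector"
  assumes "linear L" shows "L w = (\<Sum>k\<in>UNIV. (w $ k) *\<^sub>R L (axis k 1))"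
proof -
  have "L w = L (\<Sum>k\<in>UNIV. (w $ k) *\<^sub>R axis k 1)"
    by (simp add: basis_expansion scalar_mult_eq_scaleR [symmetric])
  then show ?thesis by (simp only: linear_sum[OF assms] linear_scale[OF assms])
qed

text \<open>\<open>Ck_on\<close> controls derivatives in fixed directions, whereas the chain rule
  differentiates \<open>f\<close> in the moving direction given by the derivative of
  \<open>\<phi>\<close>. Expanding that direction along the axes leaves fixed directions with smooth
  coefficients.\<close>

lemma Ck_on_compose:
  fixes f :: "real^'m \<Rightarrow> 'b::real_normed_vector" and \<phi> :: "real^'n \<Rightarrow> real^'m"
  assumes "open S" "open T" "Ck_on k T f" "Ck_on k S \<phi>" "\<phi> ` S \<subseteq> T"
  shows "Ck_on k S (\<lambda>x. f (\<phi> x))"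
  using assms(3,4)
proof (induction k arbitrary: f)
  case 0
  then show ?case using assms(5) by (auto intro: continuous_on_compose2)
next
  case (Suc k)
  have "Ck_on k S (\<lambda>x. frechet_derivative f (at (\<phi> x)) v)" for v
    by (rule Suc.IH) (use Suc.prems Ck_on_Suc in auto)
  moreover have "Ck_on k S (\<lambda>x. frechet_derivative \<phi> (at x) v $ j)" for v j
    by (rule Ck_on_bounded_linear[OF assms(1) bounded_linear_vec_nth]) (use Suc.prems in auto)
  ultimately have 1: "Ck_on k S (\<lambda>x. \<Sum>j\<in>UNIV. (frechet_derivative \<phi> (at x) v $ j) *\<^sub>R frechet_derivative f (at (\<phi> x)) (axis j 1))" for v
    by (intro Ck_on_sum Ck_on_bounded_bilinear[OF _ bounded_bilinear_scaleR] assms(1))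
  have 2: "((\<lambda>x. f (\<phi> x)) has_derivative (\<lambda>v. frechet_derivative f (at (\<phi> x)) (frechet_derivative \<phi> (at x) v))) (at x)"
    if "x \<in> S" for x
    using that assms(5) by (intro has_derivative_compose[OF Ck_on_SucD[OF Suc.prems(2)]] Ck_on_SucD[OF Suc.prems(1)]) auto
  have 3: "frechet_derivative f (at (\<phi> x)) w = (\<Sum>j\<in>UNIV. (w $ j) *\<^sub>R frechet_derivative f (at (\<phi> x)) (axis j 1))"
    if "x \<in> S" for x w
  proof -
    have "\<phi> x \<in> T" using that assms(5) by auto
    then have "linear (frechet_derivative f (at (\<phi> x)))"
      by (rule has_derivative_linear[OF Ck_on_SucD[OF Suc.prems(1)]])
    then show ?thesis by (rule linear_axis_expand)
  qed
  have "Ck_on k S (\<lambda>x. frechet_derivative f (at (\<phi> x)) (frechet_derivative \<phi> (at x) v))" for v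
    by (rule Ck_on_cong[OF assms(1) _ 1[of v]]) (rule 3[symmetric])
  then show "Ck_on (Suc k) S (\<lambda>x. f (\<phi> x))"
    by (rule Ck_on_SucI2, intro assms(1)) (rule 2)
qed

lemma Ck_on_open_cover:
  assumes "\<And>x. x \<in> S \<Longrightarrow> \<exists>U. open U \<and> x \<in> U \<and> Ck_on k U f"
  shows "Ck_on k S f"
  using assms
proof (induction k arbitrary: f)
  case 0
  show ?case unfolding Ck_on.simps
  proof (rule continuous_at_imp_continuous_on, rule ballI)
    fix x assume "x \<in> S"
    then obtain U where "open U" "x \<in> U" "continuous_on U f" using 0 by auto
    then show "isCont f x" by (simp add: continuous_on_eq_continuous_at)
  qed
next
  case (Suc k)
  have "Ck_on k S (\<lambda>x. frechet_derivative f (at x) v)" for v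
  proof (rule Suc.IH)
    fix x assume "x \<in> S"
    then obtain U where "open U" "x \<in> U" "Ck_on (Suc k) U f" using Suc.prems by blast
    then show "\<exists>U. open U \<and> x \<in> U \<and> Ck_on k U (\<lambda>x. frechet_derivative f (at x) v)" by auto
  qed
  then show ?case using Suc.prems by fastforce
qed

lemma smooth_on_cong:
  "open S \<Longrightarrow> (\<And>x. x \<in> S \<Longrightarrow> f x = g x) \<Longrightarrow> smooth_on S f \<Longrightarrow> smooth_on S g"
  unfolding smooth_on_def using Ck_on_cong by blast

lemma smooth_on_subset: "smooth_on S f \<Longrightarrow> T \<subseteq> S \<Longrightarrow> smooth_on T f"
  unfolding smooth_on_def using Ck_on_subset by blast

lemma smooth_on_continuous: "smooth_on S f \<Longrightarrow> continuous_on S f"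
  unfolding smooth_on_def using Ck_on_continuous by blast

lemma smooth_on_has_derivative:
  "smooth_on S f \<Longrightarrow> x \<in> S \<Longrightarrow> (f has_derivative frechet_derivative f (at x)) (at x)"
  unfolding smooth_on_def using Ck_on_SucD by blast

lemma smooth_on_differentiable: "smooth_on S f \<Longrightarrow> x \<in> S \<Longrightarrow> f differentiable (at x)"
  unfolding smooth_on_def by (metis Ck_on.simps(2))

lemma smooth_on_frechet: "smooth_on S f \<Longrightarrow> smooth_on S (\<lambda>x. frechet_derivative f (at x) v)"
  unfolding smooth_on_def by (metis Ck_on.simps(2))

lemma smooth_on_const [simp]: "open S \<Longrightarrow> smooth_on S (\<lambda>x. c)"
  unfolding smooth_on_def by (simp add: Ck_on_const)

lemma smooth_on_add: "open S \<Longrightarrow> smooth_on S f \<Longrightarrow> smooth_on S g \<Longrightarrow> smooth_on S (\<lambda>x. f x + g x)"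
  unfolding smooth_on_def by (blast intro: Ck_on_add)

lemma smooth_on_bounded_linear:
  "open S \<Longrightarrow> bounded_linear L \<Longrightarrow> smooth_on S f \<Longrightarrow> smooth_on S (\<lambda>x. L (f x))"
  unfolding smooth_on_def by (blast intro: Ck_on_bounded_linear)

lemma smooth_on_mult:
  fixes f g :: "real^'n \<Rightarrow> real"
  shows "open S \<Longrightarrow> smooth_on S f \<Longrightarrow> smooth_on S g \<Longrightarrow> smooth_on S (\<lambda>x. f x * g x)"
  unfolding smooth_on_def by (blast intro: Ck_on_bounded_bilinear[OF _ bounded_bilinear_mult])

lemma smooth_on_minus: "open S \<Longrightarrow> smooth_on S f \<Longrightarrow> smooth_on S (\<lambda>x. - f x)"
  using smooth_on_bounded_linear[OF _ bounded_linear_minus[OF bounded_linear_ident]] by blast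

lemma smooth_on_diff: "open S \<Longrightarrow> smooth_on S f \<Longrightarrow> smooth_on S g \<Longrightarrow> smooth_on S (\<lambda>x. f x - g x)"
  using smooth_on_add[of S f "\<lambda>x. - g x"] smooth_on_minus[of S g] by simp

lemma smooth_on_inverse:
  fixes f :: "real^'n \<Rightarrow> real"
  shows "open S \<Longrightarrow> smooth_on S f \<Longrightarrow> (\<And>x. x \<in> S \<Longrightarrow> f x \<noteq> 0) \<Longrightarrow> smooth_on S (\<lambda>x. inverse (f x))"
  unfolding smooth_on_def by (blast intro: Ck_on_inverse)

lemma smooth_on_divide:
  fixes f g :: "real^'n \<Rightarrow> real"
  shows "open S \<Longrightarrow> smooth_on S f \<Longrightarrow> smooth_on S g \<Longrightarrow> (\<And>x. x \<in> S \<Longrightarrow> g x \<noteq> 0) \<Longrightarrow> smooth_on S (\<lambda>x. f x / g x)"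
  unfolding divide_inverse by (intro smooth_on_mult smooth_on_inverse)

lemma smooth_on_sqrt:
  fixes f :: "real^'n \<Rightarrow> real"
  shows "open S \<Longrightarrow> smooth_on S f \<Longrightarrow> (\<And>x. x \<in> S \<Longrightarrow> f x > 0) \<Longrightarrow> smooth_on S (\<lambda>x. sqrt (f x))"
  unfolding smooth_on_def by (blast intro: Ck_on_sqrt)

lemma smooth_on_sum: "open S \<Longrightarrow> (\<And>i. i \<in> I \<Longrightarrow> smooth_on S (f i)) \<Longrightarrow> smooth_on S (\<lambda>x. \<Sum>i\<in>I. f i x)"
  unfolding smooth_on_def by (blast intro: Ck_on_sum)

lemma smooth_on_prod:
  fixes f :: "'i \<Rightarrow> real^'n \<Rightarrow> real"
  assumes "open S" "\<And>i. i \<in> I \<Longrightarrow> smooth_on S (f i)" shows "smooth_on S (\<lambda>x. \<Prod>i\<in>I. f i x)"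
  using assms(2)
proof (induction I rule: infinite_finite_induct)
  case (insert i I)
  then have "smooth_on S (\<lambda>x. f i x * (\<Prod>i\<in>I. f i x))" by (intro smooth_on_mult assms(1)) auto
  then show ?case using insert.hyps by simp
qed (simp_all add: assms(1))

lemma smooth_on_power:
  fixes f :: "real^'n \<Rightarrow> real"
  assumes "open S" "smooth_on S f" shows "smooth_on S (\<lambda>x. f x ^ k)"
  using smooth_on_prod[OF assms(1), of "{..<k}" "\<lambda>_. f"] assms(2) by simp

lemma smooth_on_compose:
  fixes f :: "real^'m \<Rightarrow> 'b::real_normed_vector" and \<phi> :: "real^'n \<Rightarrow> real^'m"
  shows "open S \<Longrightarrow> open T \<Longrightarrow> smooth_on T f \<Longrightarrow> smooth_on S \<phi> \<Longrightarrow> \<phi> ` S \<subseteq> T \<Longrightarrow> smooth_on S (\<lambda>x. f (\<phi> x))"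
  unfolding smooth_on_def by (blast intro: Ck_on_compose)

lemma smooth_on_open_cover:
  "(\<And>x. x \<in> S \<Longrightarrow> \<exists>U. open U \<and> x \<in> U \<and> smooth_on U f) \<Longrightarrow> smooth_on S f"
  unfolding smooth_on_def by (intro allI Ck_on_open_cover) fast

lemma smooth_on_ident [simp]: 
  assumes "open S" shows "smooth_on S (\<lambda>x. x :: real^'n)"
  unfolding smooth_on_def
proof
  fix k show "Ck_on k S (\<lambda>x. x :: real^'n)"
    by (cases k) (auto intro: Ck_on_SucI[OF assms has_derivative_ident] Ck_on_const assms simp del: Ck_on.simps(2))
qed

lemma smooth_on_vec_nth: "open S \<Longrightarrow> smooth_on S f \<Longrightarrow> smooth_on S (\<lambda>x. f x $ i)"
  by (rule smooth_on_bounded_linear[OF _ bounded_linear_vec_nth])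

lemma smooth_on_inner:
  fixes f g :: "real^'n \<Rightarrow> 'b::real_inner"
  shows "open S \<Longrightarrow> smooth_on S f \<Longrightarrow> smooth_on S g \<Longrightarrow> smooth_on S (\<lambda>x. f x \<bullet> g x)"
  unfolding smooth_on_def by (blast intro: Ck_on_bounded_bilinear[OF _ bounded_bilinear_inner])

lemma smooth_on_det:
  fixes M :: "real^'n \<Rightarrow> real^'m^'m::finite"
  assumes "open S" "\<And>i j. smooth_on S (\<lambda>x. M x $ i $ j)"
  shows "smooth_on S (\<lambda>x. det (M x))"
  unfolding det_def using assms by (intro smooth_on_sum smooth_on_mult smooth_on_prod smooth_on_const) auto

text \<open>By Cramer's rule the entries of the inverse are rational in the entries of the matrix,
  which is how their smoothness is obtained.\<close>

lemma matrix_inv_cramer: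
  fixes A :: "real^'n^'n::finite"
  assumes "invertible A"
  shows "matrix_inv A $ k $ l = det (\<chi> i j. if j = k then axis l 1 $ i else A $ i $ j) / det A"
proof -
  have "A *v (matrix_inv A *v axis l 1) = axis l 1"
    using matrix_inv_right[OF assms] by (simp add: matrix_vector_mul_assoc)
  then have "matrix_inv A *v axis l 1 = (\<chi> k. det (\<chi> i j. if j = k then axis l 1 $ i else A $ i $ j) / det A)"
    using cramer[of A] assms invertible_det_nz[of A] by blast
  from arg_cong[OF this, of "\<lambda>v. v $ k"] show ?thesis by simp
qed

lemma smooth_on_matrix_inv:
  fixes M :: "real^'n \<Rightarrow> real^'m^'m::finite"
  assumes "open S" "\<And>i j. smooth_on S (\<lambda>x. M x $ i $ j)" "\<And>x. x \<in> S \<Longrightarrow> invertible (M x)"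
  shows "smooth_on S (\<lambda>x. matrix_inv (M x) $ k $ l)"
proof (rule smooth_on_cong[OF assms(1)])
  show "det (\<chi> i j. if j = k then axis l 1 $ i else M x $ i $ j) / det (M x) = matrix_inv (M x) $ k $ l"
    if "x \<in> S" for x using matrix_inv_cramer[OF assms(3)[OF that]] by simp
  have "smooth_on S (\<lambda>x. (\<chi> i j. if j = k then axis l 1 $ i else M x $ i $ j) $ i $ j)" for i j
    using assms by (cases "j = k") simp_all
  then show "smooth_on S (\<lambda>x. det (\<chi> i j. if j = k then axis l 1 $ i else M x $ i $ j) / det (M x))"
    using assms by (intro smooth_on_divide smooth_on_det) (auto simp: invertible_det_nz)
qed

text \<open>Schwarz's theorem, by evaluating a second difference in two ways.\<close>

lemma second_difference:
  fixes f :: "real^'n \<Rightarrow> real"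
  assumes "r > 0"
    and dom: "\<And>s t. 0 \<le> s \<Longrightarrow> s \<le> r \<Longrightarrow> 0 \<le> t \<Longrightarrow> t \<le> r \<Longrightarrow> x + s *\<^sub>R u + t *\<^sub>R v \<in> S"
    and sm: "smooth_on S f"
  shows "\<exists>s t. 0 \<le> s \<and> s \<le> r \<and> 0 \<le> t \<and> t \<le> r \<and>
    f (x + r *\<^sub>R u + r *\<^sub>R v) - f (x + r *\<^sub>R u) - f (x + r *\<^sub>R v) + f x =
    r * r * frechet_derivative (\<lambda>y. frechet_derivative f (at y) u) (at (x + s *\<^sub>R u + t *\<^sub>R v)) v"
proof -
  have line: "((\<lambda>s. h (y + s *\<^sub>R w)) has_real_derivative frechet_derivative h (at (y + s *\<^sub>R w)) w) (at s)"
    if h: "smooth_on S h" "y + s *\<^sub>R w \<in> S" for h :: "real^'n \<Rightarrow> real" and y w s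
  proof -
    note D = smooth_on_has_derivative[OF h]
    have "((\<lambda>s. y + s *\<^sub>R w) has_derivative (\<lambda>d. d *\<^sub>R w)) (at s)"
      by (auto intro!: derivative_eq_intros)
    from has_derivative_compose[OF this D]
    have "((\<lambda>s. h (y + s *\<^sub>R w)) has_derivative (\<lambda>d. frechet_derivative h (at (y + s *\<^sub>R w)) (d *\<^sub>R w))) (at s)" .
    then show ?thesis
      by (simp add: has_field_derivative_def linear_scale[OF has_derivative_linear[OF D]] mult_commute_abs)
  qed
  \<comment> \<open>The second difference is the increment of \<open>g\<close>. The mean value
    theorem is applied to \<open>g\<close> in direction \<open>u\<close> and then to the resulting
    derivative in direction \<open>v\<close>.\<close>
  define g where "g s = f ((x + r *\<^sub>R v) + s *\<^sub>R u) - f (x + s *\<^sub>R u)" for s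
  have "\<exists>\<sigma>. 0 < \<sigma> \<and> \<sigma> < r \<and> g r - g 0 = (r - 0) *
      (frechet_derivative f (at ((x + r *\<^sub>R v) + \<sigma> *\<^sub>R u)) u - frechet_derivative f (at (x + \<sigma> *\<^sub>R u)) u)"
  proof (rule MVT2[OF assms(1)])
    fix s assume s: "0 \<le> s" "s \<le> r"
    show "DERIV g s :> frechet_derivative f (at ((x + r *\<^sub>R v) + s *\<^sub>R u)) u - frechet_derivative f (at (x + s *\<^sub>R u)) u"
      unfolding g_def using dom[OF s, of r] dom[OF s, of 0] assms(1)
      by (intro DERIV_diff line[OF sm]) (auto simp: algebra_simps)
  qed
  then obtain \<sigma> where \<sigma>: "0 < \<sigma>" "\<sigma> < r" "g r - g 0 = r *
      (frechet_derivative f (at ((x + \<sigma> *\<^sub>R u) + r *\<^sub>R v)) u - frechet_derivative f (at ((x + \<sigma> *\<^sub>R u) + 0 *\<^sub>R v)) u)"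
    by (auto simp: algebra_simps)
  have "\<exists>\<tau>. 0 < \<tau> \<and> \<tau> < r \<and> frechet_derivative f (at ((x + \<sigma> *\<^sub>R u) + r *\<^sub>R v)) u - frechet_derivative f (at ((x + \<sigma> *\<^sub>R u) + 0 *\<^sub>R v)) u
      = (r - 0) * frechet_derivative (\<lambda>y. frechet_derivative f (at y) u) (at ((x + \<sigma> *\<^sub>R u) + \<tau> *\<^sub>R v)) v"
  proof (rule MVT2[OF assms(1)])
    fix t assume t: "0 \<le> t" "t \<le> r"
    show "DERIV (\<lambda>t. frechet_derivative f (at ((x + \<sigma> *\<^sub>R u) + t *\<^sub>R v)) u) t :>
        frechet_derivative (\<lambda>y. frechet_derivative f (at y) u) (at ((x + \<sigma> *\<^sub>R u) + t *\<^sub>R v)) v"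
      using dom[OF _ _ t, of \<sigma>] \<sigma> by (intro line[OF smooth_on_frechet[OF sm]]) auto
  qed
  then obtain \<tau> where "0 < \<tau>" "\<tau> < r" "g r - g 0 = r * (r * frechet_derivative (\<lambda>y. frechet_derivative f (at y) u) (at ((x + \<sigma> *\<^sub>R u) + \<tau> *\<^sub>R v)) v)"
    using \<sigma>(3) by auto
  then show ?thesis using \<sigma> unfolding g_def by (intro exI[of _ \<sigma>] exI[of _ \<tau>]) (auto simp: algebra_simps)
qed

lemma second_derivative_symmetric:
  fixes f :: "real^'n \<Rightarrow> real"
  assumes "open S" "smooth_on S f" "x \<in> S"
  shows "frechet_derivative (\<lambda>y. frechet_derivative f (at y) u) (at x) v =
    frechet_derivative (\<lambda>y. frechet_derivative f (at y) v) (at x) u"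
proof (rule ccontr)
  define A where "A y = frechet_derivative (\<lambda>y. frechet_derivative f (at y) u) (at y) v" for y
  define B where "B y = frechet_derivative (\<lambda>y. frechet_derivative f (at y) v) (at y) u" for y
  assume "\<not> ?thesis"
  then have "\<bar>A x - B x\<bar> > 0" by (simp add: A_def B_def)
  \<comment> \<open>Within \<open>e\<close>, half of the gap, of their values at \<open>x\<close>,
    the functions \<open>A\<close> and \<open>B\<close> cannot take a common value; the second
    difference produces one.\<close>
  define e where "e = \<bar>A x - B x\<bar> / 2"
  have e: "e > 0" using \<open>\<bar>A x - B x\<bar> > 0\<close> by (simp add: e_def)
  have "continuous_on S A" "continuous_on S B"
    unfolding A_def B_def by (intro smooth_on_continuous smooth_on_frechet assms(2))+
  then have cA: "isCont A x" and cB: "isCont B x" using assms by (auto simp: continuous_on_eq_continuous_at)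
  obtain d1 where d1: "d1 > 0" "\<And>y. dist y x < d1 \<Longrightarrow> dist (A y) (A x) < e"
    using cA e unfolding continuous_at_eps_delta by blast
  obtain d2 where d2: "d2 > 0" "\<And>y. dist y x < d2 \<Longrightarrow> dist (B y) (B x) < e"
    using cB e unfolding continuous_at_eps_delta by blast
  obtain d3 where d3: "d3 > 0" "ball x d3 \<subseteq> S" using assms(1,3) openE by blast
  define d where "d = min d1 (min d2 d3)"
  have d: "d > 0" "d \<le> d1" "d \<le> d2" "d \<le> d3" using d1 d2 d3 by (auto simp: d_def)
  \<comment> \<open>The whole parallelogram then stays within distance \<open>d\<close> of
    \<open>x\<close>; the summand 1 keeps the denominator positive when \<open>u\<close> and
    \<open>v\<close> vanish.\<close>
  define r where "r = d / (2 * (norm u + norm v + 1))"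
  have pos: "norm u + norm v + 1 > 0" by (simp add: add_nonneg_pos)
  have r: "r > 0" using d pos by (simp add: r_def)
  have near: "dist (x + s *\<^sub>R u + t *\<^sub>R v) x < d" if "0 \<le> s" "s \<le> r" "0 \<le> t" "t \<le> r" for s t
  proof -
    have "dist (x + s *\<^sub>R u + t *\<^sub>R v) x \<le> s * norm u + t * norm v"
      using norm_triangle_ineq[of "s *\<^sub>R u" "t *\<^sub>R v"] that by (simp add: dist_norm add.assoc)
    also have "\<dots> \<le> r * norm u + r * norm v" using that by (intro add_mono mult_right_mono) auto
    also have "\<dots> \<le> r * (norm u + norm v + 1)" using r by (simp add: algebra_simps)
    also have "\<dots> = d / 2" using pos unfolding r_def by (simp only: times_divide_eq_left) (simp add: field_simps)
    also have "\<dots> < d" using d by simp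
    finally show ?thesis .
  qed
  have dom: "x + s *\<^sub>R u + t *\<^sub>R v \<in> S" if "0 \<le> s" "s \<le> r" "0 \<le> t" "t \<le> r" for s t
    using near[OF that] d d3(2) by (auto simp: dist_commute subset_iff)
  then have dom': "x + s *\<^sub>R v + t *\<^sub>R u \<in> S" if "0 \<le> s" "s \<le> r" "0 \<le> t" "t \<le> r" for s t
    using dom[OF that(3,4,1,2)] by (simp add: add.commute add.left_commute)
  obtain s t where 1: "0 \<le> s" "s \<le> r" "0 \<le> t" "t \<le> r"
    "f (x + r *\<^sub>R u + r *\<^sub>R v) - f (x + r *\<^sub>R u) - f (x + r *\<^sub>R v) + f x = r * r * A (x + s *\<^sub>R u + t *\<^sub>R v)"
    using second_difference[OF r dom assms(2)] unfolding A_def by blast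
  obtain s' t' where 2: "0 \<le> s'" "s' \<le> r" "0 \<le> t'" "t' \<le> r"
    "f (x + r *\<^sub>R v + r *\<^sub>R u) - f (x + r *\<^sub>R v) - f (x + r *\<^sub>R u) + f x = r * r * B (x + s' *\<^sub>R v + t' *\<^sub>R u)"
    using second_difference[OF r dom' assms(2)] unfolding B_def by blast
  have "r * r * A (x + s *\<^sub>R u + t *\<^sub>R v) = r * r * B (x + t' *\<^sub>R u + s' *\<^sub>R v)"
  proof -
    have eqs: "x + r *\<^sub>R v + r *\<^sub>R u = x + r *\<^sub>R u + r *\<^sub>R v" "x + s' *\<^sub>R v + t' *\<^sub>R u = x + t' *\<^sub>R u + s' *\<^sub>R v"
      by (simp_all add: algebra_simps)
    show ?thesis using 1(5) 2(5)[unfolded eqs] by linarith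
  qed
  then have "A (x + s *\<^sub>R u + t *\<^sub>R v) = B (x + t' *\<^sub>R u + s' *\<^sub>R v)" using r by simp
  moreover have "dist (A (x + s *\<^sub>R u + t *\<^sub>R v)) (A x) < e" using near[OF 1(1-4)] d by (intro d1) auto
  moreover have "dist (B (x + t' *\<^sub>R u + s' *\<^sub>R v)) (B x) < e" using near[OF 2(3,4,1,2)] d by (intro d2) auto
  moreover have "e + e = \<bar>A x - B x\<bar>" by (simp add: e_def)
  ultimately show False unfolding dist_real_def by argo
qed

section \<open>Smooth families of alternating functions\<close>

definition smooth_family :: "(real^'n) set \<Rightarrow> (real^'n \<Rightarrow> (real^'m) list \<Rightarrow> real) \<Rightarrow> bool" where
  "smooth_family S a \<longleftrightarrow> (\<forall>x\<in>S. alternating (a x)) \<and> (\<forall>vs. smooth_on S (\<lambda>x. a x vs))"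

definition pdiff :: "(real^'n \<Rightarrow> 'v list \<Rightarrow> real) \<Rightarrow> real^'n \<Rightarrow> real^'n \<Rightarrow> 'v list \<Rightarrow> real" where
  "pdiff a v x = (\<lambda>vs. frechet_derivative (\<lambda>y. a y vs) (at x) v)"

text \<open>The exterior derivative in coordinates, as \<open>e_j \<and>\<close> applied to the j-th
  partial derivative. This shape lets the rules for \<open>wedge\<close>, \<open>contr\<close> and
  \<open>pull\<close> act on it; \<open>dloc_eval\<close> identifies it with the alternating sum in
  \<open>ext_d\<close>.\<close>

definition dloc :: "(real^'n::finite \<Rightarrow> (real^'n) list \<Rightarrow> real) \<Rightarrow> real^'n \<Rightarrow> (real^'n) list \<Rightarrow> real" where
  "dloc a x = (\<Sum>j\<in>UNIV. wedge (axis j 1) (pdiff a (axis j 1) x))"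

definition grad :: "(real^'n::finite \<Rightarrow> real) \<Rightarrow> real^'n \<Rightarrow> real^'n" where
  "grad f x = (\<chi> j. frechet_derivative f (at x) (axis j 1))"

lemma smooth_familyD: "smooth_family S a \<Longrightarrow> x \<in> S \<Longrightarrow> alternating (a x)"
  and smooth_family_smooth: "smooth_family S a \<Longrightarrow> smooth_on S (\<lambda>x. a x vs)"
  by (auto simp: smooth_family_def)

lemma smooth_family_cong:
  assumes "open S" "\<And>x. x \<in> S \<Longrightarrow> a x = b x" "smooth_family S a" shows "smooth_family S b"
proof -
  have "smooth_on S (\<lambda>x. b x vs)" for vs
    by (rule smooth_on_cong[OF assms(1) _ smooth_family_smooth[OF assms(3)]]) (simp add: assms(2))
  then show ?thesis using assms(2,3) by (auto simp: smooth_family_def)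
qed

lemma smooth_family_zero: "open S \<Longrightarrow> smooth_family S (\<lambda>x. 0)"
  by (simp add: smooth_family_def)

lemma smooth_family_add:
  "open S \<Longrightarrow> smooth_family S a \<Longrightarrow> smooth_family S b \<Longrightarrow> smooth_family S (\<lambda>x. a x + b x)"
  unfolding smooth_family_def by (auto intro: smooth_on_add)

lemma smooth_family_tscale:
  "open S \<Longrightarrow> smooth_on S f \<Longrightarrow> smooth_family S a \<Longrightarrow> smooth_family S (\<lambda>x. tscale (f x) (a x))"
  unfolding smooth_family_def by (auto intro: smooth_on_mult)

lemma smooth_family_sum:
  assumes "open S" "\<And>i. i \<in> I \<Longrightarrow> smooth_family S (a i)" shows "smooth_family S (\<lambda>x. \<Sum>i\<in>I. a i x)"
proof -
  have "alternating (\<Sum>i\<in>I. a i x)" if "x \<in> S" for x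
    using that assms(2) by (intro alternating_sum) (auto simp: smooth_family_def)
  moreover have "smooth_on S (\<lambda>x. (\<Sum>i\<in>I. a i x) vs)" for vs
    unfolding fun_sum_apply using assms by (intro smooth_on_sum) (auto simp: smooth_family_def)
  ultimately show ?thesis by (simp add: smooth_family_def)
qed

lemma smooth_family_contr: "smooth_family S a \<Longrightarrow> smooth_family S (\<lambda>x. contr v (a x))"
  unfolding smooth_family_def by auto

lemma smooth_family_wedge:
  assumes "open S" "smooth_on S \<xi>" "smooth_family S a"
  shows "smooth_family S (\<lambda>x. wedge (\<xi> x) (a x))"
proof -
  have "smooth_on S (\<lambda>x. wedge (\<xi> x) (a x) vs)" for vs
    using assms(3)
  proof (induction vs arbitrary: a)
    case (Cons v vs)
    have "smooth_on S (\<lambda>x. wedge (\<xi> x) (contr v (a x)) vs)"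
      by (rule Cons.IH) (rule smooth_family_contr[OF Cons.prems])
    then show "smooth_on S (\<lambda>x. wedge (\<xi> x) (a x) (v # vs))"
      using assms by (simp add: smooth_on_diff smooth_on_mult smooth_on_inner smooth_family_smooth[OF Cons.prems])
  qed (simp add: assms)
  then show ?thesis using assms(3) by (auto simp: smooth_family_def)
qed

lemma smooth_on_vecI:
  fixes V :: "real^'n \<Rightarrow> real^'m::finite"
  assumes "open S" "\<And>i. smooth_on S (\<lambda>x. V x $ i)" shows "smooth_on S V"
proof -
  have "smooth_on S (\<lambda>x. \<Sum>i\<in>UNIV. (V x $ i) *\<^sub>R (axis i 1 :: real^'m))"
    by (intro smooth_on_sum smooth_on_bounded_linear[OF _ bounded_linear_scaleR_left] assms)
  then show ?thesis by (simp add: basis_expansion scalar_mult_eq_scaleR [symmetric])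
qed

lemma smooth_on_matrix_vector:
  fixes M :: "real^'n \<Rightarrow> real^'m::finite^'k::finite"
  assumes "open S" "\<And>i j. smooth_on S (\<lambda>x. M x $ i $ j)" "smooth_on S v"
  shows "smooth_on S (\<lambda>x. M x *v v x)"
  by (rule smooth_on_vecI[OF assms(1)])
    (auto simp: matrix_vector_mult_def intro!: smooth_on_sum smooth_on_mult smooth_on_vec_nth assms)

lemma smooth_family_contr_var:
  fixes a :: "real^'n \<Rightarrow> (real^'m::finite) list \<Rightarrow> real"
  assumes "open S" "smooth_on S V" "smooth_family S a"
  shows "smooth_family S (\<lambda>x. contr (V x) (a x))"
proof (rule smooth_family_cong[OF assms(1)])
  show "smooth_family S (\<lambda>x. \<Sum>k\<in>UNIV. tscale (V x $ k) (contr (axis k 1) (a x)))"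
    by (intro smooth_family_sum smooth_family_tscale smooth_family_contr smooth_on_vec_nth assms)
qed (simp add: contr_expand[OF smooth_familyD[OF assms(3)]])

lemma smooth_family_pull:
  fixes T :: "real^'n \<Rightarrow> real^'k::finite^'m::finite"
  assumes "open S" "\<And>i j. smooth_on S (\<lambda>x. T x $ i $ j)" "smooth_family S a"
  shows "smooth_family S (\<lambda>x. pull ((*v) (T x)) (a x))"
proof -
  have "smooth_on S (\<lambda>x. pull ((*v) (T x)) (a x) vs)" for vs
    using assms(3)
  proof (induction vs arbitrary: a)
    case (Cons v vs)
    have "smooth_on S (\<lambda>x. pull ((*v) (T x)) (contr (T x *v v) (a x)) vs)"
      by (rule Cons.IH)
        (intro smooth_family_contr_var smooth_on_matrix_vector assms(1,2) Cons.prems smooth_on_const)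
    then show "smooth_on S (\<lambda>x. pull ((*v) (T x)) (a x) (v # vs))" by simp
  qed (simp add: smooth_family_smooth)
  then show ?thesis using assms(3) by (auto simp: smooth_family_def)
qed

lemma smooth_family_compose:
  assumes "open S" "open T" "smooth_family T a" "smooth_on S \<phi>" "\<phi> ` S \<subseteq> T"
  shows "smooth_family S (\<lambda>x. a (\<phi> x))"
  unfolding smooth_family_def
  using assms(3,5) by (auto simp: smooth_family_def intro!: smooth_on_compose[OF assms(1,2) _ assms(4,5), where f = "\<lambda>y. a y _"])

lemma smooth_family_Lp:
  assumes "open S" "\<And>i j. smooth_on S (\<lambda>x. W x $ i $ j)" "smooth_family S a"
  shows "smooth_family S (\<lambda>x. Lp (W x) (a x))"
  unfolding Lp_def
  by (intro smooth_family_sum smooth_family_tscale smooth_family_wedge smooth_on_divide smooth_on_const assms) auto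

lemma smooth_family_Lamp:
  assumes "open S" "\<And>i j. smooth_on S (\<lambda>x. W x $ i $ j)" "smooth_family S a"
  shows "smooth_family S (\<lambda>x. Lamp (W x) (a x))"
  unfolding Lamp_def
  by (intro smooth_family_sum smooth_family_tscale smooth_family_contr smooth_on_divide smooth_on_const assms) auto

section \<open>Coordinate derivatives of families of forms\<close>

lemma smooth_family_has_derivative:
  "smooth_family S a \<Longrightarrow> x \<in> S \<Longrightarrow> ((\<lambda>y. a y vs) has_derivative (\<lambda>v. pdiff a v x vs)) (at x)"
  unfolding pdiff_def using smooth_on_has_derivative smooth_family_smooth by blast

lemma pdiffI:
  assumes "\<And>vs. ((\<lambda>y. a y vs) has_derivative (\<lambda>v. D v vs)) (at x)"
  shows "pdiff a v x = D v"
  by (simp add: pdiff_def fun_eq_iff frechet_derivative_eq[OF assms])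

lemma pdiff_cong:
  assumes "open S" "x \<in> S" "\<And>y. y \<in> S \<Longrightarrow> a y = b y" shows "pdiff a v x = pdiff b v x"
  unfolding pdiff_def
  by (rule ext, rule fun_cong[OF frechet_derivative_cong_open(1)[OF assms(1,2)]]) (simp add: assms(3))

lemma dloc_cong:
  assumes "open S" "x \<in> S" "\<And>y. y \<in> S \<Longrightarrow> a y = b y" shows "dloc a x = dloc b x"
  unfolding dloc_def using pdiff_cong[OF assms] by simp

text \<open>Linear identities among the values of \<open>a\<close> hold near \<open>x\<close>, so
  they pass to the derivatives by uniqueness of the derivative.\<close>

lemma pdiff_alternating:
  assumes "open S" "smooth_family S a" "x \<in> S" shows "alternating (pdiff a v x)"
proof (rule alternatingI)
  note D = smooth_family_has_derivative[OF assms(2,3)]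
  fix us vs
  show "linear (\<lambda>w. pdiff a v x (us @ w # vs))"
  proof (rule linearI)
    fix w w' r
    have "((\<lambda>y. a y (us @ (w + w') # vs)) has_derivative (\<lambda>v. pdiff a v x (us @ w # vs) + pdiff a v x (us @ w' # vs))) (at x)"
      by (rule has_derivative_transform_within_open[OF has_derivative_add[OF D D] assms(1,3)])
        (simp add: linear_add[OF alternating_linear[OF smooth_familyD[OF assms(2)]]])
    from has_derivative_unique[OF this D] show "pdiff a v x (us @ (w + w') # vs) = pdiff a v x (us @ w # vs) + pdiff a v x (us @ w' # vs)"
      by metis
    have "((\<lambda>y. a y (us @ (r *\<^sub>R w) # vs)) has_derivative (\<lambda>v. r *\<^sub>R pdiff a v x (us @ w # vs))) (at x)"
      by (rule has_derivative_transform_within_open[OF has_derivative_scaleR_right[OF D] assms(1,3)])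
        (simp add: linear_scale[OF alternating_linear[OF smooth_familyD[OF assms(2)]]])
    from has_derivative_unique[OF this D] show "pdiff a v x (us @ (r *\<^sub>R w) # vs) = r *\<^sub>R pdiff a v x (us @ w # vs)"
      by metis
  qed
  fix w
  have "((\<lambda>y. a y (us @ w # w # vs)) has_derivative (\<lambda>v. 0)) (at x)"
    by (rule has_derivative_transform_within_open[OF has_derivative_const[of 0] assms(1,3)])
      (simp add: alternating_adjacent[OF smooth_familyD[OF assms(2)]])
  from has_derivative_unique[OF this D] show "pdiff a v x (us @ w # w # vs) = 0" by metis
qed

lemma smooth_family_pdiff: "open S \<Longrightarrow> smooth_family S a \<Longrightarrow> smooth_family S (pdiff a v)"
  unfolding smooth_family_def[of S "pdiff a v"]
  by (auto intro: pdiff_alternating) (simp add: pdiff_def smooth_on_frechet smooth_family_smooth)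

lemma smooth_family_dloc: "open S \<Longrightarrow> smooth_family S a \<Longrightarrow> smooth_family S (dloc a)"
proof -
  assume "open S" "smooth_family S a"
  then have "smooth_family S (\<lambda>x. dloc a x)"
    unfolding dloc_def by (intro smooth_family_sum smooth_family_wedge smooth_family_pdiff smooth_on_const)
  then show ?thesis .
qed

lemma pdiff_linear_comb:
  assumes "open S" "smooth_family S a" "x \<in> S"
  shows "pdiff a (v + w) x = pdiff a v x + pdiff a w x" "pdiff a (r *\<^sub>R v) x = tscale r (pdiff a v x)"
    "pdiff a (\<Sum>i\<in>I. f i) x = (\<Sum>i\<in>I. pdiff a (f i) x)"
proof -
  have lin: "linear (\<lambda>v. pdiff a v x vs)" for vs
    by (rule has_derivative_linear[OF smooth_family_has_derivative[OF assms(2,3)]])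
  show "pdiff a (v + w) x = pdiff a v x + pdiff a w x" "pdiff a (r *\<^sub>R v) x = tscale r (pdiff a v x)"
    using linear_add[OF lin] linear_scale[OF lin] by (auto simp: fun_eq_iff)
  show "pdiff a (\<Sum>i\<in>I. f i) x = (\<Sum>i\<in>I. pdiff a (f i) x)"
    using linear_sum[OF lin] by (auto simp: fun_eq_iff fun_sum_apply)
qed

lemma pdiff_expand:
  fixes a :: "real^'n::finite \<Rightarrow> (real^'m) list \<Rightarrow> real"
  assumes "open S" "smooth_family S a" "x \<in> S"
  shows "pdiff a v x = (\<Sum>k\<in>UNIV. tscale (v $ k) (pdiff a (axis k 1) x))"
proof -
  have "v = (\<Sum>k\<in>UNIV. (v $ k) *\<^sub>R axis k 1)"
    by (simp add: basis_expansion scalar_mult_eq_scaleR [symmetric])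
  then have "pdiff a v x = pdiff a (\<Sum>k\<in>UNIV. (v $ k) *\<^sub>R axis k 1) x" by simp
  then show ?thesis by (simp only: pdiff_linear_comb[OF assms])
qed

lemma wedge_has_derivative:
  assumes "\<And>vs. ((\<lambda>y. a y vs) has_derivative (\<lambda>v. D v vs)) (at x)"
  shows "((\<lambda>y. wedge \<xi> (a y) vs) has_derivative (\<lambda>v. wedge \<xi> (D v) vs)) (at x)"
  using assms
proof (induction vs arbitrary: a D)
  case (Cons w vs)
  have "((\<lambda>y. wedge \<xi> (contr w (a y)) vs) has_derivative (\<lambda>v. wedge \<xi> (contr w (D v)) vs)) (at x)"
    by (rule Cons.IH) (simp add: Cons.prems)
  then show "((\<lambda>y. wedge \<xi> (a y) (w # vs)) has_derivative (\<lambda>v. wedge \<xi> (D v) (w # vs))) (at x)"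
    unfolding wedge_Cons by (intro has_derivative_diff has_derivative_mult_right Cons.prems)
qed simp

lemma pdiff_wedge:
  assumes "smooth_family S a" "x \<in> S"
  shows "pdiff (\<lambda>y. wedge \<xi> (a y)) v x = wedge \<xi> (pdiff a v x)"
  by (rule pdiffI) (rule wedge_has_derivative[OF smooth_family_has_derivative[OF assms]])

lemma pdiff_contr:
  assumes "smooth_family S a" "x \<in> S"
  shows "pdiff (\<lambda>y. contr w (a y)) v x = contr w (pdiff a v x)"
  by (rule pdiffI) (simp add: smooth_family_has_derivative[OF assms])

lemma pdiff_add:
  assumes "smooth_family S a" "smooth_family S b" "x \<in> S"
  shows "pdiff (\<lambda>y. a y + b y) v x = pdiff a v x + pdiff b v x"
  by (rule pdiffI, unfold plus_fun_apply)
    (rule has_derivative_add[OF smooth_family_has_derivative[OF assms(1,3)] smooth_family_has_derivative[OF assms(2,3)]])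

lemma pdiff_sum:
  assumes "\<And>i. i \<in> I \<Longrightarrow> smooth_family S (a i)" "x \<in> S"
  shows "pdiff (\<lambda>y. \<Sum>i\<in>I. a i y) v x = (\<Sum>i\<in>I. pdiff (a i) v x)"
  by (rule pdiffI) (auto simp: fun_sum_apply intro!: has_derivative_sum smooth_family_has_derivative assms)

lemma pdiff_tscale:
  assumes "smooth_family S a" "smooth_on S f" "x \<in> S"
  shows "pdiff (\<lambda>y. tscale (f y) (a y)) v x = tscale (f x) (pdiff a v x) + tscale (frechet_derivative f (at x) v) (a x)"
  by (rule pdiffI, unfold plus_fun_apply tscale_apply)
    (rule has_derivative_mult[OF smooth_on_has_derivative[OF assms(2,3)] smooth_family_has_derivative[OF assms(1,3)]])

lemma dloc_add:
  assumes "smooth_family S a" "smooth_family S b" "x \<in> S"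
  shows "dloc (\<lambda>y. a y + b y) x = dloc a x + dloc b x"
  by (simp add: dloc_def pdiff_add[OF assms] wedge_add sum.distrib)

lemma dloc_tscale:
  assumes "smooth_family S a" "smooth_on S f" "x \<in> S"
  shows "dloc (\<lambda>y. tscale (f y) (a y)) x = tscale (f x) (dloc a x) + wedge (grad f x) (a x)"
  unfolding wedge_expand[of "grad f x"]
  by (simp add: dloc_def pdiff_tscale[OF assms] wedge_add wedge_tscale sum.distrib tscale_sum grad_def)

text \<open>A symmetric array is paired with an antisymmetric one, so the sum equals its own
  negative. Both \<open>dloc_dloc\<close> and the naturality of \<open>dloc\<close> rest on this,
  with second derivatives as the symmetric array.\<close>

lemma wedge_wedge_symmetric_sum:
  fixes B :: "'n \<Rightarrow> 'n \<Rightarrow> (real^'n::finite) list \<Rightarrow> real"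
  assumes "\<And>j k. B j k = B k j"
  shows "(\<Sum>j\<in>UNIV. \<Sum>k\<in>UNIV. wedge (axis j 1) (wedge (axis k 1) (B j k))) = 0"
proof -
  let ?s = "\<Sum>j\<in>UNIV. \<Sum>k\<in>UNIV. wedge (axis j 1) (wedge (axis k 1) (B j k))"
  have "?s = - ?s"
    by (subst sum.swap, subst wedge_anticommute) (simp add: sum_negf assms)
  then show ?thesis by (auto simp: fun_eq_iff)
qed

lemma dloc_dloc:
  fixes a :: "real^'n::finite \<Rightarrow> (real^'n) list \<Rightarrow> real"
  assumes "open S" "smooth_family S a" "x \<in> S"
  shows "dloc (dloc a) x = 0"
proof -
  have "pdiff (dloc a) v x = (\<Sum>j\<in>UNIV. wedge (axis j 1) (pdiff (pdiff a (axis j 1)) v x))" for v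
  proof -
    have "pdiff (\<lambda>y. \<Sum>j\<in>UNIV. wedge (axis j 1) (pdiff a (axis j 1) y)) v x =
        (\<Sum>j\<in>UNIV. pdiff (\<lambda>y. wedge (axis j 1) (pdiff a (axis j 1) y)) v x)"
      by (rule pdiff_sum[OF _ assms(3)]) (intro smooth_family_wedge smooth_family_pdiff smooth_on_const assms)
    also have "\<dots> = (\<Sum>j\<in>UNIV. wedge (axis j 1) (pdiff (pdiff a (axis j 1)) v x))"
      by (intro sum.cong refl pdiff_wedge[OF _ assms(3)] smooth_family_pdiff assms)
    finally show ?thesis by (simp add: dloc_def[abs_def])
  qed
  then have "dloc (dloc a) x = (\<Sum>k\<in>UNIV. \<Sum>j\<in>UNIV. wedge (axis k 1) (wedge (axis j 1) (pdiff (pdiff a (axis j 1)) (axis k 1) x)))"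
    by (simp add: dloc_def[of "dloc a"] wedge_sum)
  also have "\<dots> = 0"
    by (rule wedge_wedge_symmetric_sum)
      (auto simp: pdiff_def fun_eq_iff intro!: second_derivative_symmetric[OF assms(1) smooth_family_smooth[OF assms(2)] assms(3)])
  finally show ?thesis .
qed

lemma dloc_eval:
  fixes a :: "real^'n::finite \<Rightarrow> (real^'n) list \<Rightarrow> real"
  assumes "\<And>vs. (\<lambda>y. a y vs) differentiable (at x)"
  shows "(\<Sum>i<length vs. (-1) ^ i * frechet_derivative (\<lambda>y. a y (nths vs (- {i}))) (at x) (vs ! i)) = dloc a x vs"
proof -
  have lin: "linear (frechet_derivative (\<lambda>y. a y vs) (at x))" for vs
    by (rule linear_frechet_derivative[OF assms])
  have "dloc a x vs = (\<Sum>j\<in>UNIV. \<Sum>i<length vs. (-1) ^ i * ((vs ! i) $ j * frechet_derivative (\<lambda>y. a y (nths vs (- {i}))) (at x) (axis j 1)))"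
    by (simp add: dloc_def fun_sum_apply wedge_shuffle pdiff_def inner_axis' mult.assoc)
  also have "\<dots> = (\<Sum>i<length vs. (-1) ^ i * (\<Sum>j\<in>UNIV. (vs ! i) $ j * frechet_derivative (\<lambda>y. a y (nths vs (- {i}))) (at x) (axis j 1)))"
    by (subst sum.swap) (simp add: sum_distrib_left)
  also have "\<dots> = (\<Sum>i<length vs. (-1) ^ i * frechet_derivative (\<lambda>y. a y (nths vs (- {i}))) (at x) (vs ! i))"
    by (intro sum.cong refl arg_cong[where f = "\<lambda>r. _ * r"]) (subst (2) linear_axis_expand[OF lin], simp)
  finally show ?thesis by simp
qed

lemma wedge_Lp: "wedge \<xi> (Lp W a) = Lp W (wedge \<xi> a)"
proof -
  have "wedge \<xi> (wedge \<eta> (wedge \<zeta> a)) = wedge \<eta> (wedge \<zeta> (wedge \<xi> a))" for \<eta> \<zeta>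
    by (simp only: wedge_anticommute[of \<xi> \<eta>] wedge_anticommute[of \<xi> \<zeta>] wedge_minus minus_minus)
  then show ?thesis by (simp add: Lp_def wedge_sum wedge_tscale)
qed

text \<open>\<open>W\<close> is closed as a 2-form.\<close>

definition closed_matrix :: "(real^'n::finite \<Rightarrow> real^'n^'n) \<Rightarrow> real^'n \<Rightarrow> bool" where
  "closed_matrix W x \<longleftrightarrow> (\<forall>k i j.
     frechet_derivative (\<lambda>y. W y $ i $ j) (at x) (axis k 1) +
     frechet_derivative (\<lambda>y. W y $ j $ k) (at x) (axis i 1) +
     frechet_derivative (\<lambda>y. W y $ k $ i) (at x) (axis j 1) = 0)"

text \<open>The derivatives falling on \<open>W\<close> contribute the exterior derivative of the
  2-form, wedged with \<open>a\<close>; it vanishes for closed \<open>W\<close>. Those falling on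
  \<open>a\<close> commute past, because \<open>Lp\<close> commutes with every wedge.\<close>

lemma dloc_Lp:
  fixes a :: "real^'n::finite \<Rightarrow> (real^'n) list \<Rightarrow> real"
  assumes "open S" "smooth_family S a" "\<And>i j. smooth_on S (\<lambda>y. W y $ i $ j)" "x \<in> S" "closed_matrix W x"
  shows "dloc (\<lambda>y. Lp (W y) (a y)) x = Lp (W x) (dloc a x)"
proof -
  define c where "c k i j = frechet_derivative (\<lambda>y. W y $ i $ j) (at x) (axis k 1)" for k i j
  let ?w = "\<lambda>k i j. wedge (axis k 1) (wedge (axis i 1) (wedge (axis j 1) (a x)))"
  have sw: "smooth_family S (\<lambda>y. wedge \<xi> (wedge \<eta> (a y)))" for \<xi> \<eta>
    by (intro smooth_family_wedge smooth_on_const assms)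
  have s2: "smooth_on S (\<lambda>y. W y $ i $ j / 2)" for i j
    by (intro smooth_on_divide smooth_on_const assms) auto
  have fd: "frechet_derivative (\<lambda>y. W y $ i $ j / 2) (at x) v = frechet_derivative (\<lambda>y. W y $ i $ j) (at x) v / 2" for i j v
  proof -
    have "((\<lambda>y. W y $ i $ j / 2) has_derivative (\<lambda>v. frechet_derivative (\<lambda>y. W y $ i $ j) (at x) v / 2)) (at x)"
      using bounded_linear.has_derivative[OF bounded_linear_divide smooth_on_has_derivative[OF assms(3,4)]] .
    then show ?thesis by (simp add: frechet_derivative_eq)
  qed
  have pd: "pdiff (\<lambda>y. Lp (W y) (a y)) (axis k 1) x = Lp (W x) (pdiff a (axis k 1) x) +
      (\<Sum>i\<in>UNIV. \<Sum>j\<in>UNIV. tscale (c k i j / 2) (wedge (axis i 1) (wedge (axis j 1) (a x))))" for k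
  proof -
    have "pdiff (\<lambda>y. Lp (W y) (a y)) (axis k 1) x =
       (\<Sum>i\<in>UNIV. pdiff (\<lambda>y. \<Sum>j\<in>UNIV. tscale (W y $ i $ j / 2) (wedge (axis i 1) (wedge (axis j 1) (a y)))) (axis k 1) x)"
      unfolding Lp_def
      by (rule pdiff_sum[OF _ assms(4)]) (intro smooth_family_sum smooth_family_tscale sw s2 assms)
    also have "\<dots> = (\<Sum>i\<in>UNIV. \<Sum>j\<in>UNIV. pdiff (\<lambda>y. tscale (W y $ i $ j / 2) (wedge (axis i 1) (wedge (axis j 1) (a y)))) (axis k 1) x)"
      by (intro sum.cong refl pdiff_sum[OF _ assms(4)] smooth_family_tscale sw s2 assms)
    also have "\<dots> = (\<Sum>i\<in>UNIV. \<Sum>j\<in>UNIV. tscale (W x $ i $ j / 2) (wedge (axis i 1) (wedge (axis j 1) (pdiff a (axis k 1) x)))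
        + tscale (c k i j / 2) (wedge (axis i 1) (wedge (axis j 1) (a x))))"
    proof (intro sum.cong refl)
      fix i j
      have "pdiff (\<lambda>y. wedge (axis i 1) (wedge (axis j 1) (a y))) (axis k 1) x =
          wedge (axis i 1) (wedge (axis j 1) (pdiff a (axis k 1) x))"
        by (subst pdiff_wedge[OF smooth_family_wedge[OF assms(1) smooth_on_const[OF assms(1)] assms(2)] assms(4)],
            subst pdiff_wedge[OF assms(2,4)]) (rule refl)
      then show "pdiff (\<lambda>y. tscale (W y $ i $ j / 2) (wedge (axis i 1) (wedge (axis j 1) (a y)))) (axis k 1) x =
          tscale (W x $ i $ j / 2) (wedge (axis i 1) (wedge (axis j 1) (pdiff a (axis k 1) x)))
          + tscale (c k i j / 2) (wedge (axis i 1) (wedge (axis j 1) (a x)))"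
        by (simp add: pdiff_tscale[OF sw s2 assms(4)] fd c_def)
    qed
    finally show ?thesis by (simp add: sum.distrib Lp_def)
  qed
  have "dloc (\<lambda>y. Lp (W y) (a y)) x = (\<Sum>k\<in>UNIV. Lp (W x) (wedge (axis k 1) (pdiff a (axis k 1) x))) +
      (\<Sum>k\<in>UNIV. \<Sum>i\<in>UNIV. \<Sum>j\<in>UNIV. tscale (c k i j / 2) (?w k i j))"
    by (simp add: dloc_def pd wedge_add wedge_Lp wedge_sum wedge_tscale sum.distrib)
  also have "(\<Sum>k\<in>UNIV. Lp (W x) (wedge (axis k 1) (pdiff a (axis k 1) x))) = Lp (W x) (dloc a x)"
    using sum_comp_morphism[of "Lp (W x)" "\<lambda>k. wedge (axis k 1) (pdiff a (axis k 1) x)" UNIV]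
    by (simp add: Lp_linear dloc_def o_def)
  also have "(\<Sum>k\<in>UNIV. \<Sum>i\<in>UNIV. \<Sum>j\<in>UNIV. tscale (c k i j / 2) (?w k i j)) = 0" (is "?s = 0")
  proof -
    \<comment> \<open>A triple wedge is invariant under cyclic rotation. Hence \<open>?s\<close> can
      be written with any of the three rotations of the indices of \<open>c\<close>, and their sum
      is 0 by closedness.\<close>
    have cyc: "?w k i j = ?w i j k" for i j k
      by (simp only: wedge_anticommute[of "axis k 1"] wedge_minus minus_minus)
    have "?s = (\<Sum>i\<in>UNIV. \<Sum>k\<in>UNIV. \<Sum>j\<in>UNIV. tscale (c k i j / 2) (?w k i j))"
      by (rule sum.swap)
    also have "\<dots> = (\<Sum>i\<in>UNIV. \<Sum>j\<in>UNIV. \<Sum>k\<in>UNIV. tscale (c k i j / 2) (?w i j k))"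
      by (subst cyc) (intro sum.cong refl sum.swap)
    finally have 1: "?s = (\<Sum>k\<in>UNIV. \<Sum>i\<in>UNIV. \<Sum>j\<in>UNIV. tscale (c j k i / 2) (?w k i j))" .
    also have "\<dots> = (\<Sum>i\<in>UNIV. \<Sum>k\<in>UNIV. \<Sum>j\<in>UNIV. tscale (c j k i / 2) (?w k i j))"
      by (rule sum.swap)
    also have "\<dots> = (\<Sum>i\<in>UNIV. \<Sum>j\<in>UNIV. \<Sum>k\<in>UNIV. tscale (c j k i / 2) (?w i j k))"
      by (subst cyc) (intro sum.cong refl sum.swap)
    finally have 2: "?s = (\<Sum>k\<in>UNIV. \<Sum>i\<in>UNIV. \<Sum>j\<in>UNIV. tscale (c i j k / 2) (?w k i j))" .
    have "c k i j / 2 + c j k i / 2 + c i j k / 2 = 0" for k i j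
      using assms(5)[unfolded closed_matrix_def, rule_format, where k = k and i = i and j = j] by (simp add: c_def)
    then have "(\<Sum>k\<in>UNIV. \<Sum>i\<in>UNIV. \<Sum>j\<in>UNIV. tscale (c k i j / 2 + c j k i / 2 + c i j k / 2) (?w k i j)) = 0"
      by simp
    then have "?s + ?s + ?s = 0"
      unfolding tscale_add_left sum.distrib 1[symmetric] 2[symmetric] .
    then show ?thesis by (auto simp: fun_eq_iff)
  qed
  finally show ?thesis by simp
qed

section \<open>Naturality of the exterior derivative\<close>

text \<open>The derivative at \<open>T\<close>, in the direction \<open>R\<close>, of the value of
  \<open>a\<close> on \<open>map T vs\<close>: by the product rule \<open>R\<close> replaces
  \<open>T\<close> in one argument at a time.\<close>

primrec derivation_pull :: "'u list \<Rightarrow> ('u \<Rightarrow> 'v) \<Rightarrow> ('u \<Rightarrow> 'v) \<Rightarrow> ('v list \<Rightarrow> real) \<Rightarrow> real" where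
  "derivation_pull [] T R a = 0"
| "derivation_pull (v # vs) T R a = a (R v # map T vs) + derivation_pull vs T R (contr (T v) a)"

lemma derivation_pull_linear:
  "derivation_pull vs T R (a + b) = derivation_pull vs T R a + derivation_pull vs T R b"
  "derivation_pull vs T R (tscale r a) = r * derivation_pull vs T R a"
  "derivation_pull vs T R 0 = 0"
proof -
  show "derivation_pull vs T R (a + b) = derivation_pull vs T R a + derivation_pull vs T R b"
  proof (induction vs arbitrary: a b)
    case (Cons v vs)
    have "derivation_pull vs T R (contr (T v) a + contr (T v) b) =
      derivation_pull vs T R (contr (T v) a) + derivation_pull vs T R (contr (T v) b)" by (rule Cons.IH)
    then show "derivation_pull (v # vs) T R (a + b) = derivation_pull (v # vs) T R a + derivation_pull (v # vs) T R b" by simp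
  qed simp
  show r: "derivation_pull vs T R (tscale r a) = r * derivation_pull vs T R a" for r
  proof (induction vs arbitrary: a)
    case (Cons v vs)
    have "derivation_pull vs T R (tscale r (contr (T v) a)) = r * derivation_pull vs T R (contr (T v) a)" by (rule Cons.IH)
    then show "derivation_pull (v # vs) T R (tscale r a) = r * derivation_pull (v # vs) T R a" by (simp add: algebra_simps)
  qed simp
  show "derivation_pull vs T R 0 = 0" using r[of 0] by simp
qed

lemma derivation_pull_sum: "derivation_pull vs T R (sum f I) = (\<Sum>i\<in>I. derivation_pull vs T R (f i))"
  using sum_comp_morphism[of "derivation_pull vs T R" f I] by (simp add: derivation_pull_linear o_def)

lemma derivation_pull_eq: "derivation_pull vs T (T \<circ> R) a = derivation_list vs R (pull T a)"
proof (induction vs arbitrary: a)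
  case (Cons v vs)
  have "derivation_pull vs T (T \<circ> R) (contr (T v) a) = derivation_list vs R (pull T (contr (T v) a))" by (rule Cons.IH)
  then show "derivation_pull (v # vs) T (T \<circ> R) a = derivation_list (v # vs) R (pull T a)"
    by (simp add: contr_pull del: contr_apply)
qed simp

text \<open>Both the point and the matrix move. The first argument is expanded along the axes, so
  that the moving vector \<open>T y *v w\<close> enters through scalar factors and the product rule
  applies.\<close>

lemma pull_has_derivative:
  fixes a :: "real^'n::finite \<Rightarrow> (real^'n) list \<Rightarrow> real" and T :: "real^'n \<Rightarrow> real^'n^'n"
  assumes "open U" "smooth_family U a" "\<phi> x \<in> U" "(\<phi> has_derivative \<phi>') (at x)"
    "\<And>i j. ((\<lambda>y. T y $ i $ j) has_derivative (\<lambda>v. T' v $ i $ j)) (at x)"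
    "open S" "x \<in> S" "\<phi> ` S \<subseteq> U"
  shows "((\<lambda>y. pull ((*v) (T y)) (a (\<phi> y)) vs) has_derivative
    (\<lambda>v. pull ((*v) (T x)) (pdiff a (\<phi>' v) (\<phi> x)) vs + derivation_pull vs ((*v) (T x)) ((*v) (T' v)) (a (\<phi> x)))) (at x)"
  using assms(2)
proof (induction vs arbitrary: a)
  case Nil
  show ?case using has_derivative_compose[OF assms(4) smooth_family_has_derivative[OF Nil assms(3), of "[]"]] by simp
next
  case (Cons w vs)
  let ?a = "a (\<phi> x)"
  have alt: "alternating ?a" by (rule smooth_familyD[OF Cons.prems assms(3)])
  have IH: "((\<lambda>y. pull ((*v) (T y)) (contr (axis k 1) (a (\<phi> y))) vs) has_derivative
    (\<lambda>v. pull ((*v) (T x)) (pdiff (\<lambda>y. contr (axis k 1) (a y)) (\<phi>' v) (\<phi> x)) vs +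
       derivation_pull vs ((*v) (T x)) ((*v) (T' v)) (contr (axis k 1) ?a))) (at x)" for k
    by (rule Cons.IH) (rule smooth_family_contr[OF Cons.prems])
  have Tw: "((\<lambda>y. (T y *v w) $ k) has_derivative (\<lambda>v. (T' v *v w) $ k)) (at x)" for k
    unfolding matrix_vector_mult_def vec_lambda_beta
    by (intro has_derivative_sum has_derivative_mult_left assms)
  have "((\<lambda>y. \<Sum>k\<in>UNIV. (T y *v w) $ k * pull ((*v) (T y)) (contr (axis k 1) (a (\<phi> y))) vs) has_derivative
    (\<lambda>v. \<Sum>k\<in>UNIV. (T x *v w) $ k * (pull ((*v) (T x)) (pdiff (\<lambda>y. contr (axis k 1) (a y)) (\<phi>' v) (\<phi> x)) vs +
       derivation_pull vs ((*v) (T x)) ((*v) (T' v)) (contr (axis k 1) ?a)) +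
       (T' v *v w) $ k * pull ((*v) (T x)) (contr (axis k 1) ?a) vs)) (at x)"
    by (intro has_derivative_sum has_derivative_mult Tw IH)
  then have "((\<lambda>y. pull ((*v) (T y)) (a (\<phi> y)) (w # vs)) has_derivative
    (\<lambda>v. \<Sum>k\<in>UNIV. (T x *v w) $ k * (pull ((*v) (T x)) (pdiff (\<lambda>y. contr (axis k 1) (a y)) (\<phi>' v) (\<phi> x)) vs +
       derivation_pull vs ((*v) (T x)) ((*v) (T' v)) (contr (axis k 1) ?a)) +
       (T' v *v w) $ k * pull ((*v) (T x)) (contr (axis k 1) ?a) vs)) (at x)"
  proof (rule has_derivative_transform_within_open[OF _ assms(6,7)])
    fix y assume "y \<in> S"
    then have "alternating (a (\<phi> y))" using smooth_familyD[OF Cons.prems] assms(8) by auto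
    from alternating_expand[OF this, of "[]" "T y *v w" "map ((*v) (T y)) vs"]
    show "(\<Sum>k\<in>UNIV. (T y *v w) $ k * pull ((*v) (T y)) (contr (axis k 1) (a (\<phi> y))) vs) = pull ((*v) (T y)) (a (\<phi> y)) (w # vs)"
      by simp
  qed
  moreover have "(\<Sum>k\<in>UNIV. (T x *v w) $ k * (pull ((*v) (T x)) (pdiff (\<lambda>y. contr (axis k 1) (a y)) (\<phi>' v) (\<phi> x)) vs +
       derivation_pull vs ((*v) (T x)) ((*v) (T' v)) (contr (axis k 1) ?a)) +
       (T' v *v w) $ k * pull ((*v) (T x)) (contr (axis k 1) ?a) vs) =
     pull ((*v) (T x)) (pdiff a (\<phi>' v) (\<phi> x)) (w # vs) + derivation_pull (w # vs) ((*v) (T x)) ((*v) (T' v)) ?a" for v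
  proof -
    have 1: "(\<Sum>k\<in>UNIV. (T' v *v w) $ k * pull ((*v) (T x)) (contr (axis k 1) ?a) vs) = ?a (T' v *v w # map ((*v) (T x)) vs)"
      using alternating_expand[OF alt, of "[]" "T' v *v w" "map ((*v) (T x)) vs"] by simp
    have 2: "(\<Sum>k\<in>UNIV. (T x *v w) $ k * pull ((*v) (T x)) (pdiff (\<lambda>y. contr (axis k 1) (a y)) (\<phi>' v) (\<phi> x)) vs) =
        pull ((*v) (T x)) (pdiff a (\<phi>' v) (\<phi> x)) (w # vs)"
      using alternating_expand[OF pdiff_alternating[OF assms(1) Cons.prems assms(3)], of "\<phi>' v" "[]" "T x *v w" "map ((*v) (T x)) vs"]
      by (simp add: pdiff_contr[OF Cons.prems assms(3)])
    have 3: "(\<Sum>k\<in>UNIV. (T x *v w) $ k * derivation_pull vs ((*v) (T x)) ((*v) (T' v)) (contr (axis k 1) ?a)) =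
        derivation_pull vs ((*v) (T x)) ((*v) (T' v)) (contr (T x *v w) ?a)"
      by (subst contr_expand[OF alt, of "T x *v w"]) (simp only: derivation_pull_sum derivation_pull_linear)
    show ?thesis
      unfolding ring_distribs sum.distrib 1 2 3 by simp
  qed
  ultimately show "((\<lambda>y. pull ((*v) (T y)) (a (\<phi> y)) (w # vs)) has_derivative
    (\<lambda>v. pull ((*v) (T x)) (pdiff a (\<phi>' v) (\<phi> x)) (w # vs) + derivation_pull (w # vs) ((*v) (T x)) ((*v) (T' v)) ?a)) (at x)"
    by simp
qed

lemma matrix_vector_of_linear:
  fixes f :: "real^'n \<Rightarrow> real^'m"
  assumes "linear f" shows "matrix f *v x = f x"
  by (rule matrix_works) (simp add: assms linear_matrix_vector_mul_eq)

text \<open>The first derivative of \<open>\<phi>\<close> performs the pullback. Its second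
  derivative enters as a derivation of the pulled back form and cancels by symmetry.\<close>

lemma dloc_pull:
  fixes a :: "real^'n::finite \<Rightarrow> (real^'n) list \<Rightarrow> real" and \<phi> :: "real^'n \<Rightarrow> real^'n"
  assumes "open U" "smooth_family U a" "open S" "x \<in> S" "\<phi> ` S \<subseteq> U" "smooth_on S \<phi>"
    and inv: "invertible (matrix (frechet_derivative \<phi> (at x)))"
  shows "dloc (\<lambda>y. pull ((*v) (matrix (frechet_derivative \<phi> (at y)))) (a (\<phi> y))) x =
    pull ((*v) (matrix (frechet_derivative \<phi> (at x)))) (dloc a (\<phi> x))"
proof -
  define T where "T y = matrix (frechet_derivative \<phi> (at y))" for y
  define D2 where "D2 u v = frechet_derivative (\<lambda>y. frechet_derivative \<phi> (at y) u) (at x) v" for u v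
  define T' where "T' v = matrix (\<lambda>u. D2 u v)" for v
  have \<phi>x: "\<phi> x \<in> U" using assms by auto
  have lin: "linear (frechet_derivative \<phi> (at y))" if "y \<in> S" for y
    by (rule has_derivative_linear[OF smooth_on_has_derivative[OF assms(6) that]])
  have comp: "frechet_derivative \<phi> (at y) u $ i = frechet_derivative (\<lambda>y. \<phi> y $ i) (at y) u" if "y \<in> S" for y u i
    by (subst frechet_derivative_eq[OF bounded_linear.has_derivative[OF bounded_linear_vec_nth
            smooth_on_has_derivative[OF assms(6) that]]]) (rule refl)
  have D2: "((\<lambda>y. frechet_derivative \<phi> (at y) u) has_derivative D2 u) (at x)" for u
    unfolding D2_def using smooth_on_has_derivative[OF smooth_on_frechet[OF assms(6)] assms(4)] by simp
  have D2c: "D2 u v $ i = frechet_derivative (\<lambda>y. frechet_derivative (\<lambda>y. \<phi> y $ i) (at y) u) (at x) v" for u v i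
  proof -
    have "((\<lambda>y. frechet_derivative \<phi> (at y) u $ i) has_derivative (\<lambda>v. D2 u v $ i)) (at x)"
      by (rule bounded_linear.has_derivative[OF bounded_linear_vec_nth D2])
    then have "((\<lambda>y. frechet_derivative (\<lambda>y. \<phi> y $ i) (at y) u) has_derivative (\<lambda>v. D2 u v $ i)) (at x)"
      by (rule has_derivative_transform_within_open[OF _ assms(3,4)]) (simp add: comp)
    then show ?thesis by (simp add: frechet_derivative_eq)
  qed
  have D2sym: "D2 u v = D2 v u" for u v
    unfolding vec_eq_iff D2c
    using second_derivative_symmetric[OF assms(3) smooth_on_vec_nth[OF assms(3,6)] assms(4)] by blast
  have D2lin: "linear (D2 u)" for u by (rule has_derivative_linear[OF D2])
  \<comment> \<open>\<open>D2 u v\<close> is linear in \<open>v\<close> as a derivative; linearity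
    in \<open>u\<close> is read off from the symmetry just proved.\<close>
  have D2lin': "linear (\<lambda>u. D2 u v)" for v
  proof -
    have "(\<lambda>u. D2 u v) = D2 v" by (rule ext) (rule D2sym)
    then show ?thesis using D2lin by simp
  qed
  have T'v: "T' v *v u = D2 u v" for u v unfolding T'_def by (simp add: matrix_vector_of_linear[OF D2lin'])
  have Tv: "T y *v u = frechet_derivative \<phi> (at y) u" if "y \<in> S" for y u
    unfolding T_def by (simp add: matrix_vector_of_linear[OF lin[OF that]])
  have dT: "((\<lambda>y. T y $ i $ j) has_derivative (\<lambda>v. T' v $ i $ j)) (at x)" for i j
    using bounded_linear.has_derivative[OF bounded_linear_vec_nth D2[of "axis j 1"], of i]
    by (simp add: T_def T'_def matrix_def)
  \<comment> \<open>Invertibility factors the variation \<open>T' v\<close> through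
    \<open>T x\<close>; \<open>derivation_pull_eq\<close> then makes it a derivation of the pulled
    back form, to which \<open>derivation_list_eq\<close> applies.\<close>
  define N where "N v = matrix_inv (T x) ** T' v" for v
  have TN: "(*v) (T' v) = (*v) (T x) \<circ> (*v) (N v)" for v
    using matrix_inv_right[OF inv] by (simp add: fun_eq_iff N_def matrix_vector_mul_assoc matrix_mul_assoc T_def)
  let ?b = "pull ((*v) (T x)) (a (\<phi> x))"
  have altb: "alternating ?b" using smooth_familyD[OF assms(2) \<phi>x] by blast
  have pd: "pdiff (\<lambda>y. pull ((*v) (T y)) (a (\<phi> y))) v x = pull ((*v) (T x)) (pdiff a (T x *v v) (\<phi> x)) +
     (\<Sum>l\<in>UNIV. wedge (axis l 1) (contr (N v *v axis l 1) ?b))" for v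
  proof -
    have "pdiff (\<lambda>y. pull ((*v) (T y)) (a (\<phi> y))) v x = pull ((*v) (T x)) (pdiff a (frechet_derivative \<phi> (at x) v) (\<phi> x)) +
      (\<lambda>vs. derivation_pull vs ((*v) (T x)) ((*v) (T' v)) (a (\<phi> x)))"
      by (rule pdiffI, unfold plus_fun_apply)
        (rule pull_has_derivative[OF assms(1,2) \<phi>x smooth_on_has_derivative[OF assms(6,4)] dT assms(3,4,5)])
    also have "(\<lambda>vs. derivation_pull vs ((*v) (T x)) ((*v) (T' v)) (a (\<phi> x))) = (\<Sum>l\<in>UNIV. wedge (axis l 1) (contr (N v *v axis l 1) ?b))"
      by (rule ext) (simp only: TN derivation_pull_eq derivation_list_eq[OF altb matrix_vector_mul_linear] fun_sum_apply)
    finally show ?thesis by (simp only: Tv[OF assms(4), of v])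
  qed
  have "dloc (\<lambda>y. pull ((*v) (T y)) (a (\<phi> y))) x = (\<Sum>j\<in>UNIV. wedge (axis j 1) (pull ((*v) (T x)) (pdiff a (T x *v axis j 1) (\<phi> x)))) +
     (\<Sum>j\<in>UNIV. \<Sum>l\<in>UNIV. wedge (axis j 1) (wedge (axis l 1) (contr (N (axis j 1) *v axis l 1) ?b)))"
    by (simp only: dloc_def pd wedge_add wedge_sum sum.distrib)
  \<comment> \<open>\<open>N (axis j 1) *v axis l 1\<close> is the inverse of \<open>T x\<close>
    applied to a second derivative of \<open>\<phi>\<close>, hence symmetric in \<open>j\<close> and
    \<open>l\<close>.\<close>
  also have "(\<Sum>j\<in>UNIV. \<Sum>l\<in>UNIV. wedge (axis j 1) (wedge (axis l 1) (contr (N (axis j 1) *v axis l 1) ?b))) = 0"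
    by (rule wedge_wedge_symmetric_sum) (simp only: N_def matrix_vector_mul_assoc[symmetric] T'v D2sym[of "axis _ 1" "axis _ 1"])
  also have "(\<Sum>j\<in>UNIV. wedge (axis j 1) (pull ((*v) (T x)) (pdiff a (T x *v axis j 1) (\<phi> x)))) =
     (\<Sum>j\<in>UNIV. \<Sum>k\<in>UNIV. tscale (T x $ k $ j) (wedge (axis j 1) (pull ((*v) (T x)) (pdiff a (axis k 1) (\<phi> x)))))"
    by (subst pdiff_expand[OF assms(1,2) \<phi>x]) (simp only: pull_sum pull_tscale wedge_sum wedge_tscale matrix_vector_axis_nth)
  also have "\<dots> = (\<Sum>k\<in>UNIV. \<Sum>j\<in>UNIV. tscale (T x $ k $ j) (wedge (axis j 1) (pull ((*v) (T x)) (pdiff a (axis k 1) (\<phi> x)))))"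
    by (rule sum.swap)
  also have "\<dots> = (\<Sum>k\<in>UNIV. wedge (T x $ k) (pull ((*v) (T x)) (pdiff a (axis k 1) (\<phi> x))))"
    by (subst wedge_expand[of "T x $ _"]) (rule refl)
  also have "\<dots> = (\<Sum>k\<in>UNIV. pull ((*v) (T x)) (wedge (axis k 1) (pdiff a (axis k 1) (\<phi> x))))"
    by (intro sum.cong refl pull_wedge[symmetric]) (simp add: inner_axis' matrix_vector_mult_def, simp add: inner_vec_def)
  also have "\<dots> = pull ((*v) (T x)) (dloc a (\<phi> x))" by (simp only: dloc_def pull_sum)
  finally show ?thesis unfolding T_def add_0_right .
qed

section \<open>The local formula for the codifferential\<close>

definition vol :: "real^'n^'n::finite \<Rightarrow> real" where
  "vol G = sqrt (det G)"

text \<open>All indices raised and weighted by the volume density. Pairing with it turns the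
  weighted metric product into the Euclidean one (\<open>alt_inner_raise\<close>), so that no
  derivative of \<open>G\<close> occurs in the integration by parts.\<close>

definition raise :: "real^'n^'n::finite \<Rightarrow> ((real^'n) list \<Rightarrow> real) \<Rightarrow> (real^'n) list \<Rightarrow> real" where
  "raise G a = tscale (vol G) (pull ((*v) (matrix_inv G)) a)"

text \<open>The classical expression: minus the coordinate divergence of the raised density, divided
  by the volume density, with the indices lowered again.\<close>

definition codloc :: "(real^'n::finite \<Rightarrow> real^'n^'n) \<Rightarrow> (real^'n \<Rightarrow> (real^'n) list \<Rightarrow> real) \<Rightarrow> real^'n \<Rightarrow> (real^'n) list \<Rightarrow> real" where
  "codloc G a x = tscale (- 1 / vol (G x)) (pull ((*v) (G x))
     (\<Sum>j\<in>UNIV. contr (axis j 1) (pdiff (\<lambda>y. raise (G y) (a y)) (axis j 1) x)))"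

text \<open>By the factorisation the determinant is a square, and it is nonzero.\<close>

lemma spd_det_pos:
  fixes G :: "real^'n^'n::finite"
  assumes "spd G" shows "det G > 0"
proof -
  have psd: "x \<bullet> (G *v x) \<ge> 0" for x using assms by (cases "x = 0") (auto simp: spd_def less_imp_le)
  have "transpose G = G" using assms by (simp add: spd_def)
  then obtain W :: "real^'n^'n" where "G = W ** transpose W" using psd_factorization[of G, OF _ psd] by blast
  then have "det G = det W * det W" by (simp add: det_mul)
  moreover have "det G \<noteq> 0" using spd_invertible[OF assms] by (simp add: invertible_det_nz)
  ultimately show ?thesis by (metis mult_zero_left not_real_square_gt_zero)
qed

lemma vol_pos: "spd G \<Longrightarrow> vol G > 0"
  by (simp add: vol_def spd_det_pos)

definition smooth_metric :: "(real^'n) set \<Rightarrow> (real^'n \<Rightarrow> real^'n^'n::finite) \<Rightarrow> bool" where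
  "smooth_metric S G \<longleftrightarrow> open S \<and> (\<forall>x\<in>S. spd (G x)) \<and> (\<forall>i j. smooth_on S (\<lambda>x. G x $ i $ j))"

lemma smooth_metricD:
  assumes "smooth_metric S G"
  shows "open S" "x \<in> S \<Longrightarrow> spd (G x)" "smooth_on S (\<lambda>x. G x $ i $ j)"
    "smooth_on S (\<lambda>x. matrix_inv (G x) $ i $ j)" "smooth_on S (\<lambda>x. vol (G x))"
  using assms unfolding smooth_metric_def vol_def
  by (auto intro!: smooth_on_matrix_inv spd_invertible smooth_on_sqrt smooth_on_det spd_det_pos)

lemma smooth_family_raise:
  "smooth_metric S G \<Longrightarrow> smooth_family S a \<Longrightarrow> smooth_family S (\<lambda>y. raise (G y) (a y))"
  unfolding raise_def by (intro smooth_family_tscale smooth_family_pull smooth_metricD)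

lemma smooth_family_codloc:
  assumes "smooth_metric S G" "smooth_family S a"
  shows "smooth_family S (codloc G a)"
proof -
  note m = smooth_metricD[OF assms(1)]
  have "smooth_on S (\<lambda>x. - 1 / vol (G x))"
    using m vol_pos by (intro smooth_on_divide smooth_on_const) force+
  then have "smooth_family S (\<lambda>x. codloc G a x)"
    unfolding codloc_def
    by (intro smooth_family_tscale smooth_family_pull smooth_family_sum smooth_family_contr smooth_family_pdiff
        smooth_family_raise assms m)
  then show ?thesis .
qed

lemma pull_matrix_inv:
  assumes "spd G"
  shows "pull ((*v) (matrix_inv G)) (pull ((*v) G) a) = a" "pull ((*v) G) (pull ((*v) (matrix_inv G)) a) = a"
  using spd_matrix_inv(1,2)[OF assms] by (auto simp: fun_eq_iff o_def matrix_vector_mul_assoc)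

text \<open>Only the differentiated factor \<open>f\<close> produces a new term, contraction of the
  raised density with \<open>grad f x\<close>; lowering the indices makes it contraction with the
  Riemannian gradient. This is the source of the symbol of the codifferential.\<close>

lemma codloc_tscale:
  fixes a :: "real^'n::finite \<Rightarrow> (real^'n) list \<Rightarrow> real"
  assumes "smooth_metric S G" "smooth_family S a" "smooth_on S f" "x \<in> S"
  shows "codloc G (\<lambda>y. tscale (f y) (a y)) x = tscale (f x) (codloc G a x) - contr (matrix_inv (G x) *v grad f x) (a x)"
proof -
  note m = smooth_metricD[OF assms(1)]
  let ?B = "\<lambda>y. raise (G y) (a y)"
  have B: "smooth_family S ?B" by (rule smooth_family_raise[OF assms(1,2)])
  have "(\<lambda>y. raise (G y) (tscale (f y) (a y))) = (\<lambda>y. tscale (f y) (?B y))"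
    by (auto simp: raise_def pull_tscale mult.commute)
  then have pd: "pdiff (\<lambda>y. raise (G y) (tscale (f y) (a y))) v x =
      tscale (f x) (pdiff ?B v x) + tscale (frechet_derivative f (at x) v) (?B x)" for v
    using pdiff_tscale[OF B assms(3,4)] by simp
  have "(\<Sum>j\<in>UNIV. contr (axis j 1) (tscale (frechet_derivative f (at x) (axis j 1)) (?B x))) = contr (grad f x) (?B x)"
    by (subst contr_expand[OF smooth_familyD[OF B assms(4)], of "grad f x"]) (simp add: grad_def)
  then have "codloc G (\<lambda>y. tscale (f y) (a y)) x = tscale (f x) (codloc G a x) +
      tscale (- 1 / vol (G x)) (pull ((*v) (G x)) (contr (grad f x) (?B x)))"
    by (simp add: codloc_def pd sum.distrib tscale_sum[symmetric] pull_add pull_tscale tscale_add mult.commute)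
  also have "tscale (- 1 / vol (G x)) (pull ((*v) (G x)) (contr (grad f x) (?B x))) = - contr (matrix_inv (G x) *v grad f x) (a x)"
    using vol_pos[OF m(2)[OF assms(4)]] pull_matrix_inv(2)[OF m(2)[OF assms(4)]]
    by (simp add: raise_def contr_pull pull_tscale tscale_minus_left del: contr_apply)
  finally show ?thesis by (simp only: diff_conv_add_uminus)
qed

lemma spd_mat_1: "spd (mat 1 :: real^'n^'n::finite)"
  by (simp add: spd_def transpose_mat)

lemma matrix_inv_mat_1: "matrix_inv (mat 1 :: real^'n^'n::finite) = mat 1"
  using spd_matrix_inv(1)[OF spd_mat_1] by simp

lemma alt_inner_mat_1:
  fixes a :: "(real^'n::finite) list \<Rightarrow> real"
  assumes "alternating b"
  shows "alt_inner (mat 1) a b = (\<Sum>k\<le>CARD('n). (\<Sum>I | length I = k. a (basis_list I) * b (basis_list I)) / fact k)"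
  by (simp add: alt_inner_eq[OF spd_mat_1 assms] matrix_inv_mat_1 cinner_lists o_def)

lemma alt_inner_raise:
  fixes a :: "(real^'n::finite) list \<Rightarrow> real"
  assumes "spd G" "alternating b"
  shows "vol G * alt_inner G a b = alt_inner (mat 1) a (raise G b)"
  using assms
  by (simp add: alt_inner_eq[OF assms] alt_inner_eq[OF spd_mat_1] alternating_pull_matrix alternating_tscale
      matrix_inv_mat_1 raise_def pull_tscale cinner_tscale_right alt_inner_linear(9) pull_pull o_def)

text \<open>The components of the vector field whose divergence is the defect of adjointness.\<close>

definition flux :: "(real^'n::finite \<Rightarrow> real^'n^'n) \<Rightarrow> (real^'n \<Rightarrow> (real^'n) list \<Rightarrow> real) \<Rightarrow>
    (real^'n \<Rightarrow> (real^'n) list \<Rightarrow> real) \<Rightarrow> 'n \<Rightarrow> real^'n \<Rightarrow> real" where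
  "flux G a b j y = alt_inner (mat 1) (a y) (contr (axis j 1) (raise (G y) (b y)))"

lemma alt_inner_family_derivative:
  fixes a b :: "real^'n \<Rightarrow> (real^'m::finite) list \<Rightarrow> real"
  assumes "open S" "smooth_family S a" "smooth_family S b" "x \<in> S"
  shows "((\<lambda>y. alt_inner (mat 1) (a y) (b y)) has_derivative
    (\<lambda>v. alt_inner (mat 1) (pdiff a v x) (b x) + alt_inner (mat 1) (a x) (pdiff b v x))) (at x)"
proof -
  have "((\<lambda>y. \<Sum>k\<le>CARD('m). (\<Sum>I | length I = k. a y (basis_list I) * b y (basis_list I)) / fact k) has_derivative
    (\<lambda>v. \<Sum>k\<le>CARD('m). (\<Sum>I | length I = k. a x (basis_list I) * pdiff b v x (basis_list I) + pdiff a v x (basis_list I) * b x (basis_list I)) / fact k)) (at x)"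
    by (intro has_derivative_sum bounded_linear.has_derivative[OF bounded_linear_divide] has_derivative_mult
        smooth_family_has_derivative[OF assms(2,4)] smooth_family_has_derivative[OF assms(3,4)])
  then have "((\<lambda>y. alt_inner (mat 1) (a y) (b y)) has_derivative
    (\<lambda>v. \<Sum>k\<le>CARD('m). (\<Sum>I | length I = k. a x (basis_list I) * pdiff b v x (basis_list I) + pdiff a v x (basis_list I) * b x (basis_list I)) / fact k)) (at x)"
    by (rule has_derivative_transform_within_open[OF _ assms(1,4)])
      (simp add: alt_inner_mat_1[OF smooth_familyD[OF assms(3)]])
  then show ?thesis
    by (simp add: alt_inner_mat_1[OF smooth_familyD[OF assms(3,4)]] alt_inner_mat_1[OF pdiff_alternating[OF assms(1,3,4)]]
       sum.distrib add_divide_distrib add.commute)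
qed

lemma smooth_on_alt_inner_1:
  fixes a b :: "real^'n \<Rightarrow> (real^'m::finite) list \<Rightarrow> real"
  assumes "open S" "smooth_family S a" "smooth_family S b"
  shows "smooth_on S (\<lambda>y. alt_inner (mat 1) (a y) (b y))"
proof (rule smooth_on_cong[OF assms(1)])
  show "smooth_on S (\<lambda>y. \<Sum>k\<le>CARD('m). (\<Sum>I | length I = k. a y (basis_list I) * b y (basis_list I)) / fact k)"
    by (intro smooth_on_sum smooth_on_divide smooth_on_mult smooth_on_const smooth_family_smooth[OF assms(2)]
        smooth_family_smooth[OF assms(3)] assms(1)) auto
qed (simp add: alt_inner_mat_1[OF smooth_familyD[OF assms(3)]])

lemma smooth_on_flux:
  assumes "smooth_metric S G" "smooth_family S a" "smooth_family S b"
  shows "smooth_on S (flux G a b j)"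
proof -
  have "smooth_on S (\<lambda>y. flux G a b j y)"
    unfolding flux_def
    by (intro smooth_on_alt_inner_1 smooth_family_contr smooth_family_raise smooth_metricD(1)[OF assms(1)] assms)
  then show ?thesis .
qed

text \<open>For the Euclidean product \<open>wedge (axis j 1)\<close> and
  \<open>contr (axis j 1)\<close> are adjoint. The product rule for \<open>flux\<close> therefore
  yields the derivative term of \<open>a\<close> and, with opposite sign, the codifferential term of
  \<open>b\<close>.\<close>

lemma codifferential_divergence:
  fixes a b :: "real^'n::finite \<Rightarrow> (real^'n) list \<Rightarrow> real"
  assumes "smooth_metric S G" "smooth_family S a" "smooth_family S b" "x \<in> S"
  shows "vol (G x) * alt_inner (G x) (dloc a x) (b x) - vol (G x) * alt_inner (G x) (a x) (codloc G b x) =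
    (\<Sum>j\<in>UNIV. frechet_derivative (flux G a b j) (at x) (axis j 1))"
proof -
  note m = smooth_metricD[OF assms(1)]
  let ?B = "\<lambda>y. raise (G y) (b y)"
  have B: "smooth_family S ?B" by (rule smooth_family_raise[OF assms(1,3)])
  have altB: "alternating (?B x)" by (rule smooth_familyD[OF B assms(4)])
  have spd: "spd (G x)" by (rule m(2)[OF assms(4)])
  have altb: "alternating (b x)" by (rule smooth_familyD[OF assms(3,4)])
  have 1: "vol (G x) * alt_inner (G x) (dloc a x) (b x) = (\<Sum>j\<in>UNIV. alt_inner (mat 1) (pdiff a (axis j 1) x) (contr (axis j 1) (?B x)))"
    unfolding alt_inner_raise[OF spd altb]
    by (simp add: dloc_def alt_inner_sum alt_inner_wedge[OF spd_mat_1 pdiff_alternating[OF m(1) assms(2,4)] altB] matrix_inv_mat_1)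
  have altc: "alternating (codloc G b x)"
    by (rule smooth_familyD[OF smooth_family_codloc[OF assms(1,3)] assms(4)])
  have "raise (G x) (codloc G b x) = - (\<Sum>j\<in>UNIV. contr (axis j 1) (pdiff ?B (axis j 1) x))"
    using vol_pos[OF spd] by (simp add: codloc_def raise_def pull_tscale pull_matrix_inv[OF spd])
  then have 2: "vol (G x) * alt_inner (G x) (a x) (codloc G b x) = - (\<Sum>j\<in>UNIV. alt_inner (mat 1) (a x) (contr (axis j 1) (pdiff ?B (axis j 1) x)))"
    unfolding alt_inner_raise[OF spd altc] by (simp add: alt_inner_linear alt_inner_sum)
  have "frechet_derivative (flux G a b j) (at x) (axis j 1) =
      alt_inner (mat 1) (pdiff a (axis j 1) x) (contr (axis j 1) (?B x)) + alt_inner (mat 1) (a x) (contr (axis j 1) (pdiff ?B (axis j 1) x))" for j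
    using frechet_derivative_eq[OF alt_inner_family_derivative[OF m(1) assms(2) smooth_family_contr[OF B, of "axis j 1"] assms(4)]]
    by (simp add: flux_def[abs_def] pdiff_contr[OF B assms(4)] del: contr_apply)
  then show ?thesis by (simp add: 1 2 sum.distrib)
qed

section \<open>Change of variables for arbitrary finite index types\<close>

text \<open>
  The library proves the change-of-variables theorem for index types of class \<open>wellorder\<close>; a copy
  of an arbitrary finite type with an artificial order removes this restriction.
\<close>

typedef 'a ordered_copy = "UNIV :: 'a set" by simp

instance ordered_copy :: (finite) finite
proof
  have "(UNIV :: 'a ordered_copy set) = Abs_ordered_copy ` UNIV"
    by (rule type_definition.Abs_image[OF type_definition_ordered_copy, symmetric])
  then show "finite (UNIV :: 'a ordered_copy set)" by (metis finite finite_imageI)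
qed

definition copy_index :: "'a::finite ordered_copy \<Rightarrow> nat" where
  "copy_index = (SOME f. inj f)"

lemma inj_copy_index: "inj (copy_index :: 'a::finite ordered_copy \<Rightarrow> nat)"
proof -
  have "\<exists>f :: 'a ordered_copy \<Rightarrow> nat. inj f"
    using finite_imp_inj_to_nat_seg[OF finite[of "UNIV :: 'a ordered_copy set"]] by blast
  then show ?thesis unfolding copy_index_def by (rule someI_ex)
qed

instantiation ordered_copy :: (finite) linorder
begin

definition "x \<le> y \<longleftrightarrow> copy_index x \<le> copy_index y"
definition "x < y \<longleftrightarrow> copy_index x < copy_index y"

instance
proof
  fix x y z :: "'a ordered_copy"
  show "x < y \<longleftrightarrow> x \<le> y \<and> \<not> y \<le> x" "x \<le> x" "x \<le> y \<or> y \<le> x"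
    by (auto simp: less_eq_ordered_copy_def less_ordered_copy_def)
  show "x \<le> y \<Longrightarrow> y \<le> z \<Longrightarrow> x \<le> z" by (simp add: less_eq_ordered_copy_def)
  show "x \<le> y \<Longrightarrow> y \<le> x \<Longrightarrow> x = y"
    unfolding less_eq_ordered_copy_def by (rule injD[OF inj_copy_index]) simp
qed

end

instance ordered_copy :: (finite) wellorder
proof (rule wf_wellorderI)
  have "{(x, y :: 'a ordered_copy). x < y} = Wellfounded.measure copy_index"
    by (auto simp: less_ordered_copy_def)
  then show "wf {(x, y :: 'a ordered_copy). x < y}" by simp
qed intro_classes

definition to_copy :: "real^'n::finite \<Rightarrow> real^'n ordered_copy" where
  "to_copy v = (\<chi> i. v $ Rep_ordered_copy i)"

definition of_copy :: "real^'n::finite ordered_copy \<Rightarrow> real^'n" where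
  "of_copy v = (\<chi> i. v $ Abs_ordered_copy i)"

lemma copy_inverse [simp]: "to_copy (of_copy w) = w" "of_copy (to_copy v) = v"
  by (simp_all add: to_copy_def of_copy_def vec_eq_iff Rep_ordered_copy_inverse Abs_ordered_copy_inverse)

lemma linear_to_copy: "linear to_copy" and linear_of_copy: "linear of_copy"
  by (auto intro!: linearI simp: to_copy_def of_copy_def vec_eq_iff)

lemma bounded_linear_to_copy: "bounded_linear to_copy" and bounded_linear_of_copy: "bounded_linear of_copy"
  using linear_to_copy linear_of_copy linear_conv_bounded_linear by blast+

lemma measurable_to_copy [measurable]: "to_copy \<in> borel_measurable borel"
  and measurable_of_copy [measurable]: "of_copy \<in> borel_measurable borel"
  by (auto intro!: borel_measurable_continuous_onI linear_continuous_on bounded_linear_to_copy bounded_linear_of_copy)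

lemma bij_Rep_ordered_copy: "bij Rep_ordered_copy" and bij_Abs_ordered_copy: "bij Abs_ordered_copy"
  by (rule o_bij[of Abs_ordered_copy], auto simp: fun_eq_iff Abs_ordered_copy_inverse Rep_ordered_copy_inverse)
    (rule o_bij[of Rep_ordered_copy], auto simp: fun_eq_iff Abs_ordered_copy_inverse Rep_ordered_copy_inverse)

lemma basis_vec: "(Basis :: (real^'n) set) = (\<lambda>i. axis i 1) ` UNIV"
  by (auto simp: Basis_vec_def)

lemma prod_Basis_vec: "(\<Prod>b\<in>Basis. (v :: real^'n) \<bullet> b) = (\<Prod>i\<in>UNIV. v $ i)"
  unfolding basis_vec by (subst prod.reindex) (auto simp: inj_on_def axis_eq_axis inner_axis)

lemma distr_to_copy: "distr lborel borel to_copy = (lborel :: (real^'n::finite ordered_copy) measure)"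
proof (rule lborel_eqI[symmetric])
  fix l u :: "real^'n ordered_copy"
  assume le: "\<And>b. b \<in> Basis \<Longrightarrow> l \<bullet> b \<le> u \<bullet> b"
  have le': "l $ i \<le> u $ i" for i using le[of "axis i 1"] by (auto simp: basis_vec inner_axis)
  have "to_copy -` box l u = box (of_copy l) (of_copy u)"
    unfolding set_eq_iff vimage_eq mem_box_cart to_copy_def of_copy_def vec_lambda_beta
    by (metis Abs_ordered_copy_inverse Rep_ordered_copy_inverse UNIV_I)
  then have "emeasure (distr lborel borel to_copy) (box l u) = emeasure lborel (box (of_copy l) (of_copy u))"
    by (simp add: emeasure_distr)
  also have "\<dots> = (\<Prod>b\<in>Basis. (of_copy u - of_copy l) \<bullet> b)"
    using le' by (intro emeasure_lborel_box) (auto simp: basis_vec inner_axis of_copy_def)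
  also have "(\<Prod>b\<in>Basis. (of_copy u - of_copy l) \<bullet> b) = (\<Prod>i\<in>UNIV. (u - l) $ Abs_ordered_copy i)"
    by (simp add: prod_Basis_vec of_copy_def)
  also have "\<dots> = (\<Prod>i\<in>UNIV. (u - l) $ i)"
    by (rule prod.reindex_bij_betw[OF bij_Abs_ordered_copy])
  finally show "emeasure (distr lborel borel to_copy) (box l u) = (\<Prod>b\<in>Basis. (u - l) \<bullet> b)"
    by (simp only: prod_Basis_vec)
qed simp

text \<open>Conjugation by \<open>r\<close> is a sign-preserving bijection between the permutations
  of the two index types.\<close>

lemma det_reindex:
  fixes A :: "real^'n::finite^'n" and r :: "'m::finite \<Rightarrow> 'n"
  assumes "bij r"
  shows "det (\<chi> i j. A $ r i $ r j) = det A"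
proof -
  let ?m = "map_permutation UNIV r" and ?m' = "map_permutation UNIV (inv r)"
  have inj: "inj r" "inj (inv r)" and bij: "bij_betw r UNIV UNIV" "bij_betw (inv r) UNIV UNIV"
    using assms by (auto simp: bij_is_inj bij_imp_bij_inv)
  have mm: "?m (?m' p) = p" if "p permutes UNIV" for p
    using that assms by (intro map_permutation_compose_inv[OF bij(2)]) (auto simp: bij_is_surj surj_f_inv_f)
  have 1: "?m p (r i) = r (p i)" for p i by (rule map_permutation_apply[OF inj(1)]) simp
  have "det A = (\<Sum>p | p permutes UNIV. of_int (sign p) * (\<Prod>i\<in>UNIV. A $ i $ p i))" by (simp add: det_def)
  also have "\<dots> = (\<Sum>p | p permutes (UNIV :: 'm set). of_int (sign (?m p)) * (\<Prod>i\<in>UNIV. A $ i $ ?m p i))"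
  proof (rule sum.reindex_bij_witness[of _ "?m" "?m'"])
    show "?m (?m' p) = p" if "p \<in> {p. p permutes UNIV}" for p
      using that mm by simp
    show "?m' (?m p) = p" if "p \<in> {p. p permutes UNIV}" for p
      using that inj by (intro map_permutation_compose_inv[OF bij(1)]) auto
  qed (use map_permutation_permutes[OF bij(1)] map_permutation_permutes[OF bij(2)] mm in auto)
  also have "\<dots> = (\<Sum>p | p permutes (UNIV :: 'm set). of_int (sign p) * (\<Prod>i\<in>UNIV. A $ r i $ r (p i)))"
  proof (rule sum.cong[OF refl])
    fix p :: "'m \<Rightarrow> 'm" assume p: "p \<in> {p. p permutes UNIV}"
    have "(\<Prod>i\<in>UNIV. A $ i $ ?m p i) = (\<Prod>i\<in>UNIV. A $ r i $ ?m p (r i))"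
      using prod.reindex_bij_betw[OF assms, of "\<lambda>i. A $ i $ ?m p i"] by simp
    then show "of_int (sign (?m p)) * (\<Prod>i\<in>UNIV. A $ i $ ?m p i) = of_int (sign p) * (\<Prod>i\<in>UNIV. A $ r i $ r (p i))"
      using p inj by (simp add: 1 sign_map_permutation)
  qed
  finally show ?thesis by (simp add: det_def)
qed

text \<open>\<open>has_measure_differentiable_image\<close> equates finite measure of the image with
  integrability of the Jacobian. For equality in \<open>ennreal\<close> the infinite case is argued
  by contradiction: a finite integral would make the image \<open>lmeasurable\<close>.\<close>

lemma emeasure_differentiable_image_wellorder:
  fixes f :: "real^'n::{finite,wellorder} \<Rightarrow> real^'n::_"
  assumes S: "S \<in> sets borel" and fS: "f ` S \<in> sets borel"
    and der: "\<And>x. x \<in> S \<Longrightarrow> (f has_derivative f' x) (at x within S)" and inj: "inj_on f S"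
    and meas: "(\<lambda>x. \<bar>det (matrix (f' x))\<bar> * indicator S x) \<in> borel_measurable borel"
  shows "emeasure lborel (f ` S) = (\<integral>\<^sup>+x. ennreal (\<bar>det (matrix (f' x))\<bar> * indicator S x) \<partial>lborel)"
proof -
  let ?d = "\<lambda>x. \<bar>det (matrix (f' x))\<bar>"
  have S': "S \<in> sets lebesgue" using S by simp
  have iff: "f ` S \<in> lmeasurable \<and> measure lebesgue (f ` S) = m \<longleftrightarrow> (?d has_integral m) S" for m
    by (rule has_measure_differentiable_image[OF S' der inj])
  have hi: "(?d has_integral m) S \<longleftrightarrow> ((\<lambda>x. ?d x * indicator S x) has_integral m) UNIV" for m
    by (subst has_integral_restrict_UNIV[symmetric]) (intro has_integral_cong, auto simp: indicator_def)
  have em: "emeasure lebesgue (f ` S) = emeasure lborel (f ` S)" using fS by simp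
  show ?thesis
  proof (cases "f ` S \<in> lmeasurable")
    case True
    then have "((\<lambda>x. ?d x * indicator S x) has_integral measure lebesgue (f ` S)) UNIV"
      using iff hi by blast
    from nn_integral_has_integral_lborel[OF meas _ this]
    have "(\<integral>\<^sup>+x. ennreal (?d x * indicator S x) \<partial>lborel) = ennreal (measure lebesgue (f ` S))" by simp
    then show ?thesis using emeasure_eq_measure2[OF True] em by simp
  next
    case False
    then have inf: "emeasure lborel (f ` S) = \<infinity>" using fS em by (auto simp: fmeasurable_def less_top[symmetric])
    have "(\<integral>\<^sup>+x. ennreal (?d x * indicator S x) \<partial>lborel) = \<infinity>"
    proof (rule ccontr)
      assume "(\<integral>\<^sup>+x. ennreal (?d x * indicator S x) \<partial>lborel) \<noteq> \<infinity>"
      then obtain r where "0 \<le> r" "(\<integral>\<^sup>+x. ennreal (?d x * indicator S x) \<partial>lborel) = ennreal r"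
        by (cases "\<integral>\<^sup>+x. ennreal (?d x * indicator S x) \<partial>lborel" rule: ennreal_cases) auto
      from nn_integral_has_integral[OF meas _ this(2,1)] False iff hi show False by auto
    qed
    then show ?thesis using inf by simp
  qed
qed

text \<open>The map is conjugated by \<open>to_copy\<close>, which preserves Lebesgue measure and,
  by \<open>det_reindex\<close>, the Jacobian determinant.\<close>

lemma emeasure_differentiable_image:
  fixes f :: "real^'n::finite \<Rightarrow> real^'n"
  assumes S: "S \<in> sets borel" and fS: "f ` S \<in> sets borel"
    and der: "\<And>x. x \<in> S \<Longrightarrow> (f has_derivative f' x) (at x)" and inj: "inj_on f S"
    and meas: "(\<lambda>x. \<bar>det (matrix (f' x))\<bar> * indicator S x) \<in> borel_measurable borel"
  shows "emeasure lborel (f ` S) = (\<integral>\<^sup>+x. ennreal (\<bar>det (matrix (f' x))\<bar> * indicator S x) \<partial>lborel)"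
proof -
  let ?S = "to_copy ` S"
  define F where "F = (\<lambda>w. to_copy (f (of_copy w)))"
  define F' where "F' = (\<lambda>w v. to_copy (f' (of_copy w) (of_copy v)))"
  have im: "to_copy ` T = of_copy -` T" for T :: "(real^'n) set"
    by (auto simp: image_def) (metis copy_inverse(1))
  have im': "to_copy -` (to_copy ` T) = T" for T :: "(real^'n) set"
    by (auto simp: im)
  have meas_im: "to_copy ` T \<in> sets borel" if "T \<in> sets borel" for T :: "(real^'n) set"
    unfolding im using measurable_sets[OF measurable_of_copy that] by simp
  have em: "emeasure lborel (to_copy ` T) = emeasure lborel T" if "T \<in> sets borel" for T :: "(real^'n) set"
    using meas_im[OF that] by (subst distr_to_copy[symmetric]) (simp add: emeasure_distr im')
  have det: "det (matrix (F' (to_copy x))) = det (matrix (f' x))" for x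
  proof -
    have ax: "of_copy (axis j 1) = axis (Rep_ordered_copy j) 1" for j :: "'n ordered_copy"
      by (auto simp: of_copy_def vec_eq_iff axis_def Abs_ordered_copy_inverse Rep_ordered_copy_inverse)
    have "matrix (F' (to_copy x)) = (\<chi> i j. matrix (f' x) $ Rep_ordered_copy i $ Rep_ordered_copy j)"
      by (simp add: matrix_def F'_def ax) (simp add: to_copy_def)
    then show ?thesis using det_reindex[OF bij_Rep_ordered_copy, of "matrix (f' x)"] by simp
  qed
  have FS: "F ` ?S = to_copy ` (f ` S)" by (auto simp: F_def image_image)
  have "emeasure lborel (F ` ?S) = (\<integral>\<^sup>+w. ennreal (\<bar>det (matrix (F' w))\<bar> * indicator ?S w) \<partial>lborel)"
  proof (rule emeasure_differentiable_image_wellorder)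
    show "?S \<in> sets borel" by (rule meas_im[OF S])
    show "F ` ?S \<in> sets borel" unfolding FS by (rule meas_im[OF fS])
    show "(F has_derivative F' w) (at w within ?S)" if w: "w \<in> ?S" for w
    proof -
      have "of_copy w \<in> S" using w by auto
      have "((\<lambda>w. f (of_copy w)) has_derivative (\<lambda>v. f' (of_copy w) (of_copy v))) (at w)"
        by (rule has_derivative_compose[OF bounded_linear_imp_has_derivative[OF bounded_linear_of_copy] der[OF \<open>of_copy w \<in> S\<close>]])
      then have "(F has_derivative F' w) (at w)"
        unfolding F_def F'_def by (rule bounded_linear.has_derivative[OF bounded_linear_to_copy])
      then show ?thesis by (rule has_derivative_at_withinI)
    qed
    show "inj_on F ?S"
      using inj unfolding F_def inj_on_def by (auto dest!: arg_cong[where f = of_copy])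
    have "(\<lambda>w. \<bar>det (matrix (F' w))\<bar> * indicator ?S w) = (\<lambda>x. \<bar>det (matrix (f' x))\<bar> * indicator S x) \<circ> of_copy"
    proof
      fix w
      show "\<bar>det (matrix (F' w))\<bar> * indicator ?S w = ((\<lambda>x. \<bar>det (matrix (f' x))\<bar> * indicator S x) \<circ> of_copy) w"
        using det[of "of_copy w"] by (simp add: im indicator_def)
    qed
    then show "(\<lambda>w. \<bar>det (matrix (F' w))\<bar> * indicator ?S w) \<in> borel_measurable borel"
      using measurable_compose[OF measurable_of_copy meas] by (simp add: o_def)
  qed
  also have "\<dots> = (\<integral>\<^sup>+w. ennreal ((\<lambda>x. \<bar>det (matrix (f' x))\<bar> * indicator S x) (of_copy w)) \<partial>lborel)"
  proof (rule nn_integral_cong)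
    fix w
    show "ennreal (\<bar>det (matrix (F' w))\<bar> * indicator ?S w) = ennreal (\<bar>det (matrix (f' (of_copy w)))\<bar> * indicator S (of_copy w))"
      using det[of "of_copy w"] by (simp add: im indicator_def)
  qed
  also have "\<dots> = (\<integral>\<^sup>+x. ennreal (\<bar>det (matrix (f' x))\<bar> * indicator S x) \<partial>lborel)"
  proof -
    have "(\<lambda>w. ennreal ((\<lambda>x. \<bar>det (matrix (f' x))\<bar> * indicator S x) (of_copy w))) \<in> borel_measurable borel"
      using measurable_compose[OF measurable_of_copy measurable_compose[OF meas measurable_ennreal]] by simp
    then show ?thesis
      by (subst distr_to_copy[symmetric]) (simp add: nn_integral_distr)
  qed
  finally show ?thesis unfolding FS em[OF fS] .
qed

text \<open>The statement about sets says that Lebesgue measure on the image is the push-forward of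
  the Jacobian density on \<open>S\<close>; integrating \<open>h\<close> against both measures gives
  the formula.\<close>

lemma nn_integral_change_of_variables:
  fixes f :: "real^'n::finite \<Rightarrow> real^'n" and h :: "real^'n \<Rightarrow> ennreal"
  assumes S: "open S" and fS: "open (f ` S)" and cf: "continuous_on S f" and finv: "continuous_on (f ` S) (inv_into S f)"
    and der: "\<And>x. x \<in> S \<Longrightarrow> (f has_derivative f' x) (at x)" and inj: "inj_on f S"
    and cont: "continuous_on S (\<lambda>x. \<bar>det (matrix (f' x))\<bar>)"
    and h: "h \<in> borel_measurable borel"
  shows "(\<integral>\<^sup>+y. h y * indicator (f ` S) y \<partial>lborel) =
    (\<integral>\<^sup>+x. ennreal \<bar>det (matrix (f' x))\<bar> * h (f x) * indicator S x \<partial>lborel)"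
proof -
  \<comment> \<open>The value 0 outside \<open>S\<close> makes \<open>F\<close> measurable on the
    whole space; the density \<open>d\<close> vanishes there.\<close>
  define F where "F x = (if x \<in> S then f x else 0)" for x
  define d where "d x = \<bar>det (matrix (f' x))\<bar> * indicator S x" for x
  have F: "F \<in> borel_measurable borel"
    unfolding F_def using borel_measurable_continuous_on_indicator[OF borel_open[OF S] cf]
    by (simp add: indicator_scaleR_eq_if cong: if_cong)
  have d: "d \<in> borel_measurable borel"
    using borel_measurable_continuous_on_indicator[OF borel_open[OF S] cont]
    by (simp add: d_def[abs_def] mult.commute)
  have "density lborel (indicator (f ` S)) = distr (density lborel (\<lambda>x. ennreal (d x))) borel F"
  proof (rule measure_eqI)
    fix C assume "C \<in> sets (density lborel (indicator (f ` S)))"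
    then have C: "C \<in> sets borel" by simp
    let ?B = "S \<inter> F -` C"
    have B: "?B \<in> sets borel" using measurable_sets[OF F C] S by (auto intro: sets.Int borel_open)
    have fB: "f ` ?B = f ` S \<inter> C" by (auto simp: F_def)
    have "emeasure (distr (density lborel (\<lambda>x. ennreal (d x))) borel F) C = (\<integral>\<^sup>+x. ennreal (d x) * indicator (F -` C) x \<partial>lborel)"
      using F C d measurable_sets[OF F C] by (simp add: emeasure_distr emeasure_density)
    also have "\<dots> = (\<integral>\<^sup>+x. ennreal (\<bar>det (matrix (f' x))\<bar> * indicator ?B x) \<partial>lborel)"
      by (intro nn_integral_cong) (auto simp: d_def indicator_def)
    also have "\<dots> = emeasure lborel (f ` ?B)"
    proof (rule emeasure_differentiable_image[symmetric])
      show "?B \<in> sets borel" by (rule B)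
      show "f ` ?B \<in> sets borel" unfolding fB using C fS by auto
      show "(f has_derivative f' x) (at x)" if "x \<in> ?B" for x using der that by auto
      show "inj_on f ?B" using inj by (rule inj_on_subset) auto
      have "(\<lambda>x. \<bar>det (matrix (f' x))\<bar> * indicator ?B x) = (\<lambda>x. d x * indicator ?B x)"
        by (auto simp: d_def indicator_def)
      then show "(\<lambda>x. \<bar>det (matrix (f' x))\<bar> * indicator ?B x) \<in> borel_measurable borel"
        using d B by simp
    qed
    also have "\<dots> = emeasure (density lborel (indicator (f ` S))) C"
      unfolding fB using C fS by (intro emeasure_restricted[symmetric]) auto
    finally show "emeasure (density lborel (indicator (f ` S))) C = emeasure (distr (density lborel (\<lambda>x. ennreal (d x))) borel F) C" by simp
  qed simp
  then have "(\<integral>\<^sup>+y. h y \<partial>density lborel (indicator (f ` S))) = (\<integral>\<^sup>+y. h y \<partial>distr (density lborel (\<lambda>x. ennreal (d x))) borel F)"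
    by simp
  then have "(\<integral>\<^sup>+y. indicator (f ` S) y * h y \<partial>lborel) = (\<integral>\<^sup>+x. ennreal (d x) * h (F x) \<partial>lborel)"
    using F d h fS by (simp add: nn_integral_density nn_integral_distr)
  also have "\<dots> = (\<integral>\<^sup>+x. ennreal \<bar>det (matrix (f' x))\<bar> * h (f x) * indicator S x \<partial>lborel)"
    by (intro nn_integral_cong) (auto simp: d_def F_def indicator_def)
  finally show ?thesis by (simp add: mult.commute)
qed

section \<open>Derivatives of compactly supported functions have integral zero\<close>

text \<open>By translation invariance every difference quotient in direction \<open>v\<close> has
  integral 0; the quotients converge to the derivative, dominated by a constant on a compact
  set.\<close>

lemma integral_frechet_derivative_zero:
  fixes h :: "real^'n::finite \<Rightarrow> real"
  assumes sm: "smooth_on UNIV h" and K: "compact K" and supp: "\<And>x. x \<notin> K \<Longrightarrow> h x = 0"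
  shows "(\<integral>x. frechet_derivative h (at x) v \<partial>lborel) = 0"
proof -
  define d where "d x = frechet_derivative h (at x) v" for x
  have cd: "continuous_on UNIV d" unfolding d_def by (rule smooth_on_continuous[OF smooth_on_frechet[OF sm]])
  have ch: "continuous_on UNIV h" by (rule smooth_on_continuous[OF sm])
  have d0: "d x = 0" if "x \<notin> K" for x
  proof -
    have "open (- K)" using K compact_imp_closed by blast
    then have "frechet_derivative h (at x) = frechet_derivative (\<lambda>x. 0) (at x)"
      using that by (intro frechet_derivative_cong_open(1)[of "- K"]) (auto simp: supp)
    then show ?thesis by (simp add: d_def frechet_derivative_const)
  qed
  obtain M where M: "\<And>x. \<bar>d x\<bar> \<le> M" 
  proof -
    have "bounded (d ` K)" using compact_continuous_image[OF continuous_on_subset[OF cd] K] compact_imp_bounded by blast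
    then obtain M where "\<And>x. x \<in> K \<Longrightarrow> \<bar>d x\<bar> \<le> M" by (auto simp: bounded_iff)
    then have "\<bar>d x\<bar> \<le> max M 0" for x using d0[of x] by (cases "x \<in> K") (auto simp: max.coboundedI1)
    then show ?thesis using that by blast
  qed
  have line: "((\<lambda>s. h (x + s *\<^sub>R v)) has_real_derivative d (x + s *\<^sub>R v)) (at s)" for x s
  proof -
    note D = smooth_on_has_derivative[OF sm UNIV_I]
    have "((\<lambda>s. x + s *\<^sub>R v) has_derivative (\<lambda>r. r *\<^sub>R v)) (at s)"
      by (auto intro!: derivative_eq_intros)
    from has_derivative_compose[OF this D]
    have "((\<lambda>s. h (x + s *\<^sub>R v)) has_derivative (\<lambda>r. frechet_derivative h (at (x + s *\<^sub>R v)) (r *\<^sub>R v))) (at s)" .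
    then show ?thesis
      by (simp add: has_field_derivative_def linear_scale[OF has_derivative_linear[OF D]] d_def mult_commute_abs)
  qed
  define t where "t n = 1 / real (Suc n)" for n
  have t: "t n > 0" "t n \<le> 1" for n by (auto simp: t_def)
  have t0: "t \<longlonglongrightarrow> 0" unfolding t_def by (rule LIMSEQ_inverse_real_of_nat[unfolded inverse_eq_divide])
  define q where "q n x = (h (x + t n *\<^sub>R v) - h x) / t n" for n x
  \<comment> \<open>\<open>K\<close> swept back along \<open>v\<close> for times up to 1. It carries
    all the quotients \<open>q n\<close>, because the step sizes \<open>t n\<close> are at most
    1.\<close>
  define K' where "K' = (\<lambda>(k, s). k - s *\<^sub>R v) ` (K \<times> {0..1::real})"
  have K': "compact K'"
    unfolding K'_def by (intro compact_continuous_image compact_Times K compact_Icc) (auto intro!: continuous_intros simp: case_prod_unfold)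
  have bound: "\<bar>q n x\<bar> \<le> M * indicator K' x" for n x
  proof -
    obtain s where s: "0 < s" "s < t n" "h (x + t n *\<^sub>R v) - h (x + 0 *\<^sub>R v) = (t n - 0) * d (x + s *\<^sub>R v)"
      using MVT2[OF t(1)[of n], of "\<lambda>s. h (x + s *\<^sub>R v)" "\<lambda>s. d (x + s *\<^sub>R v)"] line by blast
    then have q: "q n x = d (x + s *\<^sub>R v)" using t[of n] by (simp add: q_def)
    show ?thesis
    proof (cases "x + s *\<^sub>R v \<in> K")
      case True
      then have "x \<in> K'" unfolding K'_def using s t(2)[of n] by (intro image_eqI[of _ _ "(x + s *\<^sub>R v, s)"]) auto
      then show ?thesis using M q by simp
    next
      case False
      then show ?thesis using q d0 M[of x] by (auto simp: indicator_def)
    qed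
  qed
  have lim: "(\<lambda>n. q n x) \<longlonglongrightarrow> d x" for x
  proof -
    have "((\<lambda>s. (h (x + s *\<^sub>R v) - h x) / s) \<longlongrightarrow> d x) (at 0)"
      using line[of x 0] by (simp add: has_field_derivative_def DERIV_def[symmetric] flip: has_field_derivative_def)
        (simp add: DERIV_def)
    moreover have "filterlim t (at 0) sequentially"
      unfolding filterlim_at using t0 t(1) by (auto simp: less_le)
    ultimately show ?thesis unfolding q_def by (rule filterlim_compose)
  qed
  have int: "integrable lborel (\<lambda>x. M * indicator K' x)"
    using emeasure_compact_finite[OF K'] K' by (intro integrable_mult_right integrable_real_indicator) (auto simp: compact_imp_closed)
  have hm: "h \<in> borel_measurable borel" and dm: "d \<in> borel_measurable borel"
    using ch cd by (auto intro: borel_measurable_continuous_onI)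
  have hi: "integrable lborel h"
  proof -
    have "(\<lambda>x. indicator K x *\<^sub>R h x) = h" using supp by (auto simp: indicator_def fun_eq_iff)
    then show ?thesis using borel_integrable_compact[OF K continuous_on_subset[OF ch]] by simp
  qed
  have shift: "integrable lborel (\<lambda>x. h (c + x))" "(\<integral>x. h (c + x) \<partial>lborel) = (\<integral>x. h x \<partial>lborel)" for c
  proof -
    have "integrable (distr lborel borel ((+) c)) h" using hi by (simp add: lborel_distr_plus)
    then show "integrable lborel (\<lambda>x. h (c + x))" using hm by (simp add: integrable_distr_eq)
    have "(\<integral>x. h x \<partial>distr lborel borel ((+) c)) = (\<integral>x. h (c + x) \<partial>lborel)"
      using hm by (intro integral_distr) auto
    then show "(\<integral>x. h (c + x) \<partial>lborel) = (\<integral>x. h x \<partial>lborel)" by (simp add: lborel_distr_plus)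
  qed
  have q0: "(\<integral>x. q n x \<partial>lborel) = 0" for n
    unfolding q_def using shift[of "t n *\<^sub>R v"] hi by (simp add: add.commute)
  have qm: "q n \<in> borel_measurable lborel" for n
    unfolding q_def using shift(1)[of "t n *\<^sub>R v"] hm
    by (auto intro!: borel_measurable_divide borel_measurable_diff dest!: borel_measurable_integrable simp: add.commute)
  have "(\<lambda>n. \<integral>x. q n x \<partial>lborel) \<longlonglongrightarrow> (\<integral>x. d x \<partial>lborel)"
    by (rule integral_dominated_convergence[where w = "\<lambda>x. M * indicator K' x"]) (use dm qm int lim bound in auto)
  then have "(\<integral>x. d x \<partial>lborel) = 0" by (simp add: q0 LIMSEQ_const_iff)
  then show ?thesis by (simp add: d_def)
qed

section \<open>Degrees\<close>

text \<open>The degree is an integer so that lowering it is unrestricted; a negative degree forces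
  the function to be 0, which ends the descending induction in \<open>adL_eq_0\<close>.\<close>

definition homog :: "int \<Rightarrow> ('v list \<Rightarrow> real) \<Rightarrow> bool" where
  "homog k a \<longleftrightarrow> (\<forall>vs. int (length vs) \<noteq> k \<longrightarrow> a vs = 0)"

lemma homogD: "homog k a \<Longrightarrow> int (length vs) \<noteq> k \<Longrightarrow> a vs = 0"
  by (simp add: homog_def)

lemma homog_simple: "homog k 0" "homog k a \<Longrightarrow> homog k (tscale r a)"
  "homog k a \<Longrightarrow> homog k b \<Longrightarrow> homog k (a + b)" "homog k a \<Longrightarrow> homog k (pull T a)"
  "homog (k + 1) a \<Longrightarrow> homog k (contr v a)"
  by (auto simp: homog_def)

lemma homog_sum: "(\<And>i. i \<in> S \<Longrightarrow> homog k (f i)) \<Longrightarrow> homog k (sum f S)"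
  by (auto simp: homog_def fun_sum_apply intro!: sum.neutral)

lemma homog_wedge:
  assumes "homog k a" shows "homog (k + 1) (wedge \<xi> a)"
  unfolding homog_def
proof (intro allI impI)
  fix vs :: "'a list" assume "int (length vs) \<noteq> k + 1"
  then show "wedge \<xi> a vs = 0" using assms
  proof (induction vs arbitrary: a k)
    case (Cons v vs)
    have "wedge \<xi> (contr v a) vs = 0"
      by (rule Cons.IH[of "k - 1"]) (use Cons.prems in \<open>auto simp: homog_def\<close>)
    then show ?case using Cons.prems by (auto simp: homog_def)
  qed simp
qed

lemma homog_Lp: "homog k a \<Longrightarrow> homog (k + 2) (Lp W a)"
  unfolding Lp_def using homog_wedge[OF homog_wedge, of k a]
  by (intro homog_sum homog_simple) (simp add: add.assoc)

lemma homog_Lamp: "homog (k + 2) a \<Longrightarrow> homog k (Lamp P a)"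
  unfolding Lamp_def by (intro homog_sum homog_simple) (simp add: add.assoc)

lemma homog_pdiff:
  assumes "open S" "x \<in> S" "\<And>y. y \<in> S \<Longrightarrow> homog k (a y)" shows "homog k (pdiff a v x)"
  unfolding homog_def
proof (intro allI impI)
  fix vs :: "'b list" assume "int (length vs) \<noteq> k"
  then have "frechet_derivative (\<lambda>y. a y vs) (at x) = frechet_derivative (\<lambda>y. 0) (at x)"
    by (intro frechet_derivative_cong_open(1)[OF assms(1,2)]) (use assms(3) homogD in auto)
  then show "pdiff a v x vs = 0" by (simp add: pdiff_def frechet_derivative_const)
qed

lemma homog_dloc:
  assumes "open S" "x \<in> S" "\<And>y. y \<in> S \<Longrightarrow> homog k (a y)" shows "homog (k + 1) (dloc a x)"
  unfolding dloc_def by (intro homog_sum homog_wedge homog_pdiff[OF assms])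

lemma homog_codloc:
  assumes "open S" "x \<in> S" "\<And>y. y \<in> S \<Longrightarrow> homog (k + 1) (a y)" shows "homog k (codloc G a x)"
  unfolding codloc_def raise_def
  by (intro homog_simple homog_sum homog_pdiff[OF assms(1,2)] assms(3))

lemma Lamp_Lp_homog:
  fixes W P :: "real^'n::finite^'n"
  assumes "transpose W = - W" "transpose P = - P" "P ** W = mat 1" "alternating a" "homog k a" "CARD('n) = 2 * n"
  shows "Lamp P (Lp W a) = Lp W (Lamp P a) + tscale (real n - of_int k) a"
proof -
  have "(\<Sum>l\<in>UNIV. wedge (axis l 1) (contr (axis l 1) a)) = tscale (of_int k) a"
  proof
    fix vs
    show "(\<Sum>l\<in>UNIV. wedge (axis l 1) (contr (axis l 1) a)) vs = tscale (of_int k) a vs"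
      using degree_operator[OF assms(4), of vs] homogD[OF assms(5), of vs]
      by (cases "int (length vs) = k") (auto simp: fun_sum_apply)
  qed
  then show ?thesis
    using Lamp_Lp[OF assms(1-4)] assms(6) by (simp add: fun_eq_iff algebra_simps)
qed

section \<open>Charts and transition maps\<close>

lemma bilinear_matrix:
  fixes b :: "real^'n::finite \<Rightarrow> real^'n \<Rightarrow> real"
  assumes "\<And>u. linear (b u)" "\<And>v. linear (\<lambda>u. b u v)"
  shows "b u v = u \<bullet> ((\<chi> i j. b (axis i 1) (axis j 1)) *v v)"
proof -
  have "b u v = (\<Sum>i\<in>UNIV. (u $ i) *\<^sub>R b (axis i 1) v)" by (rule linear_axis_expand[OF assms(2)])
  also have "\<dots> = (\<Sum>i\<in>UNIV. (u $ i) *\<^sub>R (\<Sum>j\<in>UNIV. (v $ j) *\<^sub>R b (axis i 1) (axis j 1)))"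
    by (subst linear_axis_expand[OF assms(1)]) (rule refl)
  also have "\<dots> = u \<bullet> ((\<chi> i j. b (axis i 1) (axis j 1)) *v v)"
    by (simp add: inner_vec_def matrix_vector_mult_def mult.commute)
  finally show ?thesis .
qed

lemma matrix_eq_inner:
  fixes M N :: "real^'n::finite^'m::finite"
  assumes "\<And>u v. u \<bullet> (M *v v) = u \<bullet> (N *v v)" shows "M = N"
  using assms[of "axis _ 1" "axis _ 1"] by (simp add: vec_eq_iff inner_axis')

lemma inner_transpose_matrix: "u \<bullet> (v v* T) = (T *v u) \<bullet> v" for T :: "real^'m::finite^'n::finite"
  using dot_lmul_matrix[of v T u] by (simp add: inner_commute)

lemma matrix_uminus_mult: "(- M) ** N = - (M ** N)" "M ** (- N) = - (M ** N)" "(- M) *v v = - (M *v v)"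
  for M :: "real^'n::finite^'m::finite" and N :: "real^'k::finite^'n"
  by (simp_all add: matrix_matrix_mult_def matrix_vector_mult_def vec_eq_iff sum_negf)

locale atlas =
  fixes A :: "('m::{t2_space, second_countable_topology}, 'n::finite) chart set"
  assumes smooth_atlas: "smooth_atlas A"
begin

lemma chart_open: "c \<in> A \<Longrightarrow> open (fst c)" "c \<in> A \<Longrightarrow> open (chart_image c)"
  and chart_homeo: "c \<in> A \<Longrightarrow> homeomorphism (fst c) (chart_image c) (snd c) (chart_inv c)"
  and chart_cover: "\<exists>c\<in>A. p \<in> fst c"
  and transition_smooth: "c \<in> A \<Longrightarrow> c' \<in> A \<Longrightarrow> smooth_on (snd c ` (fst c \<inter> fst c')) (snd c' \<circ> chart_inv c)"
  using smooth_atlas unfolding smooth_atlas_def by auto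

lemma chart_inv_snd [simp]: "c \<in> A \<Longrightarrow> p \<in> fst c \<Longrightarrow> chart_inv c (snd c p) = p"
  and snd_chart_inv [simp]: "c \<in> A \<Longrightarrow> x \<in> chart_image c \<Longrightarrow> snd c (chart_inv c x) = x"
  and chart_inv_in [simp]: "c \<in> A \<Longrightarrow> x \<in> chart_image c \<Longrightarrow> chart_inv c x \<in> fst c"
  and snd_in [simp]: "p \<in> fst c \<Longrightarrow> snd c p \<in> chart_image c"
  and continuous_chart: "c \<in> A \<Longrightarrow> continuous_on (fst c) (snd c)"
  and continuous_chart_inv: "c \<in> A \<Longrightarrow> continuous_on (chart_image c) (chart_inv c)"
  using chart_homeo[of c] by (auto simp: homeomorphism_def chart_image_def)

lemma chart_image_open:
  assumes "c \<in> A" "open W" "W \<subseteq> fst c" shows "open (snd c ` W)"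
proof -
  have "snd c ` W = chart_image c \<inter> chart_inv c -` W"
    using assms by (auto simp: image_iff) (metis chart_inv_snd snd_chart_inv subsetD)+
  then show ?thesis
    using continuous_open_preimage[OF continuous_chart_inv chart_open(2) assms(2)] assms(1) by simp
qed

definition overlap :: "('m, 'n) chart \<Rightarrow> ('m, 'n) chart \<Rightarrow> (real^'n) set" where
  "overlap c c' = snd c ` (fst c \<inter> fst c')"

definition change :: "('m, 'n) chart \<Rightarrow> ('m, 'n) chart \<Rightarrow> real^'n \<Rightarrow> real^'n" where
  "change c c' = snd c' \<circ> chart_inv c"

lemma open_overlap: "c \<in> A \<Longrightarrow> c' \<in> A \<Longrightarrow> open (overlap c c')"
  unfolding overlap_def by (rule chart_image_open) (auto intro: open_Int chart_open)

lemma overlap_subset: "overlap c c' \<subseteq> chart_image c"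
  by (auto simp: overlap_def chart_image_def)

lemma overlap_iff: "c \<in> A \<Longrightarrow> x \<in> overlap c c' \<longleftrightarrow> x \<in> chart_image c \<and> chart_inv c x \<in> fst c'"
  by (auto simp: overlap_def image_iff) (metis IntI chart_inv_in snd_chart_inv)

lemma change_in: "c \<in> A \<Longrightarrow> x \<in> overlap c c' \<Longrightarrow> change c c' x \<in> overlap c' c"
  by (auto simp: overlap_def change_def)

lemma chart_inv_change: "c \<in> A \<Longrightarrow> c' \<in> A \<Longrightarrow> x \<in> overlap c c' \<Longrightarrow> chart_inv c' (change c c' x) = chart_inv c x"
  by (auto simp: overlap_def change_def)

lemma change_change: "c \<in> A \<Longrightarrow> c' \<in> A \<Longrightarrow> x \<in> overlap c c' \<Longrightarrow> change c' c (change c c' x) = x"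
  by (auto simp: overlap_def change_def)

lemma change_image: "c \<in> A \<Longrightarrow> c' \<in> A \<Longrightarrow> change c c' ` overlap c c' = overlap c' c"
  by (auto simp: overlap_def change_def image_iff)

lemma change_smooth: "c \<in> A \<Longrightarrow> c' \<in> A \<Longrightarrow> smooth_on (overlap c c') (change c c')"
  unfolding overlap_def change_def by (rule transition_smooth)

lemma transition_change: "transition c c' p = frechet_derivative (change c c') (at (snd c p))"
  by (simp add: transition_def change_def)

definition tmat :: "('m, 'n) chart \<Rightarrow> ('m, 'n) chart \<Rightarrow> 'm \<Rightarrow> real^'n^'n" where
  "tmat c c' p = matrix (transition c c' p)"

lemma transition_has_derivative:
  assumes "c \<in> A" "c' \<in> A" "p \<in> fst c" "p \<in> fst c'"
  shows "(change c c' has_derivative transition c c' p) (at (snd c p))"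
  unfolding transition_change using assms
  by (intro smooth_on_has_derivative[OF change_smooth]) (auto simp: overlap_def)

lemma transition_linear:
  "c \<in> A \<Longrightarrow> c' \<in> A \<Longrightarrow> p \<in> fst c \<Longrightarrow> p \<in> fst c' \<Longrightarrow> linear (transition c c' p)"
  by (rule has_derivative_linear[OF transition_has_derivative])

lemma transition_tmat:
  "c \<in> A \<Longrightarrow> c' \<in> A \<Longrightarrow> p \<in> fst c \<Longrightarrow> p \<in> fst c' \<Longrightarrow> transition c c' p = (*v) (tmat c c' p)"
  by (rule ext) (simp add: tmat_def matrix_vector_of_linear transition_linear)

lemma transition_cocycle:
  assumes "c \<in> A" "c' \<in> A" "c'' \<in> A" "p \<in> fst c" "p \<in> fst c'" "p \<in> fst c''"
  shows "transition c c'' p v = transition c' c'' p (transition c c' p v)"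
proof -
  have s: "snd c' p = change c c' (snd c p)" using assms by (simp add: change_def)
  have "((\<lambda>x. change c' c'' (change c c' x)) has_derivative (\<lambda>v. transition c' c'' p (transition c c' p v))) (at (snd c p))"
    by (rule has_derivative_compose[OF transition_has_derivative[OF assms(1,2,4,5)]])
      (use transition_has_derivative[OF assms(2,3,5,6)] s in simp)
  then have "(change c c'' has_derivative (\<lambda>v. transition c' c'' p (transition c c' p v))) (at (snd c p))"
  proof (rule has_derivative_transform_within_open)
    show "open (overlap c c')" by (rule open_overlap[OF assms(1,2)])
    show "snd c p \<in> overlap c c'" using assms by (auto simp: overlap_def)
    show "change c' c'' (change c c' x) = change c c'' x" if "x \<in> overlap c c'" for x
      using that assms by (auto simp: overlap_def change_def)
  qed
  from has_derivative_unique[OF this transition_has_derivative[OF assms(1,3,4,6)]] show ?thesis by metis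
qed

lemma transition_self:
  assumes "c \<in> A" "p \<in> fst c" shows "transition c c p v = v"
proof -
  have "(change c c has_derivative (\<lambda>v. v)) (at (snd c p))"
    by (rule has_derivative_transform_within_open[OF has_derivative_ident chart_open(2)[OF assms(1)], of "snd c p"])
      (use assms in \<open>auto simp: change_def\<close>)
  from has_derivative_unique[OF this transition_has_derivative[OF assms(1,1,2,2)]] show ?thesis by metis
qed

lemma tmat_inverse:
  assumes "c \<in> A" "c' \<in> A" "p \<in> fst c" "p \<in> fst c'"
  shows "tmat c' c p ** tmat c c' p = mat 1" "invertible (tmat c c' p)"
proof -
  have 1: "tmat c' c p ** tmat c c' p = mat 1" if "c \<in> A" "c' \<in> A" "p \<in> fst c" "p \<in> fst c'" for c c'
  proof (rule matrix_eq_inner)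
    fix u v
    have "(tmat c' c p ** tmat c c' p) *v v = transition c' c p (transition c c' p v)"
      using that by (simp add: transition_tmat matrix_vector_mul_assoc)
    also have "\<dots> = v" using transition_cocycle[of c c' c p v] transition_self[of c p v] that by simp
    finally show "u \<bullet> ((tmat c' c p ** tmat c c' p) *v v) = u \<bullet> (mat 1 *v v)" by simp
  qed
  show "tmat c' c p ** tmat c c' p = mat 1" by (rule 1[OF assms])
  show "invertible (tmat c c' p)"
    unfolding invertible_def using 1[OF assms] 1[OF assms(2,1,4,3)] by blast
qed

section \<open>Differential forms in charts\<close>

definition fam :: "('m, 'n) form \<Rightarrow> ('m, 'n) chart \<Rightarrow> real^'n \<Rightarrow> (real^'n) list \<Rightarrow> real" where
  "fam \<eta> c x = \<eta> c (chart_inv c x)"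

lemma fam_snd: "c \<in> A \<Longrightarrow> p \<in> fst c \<Longrightarrow> fam \<eta> c (snd c p) = \<eta> c p"
  by (simp add: fam_def)

lemma Forms_zero: "\<eta> \<in> Forms A \<Longrightarrow> c \<notin> A \<or> p \<notin> fst c \<Longrightarrow> \<eta> c p = 0"
  unfolding Forms_def by (intro ext) (simp del: split_paired_All)

lemma Forms_alternating: "\<eta> \<in> Forms A \<Longrightarrow> c \<in> A \<Longrightarrow> p \<in> fst c \<Longrightarrow> alternating (\<eta> c p)"
  by (auto simp: Forms_def)

lemma Forms_pull:
  assumes "\<eta> \<in> Forms A" "c \<in> A" "c' \<in> A" "p \<in> fst c" "p \<in> fst c'"
  shows "\<eta> c p = pull ((*v) (tmat c c' p)) (\<eta> c' p)"
  using assms unfolding Forms_def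
  by (auto simp: fun_eq_iff transition_tmat[OF assms(2-5), symmetric])

lemma Forms_family: "\<eta> \<in> Forms A \<Longrightarrow> c \<in> A \<Longrightarrow> smooth_family (chart_image c) (fam \<eta> c)"
  by (auto simp: Forms_def smooth_family_def fam_def)

lemma FormsI:
  assumes "\<And>c p. c \<notin> A \<or> p \<notin> fst c \<Longrightarrow> \<eta> c p = 0"
    and fam: "\<And>c. c \<in> A \<Longrightarrow> smooth_family (chart_image c) (fam \<eta> c)"
    and "\<And>c c' p. c \<in> A \<Longrightarrow> c' \<in> A \<Longrightarrow> p \<in> fst c \<Longrightarrow> p \<in> fst c' \<Longrightarrow> \<eta> c p = pull ((*v) (tmat c c' p)) (\<eta> c' p)"
  shows "\<eta> \<in> Forms A"
proof -
  have "alternating (\<eta> c p)" if "c \<in> A" "p \<in> fst c" for c p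
    using smooth_familyD[OF fam[OF that(1)], of "snd c p"] that by (simp add: fam_snd)
  moreover have "\<eta> c' p (map (transition c c' p) vs) = \<eta> c p vs" if "c \<in> A" "c' \<in> A" "p \<in> fst c" "p \<in> fst c'" for c c' p vs
    using assms(3)[OF that] by (simp add: transition_tmat[OF that])
  moreover have "smooth_on (chart_image c) (\<lambda>x. \<eta> c (chart_inv c x) vs)" if "c \<in> A" for c vs
    using smooth_family_smooth[OF fam[OF that]] by (simp add: fam_def)
  moreover have "\<eta> c p vs = 0" if "c \<notin> A \<or> p \<notin> fst c" for c p vs using assms(1)[OF that] by simp
  ultimately show ?thesis unfolding Forms_def by auto
qed

lemma Forms_eqI:
  assumes "\<eta> \<in> Forms A" "\<theta> \<in> Forms A" "\<And>c p. c \<in> A \<Longrightarrow> p \<in> fst c \<Longrightarrow> \<eta> c p = \<theta> c p"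
  shows "\<eta> = \<theta>"
proof (intro ext)
  fix c p vs show "\<eta> c p vs = \<theta> c p vs"
    using assms Forms_zero[OF assms(1), of c p] Forms_zero[OF assms(2), of c p]
    by (cases "c \<in> A \<and> p \<in> fst c") auto
qed

lemma Forms_zero_mem: "0 \<in> Forms A"
  by (rule FormsI) (auto simp: fam_def[abs_def] intro!: smooth_family_zero chart_open)

lemma Forms_add:
  assumes "\<eta> \<in> Forms A" "\<theta> \<in> Forms A" shows "\<eta> + \<theta> \<in> Forms A"
proof (rule FormsI)
  show "smooth_family (chart_image c) (fam (\<eta> + \<theta>) c)" if "c \<in> A" for c
    using smooth_family_add[OF chart_open(2)[OF that] Forms_family[OF assms(1) that] Forms_family[OF assms(2) that]]
    by (simp add: fam_def[abs_def])
next
  fix c c' p assume *: "c \<in> A" "c' \<in> A" "p \<in> fst c" "p \<in> fst c'"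
  show "(\<eta> + \<theta>) c p = pull ((*v) (tmat c c' p)) ((\<eta> + \<theta>) c' p)"
  proof -
    have e: "(\<eta> + \<theta>) q r = \<eta> q r + \<theta> q r" for q r by simp
    show ?thesis
      unfolding e pull_add
      by (rule arg_cong2[of _ _ _ _ plus, OF Forms_pull[OF assms(1) *] Forms_pull[OF assms(2) *]])
  qed
qed (simp add: Forms_zero[OF assms(1)] Forms_zero[OF assms(2)])

lemma fmult_apply: "fmult f \<eta> c p = tscale (f p) (\<eta> c p)"
  by (auto simp: fmult_def)

lemma cmult_apply: "cmult r \<eta> c p = tscale r (\<eta> c p)"
  by (auto simp: cmult_def fmult_def)

lemma smooth_fun_chart: "smooth_fun A f \<Longrightarrow> c \<in> A \<Longrightarrow> smooth_on (chart_image c) (\<lambda>x. f (chart_inv c x))"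
  by (auto simp: smooth_fun_def o_def)

lemma smooth_fun_const: "smooth_fun A (\<lambda>_. r)"
  by (auto simp: smooth_fun_def o_def chart_open)

lemma smooth_fun_mult: "smooth_fun A f \<Longrightarrow> smooth_fun A h \<Longrightarrow> smooth_fun A (\<lambda>p. f p * h p)"
  by (auto simp: smooth_fun_def o_def chart_open smooth_on_mult)

lemma smooth_fun_diff: "smooth_fun A f \<Longrightarrow> smooth_fun A h \<Longrightarrow> smooth_fun A (\<lambda>p. f p - h p)"
  by (auto simp: smooth_fun_def o_def chart_open smooth_on_diff)

lemma smooth_fun_power: "smooth_fun A f \<Longrightarrow> smooth_fun A (\<lambda>p. f p ^ k)"
  by (auto simp: smooth_fun_def o_def chart_open smooth_on_power)

lemma Forms_fmult:
  assumes "\<eta> \<in> Forms A" "smooth_fun A f" shows "fmult f \<eta> \<in> Forms A"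
proof (rule FormsI)
  show "smooth_family (chart_image c) (fam (fmult f \<eta>) c)" if "c \<in> A" for c
    using smooth_family_tscale[OF chart_open(2)[OF that] smooth_fun_chart[OF assms(2) that] Forms_family[OF assms(1) that]]
    by (simp add: fam_def[abs_def] fmult_apply)
next
  fix c c' p assume *: "c \<in> A" "c' \<in> A" "p \<in> fst c" "p \<in> fst c'"
  show "fmult f \<eta> c p = pull ((*v) (tmat c c' p)) (fmult f \<eta> c' p)"
    unfolding fmult_apply Forms_pull[OF assms(1) *] pull_tscale by (rule refl)
qed (simp add: Forms_zero[OF assms(1)] fmult_apply)

lemma Forms_cmult: "\<eta> \<in> Forms A \<Longrightarrow> cmult r \<eta> \<in> Forms A"
  unfolding cmult_def by (rule Forms_fmult[OF _ smooth_fun_const])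

lemma cmult_minus: "cmult (-1) \<eta> = - \<eta>"
  by (auto simp: fun_eq_iff cmult_apply)

lemma Forms_minus: "\<eta> \<in> Forms A \<Longrightarrow> - \<eta> \<in> Forms A"
  using Forms_cmult[of \<eta> "-1"] by (simp add: cmult_minus)

lemma Forms_diff: "\<eta> \<in> Forms A \<Longrightarrow> \<theta> \<in> Forms A \<Longrightarrow> \<eta> - \<theta> \<in> Forms A"
  using Forms_add[OF _ Forms_minus, of \<eta> \<theta>] by simp

lemma fam_overlap:
  assumes "\<eta> \<in> Forms A" "c \<in> A" "c' \<in> A" "x \<in> overlap c c'"
  shows "fam \<eta> c x = pull ((*v) (matrix (frechet_derivative (change c c') (at x)))) (fam \<eta> c' (change c c' x))"
proof -
  let ?p = "chart_inv c x"
  have p: "?p \<in> fst c" "?p \<in> fst c'" "snd c ?p = x" using assms overlap_iff by auto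
  show ?thesis
    using Forms_pull[OF assms(1-3) p(1,2)]
    unfolding fam_def tmat_def transition_change chart_inv_change[OF assms(2-4)] p(3) .
qed

lemma ext_d_dloc:
  assumes "\<eta> \<in> Forms A" "c \<in> A" "p \<in> fst c"
  shows "ext_d \<eta> c p = dloc (fam \<eta> c) (snd c p)"
proof
  fix vs
  have "(\<lambda>y. fam \<eta> c y ws) differentiable at (snd c p)" for ws
    using smooth_on_differentiable[OF smooth_family_smooth[OF Forms_family[OF assms(1,2)]]] assms(3) by auto
  from dloc_eval[where a = "fam \<eta> c" and x = "snd c p" and vs = vs, OF this] show "ext_d \<eta> c p vs = dloc (fam \<eta> c) (snd c p) vs"
    using assms(3) by (simp add: ext_d_def fam_def)
qed

lemma fam_ext_d: "\<eta> \<in> Forms A \<Longrightarrow> c \<in> A \<Longrightarrow> x \<in> chart_image c \<Longrightarrow> fam (ext_d \<eta>) c x = dloc (fam \<eta> c) x"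
  using ext_d_dloc[of \<eta> c "chart_inv c x"] by (simp add: fam_def[of "ext_d \<eta>"])

lemma Forms_ext_d:
  assumes "\<eta> \<in> Forms A" shows "ext_d \<eta> \<in> Forms A"
proof (rule FormsI)
  show "ext_d \<eta> c p = 0" if "c \<notin> A \<or> p \<notin> fst c" for c p
  proof (cases "p \<in> fst c")
    \<comment> \<open>A chart outside \<open>A\<close> passes the test \<open>p \<in> fst c\<close>
      in \<open>ext_d\<close>, but there \<open>\<eta>\<close> is 0 at every point and the
      derivatives are those of a constant.\<close>
    case True
    then have "\<eta> c q = 0" for q using that Forms_zero[OF assms] by auto
    then show ?thesis by (auto simp: ext_d_def fun_eq_iff frechet_derivative_const)
  qed (auto simp: ext_d_def)
  show "smooth_family (chart_image c) (fam (ext_d \<eta>) c)" if "c \<in> A" for c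
    by (rule smooth_family_cong[OF chart_open(2)[OF that] _ smooth_family_dloc[OF chart_open(2)[OF that] Forms_family[OF assms that]]])
      (simp add: fam_ext_d[OF assms that])
next
  fix c c' p assume *: "c \<in> A" "c' \<in> A" "p \<in> fst c" "p \<in> fst c'"
  let ?x = "snd c p" and ?a = "fam \<eta> c'"
  have x: "?x \<in> overlap c c'" using * by (auto simp: overlap_def)
  have ch: "change c c' ?x = snd c' p" using * by (simp add: change_def)
  have "dloc (fam \<eta> c) ?x = dloc (\<lambda>y. pull ((*v) (matrix (frechet_derivative (change c c') (at y)))) (?a (change c c' y))) ?x"
    by (rule dloc_cong[OF open_overlap[OF *(1,2)] x]) (rule fam_overlap[OF assms *(1,2)])
  also have "\<dots> = pull ((*v) (matrix (frechet_derivative (change c c') (at ?x)))) (dloc ?a (change c c' ?x))"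
  proof (rule dloc_pull[OF chart_open(2)[OF *(2)] Forms_family[OF assms *(2)] open_overlap[OF *(1,2)] x _ change_smooth[OF *(1,2)]])
    show "change c c' ` overlap c c' \<subseteq> chart_image c'"
      using change_in[OF *(1)] overlap_subset by blast
    show "invertible (matrix (frechet_derivative (change c c') (at ?x)))"
      using tmat_inverse(2)[OF *] by (simp add: tmat_def transition_change)
  qed
  finally show "ext_d \<eta> c p = pull ((*v) (tmat c c' p)) (ext_d \<eta> c' p)"
    unfolding ext_d_dloc[OF assms *(1,3)] ext_d_dloc[OF assms *(2,4)] tmat_def transition_change ch .
qed

lemma ext_d_add:
  assumes "\<eta> \<in> Forms A" "\<theta> \<in> Forms A" shows "ext_d (\<eta> + \<theta>) = ext_d \<eta> + ext_d \<theta>"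
proof (rule Forms_eqI)
  fix c p assume *: "c \<in> A" "p \<in> fst c"
  have "fam (\<eta> + \<theta>) c = (\<lambda>y. fam \<eta> c y + fam \<theta> c y)" by (simp add: fam_def[abs_def])
  then show "ext_d (\<eta> + \<theta>) c p = (ext_d \<eta> + ext_d \<theta>) c p"
    using dloc_add[OF Forms_family[OF assms(1) *(1)] Forms_family[OF assms(2) *(1)], of "snd c p"] *
    by (simp add: ext_d_dloc Forms_add assms)
qed (auto intro: Forms_ext_d Forms_add assms)

definition dfun :: "('m \<Rightarrow> real) \<Rightarrow> ('m, 'n) chart \<Rightarrow> 'm \<Rightarrow> real^'n" where
  "dfun f c p = grad (\<lambda>x. f (chart_inv c x)) (snd c p)"

lemma ext_d_fmult:
  assumes "\<eta> \<in> Forms A" "smooth_fun A f" "c \<in> A" "p \<in> fst c"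
  shows "ext_d (fmult f \<eta>) c p = tscale (f p) (ext_d \<eta> c p) + wedge (dfun f c p) (\<eta> c p)"
proof -
  have "fam (fmult f \<eta>) c = (\<lambda>y. tscale (f (chart_inv c y)) (fam \<eta> c y))" by (simp add: fam_def[abs_def] fmult_apply)
  then show ?thesis
    using dloc_tscale[OF Forms_family[OF assms(1,3)] smooth_fun_chart[OF assms(2,3)], of "snd c p"] assms
    by (simp add: ext_d_dloc Forms_fmult dfun_def fam_snd)
qed

lemma dfun_const: "c \<in> A \<Longrightarrow> dfun (\<lambda>_. r) c p = 0"
  by (simp add: dfun_def grad_def vec_eq_iff frechet_derivative_const)

lemma ext_d_cmult:
  assumes "\<eta> \<in> Forms A" shows "ext_d (cmult r \<eta>) = cmult r (ext_d \<eta>)"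
  by (rule Forms_eqI)
    (auto simp: cmult_def ext_d_fmult[OF assms smooth_fun_const] fmult_apply dfun_const
      intro!: Forms_ext_d Forms_fmult assms smooth_fun_const)

lemma ext_d_ext_d:
  assumes "\<eta> \<in> Forms A" shows "ext_d (ext_d \<eta>) = 0"
proof (rule Forms_eqI)
  fix c p assume *: "c \<in> A" "p \<in> fst c"
  have "ext_d (ext_d \<eta>) c p = dloc (dloc (fam \<eta> c)) (snd c p)"
    unfolding ext_d_dloc[OF Forms_ext_d[OF assms] *]
    by (rule dloc_cong[OF chart_open(2)[OF *(1)]]) (use * fam_ext_d[OF assms] in auto)
  also have "\<dots> = 0" by (rule dloc_dloc[OF chart_open(2)[OF *(1)] Forms_family[OF assms *(1)]]) (use * in simp)
  finally show "ext_d (ext_d \<eta>) c p = 0 c p" by simp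
qed (auto intro: Forms_ext_d assms Forms_zero_mem)

section \<open>Forms of pure integer degree\<close>

definition HForms :: "int \<Rightarrow> ('m, 'n) form set" where
  "HForms k = {\<eta> \<in> Forms A. \<forall>c p. homog k (\<eta> c p)}"

lemma Forms_deg_HForms: "Forms_deg A k = HForms (int k)"
  by (auto simp: Forms_deg_def HForms_def homog_def)

lemma HFormsD: "\<eta> \<in> HForms k \<Longrightarrow> \<eta> \<in> Forms A" "\<eta> \<in> HForms k \<Longrightarrow> homog k (\<eta> c p)"
  unfolding HForms_def by blast+

lemma HFormsI:
  assumes "\<eta> \<in> Forms A" "\<And>c p. c \<in> A \<Longrightarrow> p \<in> fst c \<Longrightarrow> homog k (\<eta> c p)" shows "\<eta> \<in> HForms k"
proof -
  have "homog k (\<eta> c p)" for c p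
    using assms(2)[of c p] Forms_zero[OF assms(1), of c p] homog_simple(1)[of k] by (cases "c \<in> A \<and> p \<in> fst c") auto
  then show ?thesis using assms(1) unfolding HForms_def by blast
qed

lemma HForms_negative: "\<eta> \<in> HForms k \<Longrightarrow> k < 0 \<Longrightarrow> \<eta> = 0"
  by (auto simp: HForms_def homog_def fun_eq_iff)

lemma HForms_large:
  assumes "\<eta> \<in> HForms k" "k > int CARD('n)" shows "\<eta> = 0"
proof (rule Forms_eqI[OF HFormsD(1)[OF assms(1)] Forms_zero_mem])
  fix c p assume *: "c \<in> A" "p \<in> fst c"
  show "\<eta> c p = 0 c p"
  proof
    fix vs
    show "\<eta> c p vs = 0 c p vs"
      using homogD[OF HFormsD(2)[OF assms(1)], of vs c p] assms(2)
        alternating_long_zero[OF Forms_alternating[OF HFormsD(1)[OF assms(1)] *], of vs]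
      by (cases "int (length vs) = k") auto
  qed
qed

lemma HForms_ext_d:
  assumes "\<eta> \<in> HForms k" shows "ext_d \<eta> \<in> HForms (k + 1)"
proof (rule HFormsI[OF Forms_ext_d[OF HFormsD(1)[OF assms]]])
  fix c p assume *: "c \<in> A" "p \<in> fst c"
  show "homog (k + 1) (ext_d \<eta> c p)"
    unfolding ext_d_dloc[OF HFormsD(1)[OF assms] *]
    by (rule homog_dloc[OF chart_open(2)[OF *(1)]]) (use * HFormsD(2)[OF assms] in \<open>auto simp: fam_def\<close>)
qed

lemma HForms_simple:
  "0 \<in> HForms k" "\<eta> \<in> HForms k \<Longrightarrow> \<theta> \<in> HForms k \<Longrightarrow> \<eta> + \<theta> \<in> HForms k"
  "\<eta> \<in> HForms k \<Longrightarrow> smooth_fun A f \<Longrightarrow> fmult f \<eta> \<in> HForms k"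
  "\<eta> \<in> HForms k \<Longrightarrow> cmult r \<eta> \<in> HForms k"
  "\<eta> \<in> HForms k \<Longrightarrow> - \<eta> \<in> HForms k"
  "\<eta> \<in> HForms k \<Longrightarrow> \<theta> \<in> HForms k \<Longrightarrow> \<eta> - \<theta> \<in> HForms k"
  unfolding HForms_def
  by (auto simp: Forms_zero_mem Forms_add Forms_fmult Forms_cmult Forms_minus Forms_diff homog_def fmult_apply cmult_apply)

end

section \<open>The Lefschetz operators of an almost Kaehler manifold\<close>

locale riemannian_atlas = atlas A for A :: "('m::{t2_space, second_countable_topology}, 'n::finite) chart set" +
  fixes g :: "('m, 'n) bilin"
  assumes metric: "riemannian_metric A g"
begin

lemma gram_bilinear:
  assumes "c \<in> A" "p \<in> fst c" shows "g c p u v = u \<bullet> (gram g c p *v v)"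
  unfolding gram_def using metric assms
  by (intro bilinear_matrix) (auto simp: riemannian_metric_def bilinear_def)

lemma gram_spd:
  assumes "c \<in> A" "p \<in> fst c" shows "spd (gram g c p)"
proof -
  have "transpose (gram g c p) = gram g c p"
    using metric assms by (simp add: riemannian_metric_def transpose_def gram_def vec_eq_iff)
  moreover have "x \<bullet> (gram g c p *v x) > 0" if "x \<noteq> 0" for x
    using metric assms that by (simp add: gram_bilinear[OF assms, symmetric] riemannian_metric_def)
  ultimately show ?thesis by (simp add: spd_def)
qed

lemma gram_metric:
  assumes "c \<in> A" shows "smooth_metric (chart_image c) (\<lambda>x. gram g c (chart_inv c x))"
  using metric assms chart_open gram_spd by (auto simp: smooth_metric_def riemannian_metric_def gram_def)

lemma gram_pull:
  assumes "c \<in> A" "c' \<in> A" "p \<in> fst c" "p \<in> fst c'"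
  shows "gram g c p = transpose (tmat c c' p) ** gram g c' p ** tmat c c' p"
proof (rule matrix_eq_inner)
  fix u v
  have "u \<bullet> (gram g c p *v v) = g c' p (transition c c' p u) (transition c c' p v)"
    using metric assms by (simp add: gram_bilinear[symmetric] riemannian_metric_def)
  also have "\<dots> = u \<bullet> (transpose (tmat c c' p) ** gram g c' p ** tmat c c' p *v v)"
    using assms by (simp add: gram_bilinear transition_tmat matrix_vector_mul_assoc[symmetric] inner_transpose_matrix)
  finally show "u \<bullet> (gram g c p *v v) = u \<bullet> (transpose (tmat c c' p) ** gram g c' p ** tmat c c' p *v v)" .
qed

definition cinn :: "('m, 'n) form \<Rightarrow> ('m, 'n) form \<Rightarrow> ('m, 'n) chart \<Rightarrow> 'm \<Rightarrow> real" where
  "cinn \<alpha> \<beta> c p = alt_inner (gram g c p) (\<alpha> c p) (\<beta> c p)"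

lemma cinn_chart:
  assumes "\<alpha> \<in> Forms A" "\<beta> \<in> Forms A" "c \<in> A" "c' \<in> A" "p \<in> fst c" "p \<in> fst c'"
  shows "cinn \<alpha> \<beta> c p = cinn \<alpha> \<beta> c' p"
  unfolding cinn_def Forms_pull[OF assms(1,3-6)] Forms_pull[OF assms(2,3-6)]
  using assms
  by (intro alt_inner_pull gram_spd tmat_inverse gram_pull Forms_alternating)

lemma form_inner_cinn:
  assumes "\<alpha> \<in> Forms A" "\<beta> \<in> Forms A" "c \<in> A" "p \<in> fst c"
  shows "form_inner A g \<alpha> \<beta> p = cinn \<alpha> \<beta> c p"
proof -
  have "(SOME c. c \<in> A \<and> p \<in> fst c) \<in> A \<and> p \<in> fst (SOME c. c \<in> A \<and> p \<in> fst c)"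
    by (rule someI[of _ c]) (use assms in simp)
  then show ?thesis
    using cinn_chart[OF assms(1,2) _ assms(3) _ assms(4)] by (simp add: form_inner_def Let_def cinn_def)
qed

end

locale almost_kaehler = riemannian_atlas A g
  for A :: "('m::{t2_space, second_countable_topology}, 'n::finite) chart set" and g :: "('m, 'n) bilin" +
  fixes \<omega> :: "('m, 'n) form" and J :: "('m, 'n) endo" and n :: nat
  assumes card_n: "CARD('n) = 2 * n"
    and triple: "compatible_triple A \<omega> J g"
begin

abbreviation Om :: "('m, 'n) chart \<Rightarrow> 'm \<Rightarrow> real^'n^'n" where "Om c p \<equiv> omega_matrix \<omega> c p"
abbreviation Pm :: "('m, 'n) chart \<Rightarrow> 'm \<Rightarrow> real^'n^'n" where "Pm c p \<equiv> matrix_inv (omega_matrix \<omega> c p)"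
abbreviation Gi :: "('m, 'n) chart \<Rightarrow> 'm \<Rightarrow> real^'n^'n" where "Gi c p \<equiv> matrix_inv (gram g c p)"
abbreviation L :: "('m, 'n) form \<Rightarrow> ('m, 'n) form" where "L \<equiv> lefschetz \<omega>"
abbreviation Lam :: "('m, 'n) form \<Rightarrow> ('m, 'n) form" where "Lam \<equiv> lambda_op \<omega>"

lemma omega_form: "\<omega> \<in> Forms A" "\<omega> \<in> HForms 2" "ext_d \<omega> = 0"
  using triple by (auto simp: compatible_triple_def symplectic_form_def Forms_deg_HForms HForms_def)

lemma omega_matrix:
  assumes "c \<in> A" "p \<in> fst c" shows "\<omega> c p [u, v] = u \<bullet> (Om c p *v v)"
proof -
  note a = Forms_alternating[OF omega_form(1) assms]
  show ?thesis unfolding omega_matrix_def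
    using alternating_linear[OF a, of "[]" "[_]"] alternating_linear[OF a, of "[_]" "[]"]
    by (intro bilinear_matrix[of "\<lambda>u v. \<omega> c p [u, v]"]) auto
qed

lemma Om_skew:
  assumes "c \<in> A" "p \<in> fst c" shows "transpose (Om c p) = - Om c p"
proof -
  have "\<omega> c p [u, v] = - \<omega> c p [v, u]" for u v
    using alternating_swap[OF Forms_alternating[OF omega_form(1) assms], of "[]" u v "[]"] by simp
  then show ?thesis unfolding transpose_def vec_eq_iff omega_matrix_def vec_lambda_beta vector_uminus_component by blast
qed

text \<open>With \<open>K\<close> the matrix of \<open>J\<close>, compatibility reads
  \<open>?G = ?O ** ?K\<close> and \<open>?K ** ?K = - mat 1\<close>. Hence the inverse of
  \<open>?G\<close> is \<open>- (?K ** ?P)\<close>, and inserting this on both sides of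
  \<open>?O\<close> gives the last identity, the one that makes \<open>Lam\<close> the adjoint of
  \<open>L\<close>.\<close>

lemma Om_matrices:
  assumes "c \<in> A" "p \<in> fst c"
  shows "invertible (Om c p)" "Om c p ** Pm c p = mat 1" "Pm c p ** Om c p = mat 1"
    "transpose (Pm c p) = - Pm c p" "Pm c p = - (Gi c p ** Om c p ** Gi c p)"
proof -
  let ?O = "Om c p" and ?G = "gram g c p" and ?P = "Pm c p" and ?K = "matrix (J c p)"
  have Jl: "linear (J c p)" and JJ: "J c p (J c p u) = - u" for u
    using triple assms by (auto simp: compatible_triple_def almost_complex_def)
  have Kv: "?K *v v = J c p v" for v by (rule matrix_vector_of_linear[OF Jl])
  have GK: "?G = ?O ** ?K"
  proof (rule matrix_eq_inner)
    fix u v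
    show "u \<bullet> (?G *v v) = u \<bullet> (?O ** ?K *v v)"
      using triple assms by (simp add: gram_bilinear[symmetric] compatible_triple_def omega_matrix matrix_vector_mul_assoc[symmetric] Kv)
  qed
  have KK: "?K ** ?K = - mat 1"
    by (rule matrix_eq_inner)
      (simp add: matrix_vector_mul_assoc[symmetric] Kv JJ matrix_uminus_mult)
  have "?O ** (?K ** Gi c p) = mat 1"
    using spd_matrix_inv(1)[OF gram_spd[OF assms]] by (simp add: GK matrix_mul_assoc)
  then show inv: "invertible ?O" unfolding invertible_right_inverse by blast
  show OP: "?O ** ?P = mat 1" and PO: "?P ** ?O = mat 1"
    using inv by (auto intro: matrix_inv_right matrix_inv_left)
  have "transpose ?P ** transpose ?O = mat 1"
    using OP by (metis matrix_transpose_mul transpose_mat)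
  then have "- (transpose ?P) ** ?O = mat 1"
    using Om_skew[OF assms] by (simp add: matrix_uminus_mult)
  then have "- (transpose ?P) ** ?O ** ?P = ?P" by simp
  then have "- transpose ?P = ?P" by (simp add: matrix_mul_assoc[symmetric] OP)
  then show "transpose ?P = - ?P" by (metis minus_minus)
  have "?G ** (- (?K ** ?P)) = ?O ** (- (?K ** ?K) ** ?P)"
    unfolding GK by (simp add: matrix_uminus_mult matrix_mul_assoc)
  then have "?G ** (- (?K ** ?P)) = mat 1" by (simp add: KK OP)
  then have "Gi c p ** (?G ** (- (?K ** ?P))) = Gi c p" by simp
  then have "- (?K ** ?P) = Gi c p"
    using spd_matrix_inv(2)[OF gram_spd[OF assms]] by (simp add: matrix_mul_assoc)
  then have GiK: "Gi c p = - (?K ** ?P)" by simp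
  have "Gi c p ** ?O ** Gi c p = ?K ** (?P ** ?O) ** ?K ** ?P"
    unfolding GiK by (simp add: matrix_uminus_mult matrix_mul_assoc)
  also have "\<dots> = - ?P" by (simp add: PO KK matrix_uminus_mult)
  finally show "?P = - (Gi c p ** ?O ** Gi c p)" by simp
qed

lemma Om_smooth:
  assumes "c \<in> A"
  shows "smooth_on (chart_image c) (\<lambda>x. Om c (chart_inv c x) $ i $ j)"
    "smooth_on (chart_image c) (\<lambda>x. Pm c (chart_inv c x) $ i $ j)"
proof -
  show 1: "smooth_on (chart_image c) (\<lambda>x. Om c (chart_inv c x) $ i $ j)" for i j
    using smooth_family_smooth[OF Forms_family[OF omega_form(1) assms]] by (simp add: omega_matrix_def fam_def)
  show "smooth_on (chart_image c) (\<lambda>x. Pm c (chart_inv c x) $ i $ j)"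
    by (rule smooth_on_matrix_inv[OF chart_open(2)[OF assms] 1 Om_matrices(1)]) (use assms in auto)
qed

lemma Om_pull:
  assumes "c \<in> A" "c' \<in> A" "p \<in> fst c" "p \<in> fst c'"
  shows "Om c p = transpose (tmat c c' p) ** Om c' p ** tmat c c' p"
    "Pm c' p = tmat c c' p ** Pm c p ** transpose (tmat c c' p)"
proof -
  let ?T = "tmat c c' p"
  show O: "Om c p = transpose ?T ** Om c' p ** ?T"
  proof (rule matrix_eq_inner)
    fix u v
    have "u \<bullet> (Om c p *v v) = \<omega> c' p [?T *v u, ?T *v v]"
      using assms fun_cong[OF Forms_pull[OF omega_form(1) assms], of "[u, v]"] by (simp add: omega_matrix[symmetric])
    also have "\<dots> = u \<bullet> (transpose ?T ** Om c' p ** ?T *v v)"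
      using assms by (simp add: omega_matrix matrix_vector_mul_assoc[symmetric] inner_transpose_matrix)
    finally show "u \<bullet> (Om c p *v v) = u \<bullet> (transpose ?T ** Om c' p ** ?T *v v)" .
  qed
  have "?T ** Pm c p ** transpose ?T ** Om c' p ** ?T = ?T ** (Pm c p ** Om c p)"
    by (simp add: O matrix_mul_assoc)
  also have "\<dots> = ?T" using Om_matrices(3)[of c p] assms by simp
  finally have "?T ** Pm c p ** transpose ?T ** Om c' p ** (?T ** matrix_inv ?T) = ?T ** matrix_inv ?T"
    by (metis matrix_mul_assoc)
  then have "?T ** Pm c p ** transpose ?T ** Om c' p = mat 1"
    using matrix_inv_right[OF tmat_inverse(2)[OF assms]] by simp
  then have "?T ** Pm c p ** transpose ?T ** (Om c' p ** Pm c' p) = Pm c' p" by (simp add: matrix_mul_assoc)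
  then show "Pm c' p = ?T ** Pm c p ** transpose ?T" using Om_matrices(2)[of c' p] assms by simp
qed

lemma L_apply: "c \<in> A \<Longrightarrow> p \<in> fst c \<Longrightarrow> L \<eta> c p = Lp (Om c p) (\<eta> c p)"
  using Lp_shuffle[OF Forms_alternating[OF omega_form(1)], of c p]
  by (intro ext) (simp add: lefschetz_def omega_matrix_def)

lemma Lam_apply: "Lam \<eta> c p = Lamp (Pm c p) (\<eta> c p)"
  by (rule ext) (simp add: lambda_op_def Lamp_def fun_sum_apply sum_distrib_left)

lemma L_zero_outside: "\<eta> \<in> Forms A \<Longrightarrow> c \<notin> A \<or> p \<notin> fst c \<Longrightarrow> L \<eta> c p = 0"
  using Forms_zero[of \<eta> c p] by (auto simp: lefschetz_def fun_eq_iff)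

lemma Lam_zero_outside: "\<eta> \<in> Forms A \<Longrightarrow> c \<notin> A \<or> p \<notin> fst c \<Longrightarrow> Lam \<eta> c p = 0"
  using Forms_zero[of \<eta> c p] by (simp add: Lam_apply Lamp_linear)

lemma L_pull:
  assumes "\<eta> \<in> Forms A" "c \<in> A" "c' \<in> A" "p \<in> fst c" "p \<in> fst c'"
  shows "L \<eta> c p = pull ((*v) (tmat c c' p)) (L \<eta> c' p)"
proof
  fix vs :: "(real^'n) list"
  let ?f = "(*v) (tmat c c' p)"
  have 1: "\<omega> c p [u, v] = \<omega> c' p [?f u, ?f v]" for u v
    using fun_cong[OF Forms_pull[OF omega_form(1) assms(2-5)], of "[u, v]"] by simp
  have 2: "\<eta> c p ws = \<eta> c' p (map ?f ws)" for ws
    using fun_cong[OF Forms_pull[OF assms], of ws] by simp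
  show "L \<eta> c p vs = pull ?f (L \<eta> c' p) vs"
    unfolding lefschetz_def pull_apply length_map 1 2
    by (intro sum.cong refl) (simp add: nths_map)
qed

lemma Forms_L:
  assumes "\<eta> \<in> Forms A" shows "L \<eta> \<in> Forms A"
proof (rule FormsI[OF L_zero_outside[OF assms] _ L_pull[OF assms]])
  fix c assume c: "c \<in> A"
  show "smooth_family (chart_image c) (fam (L \<eta>) c)"
    by (rule smooth_family_cong[OF chart_open(2)[OF c] _
          smooth_family_Lp[OF chart_open(2)[OF c] Om_smooth(1)[OF c] Forms_family[OF assms c]]])
      (simp add: fam_def L_apply c)
qed

lemma Forms_Lam:
  assumes "\<eta> \<in> Forms A" shows "Lam \<eta> \<in> Forms A"
proof (rule FormsI[OF Lam_zero_outside[OF assms]])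
  fix c assume c: "c \<in> A"
  show "smooth_family (chart_image c) (fam (Lam \<eta>) c)"
    by (rule smooth_family_cong[OF chart_open(2)[OF c] _
          smooth_family_Lamp[OF chart_open(2)[OF c] Om_smooth(2)[OF c] Forms_family[OF assms c]]])
      (simp add: fam_def Lam_apply)
next
  fix c c' p assume *: "c \<in> A" "c' \<in> A" "p \<in> fst c" "p \<in> fst c'"
  show "Lam \<eta> c p = pull ((*v) (tmat c c' p)) (Lam \<eta> c' p)"
    unfolding Lam_apply Forms_pull[OF assms *]
    by (rule Lamp_pull[OF Om_pull(2)[OF *] Forms_alternating[OF assms *(2,4)]])
qed

lemma HForms_L:
  assumes "\<eta> \<in> HForms k" shows "L \<eta> \<in> HForms (k + 2)"
  by (rule HFormsI[OF Forms_L[OF HFormsD(1)[OF assms]]]) (simp add: L_apply homog_Lp[OF HFormsD(2)[OF assms]])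

lemma HForms_Lam:
  assumes "\<eta> \<in> HForms k" shows "Lam \<eta> \<in> HForms (k - 2)"
  by (rule HFormsI[OF Forms_Lam[OF HFormsD(1)[OF assms]]]) (simp add: Lam_apply homog_Lamp HFormsD(2)[OF assms])

lemma L_linear:
  "\<eta> \<in> Forms A \<Longrightarrow> \<theta> \<in> Forms A \<Longrightarrow> L (\<eta> + \<theta>) = L \<eta> + L \<theta>"
  "\<eta> \<in> Forms A \<Longrightarrow> L (cmult r \<eta>) = cmult r (L \<eta>)"
  "L (fmult f \<eta>) = fmult f (L \<eta>)"
  by (auto simp: fun_eq_iff lefschetz_def cmult_def fmult_def algebra_simps sum.distrib sum_distrib_left sum_subtractf sum_negf)

lemma Lam_linear:
  "\<eta> \<in> Forms A \<Longrightarrow> \<theta> \<in> Forms A \<Longrightarrow> Lam (\<eta> + \<theta>) = Lam \<eta> + Lam \<theta>"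
  "\<eta> \<in> Forms A \<Longrightarrow> Lam (cmult r \<eta>) = cmult r (Lam \<eta>)"
  "Lam (fmult f \<eta>) = fmult f (Lam \<eta>)"
  by (auto simp: fun_eq_iff lambda_op_def cmult_def fmult_def algebra_simps sum.distrib sum_distrib_left sum_subtractf sum_negf)

lemma Lam_L:
  assumes "\<eta> \<in> HForms k"
  shows "Lam (L \<eta>) = L (Lam \<eta>) + cmult (real n - of_int k) \<eta>"
proof (rule Forms_eqI)
  fix c p assume *: "c \<in> A" "p \<in> fst c"
  note O = Om_skew[OF *] Om_matrices(4,3)[OF *]
  show "Lam (L \<eta>) c p = (L (Lam \<eta>) + cmult (real n - of_int k) \<eta>) c p"
    using Lamp_Lp_homog[OF O Forms_alternating[OF HFormsD(1)[OF assms] *] HFormsD(2)[OF assms] card_n]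
    by (simp add: Lam_apply L_apply * cmult_apply)
qed (auto intro!: Forms_Lam Forms_L Forms_add Forms_cmult HFormsD(1)[OF assms])

text \<open>This is the vanishing of the exterior derivative of \<open>\<omega>\<close> on the axis
  vectors \<open>k\<close>, \<open>i\<close>, \<open>j\<close>; skewness of the middle term brings
  the three derivatives into cyclic order.\<close>

lemma closed_Om:
  assumes "c \<in> A" "x \<in> chart_image c"
  shows "closed_matrix (\<lambda>x. Om c (chart_inv c x)) x"
  unfolding closed_matrix_def
proof (intro allI)
  fix k i j
  let ?a = "fam \<omega> c"
  have alt: "alternating (pdiff ?a v x)" for v
    by (rule pdiff_alternating[OF chart_open(2)[OF assms(1)] Forms_family[OF omega_form(1) assms(1)] assms(2)])
  have fd: "frechet_derivative (\<lambda>y. Om c (chart_inv c y) $ i $ j) (at x) v = pdiff ?a v x [axis i 1, axis j 1]" for i j v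
    by (simp add: pdiff_def omega_matrix_def fam_def)
  have ev: "dloc a x [u, v, w] = pdiff a u x [v, w] - pdiff a v x [u, w] + pdiff a w x [u, v]"
    if "u \<in> range (\<lambda>i. axis i 1)" "v \<in> range (\<lambda>i. axis i 1)" "w \<in> range (\<lambda>i. axis i 1)" for a u v w
  proof -
    have s: "(\<Sum>l\<in>UNIV. (axis l 1 \<bullet> u) * h l) = h m" if "u = axis m 1" for u :: "real^'n" and m h
      unfolding that inner_axis_axis by (simp add: if_distrib[of "\<lambda>r. r * _"] cong: if_cong)
    from that obtain l m q where "u = axis l 1" "v = axis m 1" "w = axis q 1" by blast
    then show ?thesis by (simp add: dloc_def fun_sum_apply sum.distrib sum_subtractf s)
  qed
  have "dloc ?a x [axis k 1, axis i 1, axis j 1] = 0"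
    using fun_cong[OF fam_ext_d[OF omega_form(1) assms], of "[axis k 1, axis i 1, axis j 1]"]
    by (simp add: fam_def[of 0] omega_form(3))
  moreover have "pdiff ?a (axis i 1) x [axis k 1, axis j 1] = - pdiff ?a (axis i 1) x [axis j 1, axis k 1]"
    using alternating_swap[OF alt, of "axis i 1" "[]" "axis k 1" "axis j 1" "[]"] by simp
  ultimately show "frechet_derivative (\<lambda>y. Om c (chart_inv c y) $ i $ j) (at x) (axis k 1) +
     frechet_derivative (\<lambda>y. Om c (chart_inv c y) $ j $ k) (at x) (axis i 1) +
     frechet_derivative (\<lambda>y. Om c (chart_inv c y) $ k $ i) (at x) (axis j 1) = 0"
    by (simp add: ev fd)
qed

lemma ext_d_L:
  assumes "\<eta> \<in> Forms A" shows "ext_d (L \<eta>) = L (ext_d \<eta>)"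
proof (rule Forms_eqI)
  fix c p assume *: "c \<in> A" "p \<in> fst c"
  have x: "snd c p \<in> chart_image c" using * by simp
  have "ext_d (L \<eta>) c p = dloc (\<lambda>y. Lp (Om c (chart_inv c y)) (fam \<eta> c y)) (snd c p)"
    unfolding ext_d_dloc[OF Forms_L[OF assms] *]
    by (rule dloc_cong[OF chart_open(2)[OF *(1)] x]) (simp add: fam_def L_apply *)
  also have "\<dots> = Lp (Om c (chart_inv c (snd c p))) (dloc (fam \<eta> c) (snd c p))"
    by (rule dloc_Lp[OF chart_open(2)[OF *(1)] Forms_family[OF assms *(1)] Om_smooth(1)[OF *(1)] x closed_Om[OF *(1) x]])
  finally show "ext_d (L \<eta>) c p = L (ext_d \<eta>) c p"
    using * by (simp add: L_apply ext_d_dloc[OF assms *])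
qed (auto intro!: Forms_ext_d Forms_L assms)

lemma cinn_L:
  assumes "\<alpha> \<in> Forms A" "\<beta> \<in> Forms A" "c \<in> A" "p \<in> fst c"
  shows "cinn (L \<alpha>) \<beta> c p = cinn \<alpha> (Lam \<beta>) c p"
  unfolding cinn_def L_apply[OF assms(3,4)] Lam_apply
  by (rule alt_inner_Lp[OF gram_spd[OF assms(3,4)] Om_matrices(5)[OF assms(3,4)] Om_skew[OF assms(3,4)]
        Forms_alternating[OF assms(1,3,4)] Forms_alternating[OF assms(2,3,4)]])

end

section \<open>The Riemannian measure\<close>

context riemannian_atlas
begin

definition chart_vol :: "('m, 'n) chart \<Rightarrow> real^'n \<Rightarrow> real" where
  "chart_vol c x = vol (gram g c (chart_inv c x))"

text \<open>The inverse chart, extended by a constant to a Borel map on the whole model space. The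
  density used in \<open>chart_measure\<close> vanishes where the constant is taken.\<close>

definition chart_point :: "('m, 'n) chart \<Rightarrow> real^'n \<Rightarrow> 'm" where
  "chart_point c x = (if x \<in> chart_image c then chart_inv c x else undefined)"

definition chart_measure :: "('m, 'n) chart \<Rightarrow> 'm measure" where
  "chart_measure c = distr (density lborel (\<lambda>x. ennreal (chart_vol c x * indicator (chart_image c) x))) borel (chart_point c)"

lemma chart_vol_smooth: "c \<in> A \<Longrightarrow> smooth_on (chart_image c) (chart_vol c)"
  using smooth_metricD(5)[OF gram_metric] unfolding chart_vol_def[abs_def] by blast

lemma chart_vol_pos: "c \<in> A \<Longrightarrow> x \<in> chart_image c \<Longrightarrow> chart_vol c x > 0"
  unfolding chart_vol_def by (intro vol_pos gram_spd) auto

lemma measurable_cut: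
  fixes f :: "real^'n \<Rightarrow> real"
  assumes "c \<in> A" "continuous_on (chart_image c) f"
  shows "(\<lambda>x. f x * indicator (chart_image c) x) \<in> borel_measurable borel"
  using borel_measurable_continuous_on_indicator[OF borel_open[OF chart_open(2)[OF assms(1)]] assms(2)]
  by (simp add: mult.commute)

lemma measurable_chart_vol [measurable]:
  "c \<in> A \<Longrightarrow> (\<lambda>x. chart_vol c x * indicator (chart_image c) x) \<in> borel_measurable borel"
  by (rule measurable_cut) (auto intro: smooth_on_continuous chart_vol_smooth)

lemma measurable_chart_point [measurable]:
  assumes "c \<in> A" shows "chart_point c \<in> borel_measurable borel"
proof (rule borel_measurableI)
  fix S :: "'m set" assume S: "open S"
  let ?I = "chart_image c"
  have "chart_point c -` S = (?I \<inter> chart_inv c -` S) \<union> (if undefined \<in> S then - ?I else {})"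
    by (auto simp: chart_point_def split: if_splits)
  moreover have "open (?I \<inter> chart_inv c -` S)"
    by (rule continuous_open_preimage[OF continuous_chart_inv[OF assms] chart_open(2)[OF assms] S])
  moreover have "- ?I \<in> sets borel" using chart_open(2)[OF assms] by (simp add: borel_closed)
  ultimately show "chart_point c -` S \<inter> space borel \<in> sets borel" by auto
qed

lemma chart_image_sets:
  assumes "c \<in> A" "B \<in> sets borel" "B \<subseteq> fst c"
  shows "snd c ` B \<in> sets borel"
proof -
  have "snd c ` B = chart_image c \<inter> chart_point c -` B"
    using assms by (auto simp: chart_point_def image_iff) (metis chart_inv_snd snd_chart_inv subsetD)+
  then show ?thesis
    using measurable_sets[OF measurable_chart_point[OF assms(1)] assms(2)] chart_open(2)[OF assms(1)] by auto
qed

lemma emeasure_chart_measure: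
  assumes "c \<in> A" "B \<in> sets borel"
  shows "emeasure (chart_measure c) B = (\<integral>\<^sup>+x. ennreal (chart_vol c x) * indicator (snd c ` (B \<inter> fst c)) x \<partial>lborel)"
proof -
  have "emeasure (chart_measure c) B =
      (\<integral>\<^sup>+x. ennreal (chart_vol c x * indicator (chart_image c) x) * indicator (chart_point c -` B) x \<partial>lborel)"
    using measurable_chart_point[OF assms(1)] measurable_chart_vol[OF assms(1)] assms(2)
      measurable_sets[OF measurable_chart_point[OF assms(1)] assms(2)]
    by (simp add: chart_measure_def emeasure_distr emeasure_density)
  also have "\<dots> = (\<integral>\<^sup>+x. ennreal (chart_vol c x) * indicator (snd c ` (B \<inter> fst c)) x \<partial>lborel)"
  proof (rule nn_integral_cong)
    fix x
    have "x \<in> snd c ` (B \<inter> fst c) \<longleftrightarrow> x \<in> chart_image c \<and> chart_point c x \<in> B"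
      using assms(1) by (auto simp: chart_point_def image_iff) (metis IntI chart_inv_in snd_chart_inv)
    then show "ennreal (chart_vol c x * indicator (chart_image c) x) * indicator (chart_point c -` B) x =
      ennreal (chart_vol c x) * indicator (snd c ` (B \<inter> fst c)) x"
      by (auto simp: indicator_def)
  qed
  finally show ?thesis .
qed

lemma chart_vol_change:
  assumes "c \<in> A" "c' \<in> A" "x \<in> overlap c c'"
  shows "chart_vol c x = \<bar>det (matrix (frechet_derivative (change c c') (at x)))\<bar> * chart_vol c' (change c c' x)"
proof -
  let ?p = "chart_inv c x"
  have p: "?p \<in> fst c" "?p \<in> fst c'" "snd c ?p = x" using assms overlap_iff by auto
  have "det (gram g c ?p) = det (tmat c c' ?p) * det (tmat c c' ?p) * det (gram g c' ?p)"
    unfolding gram_pull[OF assms(1,2) p(1,2)] by (simp add: det_mul)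
  then have "sqrt (det (gram g c ?p)) = \<bar>det (tmat c c' ?p)\<bar> * sqrt (det (gram g c' ?p))"
    by (simp add: real_sqrt_mult)
  then show ?thesis
    by (simp add: chart_vol_def vol_def tmat_def transition_change p(3) chart_inv_change[OF assms])
qed

text \<open>The volume density picks up the absolute Jacobian determinant of the transition map
  (\<open>chart_vol_change\<close>), exactly the factor in the change of variables. This
  compatibility lets the chart measures be glued.\<close>

lemma chart_measure_overlap:
  assumes "c \<in> A" "c' \<in> A" "B \<in> sets borel" "B \<subseteq> fst c" "B \<subseteq> fst c'"
  shows "emeasure (chart_measure c) B = emeasure (chart_measure c') B"
proof -
  define h where "h y = ennreal (chart_vol c' y * indicator (chart_image c') y) * indicator (snd c' ` B) y" for y
  let ?S = "overlap c c'" and ?f = "change c c'"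
  have hm: "h \<in> borel_measurable borel"
    unfolding h_def using measurable_chart_vol[OF assms(2)] chart_image_sets[OF assms(2,3,5)] by measurable
  have Bs: "snd c' ` B \<subseteq> overlap c' c" "snd c ` B \<subseteq> ?S" using assms(4,5) by (auto simp: overlap_def)
  have inv: "inv_into ?S ?f y = change c' c y" if "y \<in> overlap c' c" for y
  proof (rule inv_into_f_eq)
    show "inj_on ?f ?S" by (rule inj_on_inverseI[of _ "change c' c"]) (rule change_change[OF assms(1,2)])
    show "change c' c y \<in> ?S" by (rule change_in[OF assms(2) that])
    show "?f (change c' c y) = y" by (rule change_change[OF assms(2,1) that])
  qed
  have "emeasure (chart_measure c') B = (\<integral>\<^sup>+y. h y * indicator (?f ` ?S) y \<partial>lborel)"
  proof -
    have "B \<inter> fst c' = B" using assms by auto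
    then show ?thesis
      unfolding emeasure_chart_measure[OF assms(2,3)] change_image[OF assms(1,2)]
      using Bs(1) overlap_subset[of c' c] by (intro nn_integral_cong) (auto simp: h_def indicator_def)
  qed
  also have "\<dots> = (\<integral>\<^sup>+x. ennreal \<bar>det (matrix (frechet_derivative ?f (at x)))\<bar> * h (?f x) * indicator ?S x \<partial>lborel)"
  proof (rule nn_integral_change_of_variables)
    show "open ?S" by (rule open_overlap[OF assms(1,2)])
    show "open (?f ` ?S)" unfolding change_image[OF assms(1,2)] by (rule open_overlap[OF assms(2,1)])
    show "continuous_on ?S ?f" by (rule smooth_on_continuous[OF change_smooth[OF assms(1,2)]])
    show "continuous_on (?f ` ?S) (inv_into ?S ?f)"
      unfolding change_image[OF assms(1,2)]
      using smooth_on_continuous[OF change_smooth[OF assms(2,1)]] inv by (simp cong: continuous_on_cong)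
    show "(?f has_derivative frechet_derivative ?f (at x)) (at x)" if "x \<in> ?S" for x
      by (rule smooth_on_has_derivative[OF change_smooth[OF assms(1,2)] that])
    show "inj_on ?f ?S" by (rule inj_on_inverseI[of _ "change c' c"]) (rule change_change[OF assms(1,2)])
    have "smooth_on ?S (\<lambda>x. det (matrix (frechet_derivative ?f (at x))))"
      by (rule smooth_on_det[OF open_overlap[OF assms(1,2)]])
        (simp add: matrix_def smooth_on_vec_nth[OF open_overlap[OF assms(1,2)] smooth_on_frechet[OF change_smooth[OF assms(1,2)]]])
    then show "continuous_on ?S (\<lambda>x. \<bar>det (matrix (frechet_derivative ?f (at x)))\<bar>)"
      by (intro continuous_on_rabs smooth_on_continuous)
  qed (rule hm)
  also have "\<dots> = emeasure (chart_measure c) B"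
  proof -
    have B: "B \<inter> fst c = B" using assms by auto
    have iff: "?f x \<in> snd c' ` B \<longleftrightarrow> x \<in> snd c ` B" if "x \<in> ?S" for x
      using that assms by (auto simp: overlap_def change_def image_iff) (metis chart_inv_snd subsetD)+
    have "ennreal \<bar>det (matrix (frechet_derivative ?f (at x)))\<bar> * h (?f x) * indicator ?S x =
        ennreal (chart_vol c x) * indicator (snd c ` B) x" for x
    proof (cases "x \<in> ?S")
      case True
      then have "?f x \<in> chart_image c'" using change_in[OF assms(1) True] overlap_subset by blast
      then show ?thesis
        using True iff[OF True] chart_vol_change[OF assms(1,2) True] less_imp_le[OF chart_vol_pos[OF assms(2)]]
        by (simp add: h_def indicator_def ennreal_mult)
    next
      case False
      then have "x \<notin> snd c ` B" using Bs by auto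
      then show ?thesis using False by simp
    qed
    then show ?thesis unfolding emeasure_chart_measure[OF assms(1,3)] B by simp
  qed
  finally show ?thesis by simp
qed

section \<open>Existence and uniqueness of the volume measure\<close>

lemma countable_charts:
  obtains cs :: "nat \<Rightarrow> ('m, 'n) chart" where "\<And>i. cs i \<in> A" "(\<Union>i. fst (cs i)) = UNIV"
proof -
  obtain F where F: "F \<subseteq> fst ` A" "countable F" "\<Union>F = \<Union>(fst ` A)"
    by (rule Lindelof[of "fst ` A"]) (use chart_open(1) in auto)
  have U: "\<Union>F = UNIV" using F(3) chart_cover by auto
  then have ne: "F \<noteq> {}" by auto
  have "\<exists>c\<in>A. fst c = from_nat_into F i" for i
    using subsetD[OF F(1) from_nat_into[OF ne, of i]] by (metis imageE)
  then obtain cs where cs: "\<And>i. cs i \<in> A \<and> fst (cs i) = from_nat_into F i" by metis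
  have "(\<Union>i. fst (cs i)) = UNIV"
    using cs U range_from_nat_into[OF ne F(2)] by auto
  then show ?thesis using that cs by blast
qed

definition volume_measure :: "'m measure \<Rightarrow> bool" where
  "volume_measure \<mu> \<longleftrightarrow> sets \<mu> = sets borel \<and>
     (\<forall>c\<in>A. \<forall>B\<in>sets borel. B \<subseteq> fst c \<longrightarrow> emeasure \<mu> B = emeasure (chart_measure c) B)"

text \<open>A countable chart cover is cut into disjoint Borel pieces, each inside one chart. The
  measure is the sum of the chart measures of the pieces, and any volume measure is determined on
  each of them.\<close>

lemma volume_measure_unique_exists: "\<exists>!\<mu>. volume_measure \<mu>"
proof -
  obtain cs :: "nat \<Rightarrow> ('m, 'n) chart" where cs: "\<And>i. cs i \<in> A" "(\<Union>i. fst (cs i)) = UNIV"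
    using countable_charts by blast
  define D where "D = disjointed (\<lambda>i. fst (cs i))"
  have Dm: "D i \<in> sets borel" for i
    unfolding D_def disjointed_def using cs(1) chart_open(1)
    by (intro sets.Diff sets.finite_UN borel_open) auto
  have Dd: "disjoint_family D" and DU: "(\<Union>i. D i) = UNIV"
    using disjoint_family_disjointed UN_disjointed_eq[of "\<lambda>i. fst (cs i)"] cs(2) by (simp_all add: D_def)
  have Ds: "D i \<subseteq> fst (cs i)" for i
    unfolding D_def by (rule disjointed_subset)
  have dec: "emeasure \<mu> B = (\<Sum>i. emeasure \<mu> (B \<inter> D i))" if "sets \<mu> = sets borel" "B \<in> sets borel" for \<mu> B
  proof -
    have "(\<Sum>i. emeasure \<mu> (B \<inter> D i)) = emeasure \<mu> (\<Union>i. B \<inter> D i)"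
      using that Dm disjoint_family_subset[OF Dd, of "\<lambda>i. B \<inter> D i"] by (intro suminf_emeasure) auto
    also have "(\<Union>i. B \<inter> D i) = B" using DU by auto
    finally show ?thesis by simp
  qed
  define \<mu> where "\<mu> = measure_of UNIV (sets borel) (\<lambda>B. \<Sum>i. emeasure (chart_measure (cs i)) (B \<inter> D i))"
  have sm: "sets \<mu> = sets borel" unfolding \<mu>_def
    by (subst sets_measure_of) (auto simp: sets.sigma_sets_eq[of borel, unfolded space_borel])
  have em: "emeasure \<mu> B = (\<Sum>i. emeasure (chart_measure (cs i)) (B \<inter> D i))" if "B \<in> sets borel" for B
    unfolding \<mu>_def
  proof (rule emeasure_measure_of_sigma)
    show "sigma_algebra UNIV (sets (borel :: 'm measure))" using sets.sigma_algebra_axioms[of borel] by simp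
    show "positive (sets (borel :: 'm measure)) (\<lambda>B. \<Sum>i. emeasure (chart_measure (cs i)) (B \<inter> D i))"
      by (simp add: positive_def)
    show "countably_additive (sets (borel :: 'm measure)) (\<lambda>B. \<Sum>i. emeasure (chart_measure (cs i)) (B \<inter> D i))"
    proof (rule countably_additiveI)
      fix F :: "nat \<Rightarrow> 'm set" assume F: "range F \<subseteq> sets borel" "disjoint_family F"
      \<comment> \<open>The order of the two infinite sums is exchanged by reading the inner one as
        an integral over the counting measure.\<close>
      have "(\<Sum>k. \<Sum>i. emeasure (chart_measure (cs i)) (F k \<inter> D i)) = (\<Sum>i. \<Sum>k. emeasure (chart_measure (cs i)) (F k \<inter> D i))"
        using nn_integral_suminf[of "\<lambda>k i. emeasure (chart_measure (cs i)) (F k \<inter> D i)" "count_space UNIV"]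
        by (simp add: nn_integral_count_space_nat)
      also have "\<dots> = (\<Sum>i. emeasure (chart_measure (cs i)) (\<Union>(range F) \<inter> D i))"
      proof (rule arg_cong[where f = suminf], rule ext)
        fix i
        have "(\<Sum>k. emeasure (chart_measure (cs i)) (F k \<inter> D i)) = emeasure (chart_measure (cs i)) (\<Union>k. F k \<inter> D i)"
          using F(1) Dm disjoint_family_subset[OF F(2), of "\<lambda>k. F k \<inter> D i"]
          by (intro suminf_emeasure) (auto simp: chart_measure_def)
        also have "(\<Union>k. F k \<inter> D i) = \<Union>(range F) \<inter> D i" by auto
        finally show "(\<Sum>k. emeasure (chart_measure (cs i)) (F k \<inter> D i)) = emeasure (chart_measure (cs i)) (\<Union>(range F) \<inter> D i)" .
      qed
      finally show "(\<Sum>k. \<Sum>i. emeasure (chart_measure (cs i)) (F k \<inter> D i)) = (\<Sum>i. emeasure (chart_measure (cs i)) (\<Union>(range F) \<inter> D i))" .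
    qed
  qed (rule that)
  have "volume_measure \<mu>"
    unfolding volume_measure_def
  proof (intro conjI ballI impI)
    fix c B assume *: "c \<in> A" "B \<in> sets borel" "B \<subseteq> fst c"
    have "emeasure (chart_measure (cs i)) (B \<inter> D i) = emeasure (chart_measure c) (B \<inter> D i)" for i
      using * cs(1) Ds[of i] Dm[of i] by (intro chart_measure_overlap) auto
    then show "emeasure \<mu> B = emeasure (chart_measure c) B"
      using em[OF *(2)] dec[of "chart_measure c" B] *(2) by (simp add: chart_measure_def)
  qed (rule sm)
  moreover have "\<mu>1 = \<mu>2" if v: "volume_measure \<mu>1" "volume_measure \<mu>2" for \<mu>1 \<mu>2
  proof (rule measure_eqI)
    show "sets \<mu>1 = sets \<mu>2" using v by (simp add: volume_measure_def)
    fix B assume "B \<in> sets \<mu>1"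
    then have B: "B \<in> sets borel" using v by (simp add: volume_measure_def)
    have "emeasure \<mu>1 (B \<inter> D i) = emeasure \<mu>2 (B \<inter> D i)" for i
      using v cs(1)[of i] B Dm[of i] Ds[of i] unfolding volume_measure_def
      by (metis inf.coboundedI2 sets.Int)
    then show "emeasure \<mu>1 B = emeasure \<mu>2 B"
      using dec[of \<mu>1 B] dec[of \<mu>2 B] v B by (simp add: volume_measure_def)
  qed
  ultimately show ?thesis by blast
qed

abbreviation RM :: "'m measure" where "RM \<equiv> riemannian_measure A g"

lemma riemannian_measure_volume: "volume_measure RM"
proof -
  have "volume_measure = (\<lambda>\<mu>. sets \<mu> = sets borel \<and>
     (\<forall>c\<in>A. \<forall>B\<in>sets borel. B \<subseteq> fst c \<longrightarrow>
        emeasure \<mu> B = (\<integral>\<^sup>+x. ennreal (sqrt (det (gram g c (chart_inv c x)))) * indicator (snd c ` B) x \<partial>lborel)))"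
  proof
    fix \<mu>
    have "emeasure (chart_measure c) B = (\<integral>\<^sup>+x. ennreal (sqrt (det (gram g c (chart_inv c x)))) * indicator (snd c ` B) x \<partial>lborel)"
      if "c \<in> A" "B \<in> sets borel" "B \<subseteq> fst c" for c B
      using that by (simp add: emeasure_chart_measure inf.absorb1 chart_vol_def vol_def)
    then show "volume_measure \<mu> = (sets \<mu> = sets borel \<and>
     (\<forall>c\<in>A. \<forall>B\<in>sets borel. B \<subseteq> fst c \<longrightarrow>
        emeasure \<mu> B = (\<integral>\<^sup>+x. ennreal (sqrt (det (gram g c (chart_inv c x)))) * indicator (snd c ` B) x \<partial>lborel)))"
      unfolding volume_measure_def by auto
  qed
  then have "RM = (THE \<mu>. volume_measure \<mu>)" by (simp add: riemannian_measure_def)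
  then show ?thesis using theI'[OF volume_measure_unique_exists] by simp
qed

section \<open>Integration against the Riemannian measure\<close>

lemma sets_RM: "sets RM = sets borel" "space RM = UNIV"
  using riemannian_measure_volume sets_eq_imp_space_eq[of RM borel] by (auto simp: volume_measure_def)

lemma emeasure_RM:
  "c \<in> A \<Longrightarrow> B \<in> sets borel \<Longrightarrow> B \<subseteq> fst c \<Longrightarrow> emeasure RM B = emeasure (chart_measure c) B"
  using riemannian_measure_volume by (simp add: volume_measure_def)

lemma density_RM:
  assumes "c \<in> A" shows "density RM (indicator (fst c)) = chart_measure c"
proof (rule measure_eqI)
  show "sets (density RM (indicator (fst c))) = sets (chart_measure c)" by (simp add: sets_RM chart_measure_def)
  fix B assume "B \<in> sets (density RM (indicator (fst c)))"
  then have B: "B \<in> sets borel" by (simp add: sets_RM)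
  have f: "fst c \<in> sets borel" using chart_open(1)[OF assms] by simp
  have "emeasure (density RM (indicator (fst c))) B = emeasure RM (fst c \<inter> B)"
    using B f by (intro emeasure_restricted) (auto simp: sets_RM)
  also have "\<dots> = emeasure (chart_measure c) (fst c \<inter> B)" using B f assms by (intro emeasure_RM) auto
  also have "\<dots> = emeasure (chart_measure c) B"
    using B f by (simp add: emeasure_chart_measure[OF assms] Int_commute Int_left_commute)
  finally show "emeasure (density RM (indicator (fst c))) B = emeasure (chart_measure c) B" .
qed

lemma integral_chart:
  fixes F :: "'m \<Rightarrow> real"
  assumes "c \<in> A" "F \<in> borel_measurable borel" "\<And>p. p \<notin> fst c \<Longrightarrow> F p = 0"
  shows "(\<integral>p. F p \<partial>RM) = (\<integral>x. indicator (chart_image c) x * (chart_vol c x * F (chart_inv c x)) \<partial>lborel)"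
proof -
  have f: "fst c \<in> sets borel" using chart_open(1)[OF assms(1)] by simp
  have dn: "AE x in lborel. 0 \<le> chart_vol c x * indicator (chart_image c) x"
    using chart_vol_pos[OF assms(1)] by (auto simp: indicator_def less_imp_le)
  have "(\<integral>p. F p \<partial>RM) = (\<integral>p. indicator (fst c) p *\<^sub>R F p \<partial>RM)"
    using assms(3) by (intro Bochner_Integration.integral_cong) (auto simp: indicator_def)
  also have "\<dots> = (\<integral>p. F p \<partial>density RM (\<lambda>p. ennreal (indicator (fst c) p)))"
    using assms(2) f by (intro integral_density[symmetric]) (auto simp: sets_RM measurable_cong_sets[OF sets_RM(1) refl])
  also have "density RM (\<lambda>p. ennreal (indicator (fst c) p)) = chart_measure c"
    using density_RM[OF assms(1)] by (simp add: ennreal_indicator)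
  also have "(\<integral>p. F p \<partial>chart_measure c) = (\<integral>x. F (chart_point c x) \<partial>density lborel (\<lambda>x. ennreal (chart_vol c x * indicator (chart_image c) x)))"
    unfolding chart_measure_def using measurable_chart_point[OF assms(1)] assms(2) by (intro integral_distr) auto
  also have "\<dots> = (\<integral>x. (chart_vol c x * indicator (chart_image c) x) *\<^sub>R F (chart_point c x) \<partial>lborel)"
    using measurable_chart_point[OF assms(1)] measurable_chart_vol[OF assms(1)] assms(2) dn
    by (intro integral_density) auto
  also have "\<dots> = (\<integral>x. indicator (chart_image c) x * (chart_vol c x * F (chart_inv c x)) \<partial>lborel)"
    by (intro Bochner_Integration.integral_cong) (auto simp: chart_point_def indicator_def)
  finally show ?thesis .
qed

text \<open>Every point has a neighbourhood of finite volume, a coordinate ball on whose closure the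
  density is bounded; finitely many of these cover \<open>K\<close>.\<close>

lemma emeasure_RM_compact:
  assumes "compact K" shows "emeasure RM K < \<infinity>"
proof -
  have loc: "\<exists>W. open W \<and> p \<in> W \<and> emeasure RM W < \<infinity>" for p
  proof -
    obtain c where c: "c \<in> A" "p \<in> fst c" using chart_cover by blast
    obtain e where e: "e > 0" "cball (snd c p) e \<subseteq> chart_image c"
      using open_contains_cball[of "chart_image c"] chart_open(2)[OF c(1)] snd_in[OF c(2)] by blast
    let ?W = "chart_inv c ` ball (snd c p) e"
    have bs: "ball (snd c p) e \<subseteq> chart_image c" using e(2) by auto
    have W: "?W = fst c \<inter> snd c -` ball (snd c p) e"
      using c(1) bs by (auto simp: image_iff subset_iff) (metis chart_inv_snd mem_ball)
    have oW: "open ?W" unfolding W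
      by (rule continuous_open_preimage[OF continuous_chart[OF c(1)] chart_open(1)[OF c(1)] open_ball])
    have pW: "p \<in> ?W" unfolding W using c e by simp
    have "bounded (chart_vol c ` cball (snd c p) e)"
      by (intro compact_imp_bounded compact_continuous_image continuous_on_subset[OF smooth_on_continuous[OF chart_vol_smooth[OF c(1)]] e(2)]) simp
    then obtain M where M: "\<forall>x\<in>cball (snd c p) e. \<bar>chart_vol c x\<bar> \<le> M" by (auto simp: bounded_iff)
    have Wf: "?W \<subseteq> fst c" unfolding W by auto
    have sW: "snd c ` ?W = ball (snd c p) e" using c(1) bs by (force simp: image_image subset_iff)
    have "emeasure RM ?W = (\<integral>\<^sup>+x. ennreal (chart_vol c x) * indicator (ball (snd c p) e) x \<partial>lborel)"
      using oW Wf c(1) by (simp add: emeasure_RM emeasure_chart_measure inf.absorb1 sW)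
    also have "\<dots> \<le> (\<integral>\<^sup>+x. ennreal M * indicator (ball (snd c p) e) x \<partial>lborel)"
      using M by (intro nn_integral_mono) (auto simp: indicator_def intro!: ennreal_leI dest: abs_le_D1)
    also have "\<dots> = ennreal M * emeasure lborel (ball (snd c p) e)" by (rule nn_integral_cmult_indicator) simp
    also have "\<dots> < \<infinity>"
      using emeasure_bounded_finite[OF bounded_ball, of "snd c p" e] by (simp add: ennreal_mult_less_top)
    finally show ?thesis using oW pW by blast
  qed
  define C where "C = {W. open W \<and> emeasure RM W < \<infinity>}"
  have "K \<subseteq> \<Union>C" "\<And>W. W \<in> C \<Longrightarrow> open W" using loc by (auto simp: C_def)
  then obtain C' where C': "C' \<subseteq> C" "finite C'" "K \<subseteq> \<Union>C'" using compactE[OF assms] by metis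
  have "open (\<Union>C')" using C'(1) by (intro open_Union) (auto simp: C_def)
  then have "emeasure RM K \<le> emeasure RM (\<Union>C')"
    using C' by (intro emeasure_mono) (auto simp: sets_RM)
  also have "\<dots> \<le> (\<Sum>W\<in>C'. emeasure RM W)"
  proof -
    have "C' \<subseteq> sets borel" using C'(1) by (auto simp: C_def)
    then show ?thesis using emeasure_subadditive_finite[OF C'(2), of id RM] by (simp add: sets_RM)
  qed
  also have "\<dots> < \<infinity>" using C' by (auto simp: C_def ennreal_sum_less_top less_top)
  finally show ?thesis .
qed

lemma integrable_RM:
  fixes F :: "'m \<Rightarrow> real"
  assumes "continuous_on UNIV F" "compact K" "\<And>p. p \<notin> K \<Longrightarrow> F p = 0"
  shows "integrable RM F"
proof -
  have "bounded (F ` K)" using compact_continuous_image[OF continuous_on_subset[OF assms(1)] assms(2)] compact_imp_bounded by blast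
  then obtain M where M: "\<And>p. p \<in> K \<Longrightarrow> \<bar>F p\<bar> \<le> M" by (auto simp: bounded_iff)
  have Km: "K \<in> sets borel" using compact_imp_closed[OF assms(2)] by simp
  have "integrable RM (\<lambda>p. M * indicator K p)"
    using emeasure_RM_compact[OF assms(2)] Km by (intro integrable_mult_right integrable_real_indicator) (auto simp: sets_RM)
  then show ?thesis
  proof (rule Bochner_Integration.integrable_bound)
    show "F \<in> borel_measurable RM"
      using borel_measurable_continuous_onI[OF assms(1)] by (simp add: measurable_cong_sets[OF sets_RM(1) refl])
    show "AE p in RM. norm (F p) \<le> norm (M * indicator K p)"
      using M assms(3) by (intro AE_I2) (force simp: indicator_def)
  qed
qed

text \<open>A point with positive value has an open neighbourhood \<open>W\<close> of positive
  values in a chart. \<open>W\<close> would be null, and since the density is positive its nonempty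
  open coordinate image would be Lebesgue null.\<close>

lemma integral_RM_zero:
  fixes F :: "'m \<Rightarrow> real"
  assumes "continuous_on UNIV F" "compact K" "\<And>p. p \<notin> K \<Longrightarrow> F p = 0" "\<And>p. F p \<ge> 0" "(\<integral>p. F p \<partial>RM) = 0"
  shows "F p = 0"
proof (rule ccontr)
  assume "F p \<noteq> 0"
  then have Fp: "F p > 0" using assms(4)[of p] by simp
  obtain c where c: "c \<in> A" "p \<in> fst c" using chart_cover by blast
  define W where "W = {q \<in> fst c. F q > 0}"
  have oW: "open W"
  proof -
    have "W = fst c \<inter> F -` {0<..}" by (auto simp: W_def)
    then show ?thesis
      using open_Int[OF chart_open(1)[OF c(1)] open_vimage[OF open_greaterThan[of 0] assms(1)]] by simp
  qed
  have "AE q in RM. F q = 0"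
    using integral_nonneg_eq_0_iff_AE[OF integrable_RM[OF assms(1-3)]] assms(4,5) by simp
  then have "AE q in RM. q \<notin> W" by eventually_elim (auto simp: W_def)
  then have "emeasure RM W = 0" using emeasure_eq_0_AE[of "\<lambda>q. q \<in> W" RM] by (simp add: sets_RM)
  then have "(\<integral>\<^sup>+x. ennreal (chart_vol c x) * indicator (snd c ` W) x \<partial>lborel) = 0"
    using oW c(1) by (simp add: emeasure_RM emeasure_chart_measure W_def inf.absorb1 Collect_conj_eq)
  moreover have "(\<lambda>x. ennreal (chart_vol c x) * indicator (snd c ` W) x) \<in> borel_measurable borel"
  proof -
    have "(\<lambda>x. ennreal (chart_vol c x) * indicator (snd c ` W) x) =
        (\<lambda>x. ennreal (chart_vol c x * indicator (chart_image c) x) * indicator (snd c ` W) x)"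
      by (auto simp: fun_eq_iff indicator_def W_def)
    then show ?thesis
      using measurable_chart_vol[OF c(1)] chart_image_sets[OF c(1), of W] oW by (auto simp: W_def)
  qed
  ultimately have "AE x in lborel. ennreal (chart_vol c x) * indicator (snd c ` W) x = 0"
    by (simp add: nn_integral_0_iff_AE)
  moreover have "\<not> chart_vol c (snd c q) \<le> 0" if "q \<in> fst c" for q
    using chart_vol_pos[OF c(1) snd_in[OF that]] by simp
  ultimately have "AE x in lborel. x \<notin> snd c ` W"
    by (elim eventually_mono) (auto simp: W_def indicator_def ennreal_eq_0_iff split: if_splits)
  moreover have ow: "open (snd c ` W)" by (rule chart_image_open[OF c(1) oW]) (auto simp: W_def)
  ultimately have "emeasure lborel (snd c ` W) = 0"
    using emeasure_eq_0_AE[of "\<lambda>x. x \<in> snd c ` W" lborel] by simp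
  moreover have "snd c ` W \<noteq> {}" using c Fp by (auto simp: W_def)
  ultimately show False using open_not_negligible[OF ow] ow by (simp add: negligible_iff_emeasure0)
qed

end

section \<open>Bump functions\<close>

text \<open>The polynomial index makes the family closed under differentiation, as required by
  \<open>Ck_on_scalar_compose\<close>; the bump functions use the index 1.\<close>

definition flat :: "real poly \<Rightarrow> real \<Rightarrow> real" where
  "flat p t = (if t > 0 then poly p (1 / t) * exp (- (1 / t)) else 0)"

lemma poly_exp_tendsto_0: "((\<lambda>s::real. s ^ k * poly p s * exp (- s)) \<longlongrightarrow> 0) at_top"
proof (induction p arbitrary: k)
  case (pCons a p)
  have "((\<lambda>s::real. a * (s ^ k / exp s) + s ^ Suc k * poly p s * exp (- s)) \<longlongrightarrow> a * 0 + 0) at_top"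
    by (intro tendsto_add tendsto_mult tendsto_const tendsto_power_div_exp_0 pCons.IH)
  then show ?case by (simp add: exp_minus field_simps)
qed simp

text \<open>With \<open>s = 1 / t\<close> the derivative of \<open>poly p s * exp (- s)\<close> is
  \<open>s^2 * (p - p')(s) * exp (- s)\<close>, and \<open>[:0, 0, 1:]\<close> is the polynomial
  \<open>s^2\<close>.\<close>

lemma flat_derivative: "(flat p has_real_derivative flat ([:0, 0, 1:] * (p - pderiv p)) t) (at t)"
proof -
  consider "t > 0" | "t < 0" | "t = 0" by linarith
  then show ?thesis
  proof cases
    case 1
    have "((\<lambda>t. poly p (1 / t) * exp (- (1 / t))) has_real_derivative flat ([:0, 0, 1:] * (p - pderiv p)) t) (at t)"
      using 1 by (auto intro!: derivative_eq_intros poly_DERIV[THEN DERIV_chain2] simp: flat_def power2_eq_square field_simps)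
    then show ?thesis
      by (rule has_field_derivative_transform_within_open[of _ _ _ "{0<..}"]) (use 1 in \<open>auto simp: flat_def\<close>)
  next
    case 2
    have "((\<lambda>t. 0) has_real_derivative 0) (at t)" by simp
    then have "(flat p has_real_derivative 0) (at t)"
      by (rule has_field_derivative_transform_within_open[of _ _ _ "{..<0}"]) (use 2 in \<open>auto simp: flat_def\<close>)
    then show ?thesis using 2 by (simp add: flat_def)
  next
    case 3
    \<comment> \<open>With \<open>s = 1 / h\<close> the right difference quotient at 0 is
      \<open>s * poly p s * exp (- s)\<close>.\<close>
    have r: "((\<lambda>h. flat p h / h) \<longlongrightarrow> 0) (at_right 0)"
    proof -
      have "((\<lambda>h::real. (inverse h) ^ 1 * poly p (inverse h) * exp (- inverse h)) \<longlongrightarrow> 0) (at_right 0)"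
        by (rule filterlim_compose[OF poly_exp_tendsto_0 filterlim_inverse_at_top_right])
      then show ?thesis
        by (rule Lim_transform_eventually)
          (auto simp: eventually_at_right_field flat_def field_simps intro!: exI[of _ 1])
    qed
    have l: "((\<lambda>h. flat p h / h) \<longlongrightarrow> 0) (at_left 0)"
      by (rule Lim_transform_eventually[OF tendsto_const[of 0]])
        (auto simp: eventually_at_left_field flat_def intro!: exI[of _ "-1"])
    have "((\<lambda>h. flat p h / h) \<longlongrightarrow> 0) (at 0)" using l r by (simp add: filterlim_at_split)
    then show ?thesis using 3 by (simp add: DERIV_def flat_def)
  qed
qed

lemma smooth_on_flat:
  assumes "open S" "smooth_on S u" shows "smooth_on S (\<lambda>x. flat p (u x))"
  unfolding smooth_on_def
  using assms by (intro allI Ck_on_scalar_compose[where h = flat]) (auto simp: smooth_on_def intro: flat_derivative)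

lemma bump_Rn:
  fixes x0 :: "real^'n::finite"
  assumes "r > 0"
  obtains \<psi> :: "real^'n \<Rightarrow> real" where "smooth_on UNIV \<psi>" "\<And>x. \<psi> x \<ge> 0"
    "\<And>x. x \<in> ball x0 r \<Longrightarrow> \<psi> x = 1" "\<And>x. x \<notin> cball x0 (2 * r) \<Longrightarrow> \<psi> x = 0"
proof -
  \<comment> \<open>\<open>u\<close> exceeds 1 inside radius \<open>r\<close> and is at most 0
    outside radius \<open>2 * r\<close>. The quotient \<open>\<psi>\<close> is 1 in the first region
    and 0 in the second; its denominator is positive because \<open>u x\<close> or
    \<open>1 - u x\<close> is.\<close>
  define u where "u x = 2 - ((x - x0) \<bullet> (x - x0)) / r\<^sup>2" for x
  define \<psi> where "\<psi> x = flat 1 (u x) / (flat 1 (u x) + flat 1 (1 - u x))" for x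
  have pos: "flat 1 t \<ge> 0" "t > 0 \<Longrightarrow> flat 1 t > 0" for t by (auto simp: flat_def)
  have den: "flat 1 t + flat 1 (1 - t) > 0" for t
    using pos by (cases "t > 0") (auto intro: add_pos_nonneg add_nonneg_pos)
  have u: "smooth_on UNIV u"
    unfolding u_def by (intro smooth_on_diff smooth_on_divide smooth_on_inner smooth_on_const smooth_on_ident) (use assms in auto)
  have "smooth_on UNIV (\<lambda>x. \<psi> x)"
    unfolding \<psi>_def using den
    by (intro smooth_on_divide smooth_on_add smooth_on_flat smooth_on_diff smooth_on_const u) (auto simp: less_imp_neq[symmetric])
  moreover have "\<psi> x \<ge> 0" for x unfolding \<psi>_def using pos(1) den[of "u x"] by (simp add: divide_nonneg_nonneg)
  moreover have "\<psi> x = 1" if "x \<in> ball x0 r" for x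
  proof -
    have "norm (x - x0) < r" using that by (simp add: dist_norm norm_minus_commute)
    then have "(x - x0) \<bullet> (x - x0) < r\<^sup>2"
      unfolding power2_norm_eq_inner[symmetric] by (intro power_strict_mono) auto
    then have "u x > 1" using assms by (simp add: u_def field_simps)
    then show ?thesis using pos(2)[of "u x"] by (simp add: \<psi>_def flat_def)
  qed
  moreover have "\<psi> x = 0" if "x \<notin> cball x0 (2 * r)" for x
  proof -
    have "2 * r \<le> norm (x - x0)" using that by (simp add: dist_norm norm_minus_commute)
    then have "(2 * r)\<^sup>2 \<le> (x - x0) \<bullet> (x - x0)"
      unfolding power2_norm_eq_inner[symmetric] using assms by (intro power_mono) auto
    moreover have "(2 * r)\<^sup>2 = 4 * r\<^sup>2" by (simp add: power_mult_distrib)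
    ultimately have "2 * r\<^sup>2 \<le> (x - x0) \<bullet> (x - x0)" using zero_le_power2[of r] by linarith
    then have "u x \<le> 0" using assms by (simp add: u_def field_simps)
    then show ?thesis by (simp add: \<psi>_def flat_def)
  qed
  ultimately show ?thesis using that[of \<psi>] by simp
qed

lemma smooth_family_open_cover:
  assumes "\<And>x. x \<in> S \<Longrightarrow> \<exists>U. open U \<and> x \<in> U \<and> smooth_family U a"
  shows "smooth_family S a"
  unfolding smooth_family_def
proof (intro conjI ballI allI)
  show "alternating (a x)" if "x \<in> S" for x using assms[OF that] by (auto simp: smooth_family_def)
  show "smooth_on S (\<lambda>x. a x vs)" for vs
    by (rule smooth_on_open_cover) (use assms in \<open>auto simp: smooth_family_def\<close>, blast)
qed

lemma smooth_on_extend: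
  fixes f :: "real^'n \<Rightarrow> real"
  assumes "open S" "smooth_on S f" "closed K" "K \<subseteq> S" "\<And>x. x \<in> S \<Longrightarrow> x \<notin> K \<Longrightarrow> f x = 0"
  shows "smooth_on UNIV (\<lambda>x. if x \<in> S then f x else 0)"
proof (rule smooth_on_open_cover)
  fix x
  have 1: "smooth_on S (\<lambda>x. if x \<in> S then f x else 0)"
    by (rule smooth_on_cong[OF assms(1) _ assms(2)]) simp
  have 2: "smooth_on (- K) (\<lambda>x. if x \<in> S then f x else 0)"
    by (rule smooth_on_cong[OF _ _ smooth_on_const]) (use assms in auto)
  show "\<exists>U. open U \<and> x \<in> U \<and> smooth_on U (\<lambda>x. if x \<in> S then f x else 0)"
    using 1 2 assms(1,3,4) by (cases "x \<in> S") (blast, intro exI[of _ "- K"], auto)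
qed

lemma integrable_compact_support:
  fixes h :: "real^'n::finite \<Rightarrow> real"
  assumes "continuous_on UNIV h" "compact K" "\<And>x. x \<notin> K \<Longrightarrow> h x = 0"
  shows "integrable lborel h"
proof -
  have "(\<lambda>x. indicator K x *\<^sub>R h x) = h" using assms(3) by (auto simp: indicator_def fun_eq_iff)
  then show ?thesis using borel_integrable_compact[OF assms(2) continuous_on_subset[OF assms(1)]] by simp
qed

section \<open>Extending forms by zero\<close>

definition supported :: "'m set \<Rightarrow> ('m, 'n) form \<Rightarrow> bool" where
  "supported K \<alpha> \<longleftrightarrow> (\<forall>c p. p \<notin> K \<longrightarrow> \<alpha> c p = 0)"

lemma supportedD: "supported K \<alpha> \<Longrightarrow> p \<notin> K \<Longrightarrow> \<alpha> c p = 0"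
  unfolding supported_def by blast

lemma compactly_supportedI:
  fixes K :: "'m::t2_space set"
  assumes "compact K" "supported K \<alpha>" shows "compactly_supported \<alpha>"
proof -
  have "{p. \<exists>c vs. \<alpha> c p vs \<noteq> 0} \<subseteq> K" using supportedD[OF assms(2)] by force
  then have "closure {p. \<exists>c vs. \<alpha> c p vs \<noteq> 0} \<subseteq> K" by (rule closure_minimal[OF _ compact_imp_closed[OF assms(1)]])
  then have "K \<inter> closure {p. \<exists>c vs. \<alpha> c p vs \<noteq> 0} = closure {p. \<exists>c vs. \<alpha> c p vs \<noteq> 0}" by blast
  then show ?thesis
    unfolding compactly_supported_def
    using compact_Int_closed[OF assms(1) closed_closure[of "{p. \<exists>c vs. \<alpha> c p vs \<noteq> 0}"]] by (rule subst)
qed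

lemma compactly_supportedE:
  assumes "compactly_supported \<alpha>"
  obtains K where "compact K" "supported K \<alpha>"
proof -
  have "supported (closure {p. \<exists>c vs. \<alpha> c p vs \<noteq> 0}) \<alpha>"
    unfolding supported_def
  proof (intro allI impI)
    fix c p assume "p \<notin> closure {p. \<exists>c vs. \<alpha> c p vs \<noteq> 0}"
    then have "p \<notin> {p. \<exists>c vs. \<alpha> c p vs \<noteq> 0}" by (rule contrapos_nn) (rule subsetD[OF closure_subset])
    then have "\<alpha> c p vs = 0" for vs by blast
    then show "\<alpha> c p = 0" by (simp add: fun_eq_iff)
  qed
  with assms show ?thesis unfolding compactly_supported_def by (rule that)
qed

context atlas
begin

text \<open>The form given by \<open>a\<close> in the chart \<open>c\<close>, transported to the
  other charts by the transition matrices and extended by 0.\<close>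

definition ext_form :: "('m, 'n) chart \<Rightarrow> (real^'n \<Rightarrow> (real^'n) list \<Rightarrow> real) \<Rightarrow> ('m, 'n) form" where
  "ext_form c a = (\<lambda>c' p. if c' \<in> A \<and> p \<in> fst c \<and> p \<in> fst c' then pull ((*v) (tmat c' c p)) (a (snd c p)) else 0)"

lemma tmat_self: "c \<in> A \<Longrightarrow> p \<in> fst c \<Longrightarrow> tmat c c p = mat 1"
  using tmat_inverse(1)[of c c p] transition_self[of c p]
  by (intro matrix_eq_inner) (simp add: fun_cong[OF transition_tmat, symmetric])

lemma ext_form_self: "c \<in> A \<Longrightarrow> p \<in> fst c \<Longrightarrow> ext_form c a c p = a (snd c p)"
  by (rule ext) (simp add: ext_form_def tmat_self map_idI)

lemma ext_form_supported:
  assumes "c \<in> A" "\<And>p. p \<in> fst c \<Longrightarrow> p \<notin> K \<Longrightarrow> a (snd c p) = 0"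
  shows "supported K (ext_form c a)"
  using assms by (auto simp: supported_def ext_form_def)

lemma smooth_tmat:
  assumes "c \<in> A" "c' \<in> A"
  shows "smooth_on (overlap c c') (\<lambda>x. tmat c c' (chart_inv c x) $ i $ j)"
proof (rule smooth_on_cong[OF open_overlap[OF assms]])
  show "smooth_on (overlap c c') (\<lambda>x. frechet_derivative (change c c') (at x) (axis j 1) $ i)"
    by (intro smooth_on_vec_nth open_overlap smooth_on_frechet change_smooth assms)
qed (use overlap_iff[OF assms(1)] assms in \<open>simp add: tmat_def transition_change matrix_def\<close>)

text \<open>Near a point of another chart the extension is either the transported family, on the
  overlap, or identically 0, off \<open>K\<close>. The second region is open because a compact
  subset of a Hausdorff space is closed.\<close>

lemma Forms_ext_form:
  assumes c: "c \<in> A" and a: "smooth_family (chart_image c) a"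
    and K: "compact K" "K \<subseteq> fst c" "\<And>p. p \<in> fst c \<Longrightarrow> p \<notin> K \<Longrightarrow> a (snd c p) = 0"
  shows "ext_form c a \<in> Forms A"
proof (rule FormsI)
  fix c' assume c': "c' \<in> A"
  show "smooth_family (chart_image c') (fam (ext_form c a) c')"
  proof (rule smooth_family_open_cover)
    fix x assume x: "x \<in> chart_image c'"
    show "\<exists>U. open U \<and> x \<in> U \<and> smooth_family U (fam (ext_form c a) c')"
    proof (cases "x \<in> overlap c' c")
      case True
      have o: "open (overlap c' c)" by (rule open_overlap[OF c' c])
      have "smooth_family (overlap c' c) (\<lambda>y. pull ((*v) (tmat c' c (chart_inv c' y))) (a (change c' c y)))"
        using change_in[OF c'] overlap_subset
        by (intro smooth_family_pull[OF o smooth_tmat[OF c' c]] smooth_family_compose[OF o chart_open(2)[OF c] a change_smooth[OF c' c]]) blast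
      then have "smooth_family (overlap c' c) (fam (ext_form c a) c')"
        by (rule smooth_family_cong[OF o, rotated])
          (use overlap_iff[OF c'] c' in \<open>auto simp: fam_def ext_form_def change_def\<close>)
      then show ?thesis using o True by blast
    next
      case False
      then have nx: "chart_inv c' x \<notin> K" using overlap_iff[OF c'] x K(2) by auto
      let ?U = "chart_image c' \<inter> chart_inv c' -` (- K)"
      have o: "open ?U"
        by (rule continuous_open_preimage[OF continuous_chart_inv[OF c'] chart_open(2)[OF c']])
          (use compact_imp_closed[OF K(1)] in auto)
      have "smooth_family ?U (fam (ext_form c a) c')"
        by (rule smooth_family_cong[OF o _ smooth_family_zero[OF o]])
          (auto simp: fam_def ext_form_def K(3))
      then show ?thesis using o nx x by blast
    qed
  qed
next
  fix c1 c2 p assume *: "c1 \<in> A" "c2 \<in> A" "p \<in> fst c1" "p \<in> fst c2"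
  show "ext_form c a c1 p = pull ((*v) (tmat c1 c2 p)) (ext_form c a c2 p)"
  proof (cases "p \<in> fst c")
    case True
    have "(*v) (tmat c1 c p) = (*v) (tmat c2 c p) \<circ> (*v) (tmat c1 c2 p)"
      using transition_cocycle[OF *(1,2) c *(3,4) True] * c True by (simp add: transition_tmat fun_eq_iff)
    then show ?thesis using * True by (simp add: ext_form_def pull_pull)
  qed (simp add: ext_form_def)
qed (auto simp: ext_form_def)

text \<open>A function as a 0-form, so that extending functions by zero becomes a case of
  \<open>Forms_ext_form\<close>.\<close>

definition scalar_family :: "(real^'n \<Rightarrow> real) \<Rightarrow> real^'n \<Rightarrow> (real^'n) list \<Rightarrow> real" where
  "scalar_family \<phi> x vs = (if vs = [] then \<phi> x else 0)"

lemma smooth_family_scalar: "open S \<Longrightarrow> smooth_on S \<phi> \<Longrightarrow> smooth_family S (scalar_family \<phi>)"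
  unfolding smooth_family_def
proof (intro conjI ballI allI)
  show "alternating (scalar_family \<phi> x)" for x
    by (rule alternatingI) (auto simp: scalar_family_def intro!: linearI)
  show "open S \<Longrightarrow> smooth_on S \<phi> \<Longrightarrow> smooth_on S (\<lambda>x. scalar_family \<phi> x vs)" for vs
    by (cases "vs = []") (simp_all add: scalar_family_def)
qed

lemma smooth_fun_extend:
  assumes c: "c \<in> A" and \<phi>: "smooth_on (chart_image c) \<phi>"
    and K: "compact K" "K \<subseteq> fst c" "\<And>p. p \<in> fst c \<Longrightarrow> p \<notin> K \<Longrightarrow> \<phi> (snd c p) = 0"
  shows "smooth_fun A (\<lambda>p. if p \<in> fst c then \<phi> (snd c p) else 0)"
proof -
  have F: "ext_form c (scalar_family \<phi>) \<in> Forms A"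
    by (rule Forms_ext_form[OF c smooth_family_scalar[OF chart_open(2)[OF c] \<phi>] K(1,2)])
      (auto simp: scalar_family_def K(3))
  show ?thesis
    unfolding smooth_fun_def o_def
  proof
    fix c' assume c': "c' \<in> A"
    show "smooth_on (chart_image c') (\<lambda>x. if chart_inv c' x \<in> fst c then \<phi> (snd c (chart_inv c' x)) else 0)"
      by (rule smooth_on_cong[OF chart_open(2)[OF c'] _ smooth_family_smooth[OF Forms_family[OF F c'], of "[]"]])
        (use c' in \<open>auto simp: fam_def ext_form_def scalar_family_def\<close>)
  qed
qed

lemma smooth_fun_continuous:
  assumes "smooth_fun A f" shows "continuous_on UNIV f"
proof (rule continuous_at_imp_continuous_on, rule ballI)
  fix p
  obtain c where c: "c \<in> A" "p \<in> fst c" using chart_cover by blast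
  have "continuous_on (fst c) (\<lambda>q. (\<lambda>x. f (chart_inv c x)) (snd c q))"
    by (rule continuous_on_compose2[OF smooth_on_continuous[OF smooth_fun_chart[OF assms c(1)]] continuous_chart[OF c(1)]]) auto
  then have "continuous_on (fst c) f" using c(1) by (simp cong: continuous_on_cong)
  then show "isCont f p" using c chart_open(1) by (simp add: continuous_on_eq_continuous_at)
qed

lemma bump_exists:
  assumes "open W" "p \<in> W"
  obtains \<psi> K where "smooth_fun A \<psi>" "\<And>q. \<psi> q \<ge> 0" "compact K" "K \<subseteq> W" "\<And>q. q \<notin> K \<Longrightarrow> \<psi> q = 0"
    "\<exists>V. open V \<and> p \<in> V \<and> (\<forall>q\<in>V. \<psi> q = 1)"
proof -
  obtain c where c: "c \<in> A" "p \<in> fst c" using chart_cover by blast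
  let ?O = "snd c ` (W \<inter> fst c)"
  have oO: "open ?O" by (rule chart_image_open[OF c(1)]) (use assms chart_open(1)[OF c(1)] in auto)
  have "snd c p \<in> ?O" using c assms by auto
  then obtain e where e: "e > 0" "cball (snd c p) e \<subseteq> ?O" using oO open_contains_cball by blast
  obtain \<phi> :: "real^'n \<Rightarrow> real" where \<phi>: "smooth_on UNIV \<phi>" "\<And>x. \<phi> x \<ge> 0"
    "\<And>x. x \<in> ball (snd c p) (e / 2) \<Longrightarrow> \<phi> x = 1" "\<And>x. x \<notin> cball (snd c p) (2 * (e / 2)) \<Longrightarrow> \<phi> x = 0"
    using bump_Rn[of "e / 2" "snd c p"] e(1) by auto
  define K where "K = chart_inv c ` cball (snd c p) e"
  have OI: "?O \<subseteq> chart_image c" by (auto simp: chart_image_def)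
  have cb: "cball (snd c p) e \<subseteq> chart_image c" using e(2) OI by blast
  have K: "compact K" unfolding K_def
    by (rule compact_continuous_image[OF continuous_on_subset[OF continuous_chart_inv[OF c(1)] cb] compact_cball])
  have KW: "K \<subseteq> W \<inter> fst c" unfolding K_def using e(2) c(1) by (force simp: subset_iff image_iff)
  have out: "\<phi> (snd c q) = 0" if "q \<in> fst c" "q \<notin> K" for q
  proof (rule \<phi>(4))
    show "snd c q \<notin> cball (snd c p) (2 * (e / 2))"
      using that c(1) unfolding K_def by (auto simp: image_iff) (metis chart_inv_snd mem_cball)
  qed
  define \<psi> where "\<psi> q = (if q \<in> fst c then \<phi> (snd c q) else 0)" for q
  have "smooth_fun A (\<lambda>q. \<psi> q)" unfolding \<psi>_def
    by (rule smooth_fun_extend[OF c(1) smooth_on_subset[OF \<phi>(1)] K _ out]) (use KW in auto)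
  moreover have "\<psi> q \<ge> 0" for q using \<phi>(2) by (simp add: \<psi>_def)
  moreover have "\<psi> q = 0" if "q \<notin> K" for q using out that by (simp add: \<psi>_def)
  moreover have "\<exists>V. open V \<and> p \<in> V \<and> (\<forall>q\<in>V. \<psi> q = 1)"
  proof (intro exI[of _ "fst c \<inter> snd c -` ball (snd c p) (e / 2)"] conjI)
    show "open (fst c \<inter> snd c -` ball (snd c p) (e / 2))"
      by (rule continuous_open_preimage[OF continuous_chart[OF c(1)] chart_open(1)[OF c(1)] open_ball])
  qed (use c e \<phi>(3) in \<open>auto simp: \<psi>_def\<close>)
  ultimately show ?thesis using that[of \<psi> K] K KW by auto
qed

end

section \<open>The inner product of forms\<close>

context riemannian_atlas
begin

lemma smooth_on_alt_inner:
  assumes "c \<in> A" "smooth_family (chart_image c) a" "smooth_family (chart_image c) b"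
  shows "smooth_on (chart_image c) (\<lambda>x. alt_inner (gram g c (chart_inv c x)) (a x) (b x))"
proof (rule smooth_on_cong[OF chart_open(2)[OF assms(1)]])
  let ?G = "\<lambda>x. gram g c (chart_inv c x)"
  show "smooth_on (chart_image c) (\<lambda>x. alt_inner (mat 1) (a x) (raise (?G x) (b x)) / chart_vol c x)"
    using chart_vol_pos[OF assms(1)]
    by (intro smooth_on_divide smooth_on_alt_inner_1 smooth_family_raise gram_metric assms chart_open(2) chart_vol_smooth)
      (auto simp: less_imp_neq[symmetric])
  fix x assume x: "x \<in> chart_image c"
  have "vol (?G x) * alt_inner (?G x) (a x) (b x) = alt_inner (mat 1) (a x) (raise (?G x) (b x))"
    using assms(1) x by (intro alt_inner_raise gram_spd smooth_familyD[OF assms(3)]) auto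
  then show "alt_inner (mat 1) (a x) (raise (?G x) (b x)) / chart_vol c x = alt_inner (?G x) (a x) (b x)"
    using chart_vol_pos[OF assms(1) x] by (simp add: chart_vol_def field_simps)
qed

lemma smooth_fun_form_inner:
  assumes "\<alpha> \<in> Forms A" "\<beta> \<in> Forms A" shows "smooth_fun A (form_inner A g \<alpha> \<beta>)"
  unfolding smooth_fun_def o_def
proof
  fix c assume c: "c \<in> A"
  show "smooth_on (chart_image c) (\<lambda>x. form_inner A g \<alpha> \<beta> (chart_inv c x))"
    by (rule smooth_on_cong[OF chart_open(2)[OF c] _ smooth_on_alt_inner[OF c Forms_family[OF assms(1) c] Forms_family[OF assms(2) c]]])
      (simp add: form_inner_cinn[OF assms c] cinn_def fam_def c)
qed

lemma form_inner_linear: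
  assumes "\<alpha> \<in> Forms A" "\<alpha>' \<in> Forms A" "\<beta> \<in> Forms A"
  shows "form_inner A g (\<alpha> + \<alpha>') \<beta> p = form_inner A g \<alpha> \<beta> p + form_inner A g \<alpha>' \<beta> p"
    "form_inner A g (\<alpha> - \<alpha>') \<beta> p = form_inner A g \<alpha> \<beta> p - form_inner A g \<alpha>' \<beta> p"
    "form_inner A g (fmult f \<alpha>) \<beta> p = f p * form_inner A g \<alpha> \<beta> p"
    "form_inner A g \<beta> (\<alpha> + \<alpha>') p = form_inner A g \<beta> \<alpha> p + form_inner A g \<beta> \<alpha>' p"
    "form_inner A g \<beta> (\<alpha> - \<alpha>') p = form_inner A g \<beta> \<alpha> p - form_inner A g \<beta> \<alpha>' p"
    "form_inner A g \<beta> (fmult f \<alpha>) p = f p * form_inner A g \<beta> \<alpha> p"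
  by (simp_all add: form_inner_def Let_def alt_inner_linear fmult_apply)

lemma form_inner_commute:
  assumes "\<alpha> \<in> Forms A" "\<beta> \<in> Forms A" shows "form_inner A g \<alpha> \<beta> p = form_inner A g \<beta> \<alpha> p"
proof -
  obtain c where c: "c \<in> A" "p \<in> fst c" using chart_cover by blast
  show ?thesis
    unfolding form_inner_cinn[OF assms c] form_inner_cinn[OF assms(2,1) c] cinn_def
    by (intro alt_inner_commute gram_spd Forms_alternating assms c)
qed

lemma form_inner_zero: "\<alpha> (SOME c. c \<in> A \<and> p \<in> fst c) p = 0 \<Longrightarrow> form_inner A g \<alpha> \<beta> p = 0"
  by (simp add: form_inner_def Let_def alt_inner_linear)

lemma form_inner_supported: "supported K \<alpha> \<Longrightarrow> p \<notin> K \<Longrightarrow> form_inner A g \<alpha> \<beta> p = 0"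
  by (intro form_inner_zero) (rule supportedD)

lemma integrable_form_inner:
  assumes "\<alpha> \<in> Forms A" "\<beta> \<in> Forms A" "compact K" "supported K \<alpha>"
  shows "integrable RM (form_inner A g \<alpha> \<beta>)"
  by (rule integrable_RM[OF smooth_fun_continuous[OF smooth_fun_form_inner[OF assms(1,2)]] assms(3) form_inner_supported[OF assms(4)]])

lemma form_inner_pos:
  assumes "\<alpha> \<in> Forms A" shows "form_inner A g \<alpha> \<alpha> p \<ge> 0"
proof -
  obtain c where c: "c \<in> A" "p \<in> fst c" using chart_cover by blast
  show ?thesis unfolding form_inner_cinn[OF assms assms c] cinn_def
    by (intro alt_inner_nonneg gram_spd Forms_alternating assms c)
qed

lemma form_inner_self_zero:
  assumes "\<alpha> \<in> Forms A" "\<And>p. form_inner A g \<alpha> \<alpha> p = 0" shows "\<alpha> = 0"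
proof (rule Forms_eqI[OF assms(1) Forms_zero_mem])
  fix c p assume c: "c \<in> A" "p \<in> fst c"
  have "alt_inner (gram g c p) (\<alpha> c p) (\<alpha> c p) = 0"
    using assms(2)[of p] unfolding form_inner_cinn[OF assms(1,1) c] cinn_def .
  then show "\<alpha> c p = 0 c p"
    using alt_inner_eq_0[OF gram_spd[OF c] Forms_alternating[OF assms(1) c]] by simp
qed

lemma L2_inner_diff_left:
  assumes "\<alpha> \<in> Forms A" "\<alpha>' \<in> Forms A" "\<beta> \<in> Forms A" "compact K" "supported K \<alpha>" "supported K \<alpha>'"
  shows "L2_inner A g (\<alpha> - \<alpha>') \<beta> = L2_inner A g \<alpha> \<beta> - L2_inner A g \<alpha>' \<beta>"
    "L2_inner A g (\<alpha> + \<alpha>') \<beta> = L2_inner A g \<alpha> \<beta> + L2_inner A g \<alpha>' \<beta>"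
  unfolding L2_inner_def form_inner_linear[OF assms(1-3)]
  using integrable_form_inner[OF assms(1,3,4,5)] integrable_form_inner[OF assms(2,3,4,6)] by simp_all

lemma L2_inner_diff_right:
  assumes "\<alpha> \<in> Forms A" "\<beta> \<in> Forms A" "\<beta>' \<in> Forms A" "compact K" "supported K \<alpha>"
  shows "L2_inner A g \<alpha> (\<beta> - \<beta>') = L2_inner A g \<alpha> \<beta> - L2_inner A g \<alpha> \<beta>'"
    "L2_inner A g \<alpha> (\<beta> + \<beta>') = L2_inner A g \<alpha> \<beta> + L2_inner A g \<alpha> \<beta>'"
  unfolding L2_inner_def form_inner_linear[OF assms(2,3,1)]
  using integrable_form_inner[OF assms(1,2,4,5)] integrable_form_inner[OF assms(1,3,4,5)] by simp_all

lemma L2_inner_commute: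
  assumes "\<alpha> \<in> Forms A" "\<beta> \<in> Forms A" shows "L2_inner A g \<alpha> \<beta> = L2_inner A g \<beta> \<alpha>"
  unfolding L2_inner_def by (rule Bochner_Integration.integral_cong[OF refl]) (rule form_inner_commute[OF assms])

text \<open>Spaces of sections enter through their module structure over the smooth functions:
  multiplication by bump functions localises test forms without leaving \<open>E\<close>.\<close>

definition submodule :: "('m, 'n) form set \<Rightarrow> bool" where
  "submodule E \<longleftrightarrow> E \<subseteq> Forms A \<and> 0 \<in> E \<and> (\<forall>\<alpha>\<in>E. \<forall>\<beta>\<in>E. \<alpha> + \<beta> \<in> E) \<and>
     (\<forall>\<alpha>\<in>E. \<forall>f. smooth_fun A f \<longrightarrow> fmult f \<alpha> \<in> E)"

lemma submoduleD:
  assumes "submodule E"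
  shows "\<alpha> \<in> E \<Longrightarrow> \<alpha> \<in> Forms A" "0 \<in> E" "\<alpha> \<in> E \<Longrightarrow> \<beta> \<in> E \<Longrightarrow> \<alpha> + \<beta> \<in> E"
    "\<alpha> \<in> E \<Longrightarrow> smooth_fun A f \<Longrightarrow> fmult f \<alpha> \<in> E" "\<alpha> \<in> E \<Longrightarrow> cmult r \<alpha> \<in> E" "\<alpha> \<in> E \<Longrightarrow> - \<alpha> \<in> E"
    "\<alpha> \<in> E \<Longrightarrow> \<beta> \<in> E \<Longrightarrow> \<alpha> - \<beta> \<in> E"
proof -
  show 1: "\<alpha> \<in> E \<Longrightarrow> \<alpha> \<in> Forms A" "0 \<in> E" "\<alpha> \<in> E \<Longrightarrow> \<beta> \<in> E \<Longrightarrow> \<alpha> + \<beta> \<in> E"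
    "\<alpha> \<in> E \<Longrightarrow> smooth_fun A f \<Longrightarrow> fmult f \<alpha> \<in> E" for \<alpha> \<beta> f
    using assms by (auto simp: submodule_def)
  show 2: "\<alpha> \<in> E \<Longrightarrow> cmult r \<alpha> \<in> E" for \<alpha> r unfolding cmult_def by (rule 1(4)[OF _ smooth_fun_const])
  show 3: "\<alpha> \<in> E \<Longrightarrow> - \<alpha> \<in> E" for \<alpha> using 2[of \<alpha> "-1"] by (simp add: cmult_minus)
  show "\<alpha> \<in> E \<Longrightarrow> \<beta> \<in> E \<Longrightarrow> \<alpha> - \<beta> \<in> E" using 1(3)[OF _ 3, of \<alpha> \<beta>] by simp
qed

lemma submodule_Forms: "submodule (Forms A)"
  by (simp add: submodule_def Forms_zero_mem Forms_add Forms_fmult)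

lemma supported_fmult: "supported K \<alpha> \<Longrightarrow> supported K (fmult f \<alpha>)"
  by (simp add: supported_def fmult_apply)

text \<open>The test form is \<open>\<gamma>\<close> times a bump function equal to 1 near the given
  point: the integral of a nonnegative continuous function vanishes, hence so does its value at that
  point.\<close>

lemma L2_nondegenerate:
  assumes E: "submodule E" and \<gamma>: "\<gamma> \<in> E"
    and zero: "\<And>\<alpha>. \<alpha> \<in> E \<Longrightarrow> compactly_supported \<alpha> \<Longrightarrow> L2_inner A g \<alpha> \<gamma> = 0"
  shows "\<gamma> = 0"
proof (rule form_inner_self_zero[OF submoduleD(1)[OF E \<gamma>]])
  fix p
  have \<gamma>F: "\<gamma> \<in> Forms A" by (rule submoduleD(1)[OF E \<gamma>])
  obtain \<psi> K where \<psi>: "smooth_fun A \<psi>" "\<And>q. \<psi> q \<ge> 0" "compact K" "K \<subseteq> UNIV" "\<And>q. q \<notin> K \<Longrightarrow> \<psi> q = 0"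
    "\<exists>V. open V \<and> p \<in> V \<and> (\<forall>q\<in>V. \<psi> q = 1)"
    by (rule bump_exists[where W = UNIV and p = p, OF open_UNIV UNIV_I]) auto
  let ?F = "\<lambda>q. \<psi> q * form_inner A g \<gamma> \<gamma> q"
  have "supported K (fmult \<psi> \<gamma>)" using \<psi>(5) by (simp add: supported_def fmult_apply)
  then have "compactly_supported (fmult \<psi> \<gamma>)" by (rule compactly_supportedI[OF \<psi>(3)])
  then have "L2_inner A g (fmult \<psi> \<gamma>) \<gamma> = 0" by (intro zero submoduleD[OF E] \<gamma> \<psi>)
  then have int: "(\<integral>q. ?F q \<partial>RM) = 0"
    unfolding L2_inner_def form_inner_linear(3)[OF \<gamma>F \<gamma>F \<gamma>F] .
  have "?F p = 0"
    by (rule integral_RM_zero[of ?F K])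
      (use \<psi> int form_inner_pos[OF \<gamma>F] in \<open>auto intro!: smooth_fun_continuous smooth_fun_mult smooth_fun_form_inner \<gamma>F\<close>)
  then show "form_inner A g \<gamma> \<gamma> p = 0" using \<psi>(6) by auto
qed

text \<open>Evaluates the definite description: any candidate satisfying the adjointness equation is
  the unique one, by \<open>L2_nondegenerate\<close>.\<close>

lemma formal_adjoint_eq:
  assumes E: "submodule E" and D: "\<And>\<alpha>. \<alpha> \<in> E \<Longrightarrow> D \<alpha> \<in> Forms A" and \<gamma>: "\<gamma> \<in> E"
    and adj: "\<And>\<alpha>. \<alpha> \<in> E \<Longrightarrow> compactly_supported \<alpha> \<Longrightarrow> L2_inner A g (D \<alpha>) \<beta> = L2_inner A g \<alpha> \<gamma>"
  shows "formal_adjoint A g E D \<beta> = \<gamma>"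
  unfolding formal_adjoint_def
proof (rule the_equality)
  show "\<gamma> \<in> E \<and> (\<forall>\<alpha>\<in>E. compactly_supported \<alpha> \<longrightarrow> L2_inner A g (D \<alpha>) \<beta> = L2_inner A g \<alpha> \<gamma>)"
    using \<gamma> adj by blast
  fix \<gamma>' assume \<gamma>': "\<gamma>' \<in> E \<and> (\<forall>\<alpha>\<in>E. compactly_supported \<alpha> \<longrightarrow> L2_inner A g (D \<alpha>) \<beta> = L2_inner A g \<alpha> \<gamma>')"
  have "\<gamma>' - \<gamma> = 0"
  proof (rule L2_nondegenerate[OF E])
    show "\<gamma>' - \<gamma> \<in> E" using \<gamma> \<gamma>' submoduleD(7)[OF E] by blast
    fix \<alpha> assume \<alpha>: "\<alpha> \<in> E" "compactly_supported \<alpha>"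
    obtain K where K: "compact K" "supported K \<alpha>" using compactly_supportedE[OF \<alpha>(2)] by blast
    show "L2_inner A g \<alpha> (\<gamma>' - \<gamma>) = 0"
      using L2_inner_diff_right(1)[OF submoduleD(1)[OF E \<alpha>(1)] submoduleD(1)[OF E] submoduleD(1)[OF E] K] \<gamma> \<gamma>' adj \<alpha> by auto
  qed
  then show "\<gamma>' = \<gamma>" by simp
qed

end

section \<open>The codifferential\<close>

context riemannian_atlas
begin

text \<open>The coordinate formula taken separately in every chart. That the results fit together to
  a form is proved only in \<open>codiff_chart\<close>.\<close>

definition codiff :: "('m, 'n) form \<Rightarrow> ('m, 'n) form" where
  "codiff \<beta> c p = (if c \<in> A \<and> p \<in> fst c
     then codloc (\<lambda>x. gram g c (chart_inv c x)) (fam \<beta> c) (snd c p) else 0)"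

lemma fam_codiff:
  "c \<in> A \<Longrightarrow> x \<in> chart_image c \<Longrightarrow> fam (codiff \<beta>) c x = codloc (\<lambda>x. gram g c (chart_inv c x)) (fam \<beta> c) x"
  by (simp add: fam_def[of "codiff \<beta>"] codiff_def)

lemma smooth_family_codiff:
  assumes "\<beta> \<in> Forms A" "c \<in> A" shows "smooth_family (chart_image c) (fam (codiff \<beta>) c)"
  by (rule smooth_family_cong[OF chart_open(2)[OF assms(2)] _ smooth_family_codloc[OF gram_metric[OF assms(2)] Forms_family[OF assms]]])
    (simp add: fam_codiff assms)

lemma compact_snd_image:
  assumes "c \<in> A" "compact K" "K \<subseteq> fst c" shows "compact (snd c ` K)" "snd c ` K \<subseteq> chart_image c"
  using compact_continuous_image[OF continuous_on_subset[OF continuous_chart[OF assms(1)] assms(3)] assms(2)] assms(3)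
  by (auto simp: chart_image_def)

lemma ext_d_supported:
  assumes "\<alpha> \<in> Forms A" "closed K" "supported K \<alpha>" shows "supported K (ext_d \<alpha>)"
  unfolding supported_def
proof (intro allI impI)
  fix c p assume p: "p \<notin> K"
  show "ext_d \<alpha> c p = 0"
  proof (cases "c \<in> A \<and> p \<in> fst c")
    case True
    then have c: "c \<in> A" "p \<in> fst c" by auto
    let ?S = "snd c ` (- K \<inter> fst c)"
    have "dloc (fam \<alpha> c) (snd c p) = dloc (\<lambda>_. 0) (snd c p)"
    proof (rule dloc_cong)
      show "open ?S" by (rule chart_image_open[OF c(1)]) (use assms(2) chart_open(1)[OF c(1)] in auto)
      show "snd c p \<in> ?S" using c p by auto
      show "fam \<alpha> c y = 0" if "y \<in> ?S" for y
        using that c(1) supportedD[OF assms(3), of _ c] by (auto simp: fam_def)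
    qed
    also have "\<dots> = 0" by (simp add: dloc_def pdiff_def fun_eq_iff fun_sum_apply wedge_zero[unfolded zero_fun_def])
    finally show ?thesis unfolding ext_d_dloc[OF assms(1) c] .
  qed (use Forms_zero[OF Forms_ext_d[OF assms(1)]] in blast)
qed

text \<open>The pairing \<open>h\<close> is formed in the single chart \<open>c\<close>, since
  \<open>codiff \<beta>\<close> is not yet known to be a form. The difference of the two integrals
  is that of a divergence with compact support in the chart.\<close>

lemma local_adjoint:
  assumes \<alpha>: "\<alpha> \<in> Forms A" and \<beta>: "\<beta> \<in> Forms A" and c: "c \<in> A" and K: "compact K" "K \<subseteq> fst c" "supported K \<alpha>"
  defines "h \<equiv> \<lambda>p. if p \<in> fst c then alt_inner (gram g c p) (\<alpha> c p) (codiff \<beta> c p) else 0"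
  shows "smooth_fun A h" "L2_inner A g (ext_d \<alpha>) \<beta> = (\<integral>p. h p \<partial>RM)"
proof -
  let ?S = "chart_image c" and ?G = "\<lambda>x. gram g c (chart_inv c x)"
  let ?a = "fam \<alpha> c" and ?b = "fam \<beta> c" and ?K = "snd c ` K"
  note fa = Forms_family[OF \<alpha> c] and fb = Forms_family[OF \<beta> c] and fg = smooth_family_codiff[OF \<beta> c]
  note oS = chart_open(2)[OF c] and K' = compact_snd_image[OF c K(1,2)]
  have clK: "closed ?K" by (rule compact_imp_closed[OF K'(1)])
  have azero: "?a x = 0" if "x \<in> ?S" "x \<notin> ?K" for x
  proof -
    have "chart_inv c x \<notin> K" using that c snd_chart_inv[OF c that(1)] by (metis imageI)
    then show ?thesis using supportedD[OF K(3)] by (simp add: fam_def fun_eq_iff)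
  qed
  have "smooth_fun A (\<lambda>p. if p \<in> fst c then alt_inner (?G (snd c p)) (?a (snd c p)) (fam (codiff \<beta>) c (snd c p)) else 0)"
  proof (rule smooth_fun_extend[OF c smooth_on_alt_inner[OF c fa fg] K(1,2)])
    fix p assume p: "p \<in> fst c" "p \<notin> K"
    have "?a (snd c p) = 0" unfolding fam_snd[OF c p(1)] by (rule supportedD[OF K(3) p(2)])
    then show "alt_inner (?G (snd c p)) (?a (snd c p)) (fam (codiff \<beta>) c (snd c p)) = 0" by (simp only: alt_inner_linear)
  qed
  also have "(\<lambda>p. if p \<in> fst c then alt_inner (?G (snd c p)) (?a (snd c p)) (fam (codiff \<beta>) c (snd c p)) else 0) = h"
    unfolding h_def using c by (auto simp: fam_snd fun_eq_iff)
  finally show h: "smooth_fun A h" .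
  have dsup: "supported K (ext_d \<alpha>)" by (rule ext_d_supported[OF \<alpha> compact_imp_closed[OF K(1)] K(3)])
  have dzero: "dloc ?a x = 0" if "x \<in> ?S" "x \<notin> ?K" for x
  proof -
    have "chart_inv c x \<notin> K" using that c snd_chart_inv[OF c that(1)] by (metis imageI)
    then show ?thesis using supportedD[OF dsup] fam_ext_d[OF \<alpha> c that(1)] by (simp add: fam_def[of "ext_d \<alpha>"])
  qed
  let ?u = "\<lambda>x. chart_vol c x * alt_inner (?G x) (dloc ?a x) (?b x)"
  let ?v = "\<lambda>x. chart_vol c x * alt_inner (?G x) (?a x) (fam (codiff \<beta>) c x)"
  have "L2_inner A g (ext_d \<alpha>) \<beta> = (\<integral>x. indicator ?S x * (chart_vol c x * form_inner A g (ext_d \<alpha>) \<beta> (chart_inv c x)) \<partial>lborel)"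
    unfolding L2_inner_def
  proof (rule integral_chart[OF c])
    show "form_inner A g (ext_d \<alpha>) \<beta> \<in> borel_measurable borel"
      by (intro borel_measurable_continuous_onI smooth_fun_continuous smooth_fun_form_inner Forms_ext_d \<alpha> \<beta>)
    show "form_inner A g (ext_d \<alpha>) \<beta> p = 0" if "p \<notin> fst c" for p
      by (rule form_inner_supported[OF dsup]) (use that K(2) in auto)
  qed
  also have "\<dots> = (\<integral>x. (if x \<in> ?S then ?u x else 0) \<partial>lborel)"
    using form_inner_cinn[OF Forms_ext_d[OF \<alpha>] \<beta> c] c fam_ext_d[OF \<alpha> c]
    by (intro Bochner_Integration.integral_cong refl) (auto simp: cinn_def fam_def indicator_def)
  finally have 1: "L2_inner A g (ext_d \<alpha>) \<beta> = (\<integral>x. (if x \<in> ?S then ?u x else 0) \<partial>lborel)" .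
  have "(\<integral>p. h p \<partial>RM) = (\<integral>x. indicator ?S x * (chart_vol c x * h (chart_inv c x)) \<partial>lborel)"
    by (rule integral_chart[OF c borel_measurable_continuous_onI[OF smooth_fun_continuous[OF h]]]) (simp add: h_def)
  also have "\<dots> = (\<integral>x. (if x \<in> ?S then ?v x else 0) \<partial>lborel)"
    using c by (intro Bochner_Integration.integral_cong refl) (auto simp: h_def fam_def indicator_def)
  finally have 2: "(\<integral>p. h p \<partial>RM) = (\<integral>x. (if x \<in> ?S then ?v x else 0) \<partial>lborel)" .
  have int: "integrable lborel (\<lambda>x. if x \<in> ?S then f x else 0)"
    if "smooth_on ?S f" "\<And>x. x \<in> ?S \<Longrightarrow> x \<notin> ?K \<Longrightarrow> f x = 0" for f :: "real^'n \<Rightarrow> real"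
    by (rule integrable_compact_support[OF smooth_on_continuous[OF smooth_on_extend[OF oS that(1) clK K'(2) that(2)]] K'(1)])
      (use that(2) in auto)
  have iu: "integrable lborel (\<lambda>x. if x \<in> ?S then ?u x else 0)"
    by (rule int) (auto intro!: smooth_on_mult chart_vol_smooth smooth_on_alt_inner smooth_family_dloc c oS fa fb
        simp: dzero alt_inner_linear)
  have iv: "integrable lborel (\<lambda>x. if x \<in> ?S then ?v x else 0)"
    by (rule int) (auto intro!: smooth_on_mult chart_vol_smooth smooth_on_alt_inner c oS fa fg simp: azero alt_inner_linear)
  let ?F = "\<lambda>j x. if x \<in> ?S then flux ?G ?a ?b j x else 0"
  have sF: "smooth_on UNIV (?F j)" and F0: "x \<notin> ?K \<Longrightarrow> ?F j x = 0" for j x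
  proof -
    have z: "flux ?G ?a ?b j x = 0" if "x \<in> ?S" "x \<notin> ?K" for x
      using azero[OF that] by (simp add: flux_def alt_inner_linear)
    show "smooth_on UNIV (?F j)"
      by (rule smooth_on_extend[OF oS smooth_on_flux[OF gram_metric[OF c] fa fb] clK K'(2) z])
    show "x \<notin> ?K \<Longrightarrow> ?F j x = 0" using z by auto
  qed
  have iF: "integrable lborel (\<lambda>x. frechet_derivative (?F j) (at x) v)" for j v
  proof (rule integrable_compact_support[OF smooth_on_continuous[OF smooth_on_frechet[OF sF]] K'(1)])
    fix x assume "x \<notin> ?K"
    then have "frechet_derivative (?F j) (at x) = frechet_derivative (\<lambda>_. 0) (at x)"
      by (intro frechet_derivative_cong_open(1)[of "- ?K"]) (use clK F0 in auto)
    then show "frechet_derivative (?F j) (at x) v = 0" by simp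
  qed
  have div: "(if x \<in> ?S then ?u x else 0) - (if x \<in> ?S then ?v x else 0) = (\<Sum>j\<in>UNIV. frechet_derivative (?F j) (at x) (axis j 1))" for x
  proof (cases "x \<in> ?S")
    case True
    have "frechet_derivative (?F j) (at x) = frechet_derivative (flux ?G ?a ?b j) (at x)" for j
      by (rule frechet_derivative_cong_open(1)[OF oS True]) simp
    then show ?thesis
      using codifferential_divergence[OF gram_metric[OF c] fa fb True] True
      by (simp add: chart_vol_def fam_codiff[OF c True])
  next
    case False
    then have "x \<notin> ?K" using K'(2) by blast
    then have "frechet_derivative (?F j) (at x) = frechet_derivative (\<lambda>_. 0) (at x)" for j
      by (intro frechet_derivative_cong_open(1)[of "- ?K"]) (use clK F0 in auto)
    then show ?thesis using False by simp
  qed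
  have "L2_inner A g (ext_d \<alpha>) \<beta> - (\<integral>p. h p \<partial>RM)
      = (\<integral>x. (if x \<in> ?S then ?u x else 0) - (if x \<in> ?S then ?v x else 0) \<partial>lborel)"
    unfolding 1 2 by (rule Bochner_Integration.integral_diff[OF iu iv, symmetric])
  also have "\<dots> = (\<Sum>j\<in>UNIV. \<integral>x. frechet_derivative (?F j) (at x) (axis j 1) \<partial>lborel)"
    unfolding div by (rule Bochner_Integration.integral_sum) (rule iF)
  also have "\<dots> = 0"
    by (rule sum.neutral) (use integral_frechet_derivative_zero[OF sF K'(1) F0] in blast)
  finally show "L2_inner A g (ext_d \<alpha>) \<beta> = (\<integral>p. h p \<partial>RM)" by simp
qed

text \<open>Let \<open>\<delta>\<close> be the discrepancy between the two charts and
  \<open>\<alpha>\<close> the form \<open>\<psi> \<delta>\<close>. By \<open>local_adjoint\<close>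
  the pairing of \<open>\<alpha>\<close> with either local codifferential has the integral
  \<open>L2_inner A g (ext_d \<alpha>) \<beta>\<close>, so the integral of \<open>\<psi>\<close>
  times the squared norm of \<open>\<delta>\<close> is 0.\<close>

lemma codiff_chart:
  assumes \<beta>: "\<beta> \<in> Forms A" and c: "c \<in> A" "c' \<in> A" "p \<in> fst c" "p \<in> fst c'"
  shows "codiff \<beta> c p = pull ((*v) (tmat c c' p)) (codiff \<beta> c' p)"
proof -
  obtain \<psi> K where \<psi>: "smooth_fun A \<psi>" "\<And>q. \<psi> q \<ge> 0" "compact K" "K \<subseteq> fst c \<inter> fst c'" "\<And>q. q \<notin> K \<Longrightarrow> \<psi> q = 0"
    "\<exists>V. open V \<and> p \<in> V \<and> (\<forall>q\<in>V. \<psi> q = 1)"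
    by (rule bump_exists[where W = "fst c \<inter> fst c'" and p = p, OF open_Int[OF chart_open(1)[OF c(1)] chart_open(1)[OF c(2)]]
        IntI[OF c(3,4)]]) auto
  \<comment> \<open>The cut-off codifferential computed in one chart \<open>e\<close>, as a global
    form; the difference of two such is a legitimate test form before chart independence is
    known.\<close>
  define ext where "ext e = ext_form e (\<lambda>x. tscale (\<psi> (chart_inv e x)) (fam (codiff \<beta>) e x))" for e
  have ext: "ext e \<in> Forms A" "supported K (ext e)" "\<And>q. q \<in> fst e \<Longrightarrow> ext e e q = tscale (\<psi> q) (codiff \<beta> e q)"
    if e: "e \<in> A" "K \<subseteq> fst e" for e
  proof -
    have z: "tscale (\<psi> (chart_inv e (snd e q))) (fam (codiff \<beta>) e (snd e q)) = 0" if "q \<in> fst e" "q \<notin> K" for q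
      using that e(1) \<psi>(5) by simp
    have "smooth_family (chart_image e) (\<lambda>x. tscale (\<psi> (chart_inv e x)) (fam (codiff \<beta>) e x))"
      by (intro smooth_family_tscale chart_open(2) smooth_fun_chart smooth_family_codiff \<psi>(1) e(1) \<beta>)
    then show "ext e \<in> Forms A" unfolding ext_def by (rule Forms_ext_form[OF e(1) _ \<psi>(3) e(2)]) (rule z)
    show "supported K (ext e)" unfolding ext_def by (rule ext_form_supported[OF e(1)]) (rule z)
    show "ext e e q = tscale (\<psi> q) (codiff \<beta> e q)" if "q \<in> fst e" for q
      unfolding ext_def ext_form_self[OF e(1) that] chart_inv_snd[OF e(1) that] fam_snd[OF e(1) that] by (rule refl)
  qed
  have Kc: "K \<subseteq> fst c" "K \<subseteq> fst c'" using \<psi>(4) by auto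
  note e = ext[OF c(1) Kc(1)] and e' = ext[OF c(2) Kc(2)]
  define \<alpha> where "\<alpha> = ext c - ext c'"
  define \<delta> where "\<delta> q = codiff \<beta> c q - pull ((*v) (tmat c c' q)) (codiff \<beta> c' q)" for q
  have \<alpha>: "\<alpha> \<in> Forms A" unfolding \<alpha>_def by (rule Forms_diff[OF e(1) e'(1)])
  have sup: "supported K \<alpha>" using e(2) e'(2) unfolding supported_def \<alpha>_def by (simp del: split_paired_All)
  have \<alpha>c: "\<alpha> c q = tscale (\<psi> q) (\<delta> q)" if q: "q \<in> fst c" "q \<in> fst c'" for q
    using e(3)[OF q(1)] e'(3)[OF q(2)] Forms_pull[OF e'(1) c(1,2) q]
    by (simp add: \<alpha>_def \<delta>_def pull_tscale tscale_diff)
  let ?h = "\<lambda>e q. if q \<in> fst e then alt_inner (gram g e q) (\<alpha> e q) (codiff \<beta> e q) else 0"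
  note h = local_adjoint[OF \<alpha> \<beta> c(1) \<psi>(3) Kc(1) sup] and h' = local_adjoint[OF \<alpha> \<beta> c(2) \<psi>(3) Kc(2) sup]
  have alt: "alternating (codiff \<beta> e q)" if "e \<in> A" "q \<in> fst e" for e q
    using smooth_familyD[OF smooth_family_codiff[OF \<beta> that(1)], of "snd e q"] that by (simp add: fam_snd)
  have alt\<delta>: "alternating (\<delta> q)" if q: "q \<in> fst c" "q \<in> fst c'" for q
    unfolding \<delta>_def by (intro alternating_diff alternating_pull_matrix alt c q)
  have diff: "?h c q - ?h c' q = \<psi> q * alt_inner (gram g c q) (\<delta> q) (\<delta> q)" if q: "q \<in> fst c" "q \<in> fst c'" for q
  proof -
    have "alt_inner (gram g c' q) (\<alpha> c' q) (codiff \<beta> c' q)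
      = alt_inner (gram g c q) (pull ((*v) (tmat c c' q)) (\<alpha> c' q)) (pull ((*v) (tmat c c' q)) (codiff \<beta> c' q))"
      by (rule alt_inner_pull[symmetric])
        (intro gram_spd tmat_inverse gram_pull alt Forms_alternating \<alpha> c q)+
    also have "\<dots> = alt_inner (gram g c q) (\<alpha> c q) (codiff \<beta> c q - \<delta> q)"
      unfolding Forms_pull[OF \<alpha> c(1,2) q, symmetric] by (simp add: \<delta>_def)
    finally show ?thesis using q by (simp add: alt_inner_linear \<alpha>c)
  qed
  have out: "?h c q - ?h c' q = 0" if "q \<notin> K" for q
    using supportedD[OF sup that] by (simp add: alt_inner_linear)
  let ?F = "\<lambda>q. ?h c q - ?h c' q"
  have cont: "continuous_on UNIV (?h c)" "continuous_on UNIV (?h c')"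
    by (rule smooth_fun_continuous, rule h(1), rule smooth_fun_continuous, rule h'(1))
  have "?F p = 0"
  proof (rule integral_RM_zero[OF _ \<psi>(3) out])
    show "continuous_on UNIV ?F" by (rule continuous_on_diff[OF cont])
    show "?F q \<ge> 0" for q
    proof (cases "q \<in> K")
      case True
      then have q: "q \<in> fst c" "q \<in> fst c'" using Kc by auto
      show ?thesis unfolding diff[OF q] using \<psi>(2) alt_inner_nonneg[OF gram_spd[OF c(1) q(1)] alt\<delta>[OF q]] by simp
    next
      case False
      then show ?thesis using out by simp
    qed
    have "integrable RM (?h c)" "integrable RM (?h c')"
      by (rule integrable_RM[OF cont(1) \<psi>(3)], use supportedD[OF sup] in \<open>simp add: alt_inner_linear\<close>,
          rule integrable_RM[OF cont(2) \<psi>(3)], use supportedD[OF sup] in \<open>simp add: alt_inner_linear\<close>)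
    then show "(\<integral>q. ?F q \<partial>RM) = 0" using h(2) h'(2) by (subst Bochner_Integration.integral_diff) auto
  qed
  then have "alt_inner (gram g c p) (\<delta> p) (\<delta> p) = 0" using diff[OF c(3,4)] \<psi>(6) by auto
  then have "\<delta> p = 0" by (rule alt_inner_eq_0[OF gram_spd[OF c(1,3)] alt\<delta>[OF c(3,4)]])
  then show ?thesis by (simp add: \<delta>_def)
qed

lemma Forms_codiff:
  assumes "\<beta> \<in> Forms A" shows "codiff \<beta> \<in> Forms A"
  by (rule FormsI[OF _ smooth_family_codiff[OF assms] codiff_chart[OF assms]]) (auto simp: codiff_def)

lemma ext_d_diff:
  assumes "\<eta> \<in> Forms A" "\<theta> \<in> Forms A" shows "ext_d (\<eta> - \<theta>) = ext_d \<eta> - ext_d \<theta>"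
  using ext_d_add[OF assms(1) Forms_minus[OF assms(2)]] ext_d_cmult[OF assms(2), of "-1"] by (simp add: cmult_minus)

lemma ext_d_zero: "ext_d (0 :: ('m, 'n) form) = 0"
  using ext_d_diff[OF Forms_zero_mem Forms_zero_mem] by simp

lemma L2_inner_zero: "L2_inner A g 0 \<beta> = 0" "L2_inner A g \<beta> 0 = 0"
  by (simp_all add: L2_inner_def form_inner_def Let_def alt_inner_linear)

text \<open>Instead of a partition of unity, one neighbourhood is removed at a time:
  \<open>\<psi> \<alpha>\<close> is supported in a chart, while
  \<open>\<alpha> - \<psi> \<alpha>\<close> is supported in \<open>K - V\<close>, which the
  remaining sets cover.\<close>

lemma codiff_adjoint_cover:
  assumes "finite \<F>" "\<beta> \<in> Forms A" "\<alpha> \<in> Forms A" "compact K" "supported K \<alpha>" "K \<subseteq> \<Union>\<F>"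
    and "\<And>V. V \<in> \<F> \<Longrightarrow> open V \<and> (\<exists>c\<in>A. \<exists>\<psi> C. smooth_fun A \<psi> \<and> compact C \<and> C \<subseteq> fst c \<and>
      (\<forall>q. q \<notin> C \<longrightarrow> \<psi> q = 0) \<and> (\<forall>q\<in>V. \<psi> q = 1))"
  shows "L2_inner A g (ext_d \<alpha>) \<beta> = L2_inner A g \<alpha> (codiff \<beta>)"
  using assms(1,3-7)
proof (induction \<F> arbitrary: \<alpha> K rule: finite_induct)
  case empty
  then have "\<alpha> c p = 0" for c p by (intro supportedD[OF empty.prems(3)]) auto
  then have "\<alpha> = 0" by (simp add: fun_eq_iff)
  then show "L2_inner A g (ext_d \<alpha>) \<beta> = L2_inner A g \<alpha> (codiff \<beta>)" by (simp add: ext_d_zero L2_inner_zero)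
next
  case (insert V \<F>)
  note \<alpha> = insert.prems(1) and K = insert.prems(2,3)
  obtain c \<psi> C where c: "c \<in> A" and \<psi>: "smooth_fun A \<psi>" "compact C" "C \<subseteq> fst c" "\<forall>q. q \<notin> C \<longrightarrow> \<psi> q = 0" "\<forall>q\<in>V. \<psi> q = 1"
    using insert.prems(5)[of V] by blast
  have V: "open V" using insert.prems(5)[of V] by blast
  let ?\<alpha> = "fmult \<psi> \<alpha>"
  have F: "?\<alpha> \<in> Forms A" "\<alpha> - ?\<alpha> \<in> Forms A" using \<alpha> \<psi>(1) by (auto intro: Forms_fmult Forms_diff)
  have supC: "supported C ?\<alpha>" using \<psi>(4) by (simp add: supported_def fmult_apply)
  have supK: "supported K ?\<alpha>" by (rule supported_fmult[OF K(2)])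
  have 1: "L2_inner A g (ext_d ?\<alpha>) \<beta> = L2_inner A g ?\<alpha> (codiff \<beta>)"
  proof -
    have "(if p \<in> fst c then alt_inner (gram g c p) (?\<alpha> c p) (codiff \<beta> c p) else 0) = form_inner A g ?\<alpha> (codiff \<beta>) p" for p
    proof (cases "p \<in> fst c")
      case True
      then show ?thesis using form_inner_cinn[OF F(1) Forms_codiff[OF assms(2)] c True] by (simp add: cinn_def)
    next
      case False
      then have "p \<notin> C" using \<psi>(3) by blast
      with False show ?thesis using form_inner_supported[OF supC] by simp
    qed
    then show ?thesis using local_adjoint(2)[OF F(1) assms(2) c \<psi>(2,3) supC] unfolding L2_inner_def by simp
  qed
  have 2: "L2_inner A g (ext_d (\<alpha> - ?\<alpha>)) \<beta> = L2_inner A g (\<alpha> - ?\<alpha>) (codiff \<beta>)"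
  proof (rule insert.IH[OF F(2), of "K - V"])
    show "compact (K - V)" using V K(1) by (simp add: compact_diff)
    show "supported (K - V) (\<alpha> - ?\<alpha>)"
      unfolding supported_def using supportedD[OF K(2)] \<psi>(5) by (auto simp: fmult_apply fun_eq_iff simp del: split_paired_All)
    show "K - V \<subseteq> \<Union>\<F>" using insert.prems(4) by auto
  qed (rule insert.prems(5), blast)
  have clK: "closed K" by (rule compact_imp_closed[OF K(1)])
  have "L2_inner A g (ext_d \<alpha>) \<beta> - L2_inner A g (ext_d ?\<alpha>) \<beta> = L2_inner A g \<alpha> (codiff \<beta>) - L2_inner A g ?\<alpha> (codiff \<beta>)"
    using 2 unfolding ext_d_diff[OF \<alpha> F(1)]
      L2_inner_diff_left(1)[OF Forms_ext_d[OF \<alpha>] Forms_ext_d[OF F(1)] assms(2) K(1) ext_d_supported[OF \<alpha> clK K(2)] ext_d_supported[OF F(1) clK supK]]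
      L2_inner_diff_left(1)[OF \<alpha> F(1) Forms_codiff[OF assms(2)] K supK] .
  then show "L2_inner A g (ext_d \<alpha>) \<beta> = L2_inner A g \<alpha> (codiff \<beta>)" using 1 by simp
qed

lemma codiff_adjoint:
  assumes "\<alpha> \<in> Forms A" "\<beta> \<in> Forms A" "compactly_supported \<alpha>"
  shows "L2_inner A g (ext_d \<alpha>) \<beta> = L2_inner A g \<alpha> (codiff \<beta>)"
proof -
  obtain K where K: "compact K" "supported K \<alpha>" using compactly_supportedE[OF assms(3)] by blast
  define N where "N V \<longleftrightarrow> open V \<and> (\<exists>c\<in>A. \<exists>\<psi> C. smooth_fun A \<psi> \<and> compact C \<and> C \<subseteq> fst c \<and>
      (\<forall>q. q \<notin> C \<longrightarrow> \<psi> q = 0) \<and> (\<forall>q\<in>V. \<psi> q = 1))" for V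
  have "\<exists>V. p \<in> V \<and> N V" for p
  proof -
    obtain c where c: "c \<in> A" "p \<in> fst c" using chart_cover by blast
    obtain \<psi> C where "smooth_fun A \<psi>" "\<And>q. \<psi> q \<ge> 0" "compact C" "C \<subseteq> fst c" "\<And>q. q \<notin> C \<Longrightarrow> \<psi> q = 0"
      "\<exists>V. open V \<and> p \<in> V \<and> (\<forall>q\<in>V. \<psi> q = 1)"
      by (rule bump_exists[OF chart_open(1)[OF c(1)] c(2)]) auto
    then show ?thesis unfolding N_def using c(1) by blast
  qed
  then have "K \<subseteq> \<Union>{V. N V}" by auto
  moreover have "open V" if "V \<in> {V. N V}" for V using that by (simp add: N_def)
  ultimately obtain \<F> where \<F>: "\<F> \<subseteq> {V. N V}" "finite \<F>" "K \<subseteq> \<Union>\<F>"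
    using compactE[OF K(1), of "{V. N V}"] by metis
  show ?thesis
  proof (rule codiff_adjoint_cover[OF \<F>(2) assms(2,1) K \<F>(3)])
    fix V assume "V \<in> \<F>"
    then have "N V" using \<F>(1) by blast
    then show "open V \<and> (\<exists>c\<in>A. \<exists>\<psi> C. smooth_fun A \<psi> \<and> compact C \<and> C \<subseteq> fst c \<and>
      (\<forall>q. q \<notin> C \<longrightarrow> \<psi> q = 0) \<and> (\<forall>q\<in>V. \<psi> q = 1))" unfolding N_def .
  qed
qed

section \<open>The adjoint \<open>d_star\<close> and its algebraic rules\<close>

lemma d_star_codiff:
  assumes "\<beta> \<in> Forms A" shows "d_star A g \<beta> = codiff \<beta>"
  unfolding d_star_def
  by (rule formal_adjoint_eq[OF submodule_Forms Forms_ext_d Forms_codiff[OF assms]]) (auto intro: codiff_adjoint assms)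

lemma Forms_d_star: "\<beta> \<in> Forms A \<Longrightarrow> d_star A g \<beta> \<in> Forms A"
  by (simp add: d_star_codiff Forms_codiff)

lemma d_star_adjoint:
  assumes "\<alpha> \<in> Forms A" "\<beta> \<in> Forms A" "compactly_supported \<alpha>"
  shows "L2_inner A g (ext_d \<alpha>) \<beta> = L2_inner A g \<alpha> (d_star A g \<beta>)"
  by (simp add: d_star_codiff assms codiff_adjoint)

lemma HForms_d_star:
  assumes "\<beta> \<in> HForms k" shows "d_star A g \<beta> \<in> HForms (k - 1)"
proof (rule HFormsI[OF Forms_d_star[OF HFormsD(1)[OF assms]]])
  fix c p assume *: "c \<in> A" "p \<in> fst c"
  have "homog (k - 1) (codloc (\<lambda>x. gram g c (chart_inv c x)) (fam \<beta> c) (snd c p))"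
    by (rule homog_codloc[OF chart_open(2)[OF *(1)]]) (use * HFormsD(2)[OF assms] in \<open>auto simp: fam_def\<close>)
  then show "homog (k - 1) (d_star A g \<beta> c p)"
    unfolding d_star_codiff[OF HFormsD(1)[OF assms]] codiff_def using * by simp
qed

lemma d_star_fmult:
  assumes "\<beta> \<in> Forms A" "smooth_fun A f" "c \<in> A" "p \<in> fst c"
  shows "d_star A g (fmult f \<beta>) c p = tscale (f p) (d_star A g \<beta> c p) - contr (matrix_inv (gram g c p) *v dfun f c p) (\<beta> c p)"
proof -
  have "fam (fmult f \<beta>) c = (\<lambda>x. tscale (f (chart_inv c x)) (fam \<beta> c x))"
    by (simp add: fam_def[abs_def] fmult_apply)
  then show ?thesis
    unfolding d_star_codiff[OF assms(1)] d_star_codiff[OF Forms_fmult[OF assms(1,2)]] codiff_def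
    using codloc_tscale[OF gram_metric[OF assms(3)] Forms_family[OF assms(1,3)] smooth_fun_chart[OF assms(2,3)], of "snd c p"]
      assms(3,4)
    by (simp add: fam_snd dfun_def)
qed

lemma d_star_cmult:
  assumes "\<beta> \<in> Forms A" shows "d_star A g (cmult r \<beta>) = cmult r (d_star A g \<beta>)"
proof (rule Forms_eqI)
  fix c p assume c: "c \<in> A" "p \<in> fst c"
  show "d_star A g (cmult r \<beta>) c p = cmult r (d_star A g \<beta>) c p"
    unfolding cmult_def d_star_fmult[OF assms smooth_fun_const c] fmult_apply dfun_const[OF c(1)]
    using contr_linear_comb(4)[OF Forms_alternating[OF assms c]] by simp
qed (intro Forms_d_star Forms_cmult assms)+

lemma formal_adjoint_unique:
  assumes "submodule E" "\<gamma> \<in> E" "\<gamma>' \<in> E"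
    and eq: "\<And>\<alpha> K. \<alpha> \<in> E \<Longrightarrow> compact K \<Longrightarrow> supported K \<alpha> \<Longrightarrow> L2_inner A g \<alpha> \<gamma> = L2_inner A g \<alpha> \<gamma>'"
  shows "\<gamma> = \<gamma>'"
proof -
  have "\<gamma> - \<gamma>' = 0"
  proof (rule L2_nondegenerate[OF assms(1) submoduleD(7)[OF assms(1-3)]])
    fix \<alpha> assume \<alpha>: "\<alpha> \<in> E" "compactly_supported \<alpha>"
    obtain K where K: "compact K" "supported K \<alpha>" using compactly_supportedE[OF \<alpha>(2)] by blast
    note F = submoduleD(1)[OF assms(1)]
    show "L2_inner A g \<alpha> (\<gamma> - \<gamma>') = 0"
      using L2_inner_diff_right(1)[OF F[OF \<alpha>(1)] F[OF assms(2)] F[OF assms(3)] K] eq[OF \<alpha>(1) K] by simp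
  qed
  then show ?thesis by simp
qed

lemma d_star_add:
  assumes "\<beta> \<in> Forms A" "\<beta>' \<in> Forms A"
  shows "d_star A g (\<beta> + \<beta>') = d_star A g \<beta> + d_star A g \<beta>'"
proof (rule formal_adjoint_unique[OF submodule_Forms])
  fix \<alpha> K assume \<alpha>: "\<alpha> \<in> Forms A" and K: "compact K" "supported K \<alpha>"
  note s = ext_d_supported[OF \<alpha> compact_imp_closed[OF K(1)] K(2)] and cs = compactly_supportedI[OF K]
  show "L2_inner A g \<alpha> (d_star A g (\<beta> + \<beta>')) = L2_inner A g \<alpha> (d_star A g \<beta> + d_star A g \<beta>')"
    unfolding L2_inner_diff_right(2)[OF \<alpha> Forms_d_star[OF assms(1)] Forms_d_star[OF assms(2)] K]
      d_star_adjoint[OF \<alpha> assms(1) cs, symmetric] d_star_adjoint[OF \<alpha> assms(2) cs, symmetric]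
      d_star_adjoint[OF \<alpha> Forms_add[OF assms] cs, symmetric]
    by (rule L2_inner_diff_right(2)[OF Forms_ext_d[OF \<alpha>] assms K(1) s])
qed (intro Forms_add Forms_d_star assms)+

lemma d_star_d_star:
  assumes "\<beta> \<in> Forms A" shows "d_star A g (d_star A g \<beta>) = 0"
proof (rule formal_adjoint_unique[OF submodule_Forms])
  fix \<alpha> K assume \<alpha>: "\<alpha> \<in> Forms A" and K: "compact K" "supported K \<alpha>"
  note s = ext_d_supported[OF \<alpha> compact_imp_closed[OF K(1)] K(2)]
  show "L2_inner A g \<alpha> (d_star A g (d_star A g \<beta>)) = L2_inner A g \<alpha> 0"
    using d_star_adjoint[OF \<alpha> Forms_d_star[OF assms] compactly_supportedI[OF K]]
      d_star_adjoint[OF Forms_ext_d[OF \<alpha>] assms compactly_supportedI[OF K(1) s]]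
    by (simp add: ext_d_ext_d[OF \<alpha>] L2_inner_zero)
qed (intro Forms_d_star Forms_zero_mem assms)+

end

section \<open>The Laplacians on primitive middle forms\<close>

lemma cmult_simps:
  "cmult r 0 = 0" "cmult 0 \<eta> = 0" "cmult 1 \<eta> = \<eta>" "cmult r (cmult s \<eta>) = cmult (r * s) \<eta>"
  "cmult r (\<eta> + \<theta>) = cmult r \<eta> + cmult r \<theta>" "cmult r (\<eta> - \<theta>) = cmult r \<eta> - cmult r \<theta>"
  "cmult r (- \<eta>) = - cmult r \<eta>" "cmult (r + s) \<eta> = cmult r \<eta> + cmult s \<eta>" "cmult (r - s) \<eta> = cmult r \<eta> - cmult s \<eta>"
  by (simp_all add: cmult_def fmult_def fun_eq_iff algebra_simps del: split_paired_All)

context atlas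
begin

lemma linear_opD:
  assumes "linear_op (Forms A) (Forms A) F" "\<eta> \<in> Forms A" "\<theta> \<in> Forms A"
  shows "F \<eta> \<in> Forms A" "F (\<eta> + \<theta>) = F \<eta> + F \<theta>" "F (cmult r \<eta>) = cmult r (F \<eta>)" "F (- \<eta>) = - F \<eta>"
    "F (\<eta> - \<theta>) = F \<eta> - F \<theta>" "F 0 = 0"
proof -
  show a: "F \<eta> \<in> Forms A" "F (\<eta> + \<theta>) = F \<eta> + F \<theta>" "F (cmult r \<eta>) = cmult r (F \<eta>)" for r
    using assms by (auto simp: linear_op_def)
  have m: "F (- \<eta>) = - F \<eta>" if "\<eta> \<in> Forms A" for \<eta>
    using assms(1) that unfolding linear_op_def cmult_minus[symmetric] by blast
  show "F (- \<eta>) = - F \<eta>" by (rule m[OF assms(2)])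
  have "F (\<eta> + - \<theta>) = F \<eta> + F (- \<theta>)"
    using assms Forms_minus unfolding linear_op_def by blast
  then show "F (\<eta> - \<theta>) = F \<eta> - F \<theta>" by (simp add: m[OF assms(3)])
  show "F 0 = 0" using a(3)[of 0] by (simp add: cmult_simps)
qed

lemma linear_op_compose:
  "linear_op E E' F \<Longrightarrow> linear_op E' E'' F' \<Longrightarrow> linear_op E E'' (\<lambda>\<eta>. F' (F \<eta>))"
  by (simp add: linear_op_def)

lemma linear_op_diff:
  assumes "linear_op E (Forms A) F" "linear_op E (Forms A) F'" shows "linear_op E (Forms A) (\<lambda>\<eta>. F \<eta> - F' \<eta>)"
  using assms unfolding linear_op_def by (auto simp: Forms_diff cmult_simps)

lemma linear_op_ext_d: "linear_op (Forms A) (Forms A) ext_d"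
  by (simp add: linear_op_def Forms_ext_d ext_d_add ext_d_cmult)

end

context almost_kaehler
begin

abbreviation ds :: "('m, 'n) form \<Rightarrow> ('m, 'n) form" where "ds \<equiv> d_star A g"

lemma linear_op_L: "linear_op (Forms A) (Forms A) L"
  by (simp add: linear_op_def Forms_L L_linear)

lemma linear_op_Lam: "linear_op (Forms A) (Forms A) Lam"
  by (simp add: linear_op_def Forms_Lam Lam_linear)

lemma linear_op_ds: "linear_op (Forms A) (Forms A) ds"
  by (simp add: linear_op_def Forms_d_star d_star_add d_star_cmult)

lemmas Forms_ops = Forms_ext_d Forms_d_star Forms_L Forms_Lam Forms_zero_mem Forms_add Forms_diff Forms_minus Forms_cmult
lemmas linear_ops = linear_opD(2-)[OF linear_op_ext_d] linear_opD(2-)[OF linear_op_L]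
  linear_opD(2-)[OF linear_op_Lam] linear_opD(2-)[OF linear_op_ds]

lemma ops_zero: "ext_d (0 :: ('m, 'n) form) = 0" "L 0 = 0" "Lam 0 = 0" "ds 0 = 0"
  using linear_ops(5,10,15,20)[OF Forms_zero_mem Forms_zero_mem] by auto

text \<open>\<open>adL k\<close> is \<open>ad(\<Lambda>)^k d\<close>. Since \<open>ad(L) d = 0\<close>, the \<open>sl\<^sub>2\<close>-module spanned by these operators has
  dimension 2, whence \<open>ad(\<Lambda>)^2 d = 0\<close>.\<close>

primrec adL :: "nat \<Rightarrow> ('m, 'n) form \<Rightarrow> ('m, 'n) form" where
  "adL 0 = ext_d"
| "adL (Suc k) = (\<lambda>\<eta>. Lam (adL k \<eta>) - adL k (Lam \<eta>))"

lemma linear_op_adL: "linear_op (Forms A) (Forms A) (adL k)"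
proof (induction k)
  case 0
  show "linear_op (Forms A) (Forms A) (adL 0)" using linear_op_ext_d by simp
next
  case (Suc k)
  show "linear_op (Forms A) (Forms A) (adL (Suc k))"
    unfolding adL.simps
    by (intro linear_op_diff linear_op_compose[OF Suc.IH linear_op_Lam] linear_op_compose[OF linear_op_Lam Suc.IH])
qed

lemma HForms_adL: "\<eta> \<in> HForms j \<Longrightarrow> adL k \<eta> \<in> HForms (j + 1 - 2 * int k)"
proof (induction k arbitrary: j \<eta>)
  case 0
  then show "adL 0 \<eta> \<in> HForms (j + 1 - 2 * int 0)" using HForms_ext_d[OF 0] by simp
next
  case (Suc k)
  have "Lam (adL k \<eta>) \<in> HForms (j + 1 - 2 * int k - 2)" by (rule HForms_Lam[OF Suc.IH[OF Suc.prems]])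
  moreover have "adL k (Lam \<eta>) \<in> HForms (j - 2 + 1 - 2 * int k)" by (rule Suc.IH[OF HForms_Lam[OF Suc.prems]])
  moreover have "j + 1 - 2 * int k - 2 = j + 1 - 2 * int (Suc k)" "j - 2 + 1 - 2 * int k = j + 1 - 2 * int (Suc k)" by simp_all
  ultimately show "adL (Suc k) \<eta> \<in> HForms (j + 1 - 2 * int (Suc k))" unfolding adL.simps by (metis HForms_simple(6))
qed

text \<open>The string relation of \<open>sl\<^sub>2\<close> with lowest term
  \<open>[L, d] = 0\<close>. Passing from \<open>k\<close> to \<open>k + 1\<close> adds the weight
  \<open>1 - 2k\<close> coming from \<open>[\<Lambda>, L]\<close>, and
  \<open>k (2 - k) + (1 - 2k) = (k + 1)(2 - (k + 1))\<close>.\<close>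

lemma L_adL:
  assumes "\<eta> \<in> HForms j"
  shows "L (adL k \<eta>) - adL k (L \<eta>) = cmult (real k * (2 - real k)) (adL (k - 1) \<eta>)"
  using assms
proof (induction k arbitrary: j \<eta>)
  case 0
  then show "L (adL 0 \<eta>) - adL 0 (L \<eta>) = cmult (real 0 * (2 - real 0)) (adL (0 - 1) \<eta>)"
    using ext_d_L[OF HFormsD(1)[OF 0]] by (simp add: cmult_simps)
next
  case (Suc k)
  note \<eta> = HFormsD(1)[OF Suc.prems]
  note T = linear_opD[OF linear_op_adL, of _ _ k]
  have \<Lambda>\<eta>: "Lam \<eta> \<in> HForms (j - 2)" by (rule HForms_Lam[OF Suc.prems])
  have 1: "Lam (L (adL k \<eta>)) = L (Lam (adL k \<eta>)) + cmult (real n - of_int (j + 1 - 2 * int k)) (adL k \<eta>)"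
    by (rule Lam_L[OF HForms_adL[OF Suc.prems]])
  have 2: "adL k (Lam (L \<eta>)) = adL k (L (Lam \<eta>)) + cmult (real n - of_int j) (adL k \<eta>)"
    unfolding Lam_L[OF Suc.prems] using \<eta> by (simp add: T Forms_ops)
  have 3: "Lam (L (adL k \<eta>)) - Lam (adL k (L \<eta>)) = cmult (real k * (2 - real k)) (Lam (adL (k - 1) \<eta>))"
  proof -
    have "L (adL k \<eta>) - adL k (L \<eta>) = cmult (real k * (2 - real k)) (adL (k - 1) \<eta>)" by (rule Suc.IH[OF Suc.prems])
    from arg_cong[OF this, of Lam] show ?thesis
      unfolding linear_ops(14)[OF Forms_L[OF linear_opD(1)[OF linear_op_adL \<eta> \<eta>]] linear_opD(1)[OF linear_op_adL Forms_L[OF \<eta>] \<eta>]]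
        linear_ops(12)[OF linear_opD(1)[OF linear_op_adL \<eta> \<eta>] \<eta>] .
  qed
  have 4: "L (adL k (Lam \<eta>)) - adL k (L (Lam \<eta>)) = cmult (real k * (2 - real k)) (adL (k - 1) (Lam \<eta>))"
    by (rule Suc.IH[OF \<Lambda>\<eta>])
  \<comment> \<open>For \<open>k = 0\<close> the truncated \<open>k - 1\<close> in
    \<open>adL (k - 1)\<close> is harmless because the coefficient vanishes; for positive
    \<open>k\<close> this is the recursion of \<open>adL\<close>.\<close>
  have 5: "cmult (real k * (2 - real k)) (adL k \<eta>) =
      cmult (real k * (2 - real k)) (Lam (adL (k - 1) \<eta>)) - cmult (real k * (2 - real k)) (adL (k - 1) (Lam \<eta>))"
    by (cases k) (simp_all add: cmult_simps)
  have "L (adL (Suc k) \<eta>) - adL (Suc k) (L \<eta>)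
      = L (Lam (adL k \<eta>)) - L (adL k (Lam \<eta>)) - (Lam (adL k (L \<eta>)) - adL k (Lam (L \<eta>)))"
    using \<eta> by (simp add: linear_ops Forms_ops T)
  also have "\<dots> = (Lam (L (adL k \<eta>)) - Lam (adL k (L \<eta>))) - (L (adL k (Lam \<eta>)) - adL k (L (Lam \<eta>)))
      + (cmult (real n - of_int j) (adL k \<eta>) - cmult (real n - of_int (j + 1 - 2 * int k)) (adL k \<eta>))"
    unfolding 1 2 by simp
  also have "\<dots> = cmult (real k * (2 - real k)) (adL k \<eta>) + cmult (1 - 2 * real k) (adL k \<eta>)"
    unfolding 3 4 5[symmetric] cmult_simps(9)[symmetric] by simp
  also have "\<dots> = cmult (real (Suc k) * (2 - real (Suc k))) (adL (Suc k - 1) \<eta>)"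
    unfolding cmult_simps(8)[symmetric] by (simp add: algebra_simps)
  finally show "L (adL (Suc k) \<eta>) - adL (Suc k) (L \<eta>) = cmult (real (Suc k) * (2 - real (Suc k))) (adL (Suc k - 1) \<eta>)" .
qed

text \<open>Descending induction on \<open>k\<close>: beyond \<open>n\<close> the target degree is
  negative. If \<open>adL (Suc k)\<close> vanishes, \<open>L_adL\<close> leaves
  \<open>(k + 1)(1 - k)\<close> times \<open>adL k\<close>, and this coefficient is nonzero for
  \<open>k \<ge> 2\<close>.\<close>

lemma adL_eq_0:
  assumes "2 \<le> k" "\<eta> \<in> HForms j" shows "adL k \<eta> = 0"
  using assms
proof (induction "Suc n - k" arbitrary: k j \<eta>)
  case 0
  show "adL k \<eta> = 0"
  proof (cases "j > int CARD('n)")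
    case True
    then have "\<eta> = 0" by (rule HForms_large[OF 0(3)])
    then show ?thesis using linear_opD(6)[OF linear_op_adL Forms_zero_mem Forms_zero_mem] by simp
  next
    case False
    then show ?thesis using 0(1) card_n by (intro HForms_negative[OF HForms_adL[OF 0(3)]]) linarith
  qed
next
  case (Suc m)
  have 0: "adL (Suc k) \<theta> = 0" if "\<theta> \<in> HForms i" for \<theta> i
    by (rule Suc.hyps(1)[OF _ _ that]) (use Suc.hyps(2) Suc.prems(1) in auto)
  have "cmult (real (Suc k) * (2 - real (Suc k))) (adL k \<eta>) = 0"
    using L_adL[OF Suc.prems(2), of "Suc k"] 0[OF Suc.prems(2)] 0[OF HForms_L[OF Suc.prems(2)]]
      linear_opD(6)[OF linear_op_L Forms_zero_mem Forms_zero_mem] by (simp del: adL.simps)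
  then have "cmult (1 / (real (Suc k) * (2 - real (Suc k)))) (cmult (real (Suc k) * (2 - real (Suc k))) (adL k \<eta>)) = 0"
    by (simp only: cmult_simps(1))
  moreover have "real (Suc k) * (2 - real (Suc k)) \<noteq> 0" using Suc.prems(1) by simp
  ultimately show "adL k \<eta> = 0" unfolding cmult_simps(4) by (simp add: cmult_simps(3) del: of_nat_Suc)
qed

text \<open>Of the terms in \<open>adL 2 \<eta>\<close> only \<open>Lam (Lam (ext_d \<eta>))\<close>
  survives when \<open>Lam \<eta> = 0\<close>.\<close>

lemma Lam_Lam_ext_d:
  assumes "\<eta> \<in> HForms j" "Lam \<eta> = 0" shows "Lam (Lam (ext_d \<eta>)) = 0"
  using adL_eq_0[of 2, OF _ assms(1)] by (simp add: numeral_2_eq_2 assms(2) ops_zero)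

lemma L2_L:
  assumes "\<alpha> \<in> Forms A" "\<beta> \<in> Forms A"
  shows "L2_inner A g (L \<alpha>) \<beta> = L2_inner A g \<alpha> (Lam \<beta>)" "L2_inner A g (Lam \<alpha>) \<beta> = L2_inner A g \<alpha> (L \<beta>)"
proof -
  have 1: "L2_inner A g (L \<alpha>) \<beta> = L2_inner A g \<alpha> (Lam \<beta>)" if "\<alpha> \<in> Forms A" "\<beta> \<in> Forms A" for \<alpha> \<beta>
    unfolding L2_inner_def
  proof (rule Bochner_Integration.integral_cong[OF refl])
    fix p
    obtain c where c: "c \<in> A" "p \<in> fst c" using chart_cover by blast
    show "form_inner A g (L \<alpha>) \<beta> p = form_inner A g \<alpha> (Lam \<beta>) p"
      unfolding form_inner_cinn[OF Forms_L[OF that(1)] that(2) c] form_inner_cinn[OF that(1) Forms_Lam[OF that(2)] c]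
      by (rule cinn_L[OF that c])
  qed
  show "L2_inner A g (L \<alpha>) \<beta> = L2_inner A g \<alpha> (Lam \<beta>)" by (rule 1[OF assms])
  show "L2_inner A g (Lam \<alpha>) \<beta> = L2_inner A g \<alpha> (L \<beta>)"
    using 1[OF assms(2,1)] L2_inner_commute[OF Forms_Lam[OF assms(1)] assms(2)] L2_inner_commute[OF assms(1) Forms_L[OF assms(2)]]
    by simp
qed

section \<open>Vanishing of primitive forms and the decomposition of the exterior derivative\<close>

lemma cinn_zeroI:
  assumes "\<eta> \<in> Forms A" "\<And>c p. c \<in> A \<Longrightarrow> p \<in> fst c \<Longrightarrow> cinn \<eta> \<eta> c p \<le> 0" shows "\<eta> = 0"
proof (rule Forms_eqI[OF assms(1) Forms_zero_mem])
  fix c p assume c: "c \<in> A" "p \<in> fst c"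
  have "cinn \<eta> \<eta> c p = 0"
    using assms(2)[OF c] alt_inner_nonneg[OF gram_spd[OF c] Forms_alternating[OF assms(1) c]] by (simp add: cinn_def)
  then have "\<eta> c p = 0" unfolding cinn_def by (rule alt_inner_eq_0[OF gram_spd[OF c] Forms_alternating[OF assms(1) c]])
  then show "\<eta> c p = 0 c p" by simp
qed

text \<open>Adjointness and \<open>[\<Lambda>, L] = n - k\<close> evaluate the squared norm of
  \<open>L \<eta>\<close>. A negative factor forces \<open>\<eta> = 0\<close> above degree
  \<open>n\<close>, a zero factor forces \<open>L \<eta> = 0\<close> in degree
  \<open>n\<close>.\<close>

lemma primitive_norm_L:
  assumes "\<eta> \<in> HForms k" "Lam \<eta> = 0" "c \<in> A" "p \<in> fst c"
  shows "cinn (L \<eta>) (L \<eta>) c p = (real n - of_int k) * cinn \<eta> \<eta> c p"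
proof -
  note \<eta> = HFormsD(1)[OF assms(1)]
  have "Lam (L \<eta>) = cmult (real n - of_int k) \<eta>"
    unfolding Lam_L[OF assms(1)] assms(2) by (simp add: ops_zero)
  then show ?thesis
    unfolding cinn_L[OF \<eta> Forms_L[OF \<eta>] assms(3,4)] by (simp add: cinn_def cmult_apply alt_inner_linear)
qed

lemma primitive_above_middle:
  assumes "\<eta> \<in> HForms k" "Lam \<eta> = 0" "k > int n" shows "\<eta> = 0"
proof (rule cinn_zeroI[OF HFormsD(1)[OF assms(1)]])
  fix c p assume c: "c \<in> A" "p \<in> fst c"
  have "cinn (L \<eta>) (L \<eta>) c p \<ge> 0"
    unfolding cinn_def by (intro alt_inner_nonneg gram_spd Forms_alternating Forms_L HFormsD(1)[OF assms(1)] c)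
  moreover have "real n - of_int k < 0" using assms(3) by linarith
  ultimately show "cinn \<eta> \<eta> c p \<le> 0"
    unfolding primitive_norm_L[OF assms(1,2) c] by (simp add: zero_le_mult_iff)
qed

lemma primitive_middle:
  assumes "\<eta> \<in> HForms (int n)" "Lam \<eta> = 0" shows "L \<eta> = 0"
  by (rule cinn_zeroI[OF Forms_L[OF HFormsD(1)[OF assms(1)]]]) (simp add: primitive_norm_L[OF assms])

lemma Prim_iff: "\<eta> \<in> Prim A \<omega> k \<longleftrightarrow> \<eta> \<in> HForms (int k) \<and> Lam \<eta> = 0"
  by (simp add: Prim_def Forms_deg_HForms)

text \<open>Applying \<open>Lam\<close> to \<open>ext_d B = P + L M\<close> removes \<open>P\<close>
  and multiplies \<open>M\<close>, of degree \<open>k - 1\<close>, by \<open>n - (k - 1)\<close>; so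
  \<open>M\<close> is forced and then \<open>P\<close>. Conversely \<open>Lam_Lam_ext_d\<close>
  makes this \<open>M\<close> primitive, and the factor was chosen to make \<open>P\<close>
  primitive.\<close>

lemma d_decomposition_iff:
  assumes "B \<in> Prim A \<omega> k" "k \<le> n"
  defines "Bm \<equiv> cmult (1 / (real n - real k + 1)) (Lam (ext_d B))"
  shows "d_decomposition A \<omega> n k B P M \<longleftrightarrow> M = Bm \<and> P = ext_d B - L Bm"
proof -
  have B: "B \<in> HForms (int k)" "Lam B = 0" using assms(1) by (auto simp: Prim_iff)
  note F = HFormsD(1)[OF B(1)]
  have m: "real n - real k + 1 \<noteq> 0" using assms(2) by linarith
  have Y: "Lam (ext_d B) \<in> HForms (int k - 1)" using HForms_Lam[OF HForms_ext_d[OF B(1)]] by simp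
  have Bm: "Bm \<in> HForms (int k - 1)" unfolding Bm_def by (rule HForms_simple(4)[OF Y])
  have \<Lambda>Bm: "Lam Bm = 0"
    unfolding Bm_def using Lam_Lam_ext_d[OF B] F by (simp add: linear_ops Forms_ops cmult_simps)
  note 0 = ops_zero(2,3)
  have LM: "Lam (L M) = cmult (real n - real k + 1) M" if "M \<in> HForms (int k - 1)" "Lam M = 0" for M
    using Lam_L[OF that(1)] that(2) 0 by (simp add: algebra_simps)
  have P: "ext_d B - L Bm \<in> HForms (int k + 1)"
    using HForms_simple(6)[OF HForms_ext_d[OF B(1)]] HForms_L[OF Bm] by (simp add: add.commute)
  have \<Lambda>P: "Lam (ext_d B - L Bm) = 0"
    using LM[OF Bm \<Lambda>Bm] HFormsD(1)[OF Bm] F m by (simp add: linear_ops Forms_ops Bm_def cmult_simps)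
  have "d_decomposition A \<omega> n k B (ext_d B - L Bm) Bm"
    unfolding d_decomposition_def
  proof (intro conjI)
    \<comment> \<open>For \<open>k = n\<close> the candidate is primitive of degree
      \<open>n + 1\<close>, hence 0, as the definition demands.\<close>
    show "if k < n then ext_d B - L Bm \<in> Prim A \<omega> (k + 1) else ext_d B - L Bm = 0"
      using P \<Lambda>P assms(2) primitive_above_middle[OF P \<Lambda>P] by (auto simp: Prim_iff add.commute)
    show "if k > 0 then Bm \<in> Prim A \<omega> (k - 1) else Bm = 0"
      using Bm \<Lambda>Bm HForms_negative[OF Bm] by (auto simp: Prim_iff of_nat_diff)
  qed simp
  moreover have "M = Bm \<and> P = ext_d B - L Bm" if D: "d_decomposition A \<omega> n k B P M"
  proof -
    have P: "Lam P = 0" "P \<in> Forms A"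
      using D 0 by (auto simp: d_decomposition_def Prim_iff HFormsD Forms_zero_mem split: if_splits)
    have M: "M \<in> HForms (int k - 1)" "Lam M = 0"
      using D 0 by (auto simp: d_decomposition_def Prim_iff HForms_simple of_nat_diff split: if_splits)
    have e: "ext_d B = P + L M" using D by (simp add: d_decomposition_def)
    have "Lam (ext_d B) = cmult (real n - real k + 1) M"
      unfolding e using LM[OF M] P HFormsD(1)[OF M(1)] by (simp add: linear_ops Forms_ops)
    then have "Bm = M" unfolding Bm_def using m by (simp add: cmult_simps(3,4))
    then show ?thesis using e by simp
  qed
  ultimately show ?thesis by blast
qed

lemma del_eq:
  assumes "B \<in> Prim A \<omega> k" "k \<le> n"
  shows "del_minus A \<omega> n k B = cmult (1 / (real n - real k + 1)) (Lam (ext_d B))"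
    "del_plus A \<omega> n k B = ext_d B - L (cmult (1 / (real n - real k + 1)) (Lam (ext_d B)))"
  unfolding del_minus_def del_plus_def d_decomposition_iff[OF assms] by simp_all

lemma L_supported: "\<alpha> \<in> Forms A \<Longrightarrow> supported K \<alpha> \<Longrightarrow> supported K (L \<alpha>)"
  unfolding supported_def by (auto simp: lefschetz_def fun_eq_iff simp del: split_paired_All)

lemma Lam_supported: "\<alpha> \<in> Forms A \<Longrightarrow> supported K \<alpha> \<Longrightarrow> supported K (Lam \<alpha>)"
  unfolding supported_def by (auto simp: lambda_op_def fun_eq_iff simp del: split_paired_All)

lemma d_star_adjoint_K:
  assumes "\<alpha> \<in> Forms A" "\<beta> \<in> Forms A" "compact K" "supported K \<alpha>"
  shows "L2_inner A g (ext_d \<alpha>) \<beta> = L2_inner A g \<alpha> (ds \<beta>)"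
  by (rule d_star_adjoint[OF assms(1,2) compactly_supportedI[OF assms(3,4)]])

text \<open>The adjoint of the relation \<open>[d, L] = 0\<close>.\<close>

lemma Lam_ds:
  assumes "\<beta> \<in> Forms A" shows "Lam (ds \<beta>) = ds (Lam \<beta>)"
proof (rule formal_adjoint_unique[OF submodule_Forms])
  fix \<alpha> K assume \<alpha>: "\<alpha> \<in> Forms A" and K: "compact K" "supported K \<alpha>"
  show "L2_inner A g \<alpha> (Lam (ds \<beta>)) = L2_inner A g \<alpha> (ds (Lam \<beta>))"
    using d_star_adjoint_K[OF Forms_L[OF \<alpha>] assms K(1) L_supported[OF \<alpha> K(2)]]
      d_star_adjoint_K[OF \<alpha> Forms_Lam[OF assms] K] ext_d_L[OF \<alpha>]
      L2_L[OF \<alpha> Forms_d_star[OF assms]] L2_L[OF Forms_ext_d[OF \<alpha>] assms] by simp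
qed (intro Forms_ops assms)+

lemma d_lambda_star_eq:
  assumes "\<beta> \<in> Forms A" shows "d_lambda_star A \<omega> g \<beta> = L (ds \<beta>) - ds (L \<beta>)"
  unfolding d_lambda_star_def
proof (rule formal_adjoint_eq[OF submodule_Forms])
  show "d_lambda \<omega> \<alpha> \<in> Forms A" if "\<alpha> \<in> Forms A" for \<alpha> unfolding d_lambda_def by (intro Forms_ops that)
  show "L (ds \<beta>) - ds (L \<beta>) \<in> Forms A" by (intro Forms_ops assms)
  fix \<alpha> assume \<alpha>: "\<alpha> \<in> Forms A" and cs: "compactly_supported \<alpha>"
  obtain K where K: "compact K" "supported K \<alpha>" using compactly_supportedE[OF cs] by blast
  note cl = compact_imp_closed[OF K(1)]
  note s = Lam_supported[OF \<alpha> K(2)] and s' = ext_d_supported[OF \<alpha> cl K(2)]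
  show "L2_inner A g (d_lambda \<omega> \<alpha>) \<beta> = L2_inner A g \<alpha> (L (ds \<beta>) - ds (L \<beta>))"
    unfolding d_lambda_def
      L2_inner_diff_left(1)[OF Forms_ext_d[OF Forms_Lam[OF \<alpha>]] Forms_Lam[OF Forms_ext_d[OF \<alpha>]] assms K(1)
        ext_d_supported[OF Forms_Lam[OF \<alpha>] cl s] Lam_supported[OF Forms_ext_d[OF \<alpha>] s']]
      L2_inner_diff_right(1)[OF \<alpha> Forms_L[OF Forms_d_star[OF assms]] Forms_d_star[OF Forms_L[OF assms]] K]
      d_star_adjoint_K[OF Forms_Lam[OF \<alpha>] assms K(1) s]
      d_star_adjoint_K[OF \<alpha> Forms_L[OF assms] K, symmetric]
      L2_L(2)[OF \<alpha> Forms_d_star[OF assms]] L2_L(2)[OF Forms_ext_d[OF \<alpha>] assms] by (rule refl)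
qed

abbreviation dL :: "('m, 'n) form \<Rightarrow> ('m, 'n) form" where "dL \<equiv> d_lambda \<omega>"
abbreviation dLs :: "('m, 'n) form \<Rightarrow> ('m, 'n) form" where "dLs \<equiv> d_lambda_star A \<omega> g"

lemma n_pos: "n > 0"
proof -
  have "CARD('n) > 0" by simp
  then show ?thesis using card_n by linarith
qed

lemma Forms_dL: "\<eta> \<in> Forms A \<Longrightarrow> dL \<eta> \<in> Forms A" "\<eta> \<in> Forms A \<Longrightarrow> dLs \<eta> \<in> Forms A"
  by (simp_all add: d_lambda_def d_lambda_star_eq Forms_ops)

lemma linear_op_dL: "linear_op (Forms A) (Forms A) dL"
  unfolding d_lambda_def[abs_def]
  by (intro linear_op_diff linear_op_compose[OF linear_op_Lam linear_op_ext_d] linear_op_compose[OF linear_op_ext_d linear_op_Lam])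

lemma linear_op_dLs: "linear_op (Forms A) (Forms A) dLs"
  by (simp add: linear_op_def d_lambda_star_eq Forms_ops linear_ops cmult_simps)

lemmas linear_ops' = linear_opD(2-)[OF linear_op_dL] linear_opD(2-)[OF linear_op_dLs]

section \<open>The operators between primitive forms of degrees n - 1 and n\<close>

abbreviation dm :: "('m, 'n) form \<Rightarrow> ('m, 'n) form" where "dm \<equiv> del_minus A \<omega> n n"
abbreviation dp :: "('m, 'n) form \<Rightarrow> ('m, 'n) form" where "dp \<equiv> del_plus A \<omega> n (n - 1)"

lemma Prim_Forms: "B \<in> Prim A \<omega> k \<Longrightarrow> B \<in> Forms A"
  by (auto simp: Prim_iff HFormsD)

lemma Prim_nI: "B \<in> HForms (int n) \<Longrightarrow> Lam B = 0 \<Longrightarrow> B \<in> Prim A \<omega> n"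
  by (simp add: Prim_iff)

lemma Prim_mI: "B \<in> HForms (int n - 1) \<Longrightarrow> Lam B = 0 \<Longrightarrow> B \<in> Prim A \<omega> (n - 1)"
  using n_pos by (simp add: Prim_iff of_nat_diff)

lemma Prim_nD:
  assumes "B \<in> Prim A \<omega> n" shows "B \<in> HForms (int n)" "Lam B = 0" "L B = 0"
  using assms primitive_middle by (auto simp: Prim_iff)

lemma Prim_mD:
  assumes "C \<in> Prim A \<omega> (n - 1)" shows "C \<in> HForms (int n - 1)" "Lam C = 0" "Lam (L C) = C"
proof -
  show 1: "C \<in> HForms (int n - 1)" "Lam C = 0" using assms n_pos by (auto simp: Prim_iff of_nat_diff)
  show "Lam (L C) = C" using Lam_L[OF 1(1)] by (simp add: 1(2) ops_zero cmult_simps)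
qed

lemma submodule_Prim: "submodule (Prim A \<omega> k)"
  unfolding submodule_def
proof (intro conjI ballI allI impI subsetI)
  fix \<alpha> f assume "\<alpha> \<in> Prim A \<omega> k" "smooth_fun A f"
  moreover have "fmult f 0 = (0 :: ('m, 'n) form)" by (simp add: fmult_def fun_eq_iff del: split_paired_All)
  ultimately show "fmult f \<alpha> \<in> Prim A \<omega> k" by (simp add: Prim_iff HForms_simple Lam_linear)
qed (auto simp: Prim_iff HForms_simple ops_zero Lam_linear(1)[OF HFormsD(1) HFormsD(1)] intro: HFormsD(1))

lemma dm_eq:
  assumes "B \<in> Prim A \<omega> n"
  shows "dm B = Lam (ext_d B)" "dm B \<in> Prim A \<omega> (n - 1)" "ext_d B = L (dm B)"
proof -
  show 1: "dm B = Lam (ext_d B)" using del_eq(1)[OF assms order_refl] by (simp add: cmult_simps)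
  note B = Prim_nD[OF assms]
  have d: "ext_d B \<in> HForms (int n + 1)" by (rule HForms_ext_d[OF B(1)])
  have dm: "dm B \<in> HForms (int n - 1)" unfolding 1 using HForms_Lam[OF d] by simp
  show "dm B \<in> Prim A \<omega> (n - 1)" by (rule Prim_mI[OF dm]) (unfold 1, rule Lam_Lam_ext_d[OF B(1,2)])
  have "d_decomposition A \<omega> n n B (ext_d B - L (cmult 1 (Lam (ext_d B)))) (cmult 1 (Lam (ext_d B)))"
    using d_decomposition_iff[OF assms order_refl] by simp
  then have "ext_d B - L (cmult 1 (Lam (ext_d B))) = 0" by (simp add: d_decomposition_def)
  then show "ext_d B = L (dm B)" by (simp add: 1 cmult_simps)
qed

lemma dp_eq:
  assumes "C \<in> Prim A \<omega> (n - 1)"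
  shows "dp C = ext_d C - cmult (1/2) (L (Lam (ext_d C)))" "dp C \<in> Prim A \<omega> n"
proof -
  note C = Prim_mD[OF assms] and F = Prim_Forms[OF assms]
  \<comment> \<open>In degree \<open>n - 1\<close> the normalising factor is
    \<open>n - (n - 1) + 1 = 2\<close>; in degree \<open>n\<close> it is 1.\<close>
  have k: "1 / (real n - real (n - 1) + 1) = 1/2" using n_pos by (simp add: of_nat_diff)
  show 1: "dp C = ext_d C - cmult (1/2) (L (Lam (ext_d C)))"
    using del_eq(2)[OF assms] F unfolding k by (simp add: linear_ops Forms_ops)
  have "d_decomposition A \<omega> n (n - 1) C (dp C) (cmult (1/2) (Lam (ext_d C)))"
    using d_decomposition_iff[OF assms] del_eq(2)[OF assms] unfolding k by simp
  then show "dp C \<in> Prim A \<omega> n" using n_pos by (simp add: d_decomposition_def)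
qed

text \<open>From \<open>ext_d B = L (dm B)\<close> and \<open>[L, d] = 0\<close> the form
  \<open>L (ext_d (dm B))\<close> is \<open>ext_d (ext_d B) = 0\<close>. In degree \<open>n\<close>
  the operators \<open>Lam\<close> and \<open>L\<close> commute, so the correction term in
  \<open>dp\<close> vanishes.\<close>

lemma dp_dm:
  assumes "B \<in> Prim A \<omega> n" shows "dp (dm B) = ext_d (dm B)" "ext_d (dL B) = - dp (dm B)"
proof -
  note C = dm_eq(2)[OF assms] and F = Prim_Forms[OF assms]
  note FC = Prim_Forms[OF C] and HC = Prim_mD[OF C]
  have "L (ext_d (dm B)) = 0"
    unfolding ext_d_L[OF FC, symmetric] dm_eq(3)[OF assms, symmetric] by (rule ext_d_ext_d[OF F])
  moreover have "ext_d (dm B) \<in> HForms (int n)" using HForms_ext_d[OF HC(1)] by simp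
  ultimately have "L (Lam (ext_d (dm B))) = 0"
    using Lam_L[of "ext_d (dm B)" "int n"] by (simp add: ops_zero cmult_simps)
  then show 1: "dp (dm B) = ext_d (dm B)" unfolding dp_eq(1)[OF C] by (simp add: cmult_simps)
  show "ext_d (dL B) = - dp (dm B)"
    unfolding d_lambda_def Prim_nD(2)[OF assms] dm_eq(1)[OF assms]
    using F 1[unfolded dm_eq(1)[OF assms]] by (simp add: ops_zero linear_ops Forms_ops del: One_nat_def)
qed

lemma ds_Prim:
  assumes "B \<in> Prim A \<omega> n" shows "ds B \<in> Prim A \<omega> (n - 1)"
  by (rule Prim_mI[OF HForms_d_star[OF Prim_nD(1)[OF assms]]])
    (simp add: Lam_ds Prim_Forms[OF assms] Prim_nD[OF assms] ops_zero)

lemma dLs_ds: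
  assumes "B \<in> Prim A \<omega> n" shows "dLs (ds B) = - ds (L (ds B))"
  using Forms_d_star[OF Prim_Forms[OF assms]]
  by (simp add: d_lambda_star_eq d_star_d_star[OF Prim_Forms[OF assms]] ops_zero)

text \<open>On \<open>Prim A \<omega> n\<close> the operator is \<open>ext_d\<close>,
  \<open>Lam\<close>, \<open>ext_d\<close> in succession, so its adjoint on all forms is
  \<open>ds\<close>, \<open>L\<close>, \<open>ds\<close>. Primitivity of the result reduces to the
  vanishing of \<open>ds (ds \<beta>)\<close>.\<close>

lemma dpm_star:
  assumes "\<beta> \<in> Prim A \<omega> n"
  shows "formal_adjoint A g (Prim A \<omega> n) (dp \<circ> dm) \<beta> = ds (L (ds \<beta>))" "ds (L (ds \<beta>)) \<in> Prim A \<omega> n"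
proof -
  note F = Prim_Forms[OF assms] and C = ds_Prim[OF assms]
  have "Lam (ds (L (ds \<beta>))) = 0"
    unfolding Lam_ds[OF Forms_L[OF Forms_d_star[OF F]]] Prim_mD(3)[OF C] by (rule d_star_d_star[OF F])
  moreover have "ds (L (ds \<beta>)) \<in> HForms (int n)"
    using HForms_d_star[OF HForms_L[OF Prim_mD(1)[OF C]]] by simp
  ultimately show \<gamma>: "ds (L (ds \<beta>)) \<in> Prim A \<omega> n" by (intro Prim_nI)
  show "formal_adjoint A g (Prim A \<omega> n) (dp \<circ> dm) \<beta> = ds (L (ds \<beta>))"
  proof (rule formal_adjoint_eq[OF submodule_Prim _ \<gamma>])
    show "(dp \<circ> dm) \<alpha> \<in> Forms A" if "\<alpha> \<in> Prim A \<omega> n" for \<alpha>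
      using Prim_Forms[OF dp_eq(2)[OF dm_eq(2)[OF that]]] by simp
    fix \<alpha> assume \<alpha>: "\<alpha> \<in> Prim A \<omega> n" and cs: "compactly_supported \<alpha>"
    obtain K where K: "compact K" "supported K \<alpha>" using compactly_supportedE[OF cs] by blast
    note A = Prim_Forms[OF \<alpha>]
    note s = ext_d_supported[OF A compact_imp_closed[OF K(1)] K(2)]
    have "(dp \<circ> dm) \<alpha> = ext_d (Lam (ext_d \<alpha>))" using dp_dm(1)[OF \<alpha>] by (simp add: dm_eq(1)[OF \<alpha>] del: One_nat_def)
    then show "L2_inner A g ((dp \<circ> dm) \<alpha>) \<beta> = L2_inner A g \<alpha> (ds (L (ds \<beta>)))"
      using d_star_adjoint_K[OF Forms_Lam[OF Forms_ext_d[OF A]] F K(1) Lam_supported[OF Forms_ext_d[OF A] s]]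
        d_star_adjoint_K[OF A Forms_L[OF Forms_d_star[OF F]] K] L2_L(2)[OF Forms_ext_d[OF A] Forms_d_star[OF F]]
      by simp
  qed
qed

text \<open>The term by which \<open>dp\<close> differs from \<open>ext_d\<close> lies in the image
  of \<open>L\<close>, orthogonal to the primitive form \<open>\<beta>\<close>.\<close>

lemma dp_star:
  assumes "\<beta> \<in> Prim A \<omega> n" shows "formal_adjoint A g (Prim A \<omega> (n - 1)) dp \<beta> = ds \<beta>"
proof (rule formal_adjoint_eq[OF submodule_Prim _ ds_Prim[OF assms]])
  note F = Prim_Forms[OF assms]
  show "dp \<alpha> \<in> Forms A" if "\<alpha> \<in> Prim A \<omega> (n - 1)" for \<alpha> using Prim_Forms[OF dp_eq(2)[OF that]] .
  fix \<alpha> assume \<alpha>: "\<alpha> \<in> Prim A \<omega> (n - 1)" and cs: "compactly_supported \<alpha>"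
  obtain K where K: "compact K" "supported K \<alpha>" using compactly_supportedE[OF cs] by blast
  note A = Prim_Forms[OF \<alpha>]
  note s = ext_d_supported[OF A compact_imp_closed[OF K(1)] K(2)]
  let ?\<theta> = "cmult (1/2) (Lam (ext_d \<alpha>))"
  have T: "?\<theta> \<in> Forms A" by (intro Forms_ops A)
  have s': "supported K ?\<theta>" unfolding cmult_def by (rule supported_fmult[OF Lam_supported[OF Forms_ext_d[OF A] s]])
  have "dp \<alpha> = ext_d \<alpha> - L ?\<theta>" using A by (simp add: dp_eq(1)[OF \<alpha>] linear_ops Forms_ops del: One_nat_def)
  then show "L2_inner A g (dp \<alpha>) \<beta> = L2_inner A g \<alpha> (ds \<beta>)"
    using L2_inner_diff_left(1)[OF Forms_ext_d[OF A] Forms_L[OF T] F K(1) s L_supported[OF T s']]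
      L2_L(1)[OF T F] d_star_adjoint_K[OF A F K] by (simp add: Prim_nD(2)[OF assms] L2_inner_zero)
qed

text \<open>\<open>ds (L C)\<close> satisfies the adjointness equation but is not primitive in
  general: \<open>Lam\<close> sends it to \<open>ds C\<close>. Half of \<open>L (ds C)\<close> has
  the same image, because \<open>Lam\<close> and \<open>L\<close> compose to 2 on the primitive form
  \<open>ds C\<close> of degree \<open>n - 2\<close>, and it is orthogonal to primitive
  forms.\<close>

lemma dm_star:
  assumes "C \<in> Prim A \<omega> (n - 1)"
  shows "formal_adjoint A g (Prim A \<omega> n) dm C = ds (L C) - cmult (1/2) (L (ds C))"
    "ds (L C) - cmult (1/2) (L (ds C)) \<in> Prim A \<omega> n"
proof -
  note F = Prim_Forms[OF assms] and C = Prim_mD[OF assms]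
  have dC: "ds C \<in> HForms (int n - 2)" using HForms_d_star[OF C(1)] by (simp add: algebra_simps)
  have "ds (L C) \<in> HForms (int n)" using HForms_d_star[OF HForms_L[OF C(1)]] by simp
  moreover have "cmult (1/2) (L (ds C)) \<in> HForms (int n)" using HForms_simple(4)[OF HForms_L[OF dC]] by simp
  ultimately have H: "ds (L C) - cmult (1/2) (L (ds C)) \<in> HForms (int n)" by (rule HForms_simple(6))
  have "Lam (L (ds C)) = cmult 2 (ds C)"
    unfolding Lam_L[OF dC] Lam_ds[OF F] C(2) by (simp add: ops_zero)
  then have "Lam (ds (L C) - cmult (1/2) (L (ds C))) = 0"
    using F by (simp add: linear_ops Forms_ops Lam_ds C(3) cmult_simps)
  with H show \<gamma>: "ds (L C) - cmult (1/2) (L (ds C)) \<in> Prim A \<omega> n" by (rule Prim_nI)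
  show "formal_adjoint A g (Prim A \<omega> n) dm C = ds (L C) - cmult (1/2) (L (ds C))"
  proof (rule formal_adjoint_eq[OF submodule_Prim _ \<gamma>])
    show "dm \<alpha> \<in> Forms A" if "\<alpha> \<in> Prim A \<omega> n" for \<alpha> using Prim_Forms[OF dm_eq(2)[OF that]] .
    fix \<alpha> assume \<alpha>: "\<alpha> \<in> Prim A \<omega> n" and cs: "compactly_supported \<alpha>"
    obtain K where K: "compact K" "supported K \<alpha>" using compactly_supportedE[OF cs] by blast
    note A = Prim_Forms[OF \<alpha>]
    let ?\<theta> = "cmult (1/2) (ds C)"
    have T: "?\<theta> \<in> Forms A" by (intro Forms_ops F)
    have "cmult (1/2) (L (ds C)) = L ?\<theta>" using F by (simp add: linear_ops Forms_ops)
    moreover have "L2_inner A g \<alpha> (L ?\<theta>) = 0"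
      unfolding L2_L(2)[OF A T, symmetric] Prim_nD(2)[OF \<alpha>] by (rule L2_inner_zero(1))
    ultimately show "L2_inner A g (dm \<alpha>) C = L2_inner A g \<alpha> (ds (L C) - cmult (1/2) (L (ds C)))"
      unfolding dm_eq(1)[OF \<alpha>]
      using L2_inner_diff_right(1)[OF A Forms_d_star[OF Forms_L[OF F]] Forms_L[OF T] K]
        L2_L(2)[OF Forms_ext_d[OF A] F] d_star_adjoint_K[OF A Forms_L[OF F] K] by simp
  qed
qed

text \<open>With \<open>?C\<close> for \<open>ds B\<close>, the two summands are
  \<open>ext_d ?C\<close> and \<open>ext_d ?C - L (Lam (ext_d ?C))\<close>. The halved correction in
  \<open>dp ?C\<close> is why the sum is twice \<open>dp ?C\<close>.\<close>

lemma Q_plus: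
  assumes "B \<in> Prim A \<omega> n" shows "ext_d (ds B) + dL (dLs B) = cmult 2 (dp (ds B))"
proof -
  note F = Prim_Forms[OF assms] and B = Prim_nD[OF assms]
  let ?C = "ds B"
  note PC = ds_Prim[OF assms]
  have FC: "?C \<in> Forms A" by (rule Forms_d_star[OF F])
  have d: "ext_d ?C \<in> HForms (int n)" using HForms_ext_d[OF Prim_mD(1)[OF PC]] by simp
  have "Lam (ext_d (L ?C)) = L (Lam (ext_d ?C))"
    unfolding ext_d_L[OF FC] Lam_L[OF d] by (simp add: cmult_simps)
  moreover have "dLs B = L ?C" by (simp add: d_lambda_star_eq[OF F] B(3) ops_zero)
  ultimately have "dL (dLs B) = ext_d ?C - L (Lam (ext_d ?C))" by (simp add: d_lambda_def Prim_mD(3)[OF PC])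
  then show ?thesis unfolding dp_eq(1)[OF PC] cmult_simps(6)
    using cmult_simps(8)[of 1 1 "ext_d ?C"] by (simp add: cmult_simps(3,4))
qed

text \<open>Here \<open>ext_d B = L (dm B)\<close> and \<open>dL B = - dm B\<close>, so the summands
  are \<open>ds (L (dm B))\<close> and the same form minus \<open>L (ds (dm B))\<close>: twice the
  expression of \<open>dm_star\<close>.\<close>

lemma Q_minus:
  assumes "B \<in> Prim A \<omega> n" shows "ds (ext_d B) + dLs (dL B) = cmult 2 (ds (L (dm B)) - cmult (1/2) (L (ds (dm B))))"
proof -
  note F = Prim_Forms[OF assms] and B = Prim_nD[OF assms]
  note FC = Prim_Forms[OF dm_eq(2)[OF assms]]
  have "dL B = - dm B" by (simp add: d_lambda_def B(2) ops_zero dm_eq(1)[OF assms])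
  then have "dLs (dL B) = ds (L (dm B)) - L (ds (dm B))"
    using FC by (simp add: d_lambda_star_eq Forms_ops linear_ops)
  then show ?thesis unfolding dm_eq(3)[OF assms] cmult_simps(6)
    using cmult_simps(8)[of 1 1 "ds (L (dm B))"] by (simp add: cmult_simps(3,4))
qed

text \<open>The signs in \<open>ext_d (dL B) = - dp (dm B)\<close> and in \<open>dLs_ds\<close>
  cancel. \<open>Q_plus\<close> is applied twice, since its value is again primitive of degree
  \<open>n\<close>, and the resulting 4 meets the factor 1/4.\<close>

lemma Delta_plus_plus_eq:
  assumes "B \<in> Prim A \<omega> n" shows "Delta_dd_lambda A \<omega> g B = Delta_plus_plus A \<omega> g n B"
proof -
  note C = ds_Prim[OF assms]
  note D = dp_eq(2)[OF C] and E = dp_eq(2)[OF dm_eq(2)[OF assms]]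
  have 1: "dLs (ds (ext_d (dL B))) = ds (L (ds (dp (dm B))))"
    unfolding dp_dm(2)[OF assms] using Prim_Forms[OF E] dLs_ds[OF E] by (simp add: linear_ops linear_ops' Forms_ops)
  have "ext_d (ds (cmult 2 (dp (ds B)))) + dL (dLs (cmult 2 (dp (ds B)))) = cmult 2 (ext_d (ds (dp (ds B))) + dL (dLs (dp (ds B))))"
    using Prim_Forms[OF D] by (simp add: linear_ops linear_ops' Forms_ops Forms_dL cmult_simps del: One_nat_def)
  then show ?thesis
    unfolding Delta_dd_lambda_def Delta_plus_plus_def Let_def Q_plus[OF assms] 1 dpm_star(1)[OF E] dp_star[OF assms] dp_star[OF D]
    by (simp add: Q_plus[OF D] cmult_simps(3,4) del: One_nat_def)
qed

lemma Delta_minus_minus_eq: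
  assumes "B \<in> Prim A \<omega> n" shows "Delta_d_plus_d_lambda A \<omega> g B = Delta_minus_minus A \<omega> g n B"
proof -
  note C = dm_eq(2)[OF assms]
  note D = dm_star(2)[OF C] and E = dpm_star(2)[OF assms]
  have 1: "ext_d (dL (dLs (ds B))) = dp (dm (ds (L (ds B))))"
    unfolding dLs_ds[OF assms] using Prim_Forms[OF E] dp_dm(2)[OF E] by (simp add: linear_ops linear_ops' Forms_ops Forms_dL)
  let ?D = "ds (L (dm B)) - cmult (1/2) (L (ds (dm B)))"
  have "ds (ext_d (cmult 2 ?D)) + dLs (dL (cmult 2 ?D)) = cmult 2 (ds (ext_d ?D) + dLs (dL ?D))"
    using Prim_Forms[OF D]
    by (simp only: linear_ops linear_ops' Forms_ops Forms_dL cmult_simps(5) linear_opD(3)[OF linear_op_ext_d]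
        linear_opD(3)[OF linear_op_ds] linear_opD(3)[OF linear_op_dL] linear_opD(3)[OF linear_op_dLs])
  then show ?thesis
    unfolding Delta_d_plus_d_lambda_def Delta_minus_minus_def Let_def Q_minus[OF assms] 1 dpm_star(1)[OF assms]
      dm_star(1)[OF C] dm_star(1)[OF dm_eq(2)[OF D]]
    by (simp add: Q_minus[OF D] cmult_simps(3,4))
qed

end

section \<open>Differential operators and symbols\<close>

lemma diff_op_linear: "diff_op A E F m P \<Longrightarrow> linear_op E F P"
  by (cases m) auto

lemma diff_op_SucI:
  "linear_op E F P \<Longrightarrow> (\<And>f. smooth_fun A f \<Longrightarrow> diff_op A E F m (\<lambda>s. P (fmult f s) - fmult f (P s))) \<Longrightarrow> diff_op A E F (Suc m) P"
  unfolding diff_op.simps(2) by blast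

lemma diff_op_SucD:
  "diff_op A E F (Suc m) P \<Longrightarrow> smooth_fun A f \<Longrightarrow> diff_op A E F m (\<lambda>s. P (fmult f s) - fmult f (P s))"
  unfolding diff_op.simps(2) by blast

context riemannian_atlas
begin

lemma diff_op_cong:
  assumes "submodule E" "\<And>s. s \<in> E \<Longrightarrow> P s = P' s" "diff_op A E F m P"
  shows "diff_op A E F m P'"
  using assms(2,3)
proof (induction m arbitrary: P P')
  case 0
  then show "diff_op A E F 0 P'" using submoduleD(3-5)[OF assms(1)] by (auto simp: linear_op_def)
next
  case (Suc m)
  note E = submoduleD(3-5)[OF assms(1)]
  show "diff_op A E F (Suc m) P'"
  proof (rule diff_op_SucI)
    show "linear_op E F P'"
      using Suc.prems(1) diff_op_linear[OF Suc.prems(2)] E by (auto simp: linear_op_def)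
    fix f assume f: "smooth_fun A f"
    have "P (fmult f s) - fmult f (P s) = P' (fmult f s) - fmult f (P' s)" if "s \<in> E" for s
      using Suc.prems(1)[OF that] Suc.prems(1)[OF E(2)[OF that f]] by simp
    then show "diff_op A E F m (\<lambda>s. P' (fmult f s) - fmult f (P' s))"
      by (rule Suc.IH[OF _ diff_op_SucD[OF Suc.prems(2) f]])
  qed
qed

lemma diff_op_restrict:
  assumes "submodule E" "diff_op A (Forms A) (Forms A) m P" "\<And>s. s \<in> E \<Longrightarrow> P s \<in> E"
  shows "diff_op A E E m P"
  using assms(2,3)
proof (induction m arbitrary: P)
  case 0
  then show "diff_op A E E 0 P" using submoduleD(1)[OF assms(1)] by (auto simp: linear_op_def)
next
  case (Suc m)
  note E = submoduleD[OF assms(1)]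
  show "diff_op A E E (Suc m) P"
  proof (rule diff_op_SucI)
    show "linear_op E E P" using Suc.prems(2) diff_op_linear[OF Suc.prems(1)] E(1) by (auto simp: linear_op_def)
    fix f assume f: "smooth_fun A f"
    have "P (fmult f s) - fmult f (P s) \<in> E" if "s \<in> E" for s
      by (intro E(7) E(4) Suc.prems(2) that f)
    then show "diff_op A E E m (\<lambda>s. P (fmult f s) - fmult f (P s))"
      by (rule Suc.IH[OF diff_op_SucD[OF Suc.prems(1) f]])
  qed
qed

section \<open>Closure properties of differential operators on all forms\<close>

abbreviation dop :: "nat \<Rightarrow> (('m, 'n) form \<Rightarrow> ('m, 'n) form) \<Rightarrow> bool" where
  "dop \<equiv> diff_op A (Forms A) (Forms A)"

lemmas dop_cong = diff_op_cong[OF submodule_Forms]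

lemma fmult_simps:
  "fmult f 0 = 0" "fmult f (\<eta> + \<theta>) = fmult f \<eta> + fmult f \<theta>" "fmult f (\<eta> - \<theta>) = fmult f \<eta> - fmult f \<theta>"
  "fmult f (fmult h \<eta>) = fmult h (fmult f \<eta>)" "fmult f (cmult r \<eta>) = cmult r (fmult f \<eta>)"
  by (simp_all add: cmult_def fmult_def fun_eq_iff algebra_simps del: split_paired_All)

lemma dop_0: "dop m (\<lambda>_. 0)"
proof (induction m)
  case 0
  have "linear_op (Forms A) (Forms A) (\<lambda>_. 0)" by (simp add: linear_op_def Forms_zero_mem cmult_simps del: zero_fun_apply)
  then show "dop 0 (\<lambda>_. 0)" by (simp add: fmult_simps)
next
  case (Suc m)
  have m: "dop m (\<lambda>_. 0)" by (rule Suc.IH)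
  then have "dop m (\<lambda>s. 0 - fmult f 0)" for f by (simp add: fmult_simps)
  then show "dop (Suc m) (\<lambda>_. 0)" by (intro diff_op_SucI diff_op_linear[OF m])
qed

lemma dop_add: "dop m P \<Longrightarrow> dop m Q \<Longrightarrow> dop m (\<lambda>s. P s + Q s)"
proof (induction m arbitrary: P Q)
  case 0
  then show "dop 0 (\<lambda>s. P s + Q s)"
    by (auto simp: linear_op_def Forms_add cmult_simps fmult_simps)
next
  case (Suc m)
  have "dop m (\<lambda>s. P (fmult f s) + Q (fmult f s) - fmult f (P s + Q s))" if f: "smooth_fun A f" for f
  proof (rule dop_cong)
    show "dop m (\<lambda>s. (P (fmult f s) - fmult f (P s)) + (Q (fmult f s) - fmult f (Q s)))"
      by (rule Suc.IH[OF diff_op_SucD[OF Suc.prems(1) f] diff_op_SucD[OF Suc.prems(2) f]])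
  qed (simp add: fmult_simps)
  moreover have "linear_op (Forms A) (Forms A) (\<lambda>s. P s + Q s)"
    using diff_op_linear[OF Suc.prems(1)] diff_op_linear[OF Suc.prems(2)]
    by (auto simp: linear_op_def Forms_add cmult_simps)
  ultimately show "dop (Suc m) (\<lambda>s. P s + Q s)" by (intro diff_op_SucI)
qed

lemma dop_cmult: "dop m P \<Longrightarrow> dop m (\<lambda>s. cmult r (P s))"
proof (induction m arbitrary: P)
  case 0
  then show "dop 0 (\<lambda>s. cmult r (P s))"
    by (auto simp: linear_op_def Forms_cmult cmult_simps fmult_simps mult.commute)
next
  case (Suc m)
  have "dop m (\<lambda>s. cmult r (P (fmult f s)) - fmult f (cmult r (P s)))" if f: "smooth_fun A f" for f
  proof (rule dop_cong)
    show "dop m (\<lambda>s. cmult r (P (fmult f s) - fmult f (P s)))"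
      by (rule Suc.IH[OF diff_op_SucD[OF Suc.prems f]])
  qed (simp add: fmult_simps cmult_simps)
  moreover have "linear_op (Forms A) (Forms A) (\<lambda>s. cmult r (P s))"
    using diff_op_linear[OF Suc.prems] by (auto simp: linear_op_def Forms_cmult cmult_simps mult.commute)
  ultimately show "dop (Suc m) (\<lambda>s. cmult r (P s))" by (intro diff_op_SucI)
qed

text \<open>The commutator of a product with \<open>f\<close> is \<open>Q [P, f] + [Q, f] P\<close>,
  and each summand has total order one less. If one factor has order 0, its commutator is 0 and the
  summand drops out.\<close>

lemma dop_compose: "dop k P \<Longrightarrow> dop m Q \<Longrightarrow> dop (k + m) (\<lambda>s. Q (P s))"
proof (induction "k + m" arbitrary: k m P Q)
  case 0
  then have "dop 0 P" "dop 0 Q" by auto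
  then have "dop 0 (\<lambda>s. Q (P s))" by (auto simp: linear_op_def)
  then show "dop (k + m) (\<lambda>s. Q (P s))" using 0(1) by simp
next
  case (Suc l)
  note P = linear_opD[OF diff_op_linear[OF Suc.prems(1)]] and Q = linear_opD[OF diff_op_linear[OF Suc.prems(2)]]
  have "dop l (\<lambda>s. Q (P (fmult f s)) - fmult f (Q (P s)))" if f: "smooth_fun A f" for f
  proof (rule dop_cong)
    let ?P = "\<lambda>s. P (fmult f s) - fmult f (P s)" and ?Q = "\<lambda>s. Q (fmult f s) - fmult f (Q s)"
    have 1: "dop l (\<lambda>s. Q (?P s))"
    proof (cases k)
      case 0
      have "Q (?P s) = 0" if "s \<in> Forms A" for s
        using Suc.prems(1) 0 that f Q(6)[OF Forms_zero_mem Forms_zero_mem] by simp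
      then show ?thesis by (intro dop_cong[OF _ dop_0]) simp
    next
      case (Suc k')
      have l: "l = k' + m" using Suc.hyps(2) Suc by simp
      have "dop (k' + m) (\<lambda>s. Q (?P s))"
        by (rule Suc.hyps(1)[OF l diff_op_SucD[OF Suc.prems(1)[unfolded Suc] f] Suc.prems(2)])
      then show ?thesis using Suc.hyps(2) Suc by simp
    qed
    have 2: "dop l (\<lambda>s. ?Q (P s))"
    proof (cases m)
      case 0
      have "?Q (P s) = 0" if "s \<in> Forms A" for s
        using Suc.prems(2) 0 P(1)[OF that that] f by simp
      then show ?thesis by (intro dop_cong[OF _ dop_0]) simp
    next
      case (Suc m')
      have l: "l = k + m'" using Suc.hyps(2) Suc by simp
      have "dop (k + m') (\<lambda>s. ?Q (P s))"
        by (rule Suc.hyps(1)[OF l Suc.prems(1) diff_op_SucD[OF Suc.prems(2)[unfolded Suc] f]])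
      then show ?thesis using Suc.hyps(2) Suc by simp
    qed
    show "dop l (\<lambda>s. Q (?P s) + ?Q (P s))" by (rule dop_add[OF 1 2])
    show "Q (?P s) + ?Q (P s) = Q (P (fmult f s)) - fmult f (Q (P s))" if s: "s \<in> Forms A" for s
      using Q(5)[OF P(1)[OF Forms_fmult[OF s f] s] Forms_fmult[OF P(1)[OF s s] f]] by simp
  qed
  moreover have "linear_op (Forms A) (Forms A) (\<lambda>s. Q (P s))"
    using linear_op_compose[OF diff_op_linear[OF Suc.prems(1)] diff_op_linear[OF Suc.prems(2)]] .
  ultimately have "dop (Suc l) (\<lambda>s. Q (P s))" by (intro diff_op_SucI)
  then show "dop (k + m) (\<lambda>s. Q (P s))" using Suc.hyps(2) by simp
qed

section \<open>Symbols of first-order operators and of their fourfold products\<close>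

lemma dfun_power:
  assumes "smooth_fun A h" "c \<in> A" "p \<in> fst c"
  shows "dfun (\<lambda>q. h q ^ Suc m) c p = (real (Suc m) * h p ^ m) *\<^sub>R dfun h c p"
proof -
  let ?h = "\<lambda>x. h (chart_inv c x)"
  have "(?h has_derivative frechet_derivative ?h (at (snd c p))) (at (snd c p))"
    by (rule smooth_on_has_derivative[OF smooth_fun_chart[OF assms(1,2)]]) (use assms(3) in simp)
  then have "((\<lambda>x. ?h x ^ Suc m) has_derivative (\<lambda>y. of_nat (Suc m) * frechet_derivative ?h (at (snd c p)) y * ?h (snd c p) ^ (Suc m - 1)))
      (at (snd c p))"
    by (rule has_derivative_power)
  then show ?thesis
    unfolding dfun_def grad_def using assms(2,3)
    by (simp add: frechet_derivative_eq vec_eq_iff mult_ac del: power_Suc of_nat_Suc)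
qed

lemma dfun_differential:
  assumes "c \<in> A" "p \<in> fst c" "has_differential c p f \<xi>" shows "dfun (\<lambda>q. f q - r) c p = \<xi>"
proof -
  have "((\<lambda>x. f (chart_inv c x) - r) has_derivative (\<lambda>u. \<xi> \<bullet> u - 0)) (at (snd c p))"
    using assms(3) unfolding has_differential_def o_def by (intro has_derivative_diff has_derivative_const)
  then show ?thesis
    by (simp add: dfun_def grad_def vec_eq_iff frechet_derivative_eq inner_axis)
qed

lemma differential_exists:
  assumes "c \<in> A" "p \<in> fst c" obtains f where "smooth_fun A f" "has_differential c p f \<xi>"
proof -
  obtain \<psi> K where \<psi>: "smooth_fun A \<psi>" "\<And>q. \<psi> q \<ge> 0" "compact K" "K \<subseteq> fst c" "\<And>q. q \<notin> K \<Longrightarrow> \<psi> q = 0"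
    "\<exists>V. open V \<and> p \<in> V \<and> (\<forall>q\<in>V. \<psi> q = 1)"
    by (rule bump_exists[OF chart_open(1)[OF assms(1)] assms(2)]) auto
  obtain V where V: "open V" "p \<in> V" "\<forall>q\<in>V. \<psi> q = 1" using \<psi>(6) by blast
  define \<phi> where "\<phi> x = \<psi> (chart_inv c x) * (\<xi> \<bullet> x)" for x
  define f where "f q = (if q \<in> fst c then \<phi> (snd c q) else 0)" for q
  have "smooth_on (chart_image c) (\<lambda>x. \<phi> x)" unfolding \<phi>_def
    by (intro smooth_on_mult smooth_fun_chart smooth_on_inner smooth_on_const smooth_on_ident chart_open(2) assms \<psi>(1))
  then have "smooth_fun A (\<lambda>q. f q)" unfolding f_def
    by (rule smooth_fun_extend[OF assms(1) _ \<psi>(3,4)]) (use assms(1) \<psi>(5) in \<open>simp add: \<phi>_def\<close>)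
  moreover have "has_differential c p f \<xi>"
    unfolding has_differential_def
  proof (rule has_derivative_transform_within_open)
    show "((\<lambda>u. \<xi> \<bullet> u) has_derivative (\<lambda>u. \<xi> \<bullet> u)) (at (snd c p))"
      by (intro bounded_linear_imp_has_derivative bounded_linear_inner_right)
    show "open (snd c ` (V \<inter> fst c))" by (rule chart_image_open[OF assms(1)]) (use V chart_open(1)[OF assms(1)] in auto)
    show "snd c p \<in> snd c ` (V \<inter> fst c)" using V assms by auto
    show "\<xi> \<bullet> x = (f \<circ> chart_inv c) x" if "x \<in> snd c ` (V \<inter> fst c)" for x
      using that V(3) assms(1) by (auto simp: f_def \<phi>_def)
  qed
  ultimately show ?thesis using that[of f] by simp
qed

text \<open>\<open>\<sigma>\<close> is the commutator with multiplication operators; it is the principal symbol of \<open>P\<close>.\<close>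

definition first_order ::
  "(('m, 'n) form \<Rightarrow> ('m, 'n) form) \<Rightarrow> (('m, 'n) chart \<Rightarrow> 'm \<Rightarrow> real^'n \<Rightarrow> ((real^'n) list \<Rightarrow> real) \<Rightarrow> (real^'n) list \<Rightarrow> real) \<Rightarrow> bool" where
  "first_order P \<sigma> \<longleftrightarrow> linear_op (Forms A) (Forms A) P \<and>
     (\<forall>f s. smooth_fun A f \<longrightarrow> s \<in> Forms A \<longrightarrow> (\<forall>c\<in>A. \<forall>p\<in>fst c.
        P (fmult f s) c p = tscale (f p) (P s c p) + \<sigma> c p (dfun f c p) (s c p))) \<and>
     (\<forall>c p \<xi> r a. \<sigma> c p \<xi> (tscale r a) = tscale r (\<sigma> c p \<xi> a)) \<and>
     (\<forall>c p \<xi> r a. alternating a \<longrightarrow> \<sigma> c p (r *\<^sub>R \<xi>) a = tscale r (\<sigma> c p \<xi> a))"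

lemma first_orderD:
  assumes "first_order P \<sigma>"
  shows "linear_op (Forms A) (Forms A) P"
    "smooth_fun A f \<Longrightarrow> s \<in> Forms A \<Longrightarrow> c \<in> A \<Longrightarrow> p \<in> fst c \<Longrightarrow>
      P (fmult f s) c p = tscale (f p) (P s c p) + \<sigma> c p (dfun f c p) (s c p)"
    "\<sigma> c p \<xi> (tscale r a) = tscale r (\<sigma> c p \<xi> a)"
    "alternating a \<Longrightarrow> \<sigma> c p (r *\<^sub>R \<xi>) a = tscale r (\<sigma> c p \<xi> a)"
  using assms unfolding first_order_def by blast+

lemma dop_first_order:
  assumes "first_order P \<sigma>" shows "dop 1 P"
proof -
  note D = first_orderD[OF assms] and P = linear_opD[OF first_orderD(1)[OF assms]]
  have "dop 0 (\<lambda>s. P (fmult f s) - fmult f (P s))" if f: "smooth_fun A f" for f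
  proof -
    have mem: "P (fmult f s) - fmult f (P s) \<in> Forms A" if "s \<in> Forms A" for s
      by (intro Forms_diff Forms_fmult P(1)[OF _ Forms_zero_mem] that f)
    have "linear_op (Forms A) (Forms A) (\<lambda>s. P (fmult f s) - fmult f (P s))"
      unfolding linear_op_def using mem
      by (auto simp: fmult_simps cmult_simps P(2) P(3)[OF _ Forms_zero_mem] Forms_fmult f)
    moreover have "P (fmult f (fmult h s)) - fmult f (P (fmult h s)) = fmult h (P (fmult f s) - fmult f (P s))"
      if h: "smooth_fun A h" and s: "s \<in> Forms A" for h s
    proof (rule Forms_eqI)
      show "P (fmult f (fmult h s)) - fmult f (P (fmult h s)) \<in> Forms A" by (rule mem[OF Forms_fmult[OF s h]])
      show "fmult h (P (fmult f s) - fmult f (P s)) \<in> Forms A" by (rule Forms_fmult[OF mem[OF s] h])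
      fix c p assume c: "c \<in> A" "p \<in> fst c"
      show "(P (fmult f (fmult h s)) - fmult f (P (fmult h s))) c p = fmult h (P (fmult f s) - fmult f (P s)) c p"
        using D(2)[OF f Forms_fmult[OF s h] c] D(2)[OF f s c]
        by (simp add: fmult_apply D(3) tscale_diff tscale_add)
    qed
    ultimately show ?thesis by simp
  qed
  then have "dop (Suc 0) P" by (rule diff_op_SucI[OF D(1)])
  then show ?thesis by simp
qed

text \<open>A first-order operator lowers the power of \<open>h\<close> by one. At a zero of
  \<open>h\<close> the remaining section is the symbol times the old exponent, so applications can
  be chained.\<close>

lemma first_order_power:
  assumes "first_order P \<sigma>" "smooth_fun A h" "s \<in> Forms A" "c \<in> A" "p \<in> fst c" "h p = 0"
  obtains s' where "s' \<in> Forms A" "P (fmult (\<lambda>q. h q ^ Suc m) s) = fmult (\<lambda>q. h q ^ m) s'"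
    "s' c p = tscale (real (Suc m)) (\<sigma> c p (dfun h c p) (s c p))"
proof
  note D = first_orderD[OF assms(1)] and P = linear_opD[OF first_orderD(1)[OF assms(1)]]
  note h = assms(2) and s = assms(3)
  \<comment> \<open>By the Leibniz rule
    \<open>P (h^(m+1) s) = h^(m+1) P s + (m + 1) h^m [P, h] s\<close>, from which \<open>h^m\<close>
    is factored out.\<close>
  let ?s = "fmult h (P s) + cmult (real (Suc m)) (P (fmult h s) - fmult h (P s))"
  show mem: "?s \<in> Forms A"
    by (intro Forms_add Forms_diff Forms_fmult Forms_cmult P(1)[OF _ Forms_zero_mem] h s)
  show "P (fmult (\<lambda>q. h q ^ Suc m) s) = fmult (\<lambda>q. h q ^ m) ?s"
  proof (rule Forms_eqI)
    show "P (fmult (\<lambda>q. h q ^ Suc m) s) \<in> Forms A"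
      by (intro P(1)[OF _ Forms_zero_mem] Forms_fmult smooth_fun_power h s)
    show "fmult (\<lambda>q. h q ^ m) ?s \<in> Forms A" by (intro Forms_fmult mem smooth_fun_power h)
    fix c p assume c: "c \<in> A" "p \<in> fst c"
    show "P (fmult (\<lambda>q. h q ^ Suc m) s) c p = fmult (\<lambda>q. h q ^ m) ?s c p"
      unfolding D(2)[OF smooth_fun_power[OF h] s c] dfun_power[OF h c] D(4)[OF Forms_alternating[OF s c]]
      by (simp add: fmult_apply cmult_apply D(2)[OF h s c] tscale_add mult_ac del: of_nat_Suc)
  qed
  show "?s c p = tscale (real (Suc m)) (\<sigma> c p (dfun h c p) (s c p))"
    using assms(6) by (simp add: fmult_apply cmult_apply D(2)[OF h s assms(4,5)] del: of_nat_Suc)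
qed

text \<open>The part of the symbol calculus that \<open>principal_symbol\<close> tests: the value of
  \<open>P (h^4 s)\<close> at a zero of \<open>h\<close>. The constant 24 is \<open>4!\<close>,
  which the factor \<open>1 / fact 4\<close> in \<open>symbol_value\<close> removes.\<close>

definition op4 ::
  "(('m, 'n) form \<Rightarrow> ('m, 'n) form) \<Rightarrow> (('m, 'n) chart \<Rightarrow> 'm \<Rightarrow> real^'n \<Rightarrow> ((real^'n) list \<Rightarrow> real) \<Rightarrow> (real^'n) list \<Rightarrow> real) \<Rightarrow> bool" where
  "op4 P \<sigma> \<longleftrightarrow> dop 4 P \<and> (\<forall>h s. smooth_fun A h \<longrightarrow> s \<in> Forms A \<longrightarrow> (\<forall>c\<in>A. \<forall>p\<in>fst c. h p = 0 \<longrightarrow>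
     P (fmult (\<lambda>q. h q ^ 4) s) c p = tscale 24 (\<sigma> c p (dfun h c p) (s c p))))"

text \<open>Each of the four operators consumes one power of \<open>h\<close>; the exponents 4, 3,
  2, 1 multiply to 24.\<close>

lemma op4_compose:
  assumes "first_order P1 \<sigma>1" "first_order P2 \<sigma>2" "first_order P3 \<sigma>3" "first_order P4 \<sigma>4"
  shows "op4 (\<lambda>\<eta>. P1 (P2 (P3 (P4 \<eta>)))) (\<lambda>c p \<xi> a. \<sigma>1 c p \<xi> (\<sigma>2 c p \<xi> (\<sigma>3 c p \<xi> (\<sigma>4 c p \<xi> a))))"
  unfolding op4_def
proof (intro conjI allI impI ballI)
  have "dop (((1 + 1) + 1) + 1) (\<lambda>\<eta>. P1 (P2 (P3 (P4 \<eta>))))"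
    by (rule dop_compose[OF dop_compose[OF dop_compose[OF dop_first_order[OF assms(4)] dop_first_order[OF assms(3)]]
      dop_first_order[OF assms(2)]] dop_first_order[OF assms(1)]])
  then show "dop 4 (\<lambda>\<eta>. P1 (P2 (P3 (P4 \<eta>))))" by (simp add: numeral_eq_Suc)
next
  fix h s c p assume h: "smooth_fun A h" and s: "s \<in> Forms A" and c: "c \<in> A" "p \<in> fst c" and 0: "h p = 0"
  obtain s4 where s4: "s4 \<in> Forms A" "P4 (fmult (\<lambda>q. h q ^ Suc 3) s) = fmult (\<lambda>q. h q ^ 3) s4"
    "s4 c p = tscale (real (Suc 3)) (\<sigma>4 c p (dfun h c p) (s c p))"
    by (rule first_order_power[OF assms(4) h s c 0])
  obtain s3 where s3: "s3 \<in> Forms A" "P3 (fmult (\<lambda>q. h q ^ Suc 2) s4) = fmult (\<lambda>q. h q ^ 2) s3"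
    "s3 c p = tscale (real (Suc 2)) (\<sigma>3 c p (dfun h c p) (s4 c p))"
    by (rule first_order_power[OF assms(3) h s4(1) c 0])
  obtain s2 where s2: "s2 \<in> Forms A" "P2 (fmult (\<lambda>q. h q ^ Suc 1) s3) = fmult (\<lambda>q. h q ^ 1) s2"
    "s2 c p = tscale (real (Suc 1)) (\<sigma>2 c p (dfun h c p) (s3 c p))"
    by (rule first_order_power[OF assms(2) h s3(1) c 0])
  obtain s1 where s1: "s1 \<in> Forms A" "P1 (fmult (\<lambda>q. h q ^ Suc 0) s2) = fmult (\<lambda>q. h q ^ 0) s1"
    "s1 c p = tscale (real (Suc 0)) (\<sigma>1 c p (dfun h c p) (s2 c p))"
    by (rule first_order_power[OF assms(1) h s2(1) c 0])
  have n: "(4::nat) = Suc 3" "(3::nat) = Suc 2" "(2::nat) = Suc 1" "(1::nat) = Suc 0" by simp_all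
  have "P1 (P2 (P3 (P4 (fmult (\<lambda>q. h q ^ 4) s)))) = fmult (\<lambda>q. h q ^ 0) s1"
    unfolding n(1) s4(2) unfolding n(2) s3(2) unfolding n(3) s2(2) unfolding n(4) s1(2) by (rule refl)
  then have "P1 (P2 (P3 (P4 (fmult (\<lambda>q. h q ^ 4) s)))) c p = s1 c p" by (simp add: fmult_apply)
  then show "P1 (P2 (P3 (P4 (fmult (\<lambda>q. h q ^ 4) s)))) c p
      = tscale 24 (\<sigma>1 c p (dfun h c p) (\<sigma>2 c p (dfun h c p) (\<sigma>3 c p (dfun h c p) (\<sigma>4 c p (dfun h c p) (s c p)))))"
    unfolding s1(3) s2(3) s3(3) s4(3)
      first_orderD(3)[OF assms(1)] first_orderD(3)[OF assms(2)] first_orderD(3)[OF assms(3)] first_orderD(3)[OF assms(4)]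
    by simp
qed

lemma op4_add:
  "op4 P \<sigma> \<Longrightarrow> op4 Q \<tau> \<Longrightarrow> op4 (\<lambda>\<eta>. P \<eta> + Q \<eta>) (\<lambda>c p \<xi> a. \<sigma> c p \<xi> a + \<tau> c p \<xi> a)"
  unfolding op4_def by (auto simp: tscale_add intro: dop_add)

lemma op4_cmult: "op4 P \<sigma> \<Longrightarrow> op4 (\<lambda>\<eta>. cmult r (P \<eta>)) (\<lambda>c p \<xi> a. tscale r (\<sigma> c p \<xi> a))"
  unfolding op4_def by (auto simp: cmult_apply mult.commute intro: dop_cmult)

lemma op4_cong:
  assumes "op4 P \<sigma>" "\<And>\<eta>. \<eta> \<in> Forms A \<Longrightarrow> P \<eta> = P' \<eta>"
    and "\<And>c p \<xi> a. c \<in> A \<Longrightarrow> p \<in> fst c \<Longrightarrow> alternating a \<Longrightarrow> \<sigma> c p \<xi> a = \<sigma>' c p \<xi> a"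
  shows "op4 P' \<sigma>'"
  using assms unfolding op4_def
  by (auto simp: Forms_fmult smooth_fun_power Forms_alternating intro: dop_cong[OF assms(2)])

text \<open>Every admissible pair of a function and a section gives the same value, and at least one
  pair exists, so the definite description is evaluated.\<close>

lemma principal_symbol_op4:
  assumes "submodule E" "op4 P \<sigma>" "c \<in> A" "p \<in> fst c" "v \<in> fibre E c p"
  shows "principal_symbol A E 4 P c p \<xi> v = \<sigma> c p \<xi> v"
proof -
  note E = submoduleD[OF assms(1)]
  have val: "cmult (1 / fact 4) (P (fmult (\<lambda>q. (f q - f p) ^ 4) s)) c p = \<sigma> c p \<xi> (s c p)"
    if f: "smooth_fun A f" "has_differential c p f \<xi>" and s: "s \<in> E" for f s
  proof -
    have "smooth_fun A (\<lambda>q. f q - f p)" by (intro smooth_fun_diff smooth_fun_const f)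
    then have "P (fmult (\<lambda>q. (f q - f p) ^ 4) s) c p = tscale 24 (\<sigma> c p (dfun (\<lambda>q. f q - f p) c p) (s c p))"
      using assms(2-4) E(1)[OF s] unfolding op4_def by auto
    then show ?thesis unfolding cmult_apply dfun_differential[OF assms(3,4) f(2)] by (simp add: fact_numeral)
  qed
  show ?thesis unfolding principal_symbol_def
  proof (rule the_equality)
    obtain f where "smooth_fun A f" "has_differential c p f \<xi>" by (rule differential_exists[OF assms(3,4)])
    moreover obtain s where "s \<in> E" "s c p = v" using assms(5) by (auto simp: fibre_def)
    ultimately show "symbol_value A E 4 P c p \<xi> v (\<sigma> c p \<xi> v)" unfolding symbol_value_def using val by metis
    show "w = \<sigma> c p \<xi> v" if "symbol_value A E 4 P c p \<xi> v w" for w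
      using that val unfolding symbol_value_def by blast
  qed
qed

lemma ellipticI:
  assumes E: "submodule E" and P: "op4 P \<sigma>" "\<And>s. s \<in> E \<Longrightarrow> P s \<in> E"
    and lin: "\<And>c p \<xi> a b. \<sigma> c p \<xi> (a - b) = \<sigma> c p \<xi> a - \<sigma> c p \<xi> b" "\<And>c p \<xi> r a. \<sigma> c p \<xi> (tscale r a) = tscale r (\<sigma> c p \<xi> a)"
    and inv: "\<And>c p \<xi>. c \<in> A \<Longrightarrow> p \<in> fst c \<Longrightarrow> \<xi> \<noteq> 0 \<Longrightarrow>
      \<exists>\<alpha> \<beta>. \<beta> \<noteq> 0 \<and> (\<forall>a. alternating a \<longrightarrow> \<sigma> c p \<xi> (\<sigma> c p \<xi> a) = tscale \<alpha> (\<sigma> c p \<xi> a) - tscale \<beta> a)"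
  shows "elliptic A E 4 P"
  unfolding elliptic_def
proof (intro conjI ballI allI impI)
  show "diff_op A E E 4 P" using P by (intro diff_op_restrict[OF E]) (auto simp: op4_def)
  fix c p and \<xi> :: "real^'n" assume c: "c \<in> A" "p \<in> fst c" and "\<xi> \<noteq> 0"
  then obtain \<alpha> \<beta> where \<beta>: "\<beta> \<noteq> 0"
    and T: "\<And>a. alternating a \<Longrightarrow> \<sigma> c p \<xi> (\<sigma> c p \<xi> a) = tscale \<alpha> (\<sigma> c p \<xi> a) - tscale \<beta> a" using inv by blast
  let ?F = "fibre E c p" and ?T = "\<sigma> c p \<xi>"
  note sE = submoduleD[OF E]
  have alt: "alternating a" if "a \<in> ?F" for a
    using that Forms_alternating[OF sE(1) c] by (auto simp: fibre_def)
  have F: "a - b \<in> ?F" "tscale r a \<in> ?F" if ab: "a \<in> ?F" "b \<in> ?F" for a b r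
  proof -
    obtain s t where st: "s \<in> E" "a = s c p" "t \<in> E" "b = t c p" using ab by (auto simp: fibre_def)
    have "(s - t) c p \<in> ?F" unfolding fibre_def by (rule imageI[OF sE(7)[OF st(1,3)]])
    then show "a - b \<in> ?F" by (simp add: st)
    have "(cmult r s) c p \<in> ?F" unfolding fibre_def by (rule imageI[OF sE(5)[OF st(1)]])
    then show "tscale r a \<in> ?F" by (simp add: st cmult_apply)
  qed
  \<comment> \<open>The fibre of \<open>E\<close> need not be known explicitly: the symbol is
    realised by applying \<open>P\<close> to a section of \<open>E\<close>, and \<open>P\<close>
    preserves \<open>E\<close>.\<close>
  have TF: "?T a \<in> ?F" if a: "a \<in> ?F" for a
  proof -
    obtain f where f: "smooth_fun A f" "has_differential c p f \<xi>" by (rule differential_exists[OF c])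
    obtain s where s: "s \<in> E" "s c p = a" using a by (auto simp: fibre_def)
    have sm: "smooth_fun A (\<lambda>q. f q - f p)" by (intro smooth_fun_diff smooth_fun_const f)
    then have 1: "P (fmult (\<lambda>q. (f q - f p) ^ 4) s) c p = tscale 24 (?T a)"
      using P(1) c sE(1)[OF s(1)] dfun_differential[OF c f(2)] s(2) unfolding op4_def by auto
    have "P (fmult (\<lambda>q. (f q - f p) ^ 4) s) \<in> E"
      by (intro P(2) sE(4) s smooth_fun_power sm)
    then have "P (fmult (\<lambda>q. (f q - f p) ^ 4) s) c p \<in> ?F" unfolding fibre_def by (rule imageI)
    then have "tscale 24 (?T a) \<in> ?F" unfolding 1 .
    from F(2)[OF this this, of "1/24"] show ?thesis by simp
  qed
  have "bij_betw ?T ?F ?F"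
  \<comment> \<open>The relation \<open>T^2 = \<alpha> T - \<beta>\<close> with
    \<open>\<beta> \<noteq> 0\<close> gives the inverse
    \<open>(\<alpha> - T) / \<beta>\<close>.\<close>
  proof (rule bij_betw_byWitness[where f' = "\<lambda>a. tscale (1 / \<beta>) (tscale \<alpha> a - ?T a)"])
    show "\<forall>a\<in>?F. tscale (1 / \<beta>) (tscale \<alpha> (?T a) - ?T (?T a)) = a" using T[OF alt] \<beta> by simp
    show "\<forall>a\<in>?F. ?T (tscale (1 / \<beta>) (tscale \<alpha> a - ?T a)) = a" using T[OF alt] \<beta> by (simp add: lin)
    show "(\<lambda>a. tscale (1 / \<beta>) (tscale \<alpha> a - ?T a)) ` ?F \<subseteq> ?F" using F TF by blast
  qed (use TF in blast)
  then show "bij_betw (principal_symbol A E 4 P c p \<xi>) ?F ?F"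
    using principal_symbol_op4[OF E P(1) c] by (simp cong: bij_betw_cong)
qed

lemma elliptic_cong:
  assumes E: "submodule E" and eq: "\<And>s. s \<in> E \<Longrightarrow> P s = P' s" and P: "elliptic A E m P"
  shows "elliptic A E m P'"
proof -
  have "symbol_value A E m P c p \<xi> v w \<longleftrightarrow> symbol_value A E m P' c p \<xi> v w" for c p \<xi> v w
  proof -
    have "P (fmult (\<lambda>q. (f q - f p) ^ m) s) = P' (fmult (\<lambda>q. (f q - f p) ^ m) s)" if "smooth_fun A f" "s \<in> E" for f s
      by (intro eq submoduleD(4)[OF E that(2)] smooth_fun_power smooth_fun_diff smooth_fun_const that(1))
    then show ?thesis unfolding symbol_value_def by (metis (no_types, lifting))
  qed
  then have "symbol_value A E m P c p \<xi> v = symbol_value A E m P' c p \<xi> v" for c p \<xi> v by (intro ext)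
  then have "principal_symbol A E m P c p \<xi> = principal_symbol A E m P' c p \<xi>" for c p \<xi>
    unfolding principal_symbol_def by (intro ext) simp
  then show ?thesis
    using P diff_op_cong[OF E eq, where F = E and m = m] unfolding elliptic_def by auto
qed

end

section \<open>Ellipticity of the Laplacians\<close>

lemma skew_inner:
  fixes M :: "real^'n::finite^'n"
  assumes "transpose M = - M" shows "x \<bullet> (M *v x) = 0"
proof -
  have "x \<bullet> (M *v x) = (transpose M *v x) \<bullet> x" by (simp add: dot_lmul_matrix transpose_matrix_vector)
  also have "\<dots> = - (x \<bullet> (M *v x))" by (simp add: assms matrix_uminus_mult inner_commute)
  finally show ?thesis by simp
qed

text \<open>\<open>N\<close> and \<open>M\<close> are \<open>c\<close> times commuting projections, and \<open>T\<close> has the eigenvalues \<open>c\<^sup>2\<close> and \<open>c\<^sup>2 / 4\<close>.\<close>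

lemma quartic_identity:
  fixes N M :: "('v list \<Rightarrow> real) \<Rightarrow> 'v list \<Rightarrow> real"
  assumes N: "\<And>a b. N (a + b) = N a + N b" "\<And>a b. N (a - b) = N a - N b" "\<And>r a. N (tscale r a) = tscale r (N a)"
    and M: "\<And>a b. M (a + b) = M a + M b" "\<And>a b. M (a - b) = M a - M b" "\<And>r a. M (tscale r a) = tscale r (M a)"
    and sq: "\<And>a. N (N a) = tscale c (N a)" "\<And>a. M (M a) = tscale c (M a)"
    and comm: "M (N a) = N (M a)" "M (N (M a)) = N (M (M a))"
  defines "T \<equiv> \<lambda>a. tscale (c\<^sup>2) a - tscale (3 / 4 * c) (N a + M a) + tscale (3 / 2) (N (M a))"
  shows "T (T a) = tscale (5 / 4 * c\<^sup>2) (T a) - tscale (c\<^sup>2 * c\<^sup>2 / 4) a"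
proof -
  have 1: "N (T a) = tscale (c\<^sup>2 / 4) (N a) + tscale (3 / 4 * c) (N (M a))"
    unfolding T_def by (simp add: N sq comm) (auto simp: fun_eq_iff field_simps power2_eq_square)
  have 2: "M (T a) = tscale (c\<^sup>2 / 4) (M a) + tscale (3 / 4 * c) (N (M a))"
    unfolding T_def by (simp add: N M sq comm) (auto simp: fun_eq_iff field_simps power2_eq_square)
  have 3: "N (M (T a)) = tscale (c\<^sup>2) (N (M a))"
    unfolding 2 by (simp add: N sq) (auto simp: fun_eq_iff field_simps power2_eq_square)
  have "T (T a) = tscale (c\<^sup>2) (T a) - tscale (3 / 4 * c) (N (T a) + M (T a)) + tscale (3 / 2) (tscale (c\<^sup>2) (N (M a)))"
    unfolding 3[symmetric] by (simp only: T_def)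
  also have "\<dots> = tscale (5 / 4 * c\<^sup>2) (T a) - tscale (c\<^sup>2 * c\<^sup>2 / 4) a"
    unfolding 1 2 unfolding T_def by (auto simp: fun_eq_iff field_simps power2_eq_square)
  finally show ?thesis .
qed

text \<open>With \<open>c = \<xi> \<bullet> v\<close>, \<open>N\<close> for contraction by
  \<open>v\<close> followed by \<open>\<xi> \<and>\<close>, and \<open>M\<close> for
  \<open>\<zeta> \<and>\<close> followed by contraction by \<open>u\<close>, this is
  \<open>c^2 - (3/4) c (N + M) + (3/2) N M\<close>.\<close>

definition quartic_symbol :: "'v::real_inner \<Rightarrow> 'v \<Rightarrow> 'v \<Rightarrow> 'v \<Rightarrow> ('v list \<Rightarrow> real) \<Rightarrow> 'v list \<Rightarrow> real" where
  "quartic_symbol \<xi> v \<zeta> u a = tscale ((\<xi> \<bullet> v)\<^sup>2) a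
     - tscale (3 / 4 * (\<xi> \<bullet> v)) (wedge \<xi> (contr v a) + contr u (wedge \<zeta> a))
     + tscale (3 / 2) (wedge \<xi> (contr v (contr u (wedge \<zeta> a))))"

lemma contr_self: "alternating a \<Longrightarrow> contr u (contr u a) = 0"
  using contr_anticommute[of a u u] by (simp add: fun_eq_iff)

context
  fixes \<xi> v \<zeta> u :: "real^'n::finite"
  assumes pairing: "\<zeta> \<bullet> u = \<xi> \<bullet> v" "\<xi> \<bullet> u = 0" "\<zeta> \<bullet> v = 0"
begin

text \<open>The anticommutation relations as rewriting rules: wedges move to the left of
  contractions, \<open>\<xi>\<close> in front of \<open>\<zeta>\<close> and \<open>v\<close> in
  front of \<open>u\<close>.\<close>

lemmas normal_order = contr_wedge wedge_add wedge_diff wedge_minus wedge_tscale pairing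
  wedge_anticommute[of \<zeta> \<xi>] contr_anticommute[of _ u v] contr_self alternating_contr tscale_add tscale_diff

lemma quartic_symbol_square:
  assumes a: "alternating a"
  shows "quartic_symbol \<xi> v \<zeta> u (quartic_symbol \<xi> v \<zeta> u a)
    = tscale (5 / 4 * (\<xi> \<bullet> v)\<^sup>2) (quartic_symbol \<xi> v \<zeta> u a) - tscale ((\<xi> \<bullet> v)\<^sup>2 * (\<xi> \<bullet> v)\<^sup>2 / 4) a"
proof -
  define N where "N b = wedge \<xi> (contr v b)" for b
  define M where "M b = contr u (wedge \<zeta> b)" for b
  have N: "N (b + b') = N b + N b'" "N (b - b') = N b - N b'" "N (tscale r b) = tscale r (N b)" for b b' r
    unfolding N_def contr_add contr_diff contr_tscale wedge_add wedge_diff wedge_tscale by (rule refl)+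
  have M: "M (b + b') = M b + M b'" "M (b - b') = M b - M b'" "M (tscale r b) = tscale r (M b)" for b b' r
    unfolding M_def wedge_add wedge_diff wedge_tscale contr_add contr_diff contr_tscale by (rule refl)+
  have sq: "N (N b) = tscale (\<xi> \<bullet> v) (N b)" "M (M b) = tscale (\<xi> \<bullet> v) (M b)" for b
    by (simp_all add: N_def M_def contr_wedge wedge_diff wedge_tscale pairing del: contr_apply)
  \<comment> \<open>Contractions anticommute on alternating functions, whence the assumption on
    \<open>b\<close>; the other exchanges use that \<open>\<xi> \<bullet> u\<close> and
    \<open>\<zeta> \<bullet> v\<close> vanish.\<close>
  have comm: "M (N b) = N (M b)" if "alternating b" for b
    unfolding M_def N_def using that by (simp add: normal_order)
  have "alternating (M a)" unfolding M_def by (intro alternating_contr alternating_wedge a)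
  from quartic_identity[OF N M sq comm[OF a] comm[OF this]]
  show ?thesis unfolding quartic_symbol_def N_def[symmetric] M_def[symmetric] .
qed

text \<open>In terms of \<open>N\<close>, \<open>M\<close> and \<open>c\<close> as in
  \<open>quartic_symbol\<close>, the first summand is \<open>(c - N)(c - M)\<close> and the second
  \<open>(N + M)^2 / 4\<close>, which equals \<open>c (N + M) / 4 + N M / 2\<close>.\<close>

lemma symbol_dd_lambda:
  assumes "alternating a"
  shows "wedge \<zeta> (- contr v (wedge \<xi> (- contr u a)))
    + tscale (1 / 4) (wedge \<xi> (- contr v (wedge \<xi> (- contr v a))) + wedge \<xi> (- contr v (- contr u (wedge \<zeta> a)))
      + - contr u (wedge \<zeta> (wedge \<xi> (- contr v a))) + - contr u (wedge \<zeta> (- contr u (wedge \<zeta> a))))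
    = quartic_symbol \<xi> v \<zeta> u a"
  unfolding quartic_symbol_def using assms
  by (simp add: normal_order) (simp add: fun_eq_iff field_simps power2_eq_square)

text \<open>Now the first summand is \<open>N M\<close> and the second
  \<open>(2 c - N - M)^2 / 4\<close>, because the order of wedge and contraction is reversed in each
  factor.\<close>

lemma symbol_d_plus_d_lambda:
  assumes "alternating a"
  shows "wedge \<xi> (- contr u (wedge \<zeta> (- contr v a)))
    + tscale (1 / 4) (- contr v (wedge \<xi> (- contr v (wedge \<xi> a))) + - contr v (wedge \<xi> (wedge \<zeta> (- contr u a)))
      + wedge \<zeta> (- contr u (- contr v (wedge \<xi> a))) + wedge \<zeta> (- contr u (wedge \<zeta> (- contr u a))))
    = quartic_symbol \<xi> v \<zeta> u a"
  unfolding quartic_symbol_def using assms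
  by (simp add: normal_order) (simp add: fun_eq_iff field_simps power2_eq_square)

end

context almost_kaehler
begin

abbreviation (input) vG :: "('m, 'n) chart \<Rightarrow> 'm \<Rightarrow> real^'n \<Rightarrow> real^'n" where "vG c p \<xi> \<equiv> Gi c p *v \<xi>"
abbreviation (input) vP :: "('m, 'n) chart \<Rightarrow> 'm \<Rightarrow> real^'n \<Rightarrow> real^'n" where "vP c p \<xi> \<equiv> Pm c p *v \<xi>"
abbreviation (input) co :: "('m, 'n) chart \<Rightarrow> 'm \<Rightarrow> real^'n \<Rightarrow> real^'n" where "co c p \<xi> \<equiv> vG c p \<xi> v* Om c p"

lemma first_order_ext_d: "first_order ext_d (\<lambda>c p \<xi> a. wedge \<xi> a)"
  unfolding first_order_def by (simp add: linear_op_ext_d ext_d_fmult wedge_tscale wedge_scale_left)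

lemma first_order_ds: "first_order ds (\<lambda>c p \<xi> a. - contr (vG c p \<xi>) a)"
  unfolding first_order_def
  by (simp add: linear_op_ds d_star_fmult matrix_vector_mult_scaleR contr_linear_comb tscale_minus_left)

lemma first_order_dL: "first_order dL (\<lambda>c p \<xi> a. - contr (vP c p \<xi>) a)"
proof -
  have "dL (fmult f s) c p = tscale (f p) (dL s c p) + - contr (vP c p (dfun f c p)) (s c p)"
    if f: "smooth_fun A f" and s: "s \<in> Forms A" and c: "c \<in> A" "p \<in> fst c" for f s c p
    using ext_d_fmult[OF Forms_Lam[OF s] f c] ext_d_fmult[OF s f c]
      Lamp_wedge[OF Om_matrices(4)[OF c] Forms_alternating[OF s c]]
    by (simp add: d_lambda_def Lam_linear(3) Lam_apply Lamp_linear tscale_diff)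
  then show ?thesis
    unfolding first_order_def
    by (simp add: linear_op_dL matrix_vector_mult_scaleR contr_linear_comb tscale_minus_left)
qed

lemma first_order_dLs: "first_order dLs (\<lambda>c p \<xi> a. wedge (co c p \<xi>) a)"
proof -
  have "dLs (fmult f s) c p = tscale (f p) (dLs s c p) + wedge (co c p (dfun f c p)) (s c p)"
    if f: "smooth_fun A f" and s: "s \<in> Forms A" and c: "c \<in> A" "p \<in> fst c" for f s c p
    using d_star_fmult[OF Forms_L[OF s] f c] d_star_fmult[OF s f c] contr_Lp[OF Om_skew[OF c]]
    by (simp add: d_lambda_star_eq s Forms_fmult f L_linear(3) L_apply[OF c] Lp_linear tscale_diff)
  moreover have "(r *\<^sub>R x) v* W = r *\<^sub>R (x v* W)" for r x and W :: "real^'n^'n"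
    by (simp add: vec_eq_iff vector_matrix_mult_def sum_distrib_left mult_ac)
  ultimately show ?thesis
    unfolding first_order_def
    by (simp add: linear_op_dLs matrix_vector_mult_scaleR wedge_tscale wedge_scale_left)
qed

definition sym4 :: "('m, 'n) chart \<Rightarrow> 'm \<Rightarrow> real^'n \<Rightarrow> ((real^'n) list \<Rightarrow> real) \<Rightarrow> (real^'n) list \<Rightarrow> real" where
  "sym4 c p \<xi> = quartic_symbol \<xi> (vG c p \<xi>) (co c p \<xi>) (vP c p \<xi>)"

text \<open>The orthogonalities come from skewness of \<open>Pm\<close> and \<open>Om\<close>, the
  equality of the two diagonal pairings from \<open>Om\<close> and \<open>Pm\<close> being inverse
  to each other, and nonvanishing from positivity of the metric.\<close>

lemma pairings:
  assumes "c \<in> A" "p \<in> fst c"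
  shows "co c p \<xi> \<bullet> vP c p \<xi> = \<xi> \<bullet> vG c p \<xi>" "\<xi> \<bullet> vP c p \<xi> = 0" "co c p \<xi> \<bullet> vG c p \<xi> = 0"
    "\<xi> \<noteq> 0 \<Longrightarrow> \<xi> \<bullet> vG c p \<xi> \<noteq> 0"
proof -
  show "co c p \<xi> \<bullet> vP c p \<xi> = \<xi> \<bullet> vG c p \<xi>"
    using inner_transpose_matrix[of "vP c p \<xi>" "vG c p \<xi>" "Om c p"]
    by (simp add: matrix_vector_mul_assoc Om_matrices(2)[OF assms] inner_commute)
  show "\<xi> \<bullet> vP c p \<xi> = 0" by (rule skew_inner[OF Om_matrices(4)[OF assms]])
  show "co c p \<xi> \<bullet> vG c p \<xi> = 0"
    using inner_transpose_matrix[of "vG c p \<xi>" "vG c p \<xi>" "Om c p"] skew_inner[OF Om_skew[OF assms], of "vG c p \<xi>"]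
    by (simp add: inner_commute)
  assume "\<xi> \<noteq> 0"
  note G = spd_matrix_inv(1)[OF gram_spd[OF assms]]
  have e: "gram g c p *v vG c p \<xi> = \<xi>" by (simp add: matrix_vector_mul_assoc G)
  then have "vG c p \<xi> \<noteq> 0" using \<open>\<xi> \<noteq> 0\<close> by auto
  then have "vG c p \<xi> \<bullet> (gram g c p *v vG c p \<xi>) > 0" using gram_spd[OF assms] by (simp add: spd_def)
  then show "\<xi> \<bullet> vG c p \<xi> \<noteq> 0" unfolding e by (simp add: inner_commute)
qed

text \<open>The square in the Laplacian is multiplied out, so that every summand is a product of
  four first-order operators to which \<open>op4_compose\<close> applies.\<close>

lemma op4_dd_lambda: "op4 (Delta_dd_lambda A \<omega> g) sym4"
proof (rule op4_cong)
  note c = op4_compose and d = first_order_ext_d first_order_ds first_order_dL first_order_dLs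
  show "op4 (\<lambda>\<eta>. dLs (ds (ext_d (dL \<eta>))) + cmult (1/4) (ext_d (ds (ext_d (ds \<eta>))) + ext_d (ds (dL (dLs \<eta>)))
      + dL (dLs (ext_d (ds \<eta>))) + dL (dLs (dL (dLs \<eta>)))))
    (\<lambda>c p \<xi> a. wedge (co c p \<xi>) (- contr (vG c p \<xi>) (wedge \<xi> (- contr (vP c p \<xi>) a)))
      + tscale (1/4) (wedge \<xi> (- contr (vG c p \<xi>) (wedge \<xi> (- contr (vG c p \<xi>) a)))
      + wedge \<xi> (- contr (vG c p \<xi>) (- contr (vP c p \<xi>) (wedge (co c p \<xi>) a)))
      + - contr (vP c p \<xi>) (wedge (co c p \<xi>) (wedge \<xi> (- contr (vG c p \<xi>) a)))
      + - contr (vP c p \<xi>) (wedge (co c p \<xi>) (- contr (vP c p \<xi>) (wedge (co c p \<xi>) a)))))"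
    by (rule op4_add[OF c[OF d(4) d(2) d(1) d(3)] op4_cmult[OF op4_add[OF op4_add[OF op4_add[OF
      c[OF d(1) d(2) d(1) d(2)] c[OF d(1) d(2) d(3) d(4)]] c[OF d(3) d(4) d(1) d(2)]] c[OF d(3) d(4) d(3) d(4)]]]])
  show "dLs (ds (ext_d (dL \<eta>))) + cmult (1/4) (ext_d (ds (ext_d (ds \<eta>))) + ext_d (ds (dL (dLs \<eta>)))
      + dL (dLs (ext_d (ds \<eta>))) + dL (dLs (dL (dLs \<eta>)))) = Delta_dd_lambda A \<omega> g \<eta>" if "\<eta> \<in> Forms A" for \<eta>
    using that by (simp add: Delta_dd_lambda_def Let_def linear_ops linear_ops' Forms_ops Forms_dL add.assoc)
  fix c p and \<xi> :: "real^'n" and a :: "(real^'n) list \<Rightarrow> real" assume c: "c \<in> A" "p \<in> fst c" and a: "alternating a"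
  show "wedge (co c p \<xi>) (- contr (vG c p \<xi>) (wedge \<xi> (- contr (vP c p \<xi>) a)))
      + tscale (1/4) (wedge \<xi> (- contr (vG c p \<xi>) (wedge \<xi> (- contr (vG c p \<xi>) a)))
      + wedge \<xi> (- contr (vG c p \<xi>) (- contr (vP c p \<xi>) (wedge (co c p \<xi>) a)))
      + - contr (vP c p \<xi>) (wedge (co c p \<xi>) (wedge \<xi> (- contr (vG c p \<xi>) a)))
      + - contr (vP c p \<xi>) (wedge (co c p \<xi>) (- contr (vP c p \<xi>) (wedge (co c p \<xi>) a)))) = sym4 c p \<xi> a"
    unfolding sym4_def by (rule symbol_dd_lambda[OF pairings(1-3)[OF c] a])
qed

lemma op4_d_plus_d_lambda: "op4 (Delta_d_plus_d_lambda A \<omega> g) sym4"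
proof (rule op4_cong)
  note c = op4_compose and d = first_order_ext_d first_order_ds first_order_dL first_order_dLs
  show "op4 (\<lambda>\<eta>. ext_d (dL (dLs (ds \<eta>))) + cmult (1/4) (ds (ext_d (ds (ext_d \<eta>))) + ds (ext_d (dLs (dL \<eta>)))
      + dLs (dL (ds (ext_d \<eta>))) + dLs (dL (dLs (dL \<eta>)))))
    (\<lambda>c p \<xi> a. wedge \<xi> (- contr (vP c p \<xi>) (wedge (co c p \<xi>) (- contr (vG c p \<xi>) a)))
      + tscale (1/4) (- contr (vG c p \<xi>) (wedge \<xi> (- contr (vG c p \<xi>) (wedge \<xi> a)))
      + - contr (vG c p \<xi>) (wedge \<xi> (wedge (co c p \<xi>) (- contr (vP c p \<xi>) a)))
      + wedge (co c p \<xi>) (- contr (vP c p \<xi>) (- contr (vG c p \<xi>) (wedge \<xi> a)))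
      + wedge (co c p \<xi>) (- contr (vP c p \<xi>) (wedge (co c p \<xi>) (- contr (vP c p \<xi>) a)))))"
    by (rule op4_add[OF c[OF d(1) d(3) d(4) d(2)] op4_cmult[OF op4_add[OF op4_add[OF op4_add[OF
      c[OF d(2) d(1) d(2) d(1)] c[OF d(2) d(1) d(4) d(3)]] c[OF d(4) d(3) d(2) d(1)]] c[OF d(4) d(3) d(4) d(3)]]]])
  show "ext_d (dL (dLs (ds \<eta>))) + cmult (1/4) (ds (ext_d (ds (ext_d \<eta>))) + ds (ext_d (dLs (dL \<eta>)))
      + dLs (dL (ds (ext_d \<eta>))) + dLs (dL (dLs (dL \<eta>)))) = Delta_d_plus_d_lambda A \<omega> g \<eta>" if "\<eta> \<in> Forms A" for \<eta>
    using that by (simp add: Delta_d_plus_d_lambda_def Let_def linear_ops linear_ops' Forms_ops Forms_dL add.assoc)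
  fix c p and \<xi> :: "real^'n" and a :: "(real^'n) list \<Rightarrow> real" assume c: "c \<in> A" "p \<in> fst c" and a: "alternating a"
  show "wedge \<xi> (- contr (vP c p \<xi>) (wedge (co c p \<xi>) (- contr (vG c p \<xi>) a)))
      + tscale (1/4) (- contr (vG c p \<xi>) (wedge \<xi> (- contr (vG c p \<xi>) (wedge \<xi> a)))
      + - contr (vG c p \<xi>) (wedge \<xi> (wedge (co c p \<xi>) (- contr (vP c p \<xi>) a)))
      + wedge (co c p \<xi>) (- contr (vP c p \<xi>) (- contr (vG c p \<xi>) (wedge \<xi> a)))
      + wedge (co c p \<xi>) (- contr (vP c p \<xi>) (wedge (co c p \<xi>) (- contr (vP c p \<xi>) a)))) = sym4 c p \<xi> a"
    unfolding sym4_def by (rule symbol_d_plus_d_lambda[OF pairings(1-3)[OF c] a])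
qed

lemma elliptic_op4:
  assumes "submodule E" "op4 P sym4" "\<And>s. s \<in> E \<Longrightarrow> P s \<in> E" shows "elliptic A E 4 P"
proof (rule ellipticI[OF assms])
  show "sym4 c p \<xi> (a - b) = sym4 c p \<xi> a - sym4 c p \<xi> b" for c p \<xi> a b
    by (simp add: sym4_def quartic_symbol_def wedge_diff) (simp add: fun_eq_iff algebra_simps)
  show "sym4 c p \<xi> (tscale r a) = tscale r (sym4 c p \<xi> a)" for c p \<xi> r a
    by (simp add: sym4_def quartic_symbol_def wedge_tscale) (simp add: fun_eq_iff algebra_simps)
  fix c p and \<xi> :: "real^'n" assume c: "c \<in> A" "p \<in> fst c" and "\<xi> \<noteq> 0"
  let ?r = "(\<xi> \<bullet> vG c p \<xi>)\<^sup>2"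
  have "sym4 c p \<xi> (sym4 c p \<xi> a) = tscale (5 / 4 * ?r) (sym4 c p \<xi> a) - tscale (?r * ?r / 4) a" if "alternating a" for a
    unfolding sym4_def by (rule quartic_symbol_square[OF pairings(1-3)[OF c] that])
  moreover have "?r * ?r / 4 \<noteq> 0" using pairings(4)[OF c \<open>\<xi> \<noteq> 0\<close>] by simp
  ultimately show "\<exists>\<alpha> \<beta>. \<beta> \<noteq> 0 \<and> (\<forall>a. alternating a \<longrightarrow> sym4 c p \<xi> (sym4 c p \<xi> a) = tscale \<alpha> (sym4 c p \<xi> a) - tscale \<beta> a)"
    by blast
qed

section \<open>Invariance of the degree and of primitivity\<close>

lemma HForms_dL:
  assumes "\<eta> \<in> HForms k" shows "dL \<eta> \<in> HForms (k - 1)" "dLs \<eta> \<in> HForms (k + 1)"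
proof -
  have e: "k - 2 + 1 = k - 1" "k + 1 - 2 = k - 1" "k - 1 + 2 = k + 1" "k + 2 - 1 = k + 1" by simp_all
  show "dL \<eta> \<in> HForms (k - 1)"
    unfolding d_lambda_def
    using HForms_simple(6)[OF HForms_ext_d[OF HForms_Lam[OF assms], unfolded e] HForms_Lam[OF HForms_ext_d[OF assms], unfolded e]] .
  show "dLs \<eta> \<in> HForms (k + 1)"
    unfolding d_lambda_star_eq[OF HFormsD(1)[OF assms]]
    using HForms_simple(6)[OF HForms_L[OF HForms_d_star[OF assms], unfolded e] HForms_d_star[OF HForms_L[OF assms], unfolded e]] .
qed

lemma HForms_Delta:
  assumes "\<eta> \<in> HForms k"
  shows "Delta_dd_lambda A \<omega> g \<eta> \<in> HForms k" "Delta_d_plus_d_lambda A \<omega> g \<eta> \<in> HForms k"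
proof -
  have d: "ext_d \<theta> \<in> HForms k" if "\<theta> \<in> HForms (k - 1)" for \<theta> k using HForms_ext_d[OF that] by simp
  have dls: "dLs \<theta> \<in> HForms k" if "\<theta> \<in> HForms (k - 1)" for \<theta> k using HForms_dL(2)[OF that] by simp
  have dst: "ds \<theta> \<in> HForms k" if "\<theta> \<in> HForms (k + 1)" for \<theta> k using HForms_d_star[OF that] by simp
  have dl: "dL \<theta> \<in> HForms k" if "\<theta> \<in> HForms (k + 1)" for \<theta> k using HForms_dL(1)[OF that] by simp
  have Q: "ext_d (ds \<theta>) + dL (dLs \<theta>) \<in> HForms k" "ds (ext_d \<theta>) + dLs (dL \<theta>) \<in> HForms k" if "\<theta> \<in> HForms k" for \<theta>
    using d[OF HForms_d_star[OF that]] dl[OF HForms_dL(2)[OF that]] dst[OF HForms_ext_d[OF that]] dls[OF HForms_dL(1)[OF that]]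
    by (auto intro: HForms_simple(2))
  show "Delta_dd_lambda A \<omega> g \<eta> \<in> HForms k"
    unfolding Delta_dd_lambda_def Let_def
    by (intro HForms_simple(2)[OF dls[OF HForms_d_star[OF d[OF HForms_dL(1)[OF assms]]]]] HForms_simple(4) Q assms)
  show "Delta_d_plus_d_lambda A \<omega> g \<eta> \<in> HForms k"
    unfolding Delta_d_plus_d_lambda_def Let_def
    by (intro HForms_simple(2)[OF d[OF HForms_dL(1)[OF dls[OF HForms_d_star[OF assms]]]]] HForms_simple(4) Q assms)
qed

lemma submodule_HForms: "submodule (HForms k)"
  unfolding submodule_def by (auto simp: HForms_simple dest: HFormsD(1))

text \<open>Through \<open>Delta_plus_plus_eq\<close> and \<open>Delta_minus_minus_eq\<close> this
  says that the two Laplacians on forms preserve \<open>Prim A \<omega> n\<close>, the invariance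
  that \<open>elliptic_op4\<close> asks for.\<close>

lemma Prim_Delta:
  assumes "B \<in> Prim A \<omega> n"
  shows "Delta_plus_plus A \<omega> g n B \<in> Prim A \<omega> n" "Delta_minus_minus A \<omega> g n B \<in> Prim A \<omega> n"
proof -
  note add = submoduleD(3)[OF submodule_Prim]
  note C = ds_Prim[OF assms] and C' = dm_eq(2)[OF assms]
  note D = dp_eq(2)[OF C] and D' = dm_star(2)[OF C'] and E = dpm_star(2)[OF assms]
  show "Delta_plus_plus A \<omega> g n B \<in> Prim A \<omega> n"
    unfolding Delta_plus_plus_def Let_def dpm_star(1)[OF dp_eq(2)[OF C']] dp_star[OF assms] dp_star[OF D]
    by (intro add dpm_star(2) dp_eq(2) C' ds_Prim D)
  show "Delta_minus_minus A \<omega> g n B \<in> Prim A \<omega> n"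
    unfolding Delta_minus_minus_def Let_def dpm_star(1)[OF assms] dm_star(1)[OF C'] dm_star(1)[OF dm_eq(2)[OF D']]
    by (intro add dm_star(2) dp_eq(2) dm_eq(2) E D')
qed

lemma elliptic_Delta:
  "elliptic A (Forms_deg A k) 4 (Delta_dd_lambda A \<omega> g)"
  "elliptic A (Forms_deg A k) 4 (Delta_d_plus_d_lambda A \<omega> g)"
  "elliptic A (Prim A \<omega> n) 4 (Delta_plus_plus A \<omega> g n)"
  "elliptic A (Prim A \<omega> n) 4 (Delta_minus_minus A \<omega> g n)"
proof -
  show "elliptic A (Forms_deg A k) 4 (Delta_dd_lambda A \<omega> g)" "elliptic A (Forms_deg A k) 4 (Delta_d_plus_d_lambda A \<omega> g)"
    unfolding Forms_deg_HForms
    by (rule elliptic_op4[OF submodule_HForms op4_dd_lambda HForms_Delta(1)]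
        elliptic_op4[OF submodule_HForms op4_d_plus_d_lambda HForms_Delta(2)], assumption)+
  have plus_plus: "elliptic A (Prim A \<omega> n) 4 (Delta_dd_lambda A \<omega> g)"
    by (rule elliptic_op4[OF submodule_Prim op4_dd_lambda]) (simp add: Delta_plus_plus_eq Prim_Delta)
  show "elliptic A (Prim A \<omega> n) 4 (Delta_plus_plus A \<omega> g n)"
    by (rule elliptic_cong[OF submodule_Prim Delta_plus_plus_eq plus_plus])
  have minus_minus: "elliptic A (Prim A \<omega> n) 4 (Delta_d_plus_d_lambda A \<omega> g)"
    by (rule elliptic_op4[OF submodule_Prim op4_d_plus_d_lambda]) (simp add: Delta_minus_minus_eq Prim_Delta)
  show "elliptic A (Prim A \<omega> n) 4 (Delta_minus_minus A \<omega> g n)"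
    by (rule elliptic_cong[OF submodule_Prim Delta_minus_minus_eq minus_minus])
qed

end

theorem proposition2p15:
  fixes A :: "('m::{t2_space, second_countable_topology}, 'n::finite) chart set"
    and \<omega> :: "('m, 'n) form" and J :: "('m, 'n) endo" and g :: "('m, 'n) bilin"
    and n :: nat
  assumes "CARD('n) = 2 * n"
    and "smooth_atlas A"
    and "compatible_triple A \<omega> J g"
  shows "(\<forall>k\<le>2 * n. elliptic A (Forms_deg A k) 4 (Delta_dd_lambda A \<omega> g) \<and>
                    elliptic A (Forms_deg A k) 4 (Delta_d_plus_d_lambda A \<omega> g)) \<and>
         (\<forall>B\<in>Prim A \<omega> n. Delta_dd_lambda A \<omega> g B = Delta_plus_plus A \<omega> g n B \<and>
                         Delta_d_plus_d_lambda A \<omega> g B = Delta_minus_minus A \<omega> g n B) \<and>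
         elliptic A (Prim A \<omega> n) 4 (Delta_plus_plus A \<omega> g n) \<and>
         elliptic A (Prim A \<omega> n) 4 (Delta_minus_minus A \<omega> g n)"
proof -
  interpret almost_kaehler A g \<omega> J n
    using assms by unfold_locales (auto simp: compatible_triple_def)
  show ?thesis using elliptic_Delta Delta_plus_plus_eq Delta_minus_minus_eq by blast
qed

end
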